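(* For $v=(p:q:r)\in\mathcal V$ (with $p,q,r$ having no common factor), write $f=p/r$, $g=q/r$, $v=(f,g)$ when $r\ne0$. Then: (1) If $v=(f,g)\in\mathcal V$, then $(g(x,y))^3=(f(y,x))^3$. (2) If $v,v'\in\mathcal V$, then $v\circ v'$ and $v'\circ v$ are affiliates. (3) If $v=(f,g)\in\mathcal V$, then $f,g\in\mathbb Q[\omega](x,y)$. (4) If $d(v)=3d'$ with $d'\in\mathbb Z$, then some affiliate of $v$ can be written as $\tilde v\circ v_3$, where $\tilde v\in\mathcal V$ and $d(\tilde v)=d'$. Hence there exist forms $P,Q,R$ such that $p(x,y)=P(x^3,y^3)$, $q(x,y)=Q(x^3,y^3)$, $r(x,y)=xy\,R(x^3,y^3)$. (5) If $d(v)=3d'+1$ with $d'\in\mathbb Z$, then, up to a permutation of $(p,q)$, there exist forms $P,Q,R$ such that $p(x,y)=xP(x^3,y^3)$, $q(x,y)=yQ(x^3,y^3)$, $r(x,y)=R(x^3,y^3)$. (6) In no case is $d(v)\equiv2\pmod 3$, and no monomial appearing in any $p,q,r$ has an exponent congruent to $2$ mod $3$. (7) The real solutions are precisely those of the form $v=mh_1$ for $m\in\mathbb Z$, and have $d(v)=m^2$. The solutions of the form $v=(f,\bar f)$ are precisely those of the form $mv_3$, and have $d(v)=3m^2$. (8) If $f(d)$ denotes the number of solutions with degree $d$ ($d\ge1$), counting each collection of affiliates as one solution, then $f(d)=\sum_{e\mid d}\left(\frac{e}{3}\right)$, where $\left(\frac{\cdot}{3}\right)$ denotes the usual Legendre symbol.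 Thus, the degree of any solution has the form $m^2\prod_j p_j$ where the $p_j$ are primes $\equiv 0,1\pmod 3$.
   Context: Let $\omega=e^{2\pi i/3}$, $\zeta=e^{\pi i/6}$. A form is a homogeneous polynomial in $\mathbb C[x,y]$. $\mathcal V$ is the set of points $v=(p:q:r)$, where $p,q,r$ are forms, not all zero, with $p^3+q^3=(x^3+y^3)r^3$ (and $\deg p=\deg q=1+\deg r$ when $r\ne0$), taken up to projective equivalence, i.e. multiplication by a common nonzero homogeneous rational function; elements of $\mathcal V$ are called solutions. Representatives are normalized so that $p,q,r$ have no common factor, and the degree is $d(v)=\deg p=\deg q$ for such a representative. If $r\neq 0$ one writes $v=(f,g)$ with $f=p/r$, $g=q/r$, so $f^3+g^3=x^3+y^3$. The elements with $r=0$ (points at infinity) are $(1:-1:0),(1:-\omega:0),(1:-\omega^2:0)$, of degree $0$. Addition on $\mathcal V$ is the chord-tangent addition on the elliptic curve $X^3+Y^3=(x^3+y^3)Z^3$ over $\mathbb C(x,y)$ with identity $0=(1:-1:0)$: three points on a line (with multiplicity) sum to $0$; $-(p:q:r)=(q:p:r)$. Multiples $mv$, with $m$ an integer, refer to this group law. Composition: for $v=(p:q:r)$ and $v'=(p':q':r')$ in $\mathcal V$, $v\circ v'=(p(p',q'):q(p',q'):r'\cdot r(p',q'))\in\mathcal V$; for $v=(f,g)$, $v'=(f',g')$ this is $(f(f',g'),g(f',g'))$. The affiliates of $(f,g)$ are the $18$ elements $(\omega^jf,\omega^kg)$ and $(\omega^kg,\omega^jf)$ of $\mathcal V$, $j,k\in\{0,1,2\}$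 (in projective form: $(\omega^jp:\omega^kq:r)$ and $(\omega^kq:\omega^jp:r)$, which also makes sense when $r=0$). Here $h_1=(x,y)$ and $v_3=(\zeta^{-1}x^3+\zeta y^3:\zeta x^3+\zeta^{-1}y^3:\sqrt3\,xy)$. A bar denotes complex conjugation of coefficients; a solution is real if it can be represented with $p,q,r\in\mathbb R[x,y]$.
   Formalization: In (7) the solutions (f, f̄) are shown to be precisely the (ω^j f, ω^{-j} g) with (f,g)=m v_3, m≠0, j=0,1,2, all of degree 3m²; as stated the claim fails, since (ωf, ω²f̄) with v_3=(f,f̄) is no multiple of v_3, and 0·v_3 is at infinity. *)

theory Defs
  imports
    "HOL-Computational_Algebra.Computational_Algebra"
    "HOL-Number_Theory.Number_Theory"
begin

text \<open>
  \<open>\<complex>[x,y]\<close> is represented as \<open>(\<complex>[x])[y]\<close>: the coefficient of \<open>x\<^sup>i y\<^sup>j\<close> in \<open>p\<close> is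
  \<open>coeff (coeff p j) i\<close>, and \<open>\<complex>(x,y)\<close> is the fraction field of this domain.
\<close>

type_synonym bipoly = "complex poly poly"
type_synonym ratfun = "complex poly poly fract"
type_synonym triple = "bipoly \<times> bipoly \<times> bipoly"

definition \<omega> :: complex where "\<omega> = exp (2 * of_real pi * \<i> / 3)"
definition \<zeta> :: complex where "\<zeta> = exp (of_real pi * \<i> / 6)"

definition cst :: "complex \<Rightarrow> bipoly" where "cst c = [:[:c:]:]"
definition vx :: bipoly where "vx = [:[:0, 1:]:]"
definition vy :: bipoly where "vy = [:0, 1:]"

definition bicoeff :: "bipoly \<Rightarrow> nat \<Rightarrow> nat \<Rightarrow> complex" where
  "bicoeff p i j = Polynomial.coeff (Polynomial.coeff p j) i"

text \<open>\<open>subst p a b\<close> is \<open>p(a, b)\<close>.\<close>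

definition subst :: "bipoly \<Rightarrow> bipoly \<Rightarrow> bipoly \<Rightarrow> bipoly" where
  "subst p a b = poly (map_poly (\<lambda>c. poly (map_poly cst c) a) p) b"

definition conj_poly :: "bipoly \<Rightarrow> bipoly" where
  "conj_poly = map_poly (map_poly cnj)"

text \<open>The zero polynomial is homogeneous of every degree.\<close>

definition homog :: "nat \<Rightarrow> bipoly \<Rightarrow> bool" where
  "homog n p \<longleftrightarrow> (\<forall>i j. bicoeff p i j \<noteq> 0 \<longrightarrow> i + j = n)"

definition form :: "bipoly \<Rightarrow> bool" where
  "form p \<longleftrightarrow> (\<exists>n. homog n p)"

definition no_common_factor :: "bipoly \<Rightarrow> bipoly \<Rightarrow> bipoly \<Rightarrow> bool" where
  "no_common_factor p q r \<longleftrightarrow> (\<forall>c. c dvd p \<and> c dvd q \<and> c dvd r \<longrightarrow> is_unit c)"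


subsection \<open>The set of solutions\<close>

definition triples :: "triple set" where
  "triples = {(p, q, r). form p \<and> form q \<and> form r \<and> \<not> (p = 0 \<and> q = 0 \<and> r = 0) \<and>
     p ^ 3 + q ^ 3 = (vx ^ 3 + vy ^ 3) * r ^ 3 \<and>
     (r \<noteq> 0 \<longrightarrow> (\<exists>n. homog (1 + n) p \<and> homog (1 + n) q \<and> homog n r))}"

text \<open>Equality up to the nonzero homogeneous rational factor \<open>a / b\<close>, denominators cleared.\<close>

definition proj_eq :: "(triple \<times> triple) set" where
  "proj_eq = {((p, q, r), (p', q', r')). (p, q, r) \<in> triples \<and> (p', q', r') \<in> triples \<and>
     (\<exists>a b. form a \<and> form b \<and> a \<noteq> 0 \<and> b \<noteq> 0 \<and>
        a * p = b * p' \<and> a * q = b * q' \<and> a * r = b * r')}"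

definition solutions :: "triple set set" where
  "solutions = triples // proj_eq"

definition pt :: "bipoly \<Rightarrow> bipoly \<Rightarrow> bipoly \<Rightarrow> triple set" where
  "pt p q r = proj_eq `` {(p, q, r)}"

definition normalized :: "triple set \<Rightarrow> triple set" where
  "normalized v = {(p, q, r) \<in> v. no_common_factor p q r}"

definition sol_degree :: "triple set \<Rightarrow> nat" where
  "sol_degree v = (THE n. \<exists>(p, q, r) \<in> normalized v. homog n p \<and> homog n q)"

text \<open>
  For the left factor a normalized representative is needed: \<open>p'\<close> and \<open>q'\<close> may be proportional
  (at infinity), and then a common factor of \<open>p, q, r\<close> may vanish at \<open>(p', q')\<close>.
\<close>

definition sol_comp :: "triple set \<Rightarrow> triple set \<Rightarrow> triple set" where
  "sol_comp v v' = (\<Union>(p, q, r) \<in> normalized v. \<Union>(p', q', r') \<in> normalized v'.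
     pt (subst p p' q') (subst q p' q') (r' * subst r p' q'))"

definition affiliates :: "triple set \<Rightarrow> triple set set" where
  "affiliates v =
     {pt (cst (\<omega> ^ j) * p) (cst (\<omega> ^ k) * q) r | p q r j k. (p, q, r) \<in> v \<and> j < 3 \<and> k < 3} \<union>
     {pt (cst (\<omega> ^ k) * q) (cst (\<omega> ^ j) * p) r | p q r j k. (p, q, r) \<in> v \<and> j < 3 \<and> k < 3}"

text \<open>The affiliate \<open>(\<omega>\<^sup>j f, \<omega>\<^sup>-\<^sup>j g)\<close> of \<open>(f, g)\<close>.\<close>

definition twist :: "nat \<Rightarrow> triple set \<Rightarrow> triple set" where
  "twist j v = (\<Union>(p, q, r) \<in> v. pt (cst (\<omega> ^ j) * p) (cst (inverse \<omega> ^ j) * q) r)"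


subsection \<open>Chord-tangent addition\<close>

definition cubic :: "ratfun \<times> ratfun \<times> ratfun \<Rightarrow> ratfun" where
  "cubic = (\<lambda>(X, Y, Z). X ^ 3 + Y ^ 3 - Fract (vx ^ 3 + vy ^ 3) 1 * Z ^ 3)"

definition lincomb ::
    "ratfun \<Rightarrow> ratfun \<times> ratfun \<times> ratfun \<Rightarrow> ratfun \<Rightarrow> ratfun \<times> ratfun \<times> ratfun
       \<Rightarrow> ratfun \<times> ratfun \<times> ratfun" where
  "lincomb s = (\<lambda>(u1, u2, u3) t (w1, w2, w3). (s * u1 + t * w1, s * u2 + t * w2, s * u3 + t * w3))"

text \<open>
  \<open>line_section A B C\<close>: the points \<open>A, B, C\<close>, counted with multiplicity, are the intersection of
  the cubic with a line, parametrized as \<open>(s : t) \<mapsto> s U + t W\<close>. The restriction of the cubic to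
  the line is a nonzero binary cubic form whose roots, with multiplicity, are the parameters
  \<open>(s1 : t1), (s2 : t2), (s3 : t3)\<close> of \<open>A, B, C\<close>. As \<open>\<complex>(x,y)\<close> is infinite, the equality of
  binary forms is expressed by equality of all their values.
\<close>

definition line_section ::
    "ratfun \<times> ratfun \<times> ratfun \<Rightarrow> ratfun \<times> ratfun \<times> ratfun \<Rightarrow> ratfun \<times> ratfun \<times> ratfun \<Rightarrow> bool" where
  "line_section A B C \<longleftrightarrow>
     (\<exists>U W s1 t1 s2 t2 s3 t3 k.
        (\<forall>s t. lincomb s U t W = (0, 0, 0) \<longrightarrow> s = 0 \<and> t = 0) \<and>
        A = lincomb s1 U t1 W \<and> B = lincomb s2 U t2 W \<and> C = lincomb s3 U t3 W \<and>
        k \<noteq> 0 \<and>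
        (\<forall>s t. cubic (lincomb s U t W) =
                 k * (s * t1 - t * s1) * (s * t2 - t * s2) * (s * t3 - t * s3)))"

definition embed :: "triple \<Rightarrow> ratfun \<times> ratfun \<times> ratfun" where
  "embed = (\<lambda>(p, q, r). (Fract p 1, Fract q 1, Fract r 1))"

definition sum_zero :: "triple set \<Rightarrow> triple set \<Rightarrow> triple set \<Rightarrow> bool" where
  "sum_zero u v w \<longleftrightarrow> (\<exists>a \<in> u. \<exists>b \<in> v. \<exists>c \<in> w. line_section (embed a) (embed b) (embed c))"

definition sol_zero :: "triple set" where
  "sol_zero = pt 1 (- 1) 0"

definition sol_neg :: "triple set \<Rightarrow> triple set" where
  "sol_neg v = (\<Union>(p, q, r) \<in> v. pt q p r)"

definition sol_add :: "triple set \<Rightarrow> triple set \<Rightarrow> triple set" where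
  "sol_add u v = (THE w. w \<in> solutions \<and> sum_zero u v (sol_neg w))"

definition sol_mult :: "int \<Rightarrow> triple set \<Rightarrow> triple set" where
  "sol_mult m v =
     (if 0 \<le> m then (sol_add v ^^ nat m) sol_zero
      else sol_neg ((sol_add v ^^ nat (- m)) sol_zero))"


subsection \<open>Particular solutions and classes of solutions\<close>

definition h1 :: "triple set" where
  "h1 = pt vx vy 1"

definition v3 :: "triple set" where
  "v3 = pt (cst (inverse \<zeta>) * vx ^ 3 + cst \<zeta> * vy ^ 3)
           (cst \<zeta> * vx ^ 3 + cst (inverse \<zeta>) * vy ^ 3)
           (cst (of_real (sqrt 3)) * vx * vy)"

definition real_poly :: "bipoly \<Rightarrow> bool" where
  "real_poly p \<longleftrightarrow> (\<forall>i j. bicoeff p i j \<in> \<real>)"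

definition real_solution :: "triple set \<Rightarrow> bool" where
  "real_solution v \<longleftrightarrow> (\<exists>(p, q, r) \<in> v. real_poly p \<and> real_poly q \<and> real_poly r)"

text \<open>Solutions of the form \<open>v = (f, g)\<close> with \<open>g\<close> the complex conjugate of \<open>f\<close>.\<close>

definition conj_solution :: "triple set \<Rightarrow> bool" where
  "conj_solution v \<longleftrightarrow>
     (\<exists>(p, q, r) \<in> v. r \<noteq> 0 \<and> Fract q r = Fract (conj_poly p) (conj_poly r))"

definition Q_omega :: "complex set" where
  "Q_omega = {a + b * \<omega> | a b. a \<in> \<rat> \<and> b \<in> \<rat>}"

text \<open>The subfield \<open>\<rat>[\<omega>](x,y)\<close> of \<open>\<complex>(x,y)\<close>.\<close>

definition Q_omega_ratfuns :: "ratfun set" where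
  "Q_omega_ratfuns = {Fract a b | a b. b \<noteq> 0 \<and>
     (\<forall>i j. bicoeff a i j \<in> Q_omega) \<and> (\<forall>i j. bicoeff b i j \<in> Q_omega)}"

end

theory Submission
  imports Defs "HOL-Computational_Algebra.Field_as_Ring"
begin

text \<open>
  Setting \<open>x = 1\<close> turns a solution \<open>(p : q : r)\<close> with \<open>r \<noteq> 0\<close> into polynomials
  \<open>P, Q, R \<in> \<complex>[t]\<close> with \<open>P\<^sup>3 + Q\<^sup>3 = (1 + t\<^sup>3) R\<^sup>3\<close>, that is, into a point of an elliptic curve
  over \<open>\<complex>(t)\<close>. Equivalently \<open>(P : Q : R s)\<close> is a map from the curve \<open>s\<^sup>3 = 1 + t\<^sup>3\<close> to the Fermat
  cubic, and it pulls the invariant differential back to \<open>\<lambda> dt / s\<^sup>2\<close> with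
  \<open>\<lambda> = (P Q' - Q P') / R\<^sup>2\<close>. Since \<open>dt / s\<^sup>2\<close> is itself invariant, \<open>\<lambda>\<close> is a constant
  (\<open>multiplier_exists\<close> proves this by counting degrees). This \<^emph>\<open>multiplier\<close> controls everything. It is additive for chord-tangent addition (\<open>sol_add_chord\<close>, \<open>sol_double\<close>),
  multiplicative for composition (\<open>sol_compose\<close>), it changes sign when \<open>P\<close> and \<open>Q\<close> are
  exchanged, and it is multiplied by \<open>\<omega>\<^sup>j\<^sup>+\<^sup>k\<close> when \<open>(P, Q)\<close> is replaced by
  \<open>(\<omega>\<^sup>j P, \<omega>\<^sup>k Q)\<close>. It vanishes for no finite point (\<open>sol_nonzero\<close>); applying this to the
  difference of two points with equal multipliers shows that such points differ only by a
  twist \<open>(\<omega>\<^sup>j f, \<omega>\<^sup>-\<^sup>j g)\<close> (\<open>sol_unique\<close>). So up to twists a solution \<^emph>\<open>is\<close> a complex number.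

  Which numbers occur? A 3-descent (\<open>descent_step\<close>) divides the multiplier by a square root of
  \<open>-3\<close> and the degree by at least \<open>3\<close>; after subtracting the point \<open>(x, y)\<close> where necessary it
  applies to every point, so every multiplier is an Eisenstein integer
  (\<open>multiplier_eisenstein\<close>). Conversely \<open>(x, y)\<close> has multiplier \<open>1\<close>, and addition and multiplication
  of coordinates by \<open>\<omega>\<close> produce all nonzero elements of \<open>\<int>[\<omega>]\<close>, with coefficients in
  \<open>\<rat>[\<omega>]\<close> (\<open>realised_Eis\<close>); this gives part (3).

  The degree of the point with multiplier \<open>\<alpha>\<close> is the norm of \<open>\<alpha>\<close> (\<open>Deg_norm\<close>). The addition formulas give
  only \<open>d(\<alpha> + 1) + d(\<alpha> - 1) \<le> 2 d(\<alpha>) + 2\<close>, so that \<open>d\<close> minus the norm is concave along the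
  lines of the hexagonal lattice, and invariant under its sixfold rotation. It vanishes at \<open>0\<close> and,
  since \<open>d(\<surd>-3 \<alpha>) = 3 d(\<alpha>)\<close>, at the powers of \<open>3\<close>; and a function with these properties is identically zero (\<open>hexagonal_concave_zero\<close>).

  The statements of the theorem are then statements about \<open>\<int>[\<omega>]\<close>. The multiplier of a composition
  is the product of the multipliers, which is commutative: (2), and (1) is the case of the
  exchange of \<open>x\<close> and \<open>y\<close>. A norm divisible by \<open>3\<close> means divisibility by \<open>\<surd>-3\<close>, the
  multiplier of \<open>v\<^sub>3\<close>: (4). Composing with \<open>(\<omega> x, y)\<close> has the same effect on the multiplier as
  multiplying \<open>p\<close> by \<open>\<omega>\<close>, which determines all exponents modulo \<open>3\<close>: (4), (5), (6). A
  solution with real coefficients, or with conjugate coordinates, has a real, or purely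
  imaginary, multiplier, that is, an integer, or an integer multiple of \<open>\<surd>-3\<close>: (7). The
  affiliates of a solution correspond to the six associates of its multiplier, so (8) counts
  the elements of norm \<open>d\<close> up to units, which is classical (\<open>card_reps\<close>,
  \<open>norm_factorisation\<close>).

  For (7) the group law has to be unwound: the chord or tangent determines the third
  intersection point uniquely (\<open>chord_section\<close>, \<open>tangent_section\<close>), so the sum defined by description
  is the class given by the explicit formulas (\<open>add_chord\<close>, \<open>add_double\<close>).
\<close>

hide_const (open) Module.smult UnivPoly.coeff Coset.order UnivPoly.monom

section \<open>Addition formulas for the cubic\<close>

text \<open>
  The chord through two points of \<open>X\<^sup>3 + Y\<^sup>3 = e Z\<^sup>3\<close> meets
  the cubic again in this point; the formula is due to Desboves. Like the identities that
  follow, it holds because the difference of its sides is a combination of the two curve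
  equations, with the cofactors displayed in the proof.
\<close>

lemma third_point_on_curve:
  fixes e :: "'a::comm_ring_1"
  assumes "p1^3+q1^3 = e*r1^3" "p2^3+q2^3 = e*r2^3"
  shows "(p1^2*q2*r2 - p2^2*q1*r1)^3 + (q1^2*p2*r2 - q2^2*p1*r1)^3 = e*(r1^2*p2*q2 - r2^2*p1*q1)^3"
proof -
  have "(p1^2*q2*r2 - p2^2*q1*r1)^3 + (q1^2*p2*r2 - q2^2*p1*r1)^3 - e*(r1^2*p2*q2 - r2^2*p1*q1)^3
    = (r1^3*q2^3*r2^3*e -r1^3*q2^6 +q1^3*r2^6*e -q1^3*q2^3*r2^3 -3*p1*q1*r1*p2^2*q2^2*r2^2 +p1^3*q2^3*r2^3)
       * (p1^3+q1^3 - e*r1^3)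
    + (-(r1^6*q2^3*e) -q1^3*r1^3*r2^3*e +q1^3*r1^3*q2^3 -q1^3*r1^3*p2^3 +q1^6*r2^3 +3*p1^2*q1^2*r1^2*p2*q2*r2)
       * (p2^3+q2^3 - e*r2^3)"
    by (simp add: algebra_simps power_numeral_reduce)
  then show ?thesis using assms by simp
qed

text \<open>
  The coefficients of the two multipliers in the Wronskian of the third point, needed for
  \<open>third_point_derivation\<close>.
\<close>

lemma third_point_derivative:
  fixes e :: "'a::comm_ring_1"
  assumes "p1^3+q1^3 = e*r1^3" "p2^3+q2^3 = e*r2^3"
  shows "(q1^2*p2*r2 - q2^2*p1*r1)*(-(2*p1*q1^2*q2*r2)-p2^2*p1^2*r1) - (p1^2*q2*r2 - p2^2*q1*r1)*(2*q1*p1^2*p2*r2+q2^2*q1^2*r1)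
     = e*r1*(r1^2*p2*q2 - r2^2*p1*q1)^2" (is "?L1 = ?R1")
  and "(q1^2*p2*r2 - q2^2*p1*r1)*(p1^2*p2^2*r2+2*p2*q2^2*q1*r1) - (p1^2*q2*r2 - p2^2*q1*r1)*(-(q1^2*q2^2*r2)-2*q2*p2^2*p1*r1)
     = e*r2*(r1^2*p2*q2 - r2^2*p1*q1)^2" (is "?L2 = ?R2")
proof -
  have "?L1 - ?R1 = (r1^2*p2^2*q2^2 - 2*p1*q1*p2*q2*r2^2) * (p1^3+q1^3 - e*r1^3)
      + p1^2*q1^2*r1*r2 * (p2^3+q2^3 - e*r2^3)"
    by (simp add: algebra_simps power_numeral_reduce)
  then show "?L1 = ?R1" using assms by simp
  have "?L2 - ?R2 = r1*p2^2*q2^2*r2 * (p1^3+q1^3 - e*r1^3)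
      + (p1^2*q1^2*r2^2 - 2*p1*q1*r1^2*p2*q2) * (p2^3+q2^3 - e*r2^3)"
    by (simp add: algebra_simps power_numeral_reduce)
  then show "?L2 = ?R2" using assms by simp
qed

text \<open>
  The third point is \<open>x (p1, q1, r1) + y (p2, q2, r2)\<close>, where
  \<open>x\<close> and \<open>-y\<close> are the first factors of the two sides. The
  second factors are the values of the polar form of the cubic which are the mixed
  coefficients of its restriction to the line, so the identity says that the restriction
  vanishes at \<open>(x : y)\<close>.
\<close>

lemma third_point_on_chord:
  fixes e :: "'a::comm_ring_1"
  assumes "p1^3+q1^3 = e*r1^3" "p2^3+q2^3 = e*r2^3"
  shows "(p1*q2*r2+q1*p2*r2+r1*p2*q2) * (p1^2*p2+q1^2*q2-e*r1^2*r2)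
       = (p2*q1*r1+q2*p1*r1+r2*p1*q1) * (p1*p2^2+q1*q2^2-e*r1*r2^2)" (is "?L = ?R")
proof -
  have "?L - ?R = p2*q2*r2 * (p1^3+q1^3 - e*r1^3) - p1*q1*r1 * (p2^3+q2^3 - e*r2^3)"
    by (simp add: algebra_simps power_numeral_reduce)
  then show ?thesis using assms by simp
qed

text \<open>
  \<open>(B, A, C)\<close> and \<open>(B', A', C)\<close> represent the sum and the
  difference of two points. That all products of a coordinate \<open>A\<close>,
  \<open>B\<close> with a coordinate \<open>A'\<close>, \<open>B'\<close> are divisible by
  the common last coordinate bounds the degrees of the reduced sum and difference
  together; this is the source of \<open>Deg_concave\<close>.
\<close>

lemma sum_times_difference:
  fixes e :: "'a::comm_ring_1"
  assumes "p1^3+q1^3 = e*r1^3" "p2^3+q2^3 = e*r2^3"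
  defines "A \<equiv> p1^2*q2*r2 - p2^2*q1*r1" and "B \<equiv> q1^2*p2*r2 - q2^2*p1*r1"
    and "A' \<equiv> p1^2*p2*r2 - q2^2*q1*r1" and "B' \<equiv> q1^2*q2*r2 - p2^2*p1*r1"
    and "C \<equiv> r1^2*p2*q2 - r2^2*p1*q1"
  shows "A * A' = C * (p2*q2*q1^2 + e*r1*r2^2*p1)"
    and "B * B' = C * (p2*q2*p1^2 + e*r1*r2^2*q1)"
    and "A * B' = - (C * (p1*q1*q2^2 + e*r1^2*r2*p2))"
    and "A' * B = - (C * (p1*q1*p2^2 + e*r1^2*r2*q2))"
proof -
  have "A * A' - C * (p2*q2*q1^2 + e*r1*r2^2*p1)
      = p1*p2*q2*r2^2 * (p1^3+q1^3 - e*r1^3) - p1^2*q1*r1*r2 * (p2^3+q2^3 - e*r2^3)"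
    unfolding A_def A'_def C_def by (simp add: algebra_simps power_numeral_reduce)
  then show "A * A' = C * (p2*q2*q1^2 + e*r1*r2^2*p1)" using assms by simp
  have "B * B' - C * (p2*q2*p1^2 + e*r1*r2^2*q1)
      = q1*p2*q2*r2^2 * (p1^3+q1^3 - e*r1^3) - p1*q1^2*r1*r2 * (p2^3+q2^3 - e*r2^3)"
    unfolding B_def B'_def C_def by (simp add: algebra_simps power_numeral_reduce)
  then show "B * B' = C * (p2*q2*p1^2 + e*r1*r2^2*q1)" using assms by simp
  have "A * B' + C * (p1*q1*q2^2 + e*r1^2*r2*p2)
      = p1*q1*r1^2*p2 * (p2^3+q2^3 - e*r2^3) - r1*p2^2*q2*r2 * (p1^3+q1^3 - e*r1^3)"
    unfolding A_def B'_def C_def by (simp add: algebra_simps power_numeral_reduce)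
  then show "A * B' = - (C * (p1*q1*q2^2 + e*r1^2*r2*p2))" using assms by (simp add: eq_neg_iff_add_eq_0)
  have "A' * B + C * (p1*q1*p2^2 + e*r1^2*r2*q2)
      = p1*q1*r1^2*q2 * (p2^3+q2^3 - e*r2^3) - r1*p2*q2^2*r2 * (p1^3+q1^3 - e*r1^3)"
    unfolding A'_def B_def C_def by (simp add: algebra_simps power_numeral_reduce)
  then show "A' * B = - (C * (p1*q1*p2^2 + e*r1^2*r2*q2))" using assms by (simp add: eq_neg_iff_add_eq_0)
qed

text \<open>
  The addition theorem for the invariant differential. The assumptions express the
  derivatives of the coordinates through the multipliers \<open>a\<close>,
  \<open>b\<close> as in \<open>sol_derivative\<close>, with \<open>s\<close> a third of
  the derivative of \<open>e\<close>. After clearing denominators everything not involving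
  \<open>a\<close> or \<open>b\<close> is proportional to \<open>A\<close>, respectively
  \<open>B\<close>, and cancels in the Wronskian.
\<close>

lemma third_point_derivation:
  fixes e :: "'a::comm_ring_1"
  assumes "p1^3+q1^3 = e*r1^3" "p2^3+q2^3 = e*r2^3"
    and d: "e*r1*dp1 = s*p1*r1 - a*q1^2 + e*p1*dr1" "e*r1*dq1 = s*q1*r1 + a*p1^2 + e*q1*dr1"
      "e*r2*dp2 = s*p2*r2 - b*q2^2 + e*p2*dr2" "e*r2*dq2 = s*q2*r2 + b*p2^2 + e*q2*dr2"
  defines "A \<equiv> p1^2*q2*r2 - p2^2*q1*r1" and "B \<equiv> q1^2*p2*r2 - q2^2*p1*r1" and "C \<equiv> r1^2*p2*q2 - r2^2*p1*q1"
    and "dA \<equiv> 2*p1*dp1*q2*r2 + p1^2*dq2*r2 + p1^2*q2*dr2 - (2*p2*dp2*q1*r1 + p2^2*dq1*r1 + p2^2*q1*dr1)"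
    and "dB \<equiv> 2*q1*dq1*p2*r2 + q1^2*dp2*r2 + q1^2*p2*dr2 - (2*q2*dq2*p1*r1 + q2^2*dp1*r1 + q2^2*p1*dr1)"
  shows "e*r1*r2*(B*dA - A*dB) = e*r1*r2*((a+b)*C^2)"
proof -
  have 1: "e*r1*r2*dA = r2*(2*p1*q2*r2)*(e*r1*dp1) - r2*(p2^2*r1)*(e*r1*dq1) - r2*(p2^2*q1)*(e*r1*dr1)
       + r1*(p1^2*r2)*(e*r2*dq2) + r1*(p1^2*q2)*(e*r2*dr2) - r1*(2*p2*q1*r1)*(e*r2*dp2)"
    unfolding dA_def by (simp add: algebra_simps power_numeral_reduce)
  have 2: "e*r1*r2*dB = r2*(2*q1*p2*r2)*(e*r1*dq1) - r2*(q2^2*r1)*(e*r1*dp1) - r2*(q2^2*p1)*(e*r1*dr1)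
       + r1*(q1^2*r2)*(e*r2*dp2) + r1*(q1^2*p2)*(e*r2*dr2) - r1*(2*q2*p1*r1)*(e*r2*dq2)"
    unfolding dB_def by (simp add: algebra_simps power_numeral_reduce)
  let ?g = "r2*(2*e*r2*dr2 + e*r2*dr2)"
  have 3: "e*r1*r2*dA = (3*s*r1*r2 + 2*e*r2*dr1 + 2*e*r1*dr2) * A
      + a*r2*(-(2*p1*q1^2*q2*r2)-p2^2*p1^2*r1) + b*r1*(p1^2*p2^2*r2+2*p2*q2^2*q1*r1)"
    unfolding 1 d A_def by (simp add: algebra_simps power_numeral_reduce)
  have 4: "e*r1*r2*dB = (3*s*r1*r2 + 2*e*r2*dr1 + 2*e*r1*dr2) * B
      + a*r2*(2*q1*p1^2*p2*r2+q2^2*q1^2*r1) + b*r1*(-(q1^2*q2^2*r2)-2*q2*p2^2*p1*r1)"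
    unfolding 2 d B_def by (simp add: algebra_simps power_numeral_reduce)
  have "e*r1*r2*(B*dA - A*dB) = B*(e*r1*r2*dA) - A*(e*r1*r2*dB)" by (simp add: algebra_simps)
  also have "\<dots> = a*r2*(B*(-(2*p1*q1^2*q2*r2)-p2^2*p1^2*r1) - A*(2*q1*p1^2*p2*r2+q2^2*q1^2*r1))
      + b*r1*(B*(p1^2*p2^2*r2+2*p2*q2^2*q1*r1) - A*(-(q1^2*q2^2*r2)-2*q2*p2^2*p1*r1))"
    unfolding 3 4 by (simp add: algebra_simps)
  also have "\<dots> = a*r2*(e*r1*C^2) + b*r1*(e*r2*C^2)"
    using third_point_derivative[OF assms(1,2)] unfolding A_def B_def C_def by simp
  also have "\<dots> = e*r1*r2*((a+b)*C^2)" by (simp add: algebra_simps)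
  finally show ?thesis .
qed

lemma tangent_point_on_curve:
  fixes e :: "'a::comm_ring_1"
  assumes "p^3+q^3 = e*r^3"
  shows "(p*(p^3+2*q^3))^3 + (-(q*(2*p^3+q^3)))^3 = e*(r*(p^3-q^3))^3"
proof -
  have "(p*(p^3+2*q^3))^3 + (-(q*(2*p^3+q^3)))^3 = (p^3+q^3)*(p^3-q^3)^3"
    by (simp add: algebra_simps power_numeral_reduce)
  also have "\<dots> = e*(r*(p^3-q^3))^3" using assms by (simp add: power_mult_distrib mult.assoc)
  finally show ?thesis .
qed

section \<open>Roots of unity\<close>

lemma omega_eq: "\<omega> = Complex (-1/2) (sqrt 3/2)"
proof -
  have "\<omega> = cis (2*pi/3)" by (simp add: \<omega>_def cis_conv_exp mult_ac)
  then show ?thesis by (simp add: cis.ctr cos_120 sin_120)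
qed

lemma zeta_eq: "\<zeta> = Complex (sqrt 3/2) (1/2)"
proof -
  have "\<zeta> = cis (pi/6)" by (simp add: \<zeta>_def cis_conv_exp mult_ac)
  then show ?thesis by (simp add: cis.ctr cos_30 sin_30)
qed

lemma omega_sum: "1 + \<omega> + \<omega>^2 = 0"
  by (simp add: omega_eq complex_eq_iff power2_eq_square)

lemma omega_square: "\<omega>^2 = -1 - \<omega>"
  using omega_sum by (metis add.commute add_diff_cancel_left' diff_0 diff_diff_add minus_add_distrib uminus_add_conv_diff)

lemma omega_cube [simp]: "\<omega>^3 = 1"
  by (simp add: omega_eq complex_eq_iff power3_eq_cube)

lemma omega_neq [simp]: "\<omega> \<noteq> 0" "\<omega> \<noteq> 1" "\<omega>^2 \<noteq> 1" "\<omega>^2 \<noteq> \<omega>"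
  by (simp_all add: omega_eq complex_eq_iff power2_eq_square)

lemma omega_power_mod: "\<omega>^n = \<omega>^(n mod 3)"
proof -
  have "\<omega>^n = \<omega>^(3*(n div 3) + n mod 3)" by simp
  then show ?thesis by (simp only: power_add power_mult omega_cube power_one mult_1_left)
qed

lemma cnj_omega: "cnj \<omega> = \<omega>^2" "inverse \<omega> = \<omega>^2"
proof -
  show "cnj \<omega> = \<omega>^2" by (simp add: omega_eq complex_eq_iff power2_eq_square)
  have "\<omega> * \<omega>^2 = 1" using omega_cube by (simp add: power_numeral_reduce)
  then show "inverse \<omega> = \<omega>^2" by (rule inverse_unique)
qed

lemma nat_less_3: "(j::nat) < 3 \<Longrightarrow> j = 0 \<or> j = 1 \<or> j = 2" by auto

lemma omega_power_inj: "\<lbrakk>\<omega>^j = \<omega>^k; j < 3; k < 3\<rbrakk> \<Longrightarrow> j = k"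
  using nat_less_3[of j] nat_less_3[of k] omega_neq by fastforce

lemma cube_eq_cases:
  fixes x y :: "complex poly"
  assumes "x^3 = y^3" shows "\<exists>j<3. x = smult (\<omega>^j) y"
proof -
  have "(x - y) * (x - smult \<omega> y) * (x - smult (\<omega>^2) y)
     = x^3 - smult (1+\<omega>+\<omega>^2) (x^2*y) + smult (\<omega>+\<omega>^2+\<omega>^3) (x*y^2) - smult (\<omega>^3) (y^3)"
    by (simp add: algebra_simps power_numeral_reduce smult_add_left smult_add_right smult_diff_right)
  also have "\<omega>+\<omega>^2+\<omega>^3 = 0" using omega_sum by (simp add: add_ac)
  finally have "(x - y) * (x - smult \<omega> y) * (x - smult (\<omega>^2) y) = 0" using assms omega_sum by simp
  then consider "x = y" | "x = smult \<omega> y" | "x = smult (\<omega>^2) y" by auto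
  then show ?thesis
    by cases (rule exI[of _ 0], simp, rule exI[of _ 1], simp, rule exI[of _ 2], simp)
qed

lemma cube_eq_cases_complex:
  fixes x y :: complex
  assumes "x^3 = y^3" shows "\<exists>j<3. x = \<omega>^j * y"
proof -
  have "[:x:]^3 = [:y:]^3" using assms by (simp add: power3_eq_cube mult.assoc)
  from cube_eq_cases[OF this] show ?thesis by auto
qed

section \<open>Polynomial points and their multipliers\<close>

text \<open>
  Constant polynomials get a name of their own so that scalar factors are ordinary factors
  and ring normalisation applies to them.
\<close>

definition K :: "complex \<Rightarrow> complex poly" where "K c = [:c:]"

lemma K_simps [simp]: "K 0 = 0" "K 1 = 1" "K c = 0 \<longleftrightarrow> c = 0" "poly (K c) x = c" "degree (K c) = 0"
    "pderiv (K c) = 0" "K c dvd 1 \<longleftrightarrow> c \<noteq> 0" "c \<noteq> 0 \<Longrightarrow> order x (K c) = 0"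
  by (auto simp: K_def is_unit_const_poly_iff dvd_field_iff intro: order_0I)

lemma K_hom: "K (a + b) = K a + K b" "K (a * b) = K a * K b" "K (- a) = - K a" "K (a - b) = K a - K b"
    "K (a ^ n) = K a ^ n" "K (numeral m) = numeral m"
  by (simp_all add: K_def mult.commute poly_const_pow numeral_poly)

lemma smult_K: "smult c p = K c * p" by (simp add: K_def)

text \<open>
  The specialisation of \<open>x\<^sup>3 + y\<^sup>3\<close> at \<open>x = 1\<close>.
\<close>

definition e3 :: "complex poly" where "e3 = [:1, 0, 0, 1:]"

definition on_curve :: "complex poly \<Rightarrow> complex poly \<Rightarrow> complex poly \<Rightarrow> bool" where
  "on_curve P Q R \<longleftrightarrow> R \<noteq> 0 \<and> P^3 + Q^3 = e3 * R^3"

definition wronskian :: "complex poly \<Rightarrow> complex poly \<Rightarrow> complex poly" where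
  "wronskian P Q = P * pderiv Q - Q * pderiv P"

text \<open>
  \<open>a\<close> is the multiplier of the point, the factor by which the pullback of the
  invariant differential differs from that of \<open>(1, t)\<close>. The coordinates may
  have common factors, which do not influence \<open>a\<close>.
\<close>

definition sol :: "complex \<Rightarrow> complex poly \<Rightarrow> complex poly \<Rightarrow> complex poly \<Rightarrow> bool" where
  "sol a P Q R \<longleftrightarrow> on_curve P Q R \<and> wronskian P Q = (K a) * R^2"

lemma poly_e3: "poly e3 a = 1 + a^3"
  by (simp add: e3_def power3_eq_cube)

lemma e3_nz [simp]: "e3 \<noteq> 0" by (simp add: e3_def)

lemma degree_e3 [simp]: "degree e3 = 3" by (simp add: e3_def)

lemma pderiv_e3: "pderiv e3 = 3 * [:0,0,1:]"
  by (simp add: e3_def pderiv_pCons numeral_poly)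

lemma order_e3: "poly e3 a = 0 \<Longrightarrow> order a e3 = 1"
proof -
  have "rsquarefree e3" unfolding rsquarefree_roots pderiv_e3
    by (auto simp: poly_e3)
  then show "poly e3 a = 0 \<Longrightarrow> order a e3 = 1" by (intro rsquarefree_root_order) auto
qed

lemma order_cube: "p \<noteq> 0 \<Longrightarrow> order a (p^3) = 3 * order a (p::complex poly)"
  by (simp add: power3_eq_cube order_mult)

text \<open>
  The roots of \<open>1 + t\<^sup>3\<close> are simple, so at a root the orders of the two
  sides differ modulo \<open>3\<close>.
\<close>

lemma e3_times_cube_not_cube:
  assumes "(K c) * X^3 = e3 * R^3" shows "R = 0"
proof (rule ccontr)
  assume R: "R \<noteq> 0"
  then have "(K c) * X^3 \<noteq> 0" using assms by simp
  then have c: "c \<noteq> 0" "X \<noteq> 0" by auto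
  have "order (-1) ((K c) * X^3) = 3 * order (-1) X"
    using c by (simp add: order_mult order_cube)
  moreover have "order (-1) (e3 * R^3) = 1 + 3 * order (-1) R"
    using R by (simp add: order_mult order_cube order_e3 poly_e3)
  ultimately have "3 * order (-1) X = 1 + 3 * order (-1) R" using assms by simp
  then show False by presburger
qed

lemma on_curve_nz:
  assumes "on_curve P Q R"
  shows "P \<noteq> 0" "Q \<noteq> 0" "R \<noteq> 0" "Q \<noteq> (K c) * P" "P \<noteq> (K c) * Q"
proof -
  have R: "R \<noteq> 0" and e: "P^3 + Q^3 = e3 * R^3" using assms by (auto simp: on_curve_def)
  have *: "X \<noteq> (K c) * Y" if "X^3 + Y^3 = e3 * R^3" for X Y c
  proof
    assume "X = (K c) * Y"
    then have "X^3 + Y^3 = (K (c^3+1)) * Y^3"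
      by (simp add: power_mult_distrib algebra_simps K_hom)
    with that e3_times_cube_not_cube[of "c^3+1" Y R] R show False by simp
  qed
  show "R \<noteq> 0" by fact
  show "P \<noteq> (K c) * Q" using *[OF e] .
  show "Q \<noteq> (K c) * P" using *[of Q P c] e by (simp add: add.commute)
  show "P \<noteq> 0" using *[OF e, of 0] by simp
  show "Q \<noteq> 0" using *[of Q P 0] e by (simp add: add.commute)
qed

lemma wr_swap: "wronskian Q P = - wronskian P Q" by (simp add: wronskian_def)

lemma wr_scale: "wronskian (h*P) (h*Q) = h^2 * wronskian P Q"
  by (simp add: wronskian_def pderiv_mult algebra_simps power2_eq_square)

lemma wr_const: "wronskian ((K c)*P) ((K d)*Q) = (K (c*d)) * wronskian P Q"
  by (simp add: wronskian_def pderiv_mult algebra_simps K_hom)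

lemma on_curve_cong:
  assumes "on_curve P' Q' R'" "R \<noteq> 0" "P*R' = P'*R" "Q*R' = Q'*R"
  shows "on_curve P Q R"
proof -
  have "R'^3 * (P^3+Q^3) = (P*R')^3 + (Q*R')^3" by (simp add: algebra_simps power_mult_distrib)
  also have "\<dots> = R^3 * (P'^3 + Q'^3)" unfolding assms by (simp add: algebra_simps power_mult_distrib)
  also have "\<dots> = R'^3 * (e3 * R^3)" using assms(1) by (simp add: on_curve_def algebra_simps)
  finally show ?thesis using assms(1,2) by (simp add: on_curve_def)
qed

lemma sol_cong:
  assumes "sol a P' Q' R'" "R \<noteq> 0" "P*R' = P'*R" "Q*R' = Q'*R"
  shows "sol a P Q R"
proof -
  have R': "R' \<noteq> 0" using assms by (auto simp: sol_def on_curve_def)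
  have "R'^2 * wronskian P Q = wronskian (R'*P) (R'*Q)" by (simp add: wr_scale)
  also have "\<dots> = wronskian (R*P') (R*Q')" using assms(3,4) by (simp add: mult.commute)
  also have "\<dots> = R^2 * wronskian P' Q'" by (rule wr_scale)
  also have "\<dots> = R'^2 * ((K a) * R^2)" using assms(1) by (simp add: sol_def mult.commute)
  finally show ?thesis using assms R' on_curve_cong[OF _ assms(2-4)] by (simp add: sol_def)
qed

lemma sol_swap: "sol a P Q R \<Longrightarrow> sol (-a) Q P R"
  by (auto simp: sol_def on_curve_def wr_swap[of Q P] add.commute K_hom)

lemma sol_omega: 
  assumes "sol a P Q R" "c^3 = 1" "d^3 = 1" 
  shows "sol (c*d*a) ((K c)*P) ((K d)*Q) R"
proof -
  have "((K c)*P)^3 = P^3" "((K d)*Q)^3 = Q^3"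
    unfolding power_mult_distrib K_hom[symmetric] assms(2,3) by simp_all
  moreover have "wronskian ((K c)*P) ((K d)*Q) = K (c*d*a) * R^2"
    unfolding wr_const using assms(1) by (simp add: sol_def K_hom mult_ac)
  ultimately show ?thesis using assms(1) by (simp add: sol_def on_curve_def)
qed

lemma pderiv_cube: "pderiv (P^3) = 3 * (P^2 * pderiv (P::complex poly))"
  by (simp add: power3_eq_cube power2_eq_square pderiv_mult algebra_simps)

lemma curve_derivative:
  assumes "on_curve P Q R"
  shows "P^2 * pderiv P + Q^2 * pderiv Q = [:0,0,1:] * R^3 + e3 * R^2 * pderiv R"
proof -
  have "pderiv (P^3 + Q^3) = pderiv (e3 * R^3)" using assms by (simp add: on_curve_def)
  then have "3 * (P^2 * pderiv P + Q^2 * pderiv Q) = 3 * ([:0,0,1:] * R^3 + e3 * R^2 * pderiv R)"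
    unfolding pderiv_add pderiv_mult pderiv_cube pderiv_e3
    by (simp only: distrib_left mult_ac add_ac)
  then show ?thesis by (subst (asm) mult_cancel_left) simp
qed

text \<open>
  The derivative of the curve equation and the Wronskian are two linear equations for
  \<open>P'\<close> and \<open>Q'\<close>; these are their solutions.
\<close>

lemma sol_derivative:
  assumes "sol a P Q R"
  shows "e3*R*pderiv P = [:0,0,1:]*P*R - (K a)*Q^2 + e3*P*pderiv R"
    and "e3*R*pderiv Q = [:0,0,1:]*Q*R + (K a)*P^2 + e3*Q*pderiv R"
proof -
  have *: "e3*R*pderiv P = [:0,0,1:]*P*R - (K a)*Q^2 + e3*P*pderiv R" if "sol a P Q R" for P Q R a
  proof -
    have c: "P^3 + Q^3 = e3*R^3" and w: "P * pderiv Q - Q * pderiv P = (K a)*R^2" and R: "R \<noteq> 0"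
      and oc: "on_curve P Q R"
      using that by (auto simp: sol_def on_curve_def wronskian_def)
    have "R^2 * (e3*R*pderiv P) = (e3*R^3)*pderiv P" by (simp add: power2_eq_square power3_eq_cube mult_ac)
    also have "\<dots> = (P^3 + Q^3) * pderiv P" using c by simp
    also have "\<dots> = P * (P^2 * pderiv P + Q^2 * pderiv Q) - Q^2 * (P * pderiv Q - Q * pderiv P)"
      by (simp add: algebra_simps power_numeral_reduce)
    also have "\<dots> = P * ([:0,0,1:] * R^3 + e3 * R^2 * pderiv R) - Q^2 * ((K a)*R^2)"
      unfolding w curve_derivative[OF oc] ..
    also have "\<dots> = R^2 * ([:0,0,1:]*P*R - (K a)*Q^2 + e3*P*pderiv R)"
      by (simp only: algebra_simps power2_eq_square power3_eq_cube)
    finally show ?thesis using R by simp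
  qed
  show "e3*R*pderiv P = [:0,0,1:]*P*R - (K a)*Q^2 + e3*P*pderiv R" using *[OF assms] .
  have "(K (-a)) * P^2 = - ((K a)*P^2)" by (simp add: K_hom)
  then show "e3*R*pderiv Q = [:0,0,1:]*Q*R + (K a)*P^2 + e3*Q*pderiv R" using *[OF sol_swap[OF assms]]
    by (simp only: diff_minus_eq_add)
qed

lemma pderiv_square: "pderiv (P^2) = 2 * P * pderiv (P::complex poly)"
  by (simp add: power2_eq_square pderiv_mult algebra_simps)

lemma sol_add_chord:
  assumes s1: "sol a P1 Q1 R1" and s2: "sol b P2 Q2 R2"
  defines "A \<equiv> P1^2*Q2*R2 - P2^2*Q1*R1" and "B \<equiv> Q1^2*P2*R2 - Q2^2*P1*R1" and "C \<equiv> R1^2*P2*Q2 - R2^2*P1*Q1"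
  assumes C: "C \<noteq> 0"
  shows "sol (a+b) B A C"
proof -
  have c: "P1^3 + Q1^3 = e3*R1^3" "P2^3 + Q2^3 = e3*R2^3" and R: "R1 \<noteq> 0" "R2 \<noteq> 0"
    using s1 s2 by (auto simp: sol_def on_curve_def)
  have dA: "pderiv A = 2*P1*pderiv P1*Q2*R2 + P1^2*pderiv Q2*R2 + P1^2*Q2*pderiv R2
      - (2*P2*pderiv P2*Q1*R1 + P2^2*pderiv Q1*R1 + P2^2*Q1*pderiv R1)"
    unfolding A_def pderiv_diff pderiv_mult pderiv_square by (simp add: algebra_simps)
  have dB: "pderiv B = 2*Q1*pderiv Q1*P2*R2 + Q1^2*pderiv P2*R2 + Q1^2*P2*pderiv R2
      - (2*Q2*pderiv Q2*P1*R1 + Q2^2*pderiv P1*R1 + Q2^2*P1*pderiv R1)"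
    unfolding B_def pderiv_diff pderiv_mult pderiv_square by (simp add: algebra_simps)
  have "e3*R1*R2*(B*pderiv A - A*pderiv B) = e3*R1*R2*(((K a)+(K b))*C^2)"
    unfolding dA dB unfolding A_def B_def C_def
    by (rule third_point_derivation[OF c sol_derivative[OF s1] sol_derivative[OF s2]])
  then have "wronskian B A = (K (a+b)) * C^2" using R by (simp add: wronskian_def K_hom)
  moreover have "A^3 + B^3 = e3*C^3" unfolding A_def B_def C_def by (rule third_point_on_curve[OF c])
  ultimately show ?thesis using C by (simp add: sol_def on_curve_def add.commute)
qed

lemma sol_double:
  assumes s: "sol a P Q R"
  shows "sol (2*a) (-(Q*(2*P^3+Q^3))) (P*(P^3+2*Q^3)) (R*(P^3-Q^3))"
proof -
  have c: "P^3 + Q^3 = e3*R^3" and w: "wronskian P Q = (K a)*R^2" and R: "R \<noteq> 0"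
    and oc: "on_curve P Q R" using s by (auto simp: sol_def on_curve_def)
  have "P^3 \<noteq> Q^3"
  proof
    assume "P^3 = Q^3"
    then obtain j where "P = (K (\<omega>^j)) * Q" using cube_eq_cases[of P Q] by (auto simp: smult_K)
    with on_curve_nz[OF oc] show False by blast
  qed
  then have "R*(P^3-Q^3) \<noteq> 0" using R by simp
  moreover have "(-(Q*(2*P^3+Q^3)))^3 + (P*(P^3+2*Q^3))^3 = e3 * (R*(P^3-Q^3))^3"
    using tangent_point_on_curve[OF c] by (simp add: add.commute)
  moreover have "wronskian (-(Q*(2*P^3+Q^3))) (P*(P^3+2*Q^3)) = (K (2*a)) * (R*(P^3-Q^3))^2"
  proof -
    have two: "pderiv (2::complex poly) = 0" using pderiv_of_nat[of 2] by simp
    have dX: "pderiv (P*(P^3+2*Q^3)) = (4*P^3+2*Q^3)*pderiv P + 6*P*Q^2*pderiv Q"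
      unfolding pderiv_add pderiv_mult pderiv_cube two by (simp add: algebra_simps power_numeral_reduce)
    have dY: "pderiv (-(Q*(2*P^3+Q^3))) = -((4*Q^3+2*P^3)*pderiv Q + 6*Q*P^2*pderiv P)"
      unfolding pderiv_add pderiv_mult pderiv_cube pderiv_minus two by (simp add: algebra_simps power_numeral_reduce)
    have "wronskian (-(Q*(2*P^3+Q^3))) (P*(P^3+2*Q^3)) = 2 * (P^3-Q^3)^2 * wronskian P Q"
      unfolding wronskian_def dX dY by (simp add: algebra_simps power_numeral_reduce)
    also have "\<dots> = (K (2*a)) * (R*(P^3-Q^3))^2" unfolding w
      by (simp add: power_mult_distrib K_hom mult_ac)
    finally show ?thesis .
  qed
  ultimately show ?thesis by (simp add: sol_def on_curve_def)
qed

text \<open>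
  The last coordinate of the chord formula vanishes only if the points agree or are
  opposite, up to twists: the cubes of \<open>P2 R1\<close>, \<open>Q2 R1\<close> and
  those of \<open>P1 R2\<close>, \<open>Q1 R2\<close> then have equal sums and equal
  products, so they agree up to order.
\<close>

lemma equal_products_cases:
  assumes c: "P1^3 + Q1^3 = e3*R1^3" "P2^3 + Q2^3 = e3*R2^3" and C: "R1^2*P2*Q2 = R2^2*P1*Q1"
    and nz: "P1 \<noteq> 0" "Q1 \<noteq> 0" "R2 \<noteq> 0"
  obtains j where "j < 3" "P2*R1 = (K (\<omega>^j)) * (P1*R2)" "Q1*R2 = (K (\<omega>^j)) * (Q2*R1)"
   | j where "j < 3" "P2*R1 = (K (\<omega>^j)) * (Q1*R2)" "P1*R2 = (K (\<omega>^j)) * (Q2*R1)"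
proof -
  define X X' Y Y' where d: "X = P2*R1" "X' = Q2*R1" "Y = P1*R2" "Y' = Q1*R2"
  have p: "X*X' = Y*Y'" using C by (simp add: d algebra_simps power2_eq_square)
  have "X^3 + X'^3 = R1^3*(P2^3+Q2^3)" by (simp add: d power_mult_distrib algebra_simps)
  also have "\<dots> = R2^3*(P1^3+Q1^3)" unfolding c by (simp add: algebra_simps)
  also have "\<dots> = Y^3 + Y'^3" by (simp add: d power_mult_distrib algebra_simps)
  finally have s: "X^3 + X'^3 = Y^3 + Y'^3" .
  have "(X^3 - Y^3)*(X^3 - Y'^3) = X^3*(X^3 + X'^3) - X^3*(Y^3+Y'^3) + ((Y*Y')^3 - (X*X')^3)"
    by (simp add: algebra_simps power_mult_distrib)
  then have "(X^3 - Y^3)*(X^3 - Y'^3) = 0" using s p by simp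
  then consider "X^3 = Y^3" | "X^3 = Y'^3" by auto
  then show thesis
  proof cases
    case 1
    then obtain j where j: "j < 3" "X = (K (\<omega>^j))*Y" using cube_eq_cases[of X Y] by (auto simp: smult_K)
    have "Y * ((K (\<omega>^j))*X') = Y*Y'" using p j by (simp add: mult_ac)
    then have "Y' = (K (\<omega>^j))*X'" using nz by (simp add: d)
    with j show thesis using that(1) by (simp add: d)
  next
    case 2
    then obtain j where j: "j < 3" "X = (K (\<omega>^j))*Y'" using cube_eq_cases[of X Y'] by (auto simp: smult_K)
    have "Y' * ((K (\<omega>^j))*X') = Y'*Y" using p j by (simp add: mult_ac)
    then have "Y = (K (\<omega>^j))*X'" using nz by (simp add: d)
    with j show thesis using that(2) by (simp add: d)
  qed
qed

section \<open>Normalisation\<close>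

lemma coprime_iff_no_common_root:
  fixes P Q :: "complex poly"
  assumes "P \<noteq> 0"
  shows "coprime P Q \<longleftrightarrow> (\<forall>x. \<not> (poly P x = 0 \<and> poly Q x = 0))"
proof
  assume c: "coprime P Q"
  show "\<forall>x. \<not> (poly P x = 0 \<and> poly Q x = 0)"
  proof (intro allI notI)
    fix x assume "poly P x = 0 \<and> poly Q x = 0"
    then have "[:-x,1:] dvd P" "[:-x,1:] dvd Q" by (auto simp: poly_eq_0_iff_dvd)
    with c have "is_unit [:-x,1:]" by (meson coprime_common_divisor)
    then show False by (simp add: is_unit_poly_iff)
  qed
next
  assume n: "\<forall>x. \<not> (poly P x = 0 \<and> poly Q x = 0)"
  show "coprime P Q"
  proof (rule ccontr)
    assume "\<not> coprime P Q"
    then have "\<not> is_unit (gcd P Q)" by (simp add: coprime_iff_gcd_eq_1)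
    moreover have "gcd P Q \<noteq> 0" using assms by simp
    ultimately have "degree (gcd P Q) \<noteq> 0" by (metis is_unit_iff_degree)
    then obtain x where "poly (gcd P Q) x = 0"
      using alg_closed_imp_poly_has_root[of "gcd P Q"] by auto
    then have "poly P x = 0" "poly Q x = 0" by (meson gcd_dvd1 gcd_dvd2 poly_eq_0_iff_dvd dvd_trans)+
    with n show False by blast
  qed
qed

lemma on_curve_common_root:
  assumes "on_curve P Q R" "poly P x = 0" "poly Q x = 0" shows "poly R x = 0"
proof (rule ccontr)
  assume r: "poly R x \<noteq> 0"
  obtain P' Q' where pq: "P = [:-x,1:]*P'" "Q = [:-x,1:]*Q'"
    using assms by (auto simp: poly_eq_0_iff_dvd dvd_def)
  have "[:-x,1:]^3 * (P'^3+Q'^3) = P^3 + Q^3" unfolding pq power_mult_distrib by (simp only: distrib_left)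
  also have "\<dots> = e3*R^3" using assms by (simp add: on_curve_def)
  finally have "[:-x,1:]^3 dvd e3*R^3" by (metis dvd_triv_left)
  moreover have nz: "e3*R^3 \<noteq> 0" using r by auto
  ultimately have "3 \<le> order x (e3*R^3)" by (simp add: order_divides)
  also have "\<dots> = order x e3" using r nz by (simp add: order_mult order_0I)
  also have "\<dots> \<le> 1" using order_e3[of x] order_0I[of e3 x] by (cases "poly e3 x = 0") auto
  finally show False by simp
qed

lemma on_curve_root_R:
  assumes "on_curve P Q R" "poly R x = 0" "poly P x = 0 \<or> poly Q x = 0" 
  shows "poly P x = 0" "poly Q x = 0"
proof -
  have "poly (P^3+Q^3) x = poly (e3*R^3) x" using assms(1) by (simp add: on_curve_def)
  then have "poly P x^3 + poly Q x^3 = 0" using assms(2) by simp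
  then show "poly P x = 0" "poly Q x = 0" using assms(3) by auto
qed

lemma on_curve_normalise:
  assumes "on_curve P Q R"
  obtains g P0 Q0 R0 where "g \<noteq> 0" "P = g*P0" "Q = g*Q0" "R = g*R0" "coprime P0 Q0" "on_curve P0 Q0 R0"
proof -
  have "\<exists>g P0 Q0 R0. g \<noteq> 0 \<and> P = g*P0 \<and> Q = g*Q0 \<and> R = g*R0 \<and> coprime P0 Q0 \<and> on_curve P0 Q0 R0"
    using assms
  proof (induction "degree P" arbitrary: P Q R rule: less_induct)
    case less
    show ?case
    proof (cases "coprime P Q")
      case True then show ?thesis using less.prems by (intro exI[of _ 1] exI[of _ P] exI[of _ Q] exI[of _ R]) auto
    next
      case False
      note nz = on_curve_nz[OF less.prems]
      obtain x where x: "poly P x = 0" "poly Q x = 0" using False coprime_iff_no_common_root[OF nz(1)] by auto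
      have xr: "poly R x = 0" by (rule on_curve_common_root[OF less.prems x])
      define l where "l = [:-x,1:]"
      obtain P' Q' R' where pqr: "P = l*P'" "Q = l*Q'" "R = l*R'"
        using x xr by (auto simp: poly_eq_0_iff_dvd dvd_def l_def)
      have l: "l \<noteq> 0" "degree l = 1" by (auto simp: l_def)
      have nz': "P' \<noteq> 0" "R' \<noteq> 0" using nz pqr by auto
      have oc: "on_curve P' Q' R'" using less.prems nz' by (intro on_curve_cong[of P Q R, OF less.prems]) (auto simp: pqr)
      have "degree P' < degree P" using l nz' by (simp add: pqr degree_mult_eq)
      from less.hyps[OF this oc] obtain g P0 Q0 R0 where
        "g \<noteq> 0" "P' = g*P0" "Q' = g*Q0" "R' = g*R0" "coprime P0 Q0" "on_curve P0 Q0 R0" by blast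
      then show ?thesis using l by (intro exI[of _ "l*g"] exI[of _ P0] exI[of _ Q0] exI[of _ R0]) (auto simp: pqr mult_ac)
    qed
  qed
  then show thesis using that by blast
qed

lemma sol_normalise:
  assumes "sol a P Q R"
  obtains g P0 Q0 R0 where "g \<noteq> 0" "P = g*P0" "Q = g*Q0" "R = g*R0" "coprime P0 Q0" "sol a P0 Q0 R0"
proof -
  have oc: "on_curve P Q R" using assms by (simp add: sol_def)
  from on_curve_normalise[OF oc] obtain g P0 Q0 R0 where
     *: "g \<noteq> 0" "P = g*P0" "Q = g*Q0" "R = g*R0" "coprime P0 Q0" "on_curve P0 Q0 R0" .
  have "R0 \<noteq> 0" using *(6) by (simp add: on_curve_def)
  then have "sol a P0 Q0 R0" by (intro sol_cong[OF assms]) (auto simp: *(2-4) mult_ac)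
  with * that show thesis by blast
qed

text \<open>
  In degree \<open>3 max (deg P) (deg Q)\<close> the curve equation bounds \<open>deg
  R\<close>; solutions thus are never constant.
\<close>

lemma on_curve_degree:
  assumes "on_curve P Q R" shows "degree R + 1 \<le> max (degree P) (degree Q)"
proof -
  have e: "P^3+Q^3 = e3*R^3" "R \<noteq> 0" using assms by (auto simp: on_curve_def)
  have "3 + 3 * degree R = degree (e3*R^3)" using e by (simp add: degree_mult_eq degree_power_eq)
  also have "\<dots> = degree (P^3+Q^3)" using e by simp
  also have "\<dots> \<le> max (degree (P^3)) (degree (Q^3))" by (rule degree_add_le_max)
  also have "\<dots> = max (3 * degree P) (3 * degree Q)" using on_curve_nz[OF assms] by (simp add: degree_power_eq)
  finally show ?thesis by (auto simp: max_def split: if_splits)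
qed

text \<open>
  If the Wronskian vanishes, \<open>P\<close> and \<open>Q\<close> are proportional, which
  \<open>on_curve_nz\<close> excludes.
\<close>

lemma sol_nonzero: assumes "sol a P Q R" shows "a \<noteq> 0"
proof
  assume "a = 0"
  with assms sol_normalise obtain P0 Q0 R0 where c: "coprime P0 Q0" and s: "sol 0 P0 Q0 R0" by metis
  then have e: "P0 * pderiv Q0 = Q0 * pderiv P0" and oc: "on_curve P0 Q0 R0"
    by (auto simp: sol_def wronskian_def)
  have "P0 dvd Q0 * pderiv P0" using e by (metis dvd_triv_left)
  then have "degree P0 = 0" using c by (simp add: coprime_dvd_mult_right_iff)
  moreover have "Q0 dvd P0 * pderiv Q0" using e by (metis dvd_triv_left)
  then have "degree Q0 = 0" using c by (simp add: coprime_dvd_mult_right_iff coprime_commute)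
  ultimately show False using on_curve_degree[OF oc] by simp
qed

lemma sol_mult_unique: assumes "sol a P Q R" "sol b P Q R" shows "a = b"
proof -
  have "R \<noteq> 0" "K a * R^2 = K b * R^2" using assms by (auto simp: sol_def on_curve_def)
  then have "K a = K b" by simp
  then show ?thesis by (simp add: K_def)
qed

lemma omega_power_3: "(\<omega>^j)^3 = 1"
proof -
  have "(\<omega>^j)^3 = (\<omega>^3)^j" by (simp only: power_mult[symmetric] mult.commute)
  then show ?thesis by simp
qed

text \<open>
  If the first point minus the second were finite, it would have multiplier \<open>a - a =
  0\<close>. Therefore the last coordinate of the chord formula vanishes. Of the two cases
  of \<open>equal_products_cases\<close> the one with opposite points would give \<open>a
  = -a\<close>.
\<close>

lemma sol_unique:
  assumes s1: "sol a P1 Q1 R1" and s2: "sol a P2 Q2 R2"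
  obtains j where "j < 3" "P2*R1 = K (\<omega>^j) * (P1*R2)" "Q1*R2 = K (\<omega>^j) * (Q2*R1)"
proof -
  have oc: "on_curve P1 Q1 R1" "on_curve P2 Q2 R2" using s1 s2 by (auto simp: sol_def)
  have C: "R1^2*P2*Q2 = R2^2*P1*Q1"
  proof (rule ccontr)
    assume "R1^2*P2*Q2 \<noteq> R2^2*P1*Q1"
    then have "R1^2*Q2*P2 - R2^2*P1*Q1 \<noteq> 0" by (simp add: mult_ac)
    from sol_add_chord[OF s1 sol_swap[OF s2] this] sol_nonzero show False by fastforce
  qed
  show thesis
  proof (rule equal_products_cases[OF _ _ C])
    show "P1^3+Q1^3 = e3*R1^3" "P2^3+Q2^3 = e3*R2^3" using oc by (auto simp: on_curve_def)
    show "P1 \<noteq> 0" "Q1 \<noteq> 0" "R2 \<noteq> 0" using on_curve_nz[OF oc(1)] on_curve_nz[OF oc(2)] by auto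
  next
    fix j assume "j < 3" "P2*R1 = K (\<omega>^j) * (P1*R2)" "Q1*R2 = K (\<omega>^j) * (Q2*R1)"
    then show thesis by (rule that)
  next
    fix j assume j: "j < 3" "P2*R1 = K (\<omega>^j) * (Q1*R2)" "P1*R2 = K (\<omega>^j) * (Q2*R1)"
    let ?c = "\<omega>^j" and ?d = "(\<omega>^j)^2"
    have "?d^3 = (?c^3)^2" by (simp add: power_mult[symmetric])
    moreover have "?c * ?d = ?c^3" by (simp add: power_numeral_reduce)
    ultimately have c: "?c^3 = 1" "?d^3 = 1" "?c * ?d = 1" by (simp_all add: omega_power_3)
    have "sol (?c * ?d * (-a)) (K ?c * Q1) (K ?d * P1) R1" by (rule sol_omega[OF sol_swap[OF s1] c(1,2)])
    moreover have "P2*R1 = K ?c * Q1 * R2" using j(2) by (simp only: mult.assoc)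
    moreover have "K ?d * (P1*R2) = Q2*R1"
    proof -
      have "K ?d * (P1*R2) = K (?d * ?c) * (Q2*R1)" unfolding j(3) K_hom by (simp only: mult.assoc)
      then show ?thesis using c(3) by (simp only: mult.commute[of ?d] K_simps mult_1)
    qed
    then have "Q2*R1 = K ?d * P1 * R2" by (simp only: mult.assoc)
    moreover have "R2 \<noteq> 0" using oc by (simp add: on_curve_def)
    ultimately have "sol (?c * ?d * (-a)) P2 Q2 R2" by (blast intro: sol_cong)
    then have "sol (-a) P2 Q2 R2" unfolding c(3) by (simp only: mult_1)
    from sol_mult_unique[OF s2 this] have "a = 0" by simp
    then show thesis using sol_nonzero[OF s1] by blast
  qed
qed

section \<open>The multiplier is constant\<close>

lemma wr_lincomb: "wronskian (K a * P + K b * Q) (K c * P + K d * Q) = K (a*d - b*c) * wronskian P Q"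
  by (simp add: wronskian_def pderiv_add pderiv_mult K_hom algebra_simps)

lemma degree_wr_le: "degree (wronskian P Q) \<le> degree P + degree Q - 1"
proof (cases "degree P = 0 \<and> degree Q = 0")
  case True
  then show ?thesis by (simp add: wronskian_def pderiv_eq_0_iff[THEN iffD2])
next
  case False
  have *: "degree (P * pderiv Q) \<le> degree P + degree Q - 1" for P Q :: "complex poly"
  proof (cases "degree Q = 0")
    case True then show ?thesis by (simp add: pderiv_eq_0_iff[THEN iffD2])
  next
    case False
    have "degree (P * pderiv Q) \<le> degree P + degree (pderiv Q)" by (rule degree_mult_le)
    then show ?thesis using False by (simp add: degree_pderiv)
  qed
  show ?thesis unfolding wronskian_def using *[of P Q] *[of Q P]
    by (intro degree_diff_le) (simp_all add: add.commute)
qed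

text \<open>
  When both degrees are \<open>d\<close> the terms of degree \<open>2 d - 1\<close>
  cancel.
\<close>

lemma degree_wr_le':
  assumes "degree P \<le> d" "degree Q \<le> d"
  shows "degree (wronskian P Q) \<le> 2*d - 2"
proof (cases "degree P = d \<and> degree Q = d \<and> d > 0")
  case False
  then show ?thesis using degree_wr_le[of P Q] assms by auto
next
  case True
  define c where "c = lead_coeff P / lead_coeff Q"
  have Q: "Q \<noteq> 0" using True by auto
  have "coeff Q d \<noteq> 0" using True Q leading_coeff_0_iff by metis
  then have "coeff (P - K c * Q) d = 0" using True by (simp add: c_def K_def)
  moreover have "degree (P - K c * Q) \<le> d" using True by (intro degree_diff_le) (auto simp: K_def)
  ultimately have "degree (P - K c * Q) < d \<or> P - K c * Q = 0"
    by (metis eq_zero_or_degree_less)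
  then have dl: "degree (P - K c * Q) \<le> d - 1" using True by auto
  have "wronskian (P - K c * Q) Q = wronskian P Q"
    by (simp add: wronskian_def pderiv_diff pderiv_mult algebra_simps)
  then have "degree (wronskian P Q) \<le> degree (P - K c * Q) + d - 1"
    using degree_wr_le[of "P - K c * Q" Q] True by simp
  then show ?thesis using dl True by simp
qed

text \<open>
  The linear factors of \<open>P\<^sup>3 + Q\<^sup>3\<close>. They are pairwise coprime
  when \<open>P\<close> and \<open>Q\<close> are.
\<close>

definition U :: "nat \<Rightarrow> complex poly \<Rightarrow> complex poly \<Rightarrow> complex poly" where
  "U j P Q = P + K (\<omega>^j) * Q"

lemma omega_4: "\<omega>^4 = \<omega>" using omega_power_mod[of 4] by simp

lemma K_omega: "K (\<omega>^2) = - 1 - K \<omega>" "K \<omega> * K \<omega> = -1 - K \<omega>"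
proof -
  show "K (\<omega>^2) = - 1 - K \<omega>" by (simp only: omega_square K_hom K_simps)
  then show "K \<omega> * K \<omega> = -1 - K \<omega>" by (simp add: K_hom power2_eq_square)
qed

lemma U_prod: "U 0 P Q * U 1 P Q * U 2 P Q = P^3 + Q^3"
proof -
  have "U 0 P Q * U 1 P Q * U 2 P Q = P^3 + (1 + K \<omega> + K (\<omega>^2)) * P^2 * Q + (K \<omega> + K (\<omega>^2) + K \<omega> * K (\<omega>^2)) * P * Q^2
     + K \<omega> * K (\<omega>^2) * Q^3"
    by (simp add: U_def algebra_simps power_numeral_reduce)
  also have "K \<omega> * K (\<omega>^2) = 1" unfolding K_hom(2)[symmetric]
    using omega_cube by (simp add: power_numeral_reduce)
  finally show ?thesis by (simp add: K_omega)
qed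

lemma poly_U: "poly (U j P Q) x = poly P x + \<omega>^j * poly Q x" by (simp add: U_def)

lemma degree_U_le: "degree (U j P Q) \<le> max (degree P) (degree Q)"
  unfolding U_def by (intro degree_add_le) (auto simp: K_def)

text \<open>
  Any two of the three factors span \<open>P\<close> and \<open>Q\<close>; hence at most
  one of them has a smaller degree.
\<close>

lemma degree_U_pair:
  assumes "i < 3" "j < 3" "i \<noteq> j"
  shows "max (degree P) (degree Q) \<le> max (degree (U i P Q)) (degree (U j P Q))"
proof -
  have n: "\<omega>^i - \<omega>^j \<noteq> 0" using omega_power_inj assms by auto
  define u where "u = \<omega>^i - \<omega>^j"
  have "K u * Q = U i P Q - U j P Q" by (simp add: U_def u_def K_hom algebra_simps)
  moreover have "degree (K u * Q) = degree Q" using n by (simp add: u_def K_def)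
  ultimately have q: "degree Q \<le> max (degree (U i P Q)) (degree (U j P Q))"
    by (metis degree_diff_le_max)
  have "P = U i P Q - K (\<omega>^i) * Q" by (simp add: U_def)
  then have "degree P \<le> max (degree (U i P Q)) (degree (K (\<omega>^i) * Q))" by (metis degree_diff_le_max)
  moreover have "degree (K (\<omega>^i) * Q) = degree Q" by (simp add: K_def)
  ultimately show ?thesis using q by simp
qed

lemma U_nz: "on_curve P Q R \<Longrightarrow> U j P Q \<noteq> 0"
proof
  assume "on_curve P Q R" "U j P Q = 0"
  then have "P = K (- (\<omega>^j)) * Q" by (simp add: U_def K_hom add_eq_0_iff)
  with on_curve_nz(5)[OF \<open>on_curve P Q R\<close>] show False by blast
qed

lemma coprime_on_curve_QR:
  assumes "on_curve P Q R" "coprime P Q" shows "coprime Q R"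
proof -
  have "\<not> (poly Q x = 0 \<and> poly R x = 0)" for x
    using on_curve_root_R(1)[OF assms(1), of x] coprime_poly_0[OF assms(2), of x] by blast
  then show ?thesis using coprime_iff_no_common_root[OF on_curve_nz(2)[OF assms(1)]] by blast
qed

text \<open>
  Modulo \<open>R\<^sup>2\<close> the curve equation makes \<open>Q\<^sup>2\<close> times
  the Wronskian vanish, and \<open>Q\<close> is coprime to \<open>R\<close>; so the
  multiplier is a polynomial, and it remains to bound its degree. Up to a constant, the
  Wronskian can be computed from \<open>U j P Q\<close> and one of \<open>P\<close>,
  \<open>Q\<close>, so a small degree of a factor \<open>U j P Q\<close> makes its degree
  small. As \<open>3 + 3 deg R\<close> is the sum of the degrees of the three factors, the
  Wronskian has degree at most \<open>2 deg R\<close>.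
\<close>

theorem multiplier_exists:
  assumes oc: "on_curve P Q R" and cp: "coprime P Q"
  shows "\<exists>a. sol a P Q R"
proof -
  note nz = on_curve_nz[OF oc]
  have c: "P^3 + Q^3 = e3*R^3" using oc by (simp add: on_curve_def)
  have "Q^2 * wronskian P Q = P * (P^2 * pderiv P + Q^2 * pderiv Q) - (P^3+Q^3) * pderiv P"
    by (simp add: wronskian_def algebra_simps power_numeral_reduce)
  also have "\<dots> = R^2 * (P * ([:0,0,1:] * R + e3 * pderiv R) - e3 * R * pderiv P)"
    unfolding curve_derivative[OF oc] c by (simp only: algebra_simps power2_eq_square power3_eq_cube)
  finally have "R^2 dvd Q^2 * wronskian P Q" by simp
  moreover have "coprime (R^2) (Q^2)" using coprime_on_curve_QR[OF oc cp] by (simp add: coprime_commute)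
  ultimately have "R^2 dvd wronskian P Q" by (simp add: coprime_dvd_mult_right_iff)
  then obtain S where S: "wronskian P Q = R^2 * S" by (auto simp: dvd_def)
  show ?thesis
  proof (cases "S = 0")
    case True
    then have "sol 0 P Q R" using S oc by (simp add: sol_def)
    then show ?thesis ..
  next
    case False
    define d where "d = max (degree P) (degree Q)"
    define m where "m j = degree (U j P Q)" for j
    define w where "w = degree (wronskian P Q)"
    have d1: "d \<ge> 1" using on_curve_degree[OF oc] by (simp add: d_def)
    have w1: "w \<le> 2*d-2" unfolding w_def d_def by (intro degree_wr_le') auto
    have w2: "w + 1 \<le> d + m j" for j
    proof -
      have 1: "wronskian P (U j P Q) = K (\<omega>^j) * wronskian P Q" and 2: "wronskian Q (U j P Q) = K (-1) * wronskian P Q"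
        by (simp_all add: U_def wronskian_def pderiv_add pderiv_mult algebra_simps K_hom(1-4))
      have "w = degree (wronskian P (U j P Q))" "w = degree (wronskian Q (U j P Q))"
        unfolding 1 2 w_def by (simp_all add: K_def)
      then have "w \<le> d + m j - 1" using degree_wr_le[of P "U j P Q"] degree_wr_le[of Q "U j P Q"]
        by (auto simp: d_def m_def max_def split: if_splits)
      then show ?thesis using d1 by simp
    qed
    have md: "m j \<le> d" for j using degree_U_le by (simp add: m_def d_def)
    have mm: "d \<le> max (m 0) (m 1)" "d \<le> max (m 0) (m 2)" "d \<le> max (m 1) (m 2)"
      using degree_U_pair[of _ _ P Q] by (simp_all add: m_def d_def)
    have "degree (P^3+Q^3) = m 0 + m 1 + m 2"
      unfolding U_prod[symmetric] using U_nz[OF oc] by (simp add: degree_mult_eq m_def)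
    then have r: "m 0 + m 1 + m 2 = 3 + 3 * degree R" unfolding c using nz by (simp add: degree_mult_eq degree_power_eq)
    have "w = 2 * degree R + degree S" unfolding w_def S using False nz by (simp add: degree_mult_eq degree_power_eq)
    then have "degree S = 0" using r mm md[of 0] md[of 1] md[of 2] w2[of 0] w2[of 1] w2[of 2] w1 d1
      by (auto simp: max_def split: if_splits)
    then obtain s where "S = K s" by (metis K_def degree_eq_zeroE)
    then have "sol s P Q R" using S oc by (simp add: sol_def mult.commute)
    then show ?thesis ..
  qed
qed

section \<open>Descent\<close>

definition Eis :: "complex set" where
  "Eis = {of_int a + of_int b * \<omega> | a b. True}"

lemma EisI: "of_int a + of_int b * \<omega> \<in> Eis" by (auto simp: Eis_def)

lemma Eis_add: "x \<in> Eis \<Longrightarrow> y \<in> Eis \<Longrightarrow> x + y \<in> Eis"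
proof -
  assume "x \<in> Eis" "y \<in> Eis"
  then obtain a b c d where "x = of_int a + of_int b * \<omega>" "y = of_int c + of_int d * \<omega>" by (auto simp: Eis_def)
  then have "x + y = of_int (a+c) + of_int (b+d) * \<omega>" by (simp add: algebra_simps)
  then show ?thesis using EisI by metis
qed

lemma Eis_mult: "x \<in> Eis \<Longrightarrow> y \<in> Eis \<Longrightarrow> x * y \<in> Eis"
proof -
  assume "x \<in> Eis" "y \<in> Eis"
  then obtain a b c d where "x = of_int a + of_int b * \<omega>" "y = of_int c + of_int d * \<omega>" by (auto simp: Eis_def)
  then have "x * y = of_int a * of_int c + (of_int a * of_int d + of_int b * of_int c) * \<omega> + of_int b * of_int d * \<omega>^2"
    by (simp add: algebra_simps power2_eq_square)
  also have "\<dots> = of_int (a*c - b*d) + of_int (a*d + b*c - b*d) * \<omega>"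
    unfolding omega_square by (simp add: algebra_simps)
  finally show ?thesis using EisI by metis
qed

lemma Eis_of_int [simp]: "of_int n \<in> Eis" using EisI[of n 0] by simp
lemma Eis_omega [simp]: "\<omega> \<in> Eis" using EisI[of 0 1] by simp
lemma Eis_0 [simp]: "0 \<in> Eis" and Eis_1 [simp]: "1 \<in> Eis" using Eis_of_int[of 0] Eis_of_int[of 1] by simp_all
lemma Eis_uminus: "x \<in> Eis \<Longrightarrow> - x \<in> Eis" using Eis_mult[OF Eis_of_int[of "-1"], of x] by simp
lemma Eis_diff: "x \<in> Eis \<Longrightarrow> y \<in> Eis \<Longrightarrow> x - y \<in> Eis" using Eis_add[of x "-y"] Eis_uminus[of y] by simp
lemma Eis_power: "x \<in> Eis \<Longrightarrow> x ^ n \<in> Eis" by (induction n) (auto intro: Eis_mult)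

lemma degree_eq_sum_order:
  assumes "p \<noteq> (0 :: complex poly)"
  shows "degree p = (\<Sum>z | poly p z = 0. order z p)"
proof -
  have "p = smult (lead_coeff p) (\<Prod>z|poly p z = 0. [:-z, 1:] ^ order z p)"
    by (rule complex_poly_decompose[symmetric])
  from arg_cong[OF this, of degree] have "degree p = degree (\<Prod>z|poly p z = 0. [:-z, 1:] ^ order z p)"
    using assms by (simp only: degree_smult_eq leading_coeff_0_iff if_False)
  also have "\<dots> = (\<Sum>z | poly p z = 0. degree ([:-z, 1:] ^ order z p))"
    by (intro degree_prod_eq_sum_degree) auto
  also have "\<dots> = (\<Sum>z | poly p z = 0. order z p)" by (simp add: degree_power_eq)
  finally show ?thesis .
qed

text \<open>
  Over an algebraically closed field a polynomial is a cube as soon as all its root orders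
  are divisible by \<open>3\<close>.
\<close>

lemma cube_if_orders:
  assumes "p \<noteq> (0 :: complex poly)" "\<And>z. 3 dvd order z p"
  shows "\<exists>c. p = c^3"
proof -
  have "\<exists>s. s^3 = lead_coeff p"
    using alg_closed_imp_poly_has_root[of "[:- lead_coeff p, 0, 0, 1:]"]
    by (auto simp: algebra_simps power_numeral_reduce)
  then obtain s where s: "s^3 = lead_coeff p" by blast
  let ?q = "\<Prod>z|poly p z = 0. [:-z, 1:] ^ (order z p div 3)"
  have "(K s * ?q)^3 = K (lead_coeff p) * (\<Prod>z|poly p z = 0. ([:-z, 1:] ^ (order z p div 3))^3)"
    by (simp add: power_mult_distrib prod_power_distrib s[symmetric] K_hom)
  also have "(\<lambda>z. ([:-z, 1:] ^ (order z p div 3))^3) = (\<lambda>z. [:-z, 1:] ^ order z p)"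
    using assms(2) by (auto simp: power_mult[symmetric])
  also have "K (lead_coeff p) * (\<Prod>z|poly p z = 0. [:-z, 1:] ^ order z p) = p"
    unfolding smult_K[symmetric] by (rule complex_poly_decompose)
  finally show ?thesis by metis
qed

lemma e3_root_cases: "poly e3 z = 0 \<Longrightarrow> z = -1 \<or> z = -\<omega> \<or> z = -(\<omega>^2)"
proof -
  assume "poly e3 z = 0"
  then have "z^3 = -1" by (simp add: poly_e3 add_eq_0_iff)
  then have "(-z)^3 = 1^3" by simp
  from cube_eq_cases_complex[OF this] obtain j where "j < 3" "-z = \<omega>^j" by auto
  moreover from this(2) have "z = -(\<omega>^j)" by (metis minus_minus)
  ultimately show ?thesis using nat_less_3[of j] by auto
qed

lemma e3_roots: "{z. poly e3 z = 0} = {-1, -\<omega>, -(\<omega>^2)}"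
proof -
  have "(-\<omega>)^3 = -1" "(-(\<omega>^2))^3 = -1"
    using omega_power_3[of 2] by (simp_all add: power3_eq_cube[of "-_"] power3_eq_cube[symmetric])
  then show ?thesis using e3_root_cases by (auto simp: poly_e3)
qed

text \<open>
  At a root of \<open>1 + t\<^sup>3\<close> the point degenerates to \<open>P\<^sup>3 +
  Q\<^sup>3 = 0\<close>, and \<open>sol_derivative\<close> loses its terms with
  derivatives: the value of \<open>R\<close> is determined by the multiplier.
\<close>

lemma sol_at_e3_root:
  assumes s: "sol a P Q R" and cp: "coprime P Q" and z: "poly e3 z = 0"
  shows "poly P z \<noteq> 0" "poly Q z \<noteq> 0" "z^2 * poly P z * poly R z = a * poly Q z ^ 2"
    "\<exists>j<3. poly (U j P Q) z = 0"
proof -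
  have oc: "P^3 + Q^3 = e3*R^3" using s by (simp add: sol_def on_curve_def)
  from arg_cong[OF this, of "\<lambda>p. poly p z"] have c: "poly P z ^3 + poly Q z^3 = 0" using z by simp
  show "poly P z \<noteq> 0" "poly Q z \<noteq> 0" using c coprime_poly_0[OF cp, of z] by auto
  from arg_cong[OF sol_derivative(1)[OF s], of "\<lambda>p. poly p z"] z
  show "z^2 * poly P z * poly R z = a * poly Q z ^ 2" by (simp add: power2_eq_square algebra_simps)
  have "poly P z ^3 = (- poly Q z)^3" using c by (simp add: eq_neg_iff_add_eq_0 power3_eq_cube)
  from cube_eq_cases_complex[OF this] show "\<exists>j<3. poly (U j P Q) z = 0" by (auto simp: poly_U)
qed

lemma U_no_common_root:
  assumes "coprime P Q" "i < 3" "j < 3" "i \<noteq> j" "poly (U i P Q) x = 0" shows "poly (U j P Q) x \<noteq> 0"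
proof
  assume "poly (U j P Q) x = 0"
  then have "(\<omega>^i - \<omega>^j) * poly Q x = 0" using assms(5) by (simp add: poly_U algebra_simps add_eq_0_iff)
  then have "poly Q x = 0" using omega_power_inj assms by auto
  then show False using assms(5) coprime_poly_0[OF assms(1), of x] by (simp add: poly_U)
qed

lemma order_U:
  assumes oc: "on_curve P Q R" and cp: "coprime P Q" and j: "j < 3" and x: "poly (U j P Q) x = 0"
  shows "order x (U j P Q) = order x e3 + 3 * order x R"
proof -
  have nz: "U i P Q \<noteq> 0" for i by (rule U_nz[OF oc])
  have R: "R \<noteq> 0" using on_curve_nz[OF oc] by simp
  have o: "order x (U i P Q) = 0" if "i < 3" "i \<noteq> j" for i
    using U_no_common_root[OF cp j that(1) _ x] that by (intro order_0I) auto
  have "order x (U 0 P Q) + order x (U 1 P Q) + order x (U 2 P Q) = order x (P^3+Q^3)"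
    unfolding U_prod[symmetric] using nz by (simp add: order_mult)
  also have "\<dots> = order x (e3*R^3)" using oc by (simp add: on_curve_def)
  also have "\<dots> = order x e3 + 3 * order x R" using R by (simp add: order_mult order_cube)
  finally show ?thesis using nat_less_3[OF j] o[of 0] o[of 1] o[of 2] by auto
qed

text \<open>
  By \<open>order_U\<close> the order of \<open>U j P Q\<close> at each of its roots is a
  multiple of \<open>3\<close>, increased by \<open>1\<close> at the roots of \<open>1 +
  t\<^sup>3\<close>.
\<close>

lemma degree_U_mod_3:
  assumes oc: "on_curve P Q R" and cp: "coprime P Q" and j: "j < 3"
  shows "degree (U j P Q) mod 3 = card {z. poly e3 z = 0 \<and> poly (U j P Q) z = 0} mod 3"
proof -
  have nz: "U j P Q \<noteq> 0" by (rule U_nz[OF oc])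
  have fin: "finite {z. poly (U j P Q) z = 0}" using nz by (rule poly_roots_finite)
  have "degree (U j P Q) = (\<Sum>z | poly (U j P Q) z = 0. order z (U j P Q))"
    by (rule degree_eq_sum_order[OF nz])
  also have "\<dots> = (\<Sum>z | poly (U j P Q) z = 0. (if poly e3 z = 0 then 1 else 0) + 3 * order z R)"
    using order_U[OF oc cp j] order_e3 order_0I[of e3] by (intro sum.cong) auto
  also have "\<dots> = (\<Sum>z | poly (U j P Q) z = 0. if poly e3 z = 0 then 1 else 0) + 3 * (\<Sum>z | poly (U j P Q) z = 0. order z R)"
    by (simp add: sum.distrib sum_distrib_left)
  also have "(\<Sum>z | poly (U j P Q) z = 0. if poly e3 z = 0 then 1 else 0) = card ({z. poly (U j P Q) z = 0} \<inter> {z. poly e3 z = 0})"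
    using fin by (simp add: sum.If_cases)
  also have "{z. poly (U j P Q) z = 0} \<inter> {z. poly e3 z = 0} = {z. poly e3 z = 0 \<and> poly (U j P Q) z = 0}" by auto
  finally show ?thesis by simp
qed

lemma card_e3_roots: "card {z. poly e3 z = 0} = 3"
proof -
  have "-1 \<noteq> -\<omega>" "-1 \<noteq> -(\<omega>^2)" "-\<omega> \<noteq> -(\<omega>^2)" using omega_neq by (metis neg_equal_iff_equal)+
  then show ?thesis unfolding e3_roots by (simp del: neg_equal_iff_equal)
qed

lemma zero_if_e3_roots:
  assumes "degree p < 3" "\<And>z. poly e3 z = 0 \<Longrightarrow> poly p z = 0"
  shows "p = 0"
proof (rule ccontr)
  assume p: "p \<noteq> 0"
  have "card {z. poly e3 z = 0} \<le> card {z. poly p z = 0}"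
    using assms(2) by (intro card_mono poly_roots_finite[OF p]) auto
  also have "\<dots> \<le> degree p" by (rule card_poly_roots_bound[OF p])
  finally show False using assms(1) by (simp add: card_e3_roots)
qed

lemma e3_dvd:
  assumes "\<And>z. poly e3 z = 0 \<Longrightarrow> poly p z = 0"
  shows "e3 dvd p"
proof -
  have "p mod e3 = 0"
  proof (rule zero_if_e3_roots)
    show "degree (p mod e3) < 3" using degree_mod_less[of e3 p] by auto
    fix z assume z: "poly e3 z = 0"
    have "poly p z = poly (e3 * (p div e3) + p mod e3) z" by simp
    then show "poly (p mod e3) z = 0" using z assms[OF z] by (simp only: poly_add poly_mult mult_zero_left add_0_left)
  qed
  then show ?thesis by auto
qed

text \<open>
  Descent by the isogeny of degree \<open>3\<close>. If all roots of \<open>1 +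
  t\<^sup>3\<close> are roots of \<open>U\<^sub>0\<close>, then \<open>U\<^sub>0 / (1 +
  t\<^sup>3)\<close>, \<open>U\<^sub>1\<close> and \<open>U\<^sub>2\<close> are cubes by
  \<open>order_U\<close>. The relation \<open>U\<^sub>0 + \<omega> U\<^sub>1 +
  \<omega>\<^sup>2 U\<^sub>2 = 0\<close> makes their cube roots a point of the same curve,
  of at most a third of the degree, whose multiplier is that of the given point divided by
  a square root of \<open>-3\<close>, up to a unit.
\<close>

lemma descent_step:
  assumes s: "sol a P Q R" and cp: "coprime P Q" and z: "\<And>z. poly e3 z = 0 \<Longrightarrow> poly (U 0 P Q) z = 0"
  obtains A B c where "on_curve A B c" "3 * max (degree A) (degree B) \<le> max (degree P) (degree Q)"
    "\<And>b. sol b A B c \<Longrightarrow> b \<in> Eis \<Longrightarrow> a \<in> Eis"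
proof -
  have oc: "on_curve P Q R" using s by (simp add: sol_def)
  have R: "R \<noteq> 0" using on_curve_nz[OF oc] by simp
  obtain V0 where V0: "U 0 P Q = e3 * V0" using e3_dvd[OF z] by (auto simp: dvd_def)
  have V0nz: "V0 \<noteq> 0" using U_nz[OF oc, of 0] V0 by auto
  have no: "poly (U j P Q) x \<noteq> 0" if "poly e3 x = 0" "j = 1 \<or> j = 2" for j x
    using U_no_common_root[OF cp, of 0 j x] z[OF that(1)] that(2) by auto
  have o0: "3 dvd order x V0" for x
  proof (cases "poly (U 0 P Q) x = 0")
    case True
    have "order x (U 0 P Q) = order x e3 + 3 * order x R" using order_U[OF oc cp _ True] by simp
    then show ?thesis using V0nz by (simp add: V0 order_mult)
  next
    case False then show ?thesis by (simp add: V0 order_0I)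
  qed
  have o12: "3 dvd order x (U j P Q)" if "j = 1 \<or> j = 2" for x j
  proof (cases "poly (U j P Q) x = 0")
    case True
    then have "poly e3 x \<noteq> 0" using no that by auto
    then show ?thesis using order_U[OF oc cp _ True] that by (auto simp: order_0I)
  next
    case False then show ?thesis by (simp add: order_0I)
  qed
  obtain c0 c1 c2 where c: "V0 = c0^3" "U 1 P Q = c1^3" "U 2 P Q = c2^3"
    using cube_if_orders[OF V0nz o0] cube_if_orders[OF U_nz[OF oc] o12[of 1]] cube_if_orders[OF U_nz[OF oc] o12[of 2]]
    by auto
  have "\<exists>\<eta>. \<eta>^3 = \<omega>"
    using alg_closed_imp_poly_has_root[of "[:- \<omega>, 0, 0, 1:]"]
    by (auto simp: algebra_simps power_numeral_reduce)
  then obtain \<eta> where eta: "\<eta>^3 = \<omega>" by blast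
  \<comment> \<open>the factors are cube roots of \<open>-\<omega>\<close> and \<open>-\<omega>\<^sup>2\<close>, so that \<open>A\<^sup>3 + B\<^sup>3 = -\<omega> U\<^sub>1 - \<omega>\<^sup>2 U\<^sub>2 = U\<^sub>0\<close>\<close>
  define A B where "A = K (-\<eta>) * c1" and "B = K (-(\<eta>^2)) * c2"
  have "(-\<eta>)^3 = -\<omega>" "(-(\<eta>^2))^3 = -(\<omega>^2)"
    using eta by (simp_all add: power_mult[symmetric] eta[symmetric])
  then have "A^3 + B^3 = - (K \<omega> * U 1 P Q) - K (\<omega>^2) * U 2 P Q"
    unfolding A_def B_def power_mult_distrib K_hom(5)[symmetric] c[symmetric] by (simp add: K_hom(3))
  also have "\<dots> = - (K \<omega> + K (\<omega>^2)) * P - (K \<omega> * K \<omega> + K (\<omega>^2) * K (\<omega>^2)) * Q"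
    by (simp add: U_def algebra_simps)
  also have "K (\<omega>^2) * K (\<omega>^2) = K \<omega>" unfolding K_hom(2)[symmetric] using omega_4 by (simp add: power_add[symmetric])
  also have "- (K \<omega> + K (\<omega>^2)) * P - (K \<omega> * K \<omega> + K \<omega>) * Q = e3 * c0^3"
    unfolding c(1)[symmetric] V0[symmetric] by (simp add: K_omega U_def)
  finally have "A^3 + B^3 = e3 * c0^3" .
  moreover have c0: "c0 \<noteq> 0" using V0nz c by auto
  ultimately have ocA: "on_curve A B c0" by (simp add: on_curve_def)
  have eta0: "\<eta> \<noteq> 0" using eta by auto
  have "degree A = degree c1" "degree B = degree c2" using eta0 by (simp_all add: A_def B_def K_def)
  moreover have "3 * degree c1 = degree (U 1 P Q)" "3 * degree c2 = degree (U 2 P Q)"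
    using U_nz[OF oc, of 1] U_nz[OF oc, of 2] by (simp_all add: c degree_power_eq del: One_nat_def)
  ultimately have deg: "3 * max (degree A) (degree B) \<le> max (degree P) (degree Q)"
    using degree_U_le[of 1 P Q] degree_U_le[of 2 P Q] by (auto simp: max_def split: if_splits)
  have fin: "a \<in> Eis" if b: "sol b A B c0" "b \<in> Eis" for b
  proof -
    have wAB: "K \<omega> * wronskian c1 c2 = K b * c0^2"
    proof -
      have "wronskian A B = K ((-\<eta>)*(-(\<eta>^2))) * wronskian c1 c2" unfolding A_def B_def by (rule wr_const)
      also have "(-\<eta>)*(-(\<eta>^2)) = \<omega>" using eta by (simp add: power_numeral_reduce)
      finally show ?thesis using b by (simp add: sol_def)
    qed
    have "wronskian (U 1 P Q) (U 2 P Q) = K (\<omega>^2 - \<omega>) * wronskian P Q"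
      using wr_lincomb[of 1 P \<omega> Q 1 "\<omega>^2"] by (simp add: U_def)
    moreover have "wronskian (c1^3) (c2^3) = 3 * (c1*c2)^2 * wronskian c1 c2"
      unfolding wronskian_def pderiv_cube by (simp add: algebra_simps power_numeral_reduce)
    ultimately have w: "K (\<omega>^2 - \<omega>) * (K a * R^2) = 3 * (c1*c2)^2 * wronskian c1 c2"
      using s c by (simp add: sol_def)
    have "e3 * R^3 = e3 * (c0*c1*c2)^3"
      using oc U_prod[of P Q] by (simp add: on_curve_def V0 c power_mult_distrib mult_ac del: One_nat_def)
    then have "R^3 = (c0*c1*c2)^3" by simp
    then obtain j where j: "R = K (\<omega>^j) * (c0*c1*c2)" using cube_eq_cases[of R "c0*c1*c2"] by (auto simp: smult_K)
    have nz: "(c0*c1*c2)^2 \<noteq> 0" using j R by auto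
    have "K (\<omega> * ((\<omega>^2 - \<omega>) * a * (\<omega>^j)^2)) * (c0*c1*c2)^2 = K \<omega> * (K (\<omega>^2 - \<omega>) * (K a * R^2))"
      unfolding j by (simp add: K_hom mult_ac power_mult_distrib)
    also have "\<dots> = 3 * (c1*c2)^2 * (K \<omega> * wronskian c1 c2)" unfolding w by (simp add: mult_ac)
    also have "\<dots> = K (3*b) * (c0*c1*c2)^2" unfolding wAB by (simp add: K_hom power_mult_distrib mult_ac)
    finally have "K (\<omega> * ((\<omega>^2 - \<omega>) * a * (\<omega>^j)^2)) = K (3*b)" using nz by simp
    then have e: "\<omega> * ((\<omega>^2 - \<omega>) * a * (\<omega>^j)^2) = 3*b" by (simp add: K_def)
    have w2: "\<omega> * \<omega> = -1 - \<omega>" using omega_square by (simp add: power2_eq_square)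
    have "(\<omega>^2 - \<omega>) * (\<omega>^2 - \<omega>) = 1 + 4 * \<omega> + 4 * (\<omega> * \<omega>)"
      unfolding omega_square by (simp add: algebra_simps)
    then have sq: "(\<omega>^2 - \<omega>) * (\<omega>^2 - \<omega>) = -3" unfolding w2 by simp
    have "(\<omega>^j)^2 * \<omega>^j = 1" using omega_power_3[of j] by (simp add: power_numeral_reduce mult_ac)
    then have "-3 * a = (\<omega>^2 - \<omega>) * (\<omega>^2 - \<omega>) * a * ((\<omega>^j)^2 * \<omega>^j) * (\<omega> * \<omega>^2)"
      using sq omega_cube by (simp add: power_numeral_reduce mult_ac)
    also have "\<dots> = (\<omega> * ((\<omega>^2 - \<omega>) * a * (\<omega>^j)^2)) * ((\<omega>^2 - \<omega>) * \<omega>^j * \<omega>^2)" by (simp only: mult_ac)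
    also have "\<dots> = 3 * (b * ((\<omega>^2 - \<omega>) * \<omega>^j * \<omega>^2))" unfolding e by (simp only: mult_ac)
    finally have "3 * (- a) = 3 * (b * ((\<omega>^2 - \<omega>) * \<omega>^j * \<omega>^2))" by (simp only: mult_minus_left mult_minus_right)
    then have "- a = b * ((\<omega>^2 - \<omega>) * \<omega>^j * \<omega>^2)" by (subst (asm) mult_left_cancel) auto
    then have "a = - (b * ((\<omega>^2 - \<omega>) * \<omega>^j * \<omega>^2))" by (metis minus_minus)
    then show ?thesis using b(2) by (auto intro!: Eis_uminus Eis_mult Eis_diff Eis_power)
  qed
  show thesis by (rule that[OF ocA deg fin])
qed

lemma sol_id: "sol 1 1 [:0,1:] 1"
  by (simp add: sol_def on_curve_def e3_def wronskian_def pderiv_pCons power3_eq_cube power2_eq_square one_pCons)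

lemma e3_root_cube: "poly e3 z = 0 \<Longrightarrow> z^3 = -1" by (simp add: poly_e3 add_eq_0_iff)

lemma sol_cong_unit:
  assumes "sol a P Q R" "sol b P' Q' R'" "P*R' = P'*R" "Q*R' = Q'*R" shows "a = b"
proof -
  have "R \<noteq> 0" using assms by (simp add: sol_def on_curve_def)
  then show ?thesis using sol_cong[OF assms(2) _ assms(3,4)] sol_mult_unique[OF assms(1)] by blast
qed

text \<open>
  At the roots \<open>z\<close> of \<open>1 + t\<^sup>3\<close> the point looks like
  \<open>(1 : z)\<close>. Then \<open>A\<close> and \<open>B\<close> in the chord formula
  for its difference with \<open>(1, t)\<close> satisfy \<open>A + B = 0\<close> at these
  roots, so \<open>descent_step\<close> applies to the difference, whose multiplier is
  \<open>a - 1\<close>. For a point of degree \<open>D\<close> the difference has degree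
  at most \<open>2 D + 1\<close>, and a third of that is less than \<open>D\<close> if
  \<open>D > 1\<close>. In degree \<open>1\<close> the point is \<open>(1, t)\<close>
  itself up to a cube root of unity.
\<close>

lemma descent_aligned:
  assumes s: "sol a P Q R" and cp: "coprime P Q" and z: "\<And>z. poly e3 z = 0 \<Longrightarrow> poly Q z = z * poly P z"
    and IH: "\<And>A B c. max (degree A) (degree B) < max (degree P) (degree Q) \<Longrightarrow> on_curve A B c \<Longrightarrow> \<exists>b\<in>Eis. sol b A B c"
  shows "a \<in> Eis"
proof -
  define X where "X = [:0,1::complex:]"
  have oc: "on_curve P Q R" using s by (simp add: sol_def)
  have c: "P^3 + Q^3 = e3*R^3" using oc by (simp add: on_curve_def)
  have cX: "X^3 + 1^3 = e3 * 1^3" by (simp add: X_def e3_def power3_eq_cube one_pCons)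
  have sX: "sol (-1) X 1 1" unfolding X_def by (rule sol_swap[OF sol_id])
  have R: "R \<noteq> 0" and P: "P \<noteq> 0" using on_curve_nz[OF oc] by auto
  show ?thesis
  proof (cases "max (degree P) (degree Q) \<le> 1")
    case True
    have "Q - X * P = 0"
    proof (rule zero_if_e3_roots)
      have "degree (X * P) \<le> 2" using True degree_mult_le[of X P] by (simp add: X_def)
      then have "degree (Q - X * P) \<le> 2" using True by (intro degree_diff_le) auto
      then show "degree (Q - X * P) < 3" by simp
      show "poly (Q - X * P) z = 0" if "poly e3 z = 0" for z using z[OF that] by (simp add: X_def)
    qed
    then have Q: "Q = X * P" by simp
    have "e3 * P^3 = e3 * R^3" 
    proof -
      have "P^3 + Q^3 = (X^3 + 1^3) * P^3" unfolding Q by (simp add: power_mult_distrib algebra_simps)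
      then show ?thesis unfolding cX using c by simp
    qed
    then obtain j where j: "R = K (\<omega>^j) * P" using cube_eq_cases[of R P] by (auto simp: smult_K)
    have "wronskian P Q = P^2" unfolding Q by (simp add: wronskian_def X_def pderiv_pCons pderiv_mult algebra_simps power2_eq_square)
    then have "P^2 = K a * (K (\<omega>^j) * P)^2" using s unfolding j by (simp add: sol_def)
    then have "P^2 * K (a * (\<omega>^j)^2) = P^2 * K 1" by (simp add: K_hom power_mult_distrib mult_ac)
    then have "K (a * (\<omega>^j)^2) = K 1" using P by (subst (asm) mult_cancel_left) auto
    then have e: "a * (\<omega>^j)^2 = 1" by (simp only: K_def pCons_eq_iff)
    have "a = a * (\<omega>^j)^3" by (simp add: omega_power_3)
    also have "\<dots> = (a * (\<omega>^j)^2) * \<omega>^j" by (simp add: power_numeral_reduce)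
    finally have "a = \<omega>^j" using e by simp
    then show ?thesis by (simp add: Eis_power)
  next
    case big: False
    define A where "A = P^2*1*1 - X^2*Q*R"
    define B where "B = Q^2*X*1 - 1^2*P*R"
    define C where "C = R^2*X*1 - 1^2*P*Q"
    show ?thesis
    proof (cases "C = 0")
      case True
      then have C: "R^2*X*1 = 1^2*P*Q" by (simp add: C_def)
      show ?thesis
      proof (rule equal_products_cases[OF c cX C])
        show "P \<noteq> 0" "Q \<noteq> 0" "(1::complex poly) \<noteq> 0" using on_curve_nz[OF oc] by auto
      next
        fix j assume j: "j < 3" "X*R = K (\<omega>^j) * (P*1)" "Q*1 = K (\<omega>^j) * (1*R)"
        have "sol (\<omega>^j * 1 * a) (K (\<omega>^j) * P) (K 1 * Q) R" using s omega_power_3 by (intro sol_omega) auto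
        moreover have "sol (1 * \<omega>^j * (-1)) (K 1 * X) (K (\<omega>^j) * 1) 1" using sX omega_power_3 by (intro sol_omega) auto
        ultimately have "\<omega>^j * 1 * a = 1 * \<omega>^j * (-1)" by (rule sol_cong_unit) (use j in \<open>auto simp: mult_ac\<close>)
        then have "\<omega>^j * a = \<omega>^j * (-1)" by simp
        then have "a = -1" using omega_neq(1) by (simp only: mult_cancel_left power_not_zero) simp
        then show ?thesis by (simp add: Eis_uminus)
      next
        fix j assume j: "j < 3" "X*R = K (\<omega>^j) * (Q*1)" "P*1 = K (\<omega>^j) * (1*R)"
        have "sol (1 * \<omega>^j * a) (K 1 * P) (K (\<omega>^j) * Q) R" using s omega_power_3 by (intro sol_omega) auto
        moreover have "sol (\<omega>^j * 1 * 1) (K (\<omega>^j) * 1) (K 1 * X) 1" using sol_id omega_power_3 unfolding X_def by (intro sol_omega) auto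
        ultimately have "1 * \<omega>^j * a = \<omega>^j * 1 * 1" by (rule sol_cong_unit) (use j in \<open>auto simp: mult_ac\<close>)
        then show ?thesis by simp
      qed
    next
      case False
      have sBA: "sol (a + (-1)) B A C" unfolding A_def B_def C_def
        by (rule sol_add_chord[OF s sX]) (use False in \<open>simp add: C_def\<close>)
      show ?thesis
      proof (cases "a = -1")
        case True then show ?thesis by (simp add: Eis_uminus)
      next
        case a: False
        obtain g B0 A0 C0 where g: "g \<noteq> 0" "B = g*B0" "A = g*A0" "C = g*C0" and cp0: "coprime B0 A0" and s0: "sol (a + (-1)) B0 A0 C0"
          using sol_normalise[OF sBA] .
        have z0: "poly (U 0 B0 A0) z = 0" if e: "poly e3 z = 0" for z
        proof -
          note zz = sol_at_e3_root[OF s cp e]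
          have z3: "z^3 = -1" by (rule e3_root_cube[OF e])
          then have zn: "z \<noteq> 0" by auto
          have "z^2 * poly P z * poly R z = z^2 * poly P z * (a * poly P z)"
            using zz(3) z[OF e] by (simp add: power2_eq_square mult_ac)
          then have r: "poly R z = a * poly P z" using zn zz(1) by simp
          have "poly A z = (1 - z^3 * a) * poly P z ^ 2"
            using r z[OF e] by (simp add: A_def X_def algebra_simps power_numeral_reduce)
          then have A: "poly A z = (1 + a) * poly P z ^ 2" using z3 by simp
          have "poly B z = (z^3 - a) * poly P z ^ 2"
            using r z[OF e] by (simp add: B_def X_def algebra_simps power_numeral_reduce)
          then have B: "poly B z = -((1 + a) * poly P z ^ 2)" using z3 by (simp add: algebra_simps)
          have "1 + a \<noteq> 0" using a by (simp add: add_eq_0_iff)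
          then have "poly A z \<noteq> 0" using A zz(1) by simp
          then have "poly g z \<noteq> 0" using g by auto
          moreover have "poly g z * (poly B0 z + poly A0 z) = 0" using A B g by (simp add: distrib_left)
          ultimately show ?thesis by (simp add: poly_U)
        qed
        obtain A1 B1 c1 where d: "on_curve A1 B1 c1" "3 * max (degree A1) (degree B1) \<le> max (degree B0) (degree A0)"
          "\<And>b. sol b A1 B1 c1 \<Longrightarrow> b \<in> Eis \<Longrightarrow> a + (-1) \<in> Eis"
          using descent_step[OF s0 cp0 z0] by blast
        define D where "D = max (degree P) (degree Q)"
        have dR: "degree R \<le> D - 1" "1 \<le> D" using on_curve_degree[OF oc] by (auto simp: D_def)
        have dPQ: "degree P \<le> D" "degree Q \<le> D" by (auto simp: D_def)
        have dX: "degree X = 1" by (simp add: X_def)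
        have "degree (P^2) \<le> 2*D+1" using degree_power_le[of P 2] dPQ by simp
        moreover have "degree (X^2*Q*R) \<le> 2*D+1"
        proof -
          have "degree (X^2*Q*R) \<le> degree (X^2) + degree Q + degree R"
            using degree_mult_le[of "X^2*Q" R] degree_mult_le[of "X^2" Q] by simp
          moreover have "degree (X^2) = 2" by (simp add: degree_power_eq X_def)
          ultimately show ?thesis using dR dPQ by simp
        qed
        ultimately have dA: "degree A \<le> 2*D+1" unfolding A_def by (intro degree_diff_le) auto
        have "degree (Q^2*X) \<le> 2*D+1"
          using degree_power_le[of Q 2] degree_mult_le[of "Q^2" X] dPQ dX by simp
        moreover have "degree (P*R) \<le> 2*D+1" using degree_mult_le[of P R] dPQ dR by simp
        ultimately have dB: "degree B \<le> 2*D+1" unfolding B_def by (intro degree_diff_le) auto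
        have AB: "A0 \<noteq> 0" "B0 \<noteq> 0" using on_curve_nz[of B0 A0 C0] s0 by (simp_all add: sol_def)
        have "degree A0 \<le> degree A" "degree B0 \<le> degree B" using g AB by (auto simp: degree_mult_eq)
        then have "max (degree B0) (degree A0) \<le> 2*D+1" using dA dB by simp
        moreover have "2*D+1 < 3*D" using big by (simp add: D_def[symmetric])
        ultimately have "max (degree A1) (degree B1) < D" using d(2) by linarith
        then obtain b where "b \<in> Eis" "sol b A1 B1 c1" using IH[OF _ d(1)] by (auto simp: D_def)
        then have "a + (-1) \<in> Eis" using d(3) by blast
        then show ?thesis using Eis_add[OF _ Eis_1] by fastforce
      qed
    qed
  qed
qed

lemma Eis_cancel_omega: "\<omega>^j * a \<in> Eis \<Longrightarrow> a \<in> Eis"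
proof -
  assume "\<omega>^j * a \<in> Eis"
  then have "(\<omega>^j)^2 * (\<omega>^j * a) \<in> Eis" by (intro Eis_mult[OF Eis_power[OF Eis_power]]) auto
  also have "(\<omega>^j)^2 * (\<omega>^j * a) = (\<omega>^j)^3 * a" by (simp add: power_numeral_reduce mult_ac)
  finally show ?thesis by (simp add: omega_power_3)
qed

text \<open>
  Each root \<open>z\<close> of \<open>1 + t\<^sup>3\<close> is a root of exactly one
  factor \<open>U j P Q\<close>. If the index \<open>j\<close> is the same for the three
  roots, multiplying \<open>Q\<close> by a power of \<open>\<omega>\<close> makes it
  \<open>0\<close> and \<open>descent_step\<close> applies. If the three indices are
  distinct, multiplying a coordinate by a power of \<open>\<omega>\<close>, for one of the
  two cyclic orders after exchanging \<open>P\<close> and \<open>Q\<close>, leads to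
  \<open>descent_aligned\<close>. Exactly two equal indices cannot occur: then the degrees
  of the three factors would be pairwise incongruent modulo \<open>3\<close> by
  \<open>degree_U_mod_3\<close>, whereas two of them have the maximal degree.
\<close>

theorem multiplier_eisenstein:
  assumes "on_curve P Q R" shows "\<exists>a\<in>Eis. sol a P Q R"
  using assms
proof (induction "max (degree P) (degree Q)" arbitrary: P Q R rule: less_induct)
  case less
  obtain g P0 Q0 R0 where g: "g \<noteq> 0" "P = g*P0" "Q = g*Q0" "R = g*R0" and cp: "coprime P0 Q0" and oc: "on_curve P0 Q0 R0"
    using on_curve_normalise[OF less.prems] .
  note nz = on_curve_nz[OF oc]
  define D where "D = max (degree P0) (degree Q0)"
  have "degree P0 \<le> degree P" "degree Q0 \<le> degree Q" using g nz by (auto simp: degree_mult_eq)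
  then have IH: "\<exists>b\<in>Eis. sol b A B c" if "max (degree A) (degree B) < D" "on_curve A B c" for A B c
    using that by (intro less.hyps) (auto simp: D_def)
  have D1: "D \<ge> 1" using on_curve_degree[OF oc] by (simp add: D_def)
  obtain a where s: "sol a P0 Q0 R0" using multiplier_exists[OF oc cp] by blast
  have e3r: "poly e3 (-1) = 0" "poly e3 (-\<omega>) = 0" "poly e3 (-(\<omega>^2)) = 0" using e3_roots by auto
  obtain j0 j1 j2 where j: "j0 < 3" "j1 < 3" "j2 < 3" and
      u: "poly (U j0 P0 Q0) (-1) = 0" "poly (U j1 P0 Q0) (-\<omega>) = 0" "poly (U j2 P0 Q0) (-(\<omega>^2)) = 0"
    using sol_at_e3_root(4)[OF s cp] e3r by meson
  then have val: "poly P0 (-1) = -(\<omega>^j0 * poly Q0 (-1))" "poly P0 (-\<omega>) = -(\<omega>^j1 * poly Q0 (-\<omega>))"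
      "poly P0 (-(\<omega>^2)) = -(\<omega>^j2 * poly Q0 (-(\<omega>^2)))" by (simp_all add: poly_U eq_neg_iff_add_eq_0)
  have cpK: "coprime P0 (K (\<omega>^i) * Q0)" "coprime Q0 (K (\<omega>^i) * P0)" for i
    using coprime_iff_no_common_root[OF nz(1), of Q0] coprime_iff_no_common_root[OF nz(1), of "K (\<omega>^i) * Q0"]
      coprime_iff_no_common_root[OF nz(2), of "K (\<omega>^i) * P0"] cp by auto
  have degK: "degree (K (\<omega>^i) * X) = degree X" for i and X :: "complex poly" by (simp add: K_def)
  have sK: "sol (\<omega>^i * a) P0 (K (\<omega>^i) * Q0) R0" "sol (\<omega>^i * (-a)) Q0 (K (\<omega>^i) * P0) R0" for i
    using sol_omega[OF s, of 1 "\<omega>^i"] sol_omega[OF sol_swap[OF s], of 1 "\<omega>^i"] by (simp_all add: omega_power_3)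
  consider "j1 = j0" "j2 = j0" | "j1 = (j0+2) mod 3" "j2 = (j0+1) mod 3" | "j1 = (j0+1) mod 3" "j2 = (j0+2) mod 3"
    | "\<not> (j1 = j0 \<and> j2 = j0)" "j0 = j1 \<or> j1 = j2 \<or> j0 = j2"
    using nat_less_3[OF j(1)] nat_less_3[OF j(2)] nat_less_3[OF j(3)] by (elim disjE) auto
  then have "a \<in> Eis"
  proof cases
    case 1
    have "poly (U 0 P0 (K (\<omega>^j0) * Q0)) z = 0" if "poly e3 z = 0" for z
      using e3_root_cases[OF that] val 1 by (auto simp: poly_U)
    from descent_step[OF sK(1) cpK(1) this] obtain A B c where d: "on_curve A B c"
      "3 * max (degree A) (degree B) \<le> D" "\<And>b. sol b A B c \<Longrightarrow> b \<in> Eis \<Longrightarrow> \<omega>^j0 * a \<in> Eis"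
      by (metis D_def degK)
    have "max (degree A) (degree B) < D" using d(2) D1 by linarith
    from IH[OF this d(1)] d(3) show ?thesis using Eis_cancel_omega by blast
  next
    case 2
    have "\<omega>^(1+j1) = \<omega>^j0" "\<omega>^(2+j2) = \<omega>^j0"
      using nat_less_3[OF j(1)] 2 omega_power_mod[of "1+j1"] omega_power_mod[of "2+j2"] by (auto simp: power2_eq_square)
    then have w: "\<omega> * \<omega>^j1 = \<omega>^j0" "\<omega>^2 * \<omega>^j2 = \<omega>^j0"
      by (simp_all only: power_add power_one_right)
    have "poly (K (\<omega>^j0) * Q0) z = z * poly P0 z" if "poly e3 z = 0" for z
      using e3_root_cases[OF that] val w[symmetric] by (auto simp: mult_ac)
    from descent_aligned[OF sK(1) cpK(1) this] IH have "\<omega>^j0 * a \<in> Eis" by (simp add: degK D_def)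
    then show ?thesis by (rule Eis_cancel_omega)
  next
    case 3
    define k where "k = 2 * j0"
    have w: "\<omega>^k * \<omega>^j0 = 1" "\<omega>^k * \<omega>^j1 = \<omega>" "\<omega>^k * \<omega>^j2 = \<omega>^2"
      unfolding power_add[symmetric] using nat_less_3[OF j(1)] 3 omega_power_mod[of "k+j0"] omega_power_mod[of "k+j1"] omega_power_mod[of "k+j2"]
      by (auto simp: k_def power2_eq_square)
    have "poly (K (\<omega>^k) * P0) z = z * poly Q0 z" if "poly e3 z = 0" for z
      using e3_root_cases[OF that] val w by (auto simp: mult.assoc[symmetric])
    from descent_aligned[OF sK(2) cpK(2) this] IH have "\<omega>^k * (-a) \<in> Eis" by (simp add: degK D_def max.commute)
    then have "- a \<in> Eis" by (rule Eis_cancel_omega)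
    then show ?thesis using Eis_uminus by fastforce
  next
    case 4
    define m where "m i = degree (U i P0 Q0)" for i
    have mD: "m i \<le> D" for i using degree_U_le by (simp add: m_def D_def)
    have mm: "D \<le> max (m 0) (m 1)" "D \<le> max (m 0) (m 2)" "D \<le> max (m 1) (m 2)"
      using degree_U_pair[of _ _ P0 Q0] by (simp_all add: m_def D_def)
    have ds: "-1 \<noteq> -\<omega>" "-1 \<noteq> -(\<omega>^2)" "-\<omega> \<noteq> -(\<omega>^2)" using omega_neq by (metis neg_equal_iff_equal)+
    have mc: "m i mod 3 = ((if i = j0 then 1 else 0) + (if i = j1 then 1 else 0) + (if i = j2 then 1 else 0)) mod 3" if i: "i < 3" for i
    proof -
      have "poly (U i P0 Q0) (-1) = 0 \<longleftrightarrow> i = j0" "poly (U i P0 Q0) (-\<omega>) = 0 \<longleftrightarrow> i = j1" "poly (U i P0 Q0) (-(\<omega>^2)) = 0 \<longleftrightarrow> i = j2"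
        using U_no_common_root[OF cp _ i] u j by metis+
      then have "{z. poly e3 z = 0 \<and> poly (U i P0 Q0) z = 0} = (if i = j0 then {-1} else {}) \<union> (if i = j1 then {-\<omega>} else {}) \<union> (if i = j2 then {-(\<omega>^2)} else {})"
        using e3_root_cases e3r by (auto split: if_splits)
      then show ?thesis using degree_U_mod_3[OF oc cp i] ds by (simp add: m_def del: neg_equal_iff_equal)
    qed
    have "m 0 = m 1 \<or> m 0 = m 2 \<or> m 1 = m 2" using mm mD[of 0] mD[of 1] mD[of 2] by (auto simp: max_def split: if_splits)
    then have "m 0 mod 3 = m 1 mod 3 \<or> m 0 mod 3 = m 2 mod 3 \<or> m 1 mod 3 = m 2 mod 3" by auto
    then have False using mc[of 0] mc[of 1] mc[of 2] nat_less_3[OF j(1)] nat_less_3[OF j(2)] nat_less_3[OF j(3)] 4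
      by (elim disjE) simp_all
    then show ?thesis ..
  qed
  moreover have "sol a P Q R" using g nz by (intro sol_cong[OF s]) auto
  ultimately show ?case by blast
qed

section \<open>Concave functions on the hexagonal lattice\<close>

lemma concave_int_supergradient:
  fixes g :: "int \<Rightarrow> int"
  assumes c: "\<And>n. g (n+1) + g (n-1) \<le> 2 * g n"
  shows "g m \<le> g x + (m - x) * (g (x+1) - g x)"
proof -
  define h where "h n = g (n+1) - g n" for n
  have step: "h (n+1) \<le> h n" for n using c[of "n+1"] by (simp add: h_def algebra_simps)
  have up: "h (n + int k) \<le> h n" for n k
  proof (induction k)
    case (Suc k) then show ?case using step[of "n + int k"] by (simp add: add_ac)
  qed simp
  have r: "g (x + int k) \<le> g x + int k * h x" for k
  proof (induction k)
    case (Suc k)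
    have "g (x + int (Suc k)) = g (x + int k) + h (x + int k)" by (simp add: h_def add_ac)
    then show ?case using Suc up[of x k] by (simp add: algebra_simps)
  qed simp
  have l: "g (x - int k) \<le> g x - int k * h x" for k
  proof (induction k)
    case (Suc k)
    have "g (x - int (Suc k)) = g (x - int k) - h (x - int (Suc k))" by (simp add: h_def algebra_simps)
    moreover have "h x \<le> h (x - int (Suc k))" using up[of "x - int (Suc k)" "Suc k"] by simp
    ultimately show ?case using Suc by (simp add: algebra_simps)
  qed simp
  show ?thesis
  proof (cases "x \<le> m")
    case True then show ?thesis using r[of "nat (m - x)"] by (simp add: h_def)
  next
    case False then show ?thesis using l[of "nat (x - m)"] by (simp add: h_def algebra_simps)
  qed
qed

text \<open>
  A concave function on the integers is nonnegative between two of its zeros and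
  nonpositive outside.
\<close>

lemma concave_int_between:
  fixes g :: "int \<Rightarrow> int"
  assumes c: "\<And>n. g (n+1) + g (n-1) \<le> 2 * g n" and z: "g a = 0" "g b = 0" "a < b"
  shows "a \<le> n \<Longrightarrow> n \<le> b \<Longrightarrow> 0 \<le> g n" and "b < n \<Longrightarrow> g n \<le> 0" and "n < a \<Longrightarrow> g n \<le> 0"
proof -
  note s = concave_int_supergradient[of g, OF c]
  show "0 \<le> g n" if "a \<le> n" "n \<le> b"
  proof (cases "0 \<le> g (n+1) - g n")
    case True
    then have "(n - a) * (g (n+1) - g n) \<ge> 0" using that by simp
    then show ?thesis using s[of a n] z by (simp add: algebra_simps)
  next
    case False
    then have "(b - n) * (g (n+1) - g n) \<le> 0" using that by (simp add: mult_nonneg_nonpos)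
    then show ?thesis using s[of b n] z by (simp add: algebra_simps)
  qed
  show "g n \<le> 0" if "b < n"
  proof -
    have "0 \<le> (a - b) * (g (b+1) - g b)" using s[of a b] z by simp
    then have "g (b+1) - g b \<le> 0" using z(3) by (simp add: zero_le_mult_iff)
    then have "(n - b) * (g (b+1) - g b) \<le> 0" using that by (simp add: mult_nonneg_nonpos)
    then show ?thesis using s[of n b] z by simp
  qed
  show "g n \<le> 0" if "n < a"
  proof -
    have "0 \<le> (b - a) * (g (a+1) - g a)" using s[of b a] z by simp
    then have "g (a+1) - g a \<ge> 0" using z(3) by (simp add: zero_le_mult_iff)
    then have "(n - a) * (g (a+1) - g a) \<le> 0" using that by (simp add: mult_nonpos_nonneg)
    then show ?thesis using s[of n a] z by simp
  qed
qed

text \<open>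
  Here \<open>(x, y)\<close> stands for \<open>x + y \<omega>\<close>, and \<open>(x, y)
  \<mapsto> (x - y, x)\<close> is the rotation by a sixth of a turn. On the positive half
  of the first axis the zeros \<open>0\<close> and \<open>3\<^sup>k\<close> force \<open>E
  \<ge> 0\<close> up to \<open>3\<^sup>k\<close>, whereas the zeros \<open>0\<close> and
  \<open>1\<close> force \<open>E \<le> 0\<close> beyond \<open>1\<close>; so
  \<open>E\<close> vanishes on this ray and on its rotations. Along the row of a point
  inside the sector \<open>0 < x < y\<close> the point lies between two zeros, so \<open>E
  \<ge> 0\<close> there; after a rotation the point lies outside the segment between two
  zeros of its row, so \<open>E \<le> 0\<close>. The six rotations of this sector cover
  the lattice.
\<close>

lemma hexagonal_concave_zero:
  fixes E :: "int \<Rightarrow> int \<Rightarrow> int"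
  assumes c: "\<And>x y. E (x+1) y + E (x-1) y \<le> 2 * E x y"
    and r: "\<And>x y. E (x-y) x = E x y"
    and z: "\<And>k. E (3^k) 0 = 0" "E 0 0 = 0"
  shows "E x y = 0"
proof -
  have neg: "E (-x) (-y) = E x y" for x y using r[of x y] r[of "x-y" x] r[of "-y" "x-y"] by simp
  have pos0: "E n 0 = 0" if "0 \<le> n" for n
  proof -
    note cc = concave_int_between[of "\<lambda>x. E x 0", OF c]
    have "n < 3 ^ nat n"
    proof -
      have "nat n < 3 ^ nat n" by (rule power_gt_expt) simp
      then show ?thesis using that by (metis int_nat_eq of_nat_less_iff of_nat_numeral of_nat_power)
    qed
    then have "0 \<le> E n 0" using cc(1)[of 0 "3 ^ nat n" n] z that by simp
    moreover have "E n 0 \<le> 0" if "n > 1" using cc(2)[of 0 1 n] z(1)[of 0] z(2) that by simp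
    moreover have "n = 0 \<or> n = 1 \<or> n > 1" using that by auto
    ultimately show ?thesis using z(1)[of 0] z(2) by fastforce
  qed
  have diag: "E n n = 0" "E 0 n = 0" if "0 \<le> n" for n
    using r[of n 0] r[of n n] pos0[OF that] by simp_all
  have sector: "E x y = 0" if "0 \<le> x" "x \<le> y" for x y
  proof (cases "x = 0 \<or> x = y")
    case True then show ?thesis using diag[of y] that by auto
  next
    case False
    note cc = concave_int_between[of "\<lambda>x. E x n" 0 n for n, OF c]
    have "0 \<le> E x y" using cc(1)[of y x] diag[of y] that False by simp
    moreover have "E (x-y) x \<le> 0" using cc(3)[of x "x-y"] diag[of x] that False by simp
    ultimately show ?thesis using r[of x y] by simp
  qed
  consider "0 \<le> x" "x \<le> y" | "0 \<le> x-y" "x-y \<le> x" | "0 \<le> -y" "-y \<le> x-y"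
    | "0 \<le> -x" "-x \<le> -y" | "0 \<le> y-x" "y-x \<le> -x" | "0 \<le> y" "y \<le> y-x" by linarith
  then show ?thesis
  proof cases
    case 1 then show ?thesis by (rule sector)
  next
    case 2 then show ?thesis using sector[of "x-y" x] r[of x y] by simp
  next
    case 3 then show ?thesis using sector[of "-y" "x-y"] r[of x y] r[of "x-y" x] by simp
  next
    case 4 then show ?thesis using sector[of "-x" "-y"] neg[of x y] by simp
  next
    case 5 then show ?thesis using sector[of "y-x" "-x"] neg[of "x-y" x] r[of x y] by simp
  next
    case 6 then show ?thesis using sector[of y "y-x"] neg[of "-y" "x-y"] r[of x y] r[of "x-y" x] by simp
  qed
qed

section \<open>Degree as a function of the multiplier\<close>

lemma coprime_proportional:
  assumes oc: "on_curve P Q R" "on_curve P' Q' R'" and cp: "coprime P Q" "coprime P' Q'"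
    and e: "P*R' = P'*R" "Q*R' = Q'*R"
  obtains k where "k \<noteq> 0" "P' = K k * P" "Q' = K k * Q" "R' = K k * R"
proof -
  have "R dvd Q*R'" "R' dvd Q'*R" using e by (metis dvd_triv_right)+
  then have "R dvd R'" "R' dvd R" using coprime_on_curve_QR[OF oc(1) cp(1)] coprime_on_curve_QR[OF oc(2) cp(2)]
    by (simp_all add: coprime_dvd_mult_right_iff coprime_commute)
  moreover have nz: "R \<noteq> 0" "R' \<noteq> 0" using oc by (auto simp: on_curve_def)
  ultimately obtain u where u: "R' = R * u" "u dvd 1"
    by (metis dvd_def dvd_mult_cancel_left mult.right_neutral)
  then obtain k where k: "u = K k" by (metis K_def is_unit_polyE)
  have "P * R' = R * (K k * P)" "Q * R' = R * (K k * Q)" by (simp_all add: u(1) k mult_ac)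
  then have "R * P' = R * (K k * P)" "R * Q' = R * (K k * Q)" unfolding e by (simp_all only: mult.commute[of R])
  then have "P' = K k * P" "Q' = K k * Q" using mult_left_cancel[OF nz(1)] by blast+
  moreover have "R' = K k * R" "k \<noteq> 0" using u k nz by (auto simp: mult.commute)
  ultimately show thesis using that by blast
qed

lemma degree_K_mult: "c \<noteq> 0 \<Longrightarrow> degree (K c * p) = degree p" by (simp add: K_def)

lemma coprime_K: "c \<noteq> 0 \<Longrightarrow> d \<noteq> 0 \<Longrightarrow> coprime (K c * P) (K d * Q) \<longleftrightarrow> coprime P Q"
  by (simp add: coprime_mult_left_iff is_unit_left_imp_coprime is_unit_right_imp_coprime)

text \<open>
  For reduced coordinates \<open>sol_unique\<close> leaves only a constant factor, so the
  multiplier determines the degree.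
\<close>

lemma sol_unique_degree:
  assumes s: "sol a P Q R" "sol a P' Q' R'" and cp: "coprime P Q" "coprime P' Q'"
  obtains j k where "j < 3" "k \<noteq> 0" "P' = K (k * \<omega>^j) * P" "Q' = K (k * (\<omega>^j)^2) * Q" "R' = K k * R"
proof -
  obtain j where j: "j < 3" "P'*R = K (\<omega>^j) * (P*R')" "Q*R' = K (\<omega>^j) * (Q'*R)"
    using sol_unique[OF s] .
  let ?P = "K (\<omega>^j) * P" and ?Q = "K ((\<omega>^j)^2) * Q"
  have w: "(\<omega>^j)^2 * \<omega>^j = 1" "((\<omega>^j)^2)^3 = 1"
    using omega_power_3[of j] by (simp_all add: power_numeral_reduce mult_ac)
  have s1: "sol (\<omega>^j * (\<omega>^j)^2 * a) ?P ?Q R" using sol_omega[OF s(1) omega_power_3 w(2)] .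
  have "K ((\<omega>^j)^2) * (Q*R') = K ((\<omega>^j)^2 * \<omega>^j) * (Q'*R)" unfolding j(3) by (simp only: K_hom mult.assoc)
  then have e: "?P*R' = P'*R" "?Q*R' = Q'*R" using j(2) w by (simp_all only: mult.assoc K_simps mult_1)
  obtain k where "k \<noteq> 0" "P' = K k * ?P" "Q' = K k * ?Q" "R' = K k * R"
  proof (rule coprime_proportional[OF _ _ _ cp(2) e])
    show "on_curve ?P ?Q R" "on_curve P' Q' R'" using s1 s by (auto simp: sol_def)
    show "coprime ?P ?Q" using cp by (subst coprime_K) auto
  qed
  then show thesis using that[OF j(1)] by (metis K_hom(2) mult.assoc)
qed

text \<open>
  The degree of the reduced points with multiplier \<open>a\<close>; the value
  \<open>0\<close> for \<open>a = 0\<close> is the degree of the points at infinity.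
\<close>

definition Deg :: "complex \<Rightarrow> nat" where
  "Deg a = (if a = 0 then 0 else (THE n. \<exists>P Q R. sol a P Q R \<and> coprime P Q \<and> n = max (degree P) (degree Q)))"

lemma Deg_eq:
  assumes "sol a P Q R" "coprime P Q"
  shows "Deg a = max (degree P) (degree Q)"
proof -
  have "(THE n. \<exists>P Q R. sol a P Q R \<and> coprime P Q \<and> n = max (degree P) (degree Q)) = max (degree P) (degree Q)"
  proof (rule the_equality)
    show "\<exists>P' Q' R'. sol a P' Q' R' \<and> coprime P' Q' \<and> max (degree P) (degree Q) = max (degree P') (degree Q')"
      using assms by blast
    fix n assume "\<exists>P' Q' R'. sol a P' Q' R' \<and> coprime P' Q' \<and> n = max (degree P') (degree Q')"
    then obtain P' Q' R' where *: "sol a P' Q' R'" "coprime P' Q'" "n = max (degree P') (degree Q')" by blast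
    obtain j k where "j < 3" "k \<noteq> 0" "P' = K (k * \<omega>^j) * P" "Q' = K (k * (\<omega>^j)^2) * Q" "R' = K k * R"
      using sol_unique_degree[OF assms(1) *(1) assms(2) *(2)] .
    then show "n = max (degree P) (degree Q)" using *(3) by (simp add: degree_K_mult)
  qed
  then show ?thesis using sol_nonzero[OF assms(1)] by (simp add: Deg_def)
qed

lemma Deg_swap: assumes "sol a P Q R" shows "Deg (-a) = Deg a"
  by (rule sol_normalise[OF assms]) (use Deg_eq Deg_eq[OF sol_swap] in \<open>metis coprime_commute max.commute\<close>)

lemma Deg_omega: assumes "sol a P Q R" shows "Deg (\<omega> * a) = Deg a"
proof (rule sol_normalise[OF assms])
  fix P0 Q0 R0 assume s: "sol a P0 Q0 R0" and c: "coprime P0 Q0"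
  have "sol (\<omega> * 1 * a) (K \<omega> * P0) (K 1 * Q0) R0" by (rule sol_omega[OF s]) auto
  moreover have "coprime (K \<omega> * P0) (K 1 * Q0)" using c by (subst coprime_K) auto
  ultimately have "Deg (\<omega> * 1 * a) = max (degree (K \<omega> * P0)) (degree (K 1 * Q0))" by (rule Deg_eq)
  then show ?thesis using Deg_eq[OF s c] by (simp add: degree_K_mult)
qed

lemma chord_nonzero:
  assumes s: "sol a P1 Q1 R1" "sol b P2 Q2 R2" and ab: "a \<noteq> b" "a \<noteq> -b"
  shows "R1^2*P2*Q2 - R2^2*P1*Q1 \<noteq> 0"
proof
  assume "R1^2*P2*Q2 - R2^2*P1*Q1 = 0"
  then have C: "R1^2*P2*Q2 = R2^2*P1*Q1" by simp
  have oc: "on_curve P1 Q1 R1" "on_curve P2 Q2 R2" using s by (auto simp: sol_def)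
  show False
  proof (rule equal_products_cases[OF _ _ C])
    show "P1^3+Q1^3 = e3*R1^3" "P2^3+Q2^3 = e3*R2^3" using oc by (auto simp: on_curve_def)
    show "P1 \<noteq> 0" "Q1 \<noteq> 0" "R2 \<noteq> 0" using on_curve_nz[OF oc(1)] on_curve_nz[OF oc(2)] by auto
  next
    fix j assume j: "j < 3" "P2*R1 = K (\<omega>^j) * (P1*R2)" "Q1*R2 = K (\<omega>^j) * (Q2*R1)"
    have "sol (\<omega>^j * 1 * a) (K (\<omega>^j) * P1) (K 1 * Q1) R1" using s omega_power_3 by (intro sol_omega) auto
    moreover have "sol (1 * \<omega>^j * b) (K 1 * P2) (K (\<omega>^j) * Q2) R2" using s omega_power_3 by (intro sol_omega) auto
    ultimately have "\<omega>^j * 1 * a = 1 * \<omega>^j * b" by (rule sol_cong_unit) (use j in \<open>auto simp: mult_ac\<close>)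
    then show False using ab by simp
  next
    fix j assume j: "j < 3" "P2*R1 = K (\<omega>^j) * (Q1*R2)" "P1*R2 = K (\<omega>^j) * (Q2*R1)"
    have "sol (1 * \<omega>^j * a) (K 1 * P1) (K (\<omega>^j) * Q1) R1" using s omega_power_3 by (intro sol_omega) auto
    moreover have "sol (\<omega>^j * 1 * (-b)) (K (\<omega>^j) * Q2) (K 1 * P2) R2" using sol_swap[OF s(2)] omega_power_3 by (intro sol_omega) auto
    ultimately have "1 * \<omega>^j * a = \<omega>^j * 1 * (-b)" by (rule sol_cong_unit) (use j in \<open>auto simp: mult_ac\<close>)
    then have "\<omega>^j * a = \<omega>^j * (-b)" by (simp only: mult_1 mult_1_right)
    then have "a = -b" using omega_neq(1) by (simp only: mult_cancel_left power_not_zero) simp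
    then show False using ab by simp
  qed
qed

lemma coprime_dvd_common:
  fixes c k x y :: "complex poly"
  assumes "coprime x y" "c dvd k*x" "c dvd k*y" shows "c dvd k"
proof -
  obtain u v where "u*x + v*y = 1" using bezout_coefficients_fst_snd[of x y] assms(1) by (metis coprime_iff_gcd_eq_1)
  then have "k = u*(k*x) + v*(k*y)" by (metis distrib_left mult.left_commute mult.right_neutral)
  then show ?thesis using assms by (metis dvd_add dvd_mult)
qed

text \<open>
  The sum and the difference with \<open>(1, t)\<close> are given by triples with the same
  last coordinate \<open>C\<close>. Let \<open>g\<close> and \<open>h\<close> be the
  common factors of the two triples. By \<open>sum_times_difference\<close> all products
  of coordinates are \<open>C\<close> times something of degree at most \<open>2 D +
  2\<close>, where \<open>D\<close> is the degree of the given point; and since the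
  reduced coordinates are coprime, \<open>C\<close> divides \<open>g h\<close>. Therefore
  the degrees after removing \<open>g\<close> and \<open>h\<close> add up to at most
  \<open>2 D + 2\<close>.
\<close>

lemma Deg_concave:
  assumes s: "sol a P Q R" and a: "a \<noteq> 1" "a \<noteq> -1"
  shows "Deg (a+1) + Deg (a-1) \<le> 2 * Deg a + 2"
proof (rule sol_normalise[OF s])
  fix P Q R assume s: "sol a P Q R" and cp: "coprime P Q"
  define X where "X = [:0,1::complex:]"
  have oc: "on_curve P Q R" using s by (simp add: sol_def)
  have c: "P^3 + Q^3 = e3*R^3" using oc by (simp add: on_curve_def)
  have cX: "1^3 + X^3 = e3 * 1^3" by (simp add: X_def e3_def power3_eq_cube one_pCons)
  have sX: "sol 1 1 X 1" unfolding X_def by (rule sol_id)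
  define A where "A = P^2*X*1 - 1^2*Q*R"
  define B where "B = Q^2*1*1 - X^2*P*R"
  define A' where "A' = P^2*1*1 - X^2*Q*R"
  define B' where "B' = Q^2*X*1 - 1^2*P*R"
  define C where "C = R^2*1*X - 1^2*P*Q"
  have Cnz: "C \<noteq> 0" unfolding C_def by (rule chord_nonzero[OF s sX]) (use a in auto)
  have s1: "sol (a+1) B A C" unfolding A_def B_def C_def by (rule sol_add_chord[OF s sX]) (use Cnz in \<open>simp add: C_def\<close>)
  have C': "C = R^2*X*1 - 1^2*P*Q" by (simp add: C_def)
  have s2: "sol (a+(-1)) B' A' C" unfolding A'_def B'_def C'
    by (rule sol_add_chord[OF s sol_swap[OF sX]]) (use Cnz in \<open>simp add: C'\<close>)
  obtain g B0 A0 C0 where g: "g \<noteq> 0" "B = g*B0" "A = g*A0" "C = g*C0" "coprime B0 A0" "sol (a+1) B0 A0 C0"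
    using sol_normalise[OF s1] .
  obtain h B1 A1 C1 where h: "h \<noteq> 0" "B' = h*B1" "A' = h*A1" "C = h*C1" "coprime B1 A1" "sol (a+(-1)) B1 A1 C1"
    using sol_normalise[OF s2] .
  note pr = sum_times_difference[OF c cX, folded A_def B_def A'_def B'_def C_def]
  have d: "C dvd A*A'" "C dvd B*B'" "C dvd A*B'" "C dvd A'*B" unfolding pr by simp_all
  have "C dvd g*h"
  proof (rule coprime_dvd_common[OF g(5)]; rule coprime_dvd_common[OF h(5)])
    show "C dvd g*h*B0*B1" "C dvd g*h*B0*A1" "C dvd g*h*A0*B1" "C dvd g*h*A0*A1"
      using d by (simp_all add: g(2,3) h(2,3) mult_ac)
  qed
  then have dC: "degree C \<le> degree g + degree h" using g h by (metis degree_mult_eq dvd_imp_degree_le mult_eq_0_iff)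
  define D where "D = max (degree P) (degree Q)"
  have D: "Deg a = D" unfolding D_def by (rule Deg_eq[OF s cp])
  have dR: "degree R \<le> D - 1" "1 \<le> D" using on_curve_degree[OF oc] by (auto simp: D_def)
  have dPQ: "degree P \<le> D" "degree Q \<le> D" by (auto simp: D_def)
  have dX: "degree X = 1" "X \<noteq> 0" by (simp_all add: X_def)
  note nz = on_curve_nz[OF oc]
  have dd: "degree (1*X*Q^2 + e3*R*1^2*P) \<le> 2*D+2" "degree (1*X*P^2 + e3*R*1^2*Q) \<le> 2*D+2"
     "degree (P*Q*X^2 + e3*R^2*1*1) \<le> 2*D+2" "degree (P*Q*1^2 + e3*R^2*1*X) \<le> 2*D+2"
    using nz dX dPQ dR by (auto intro!: degree_add_le simp: degree_mult_eq degree_power_eq)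
  have nzz: "A \<noteq> 0" "B \<noteq> 0" "A' \<noteq> 0" "B' \<noteq> 0" using on_curve_nz[of B A C] on_curve_nz[of B' A' C] s1 s2 by (auto simp: sol_def)
  have de: "degree A + degree A' \<le> degree C + (2*D+2)" "degree B + degree B' \<le> degree C + (2*D+2)"
    "degree A + degree B' \<le> degree C + (2*D+2)" "degree A' + degree B \<le> degree C + (2*D+2)"
  proof -
    have "degree (C * k) \<le> degree C + (2*D+2)" if "degree k \<le> 2*D+2" for k
      using degree_mult_le[of C k] that by simp
    with dd have "degree (A*A') \<le> degree C + (2*D+2)" "degree (B*B') \<le> degree C + (2*D+2)"
      "degree (A*B') \<le> degree C + (2*D+2)" "degree (A'*B) \<le> degree C + (2*D+2)"
      unfolding pr by (simp_all only: degree_minus)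
    then show "degree A + degree A' \<le> degree C + (2*D+2)" "degree B + degree B' \<le> degree C + (2*D+2)"
    "degree A + degree B' \<le> degree C + (2*D+2)" "degree A' + degree B \<le> degree C + (2*D+2)"
      using nzz by (simp_all add: degree_mult_eq)
  qed
  have "Deg (a+1) = max (degree B0) (degree A0)" "Deg (a+(-1)) = max (degree B1) (degree A1)"
    using Deg_eq g h by blast+
  moreover have "degree B = degree g + degree B0" "degree A = degree g + degree A0"
     "degree B' = degree h + degree B1" "degree A' = degree h + degree A1"
    using g h nzz by (simp_all add: degree_mult_eq)
  ultimately show ?thesis using de dC D by (simp add: max_def)
qed

section \<open>Existence\<close>

definition rat_poly :: "complex poly \<Rightarrow> bool" where
  "rat_poly p \<longleftrightarrow> (\<forall>i. coeff p i \<in> Q_omega)"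

lemma Q_omegaI: "a \<in> \<rat> \<Longrightarrow> b \<in> \<rat> \<Longrightarrow> a + b * \<omega> \<in> Q_omega" by (auto simp: Q_omega_def)

lemma Q_omega_0 [simp]: "0 \<in> Q_omega" using Q_omegaI[of 0 0] by simp

lemma Q_omega_1 [simp]: "1 \<in> Q_omega" using Q_omegaI[of 1 0] by simp

lemma Q_omega_omega [simp]: "\<omega> \<in> Q_omega" using Q_omegaI[of 0 1] by simp

lemma Q_omega_add: "x \<in> Q_omega \<Longrightarrow> y \<in> Q_omega \<Longrightarrow> x + y \<in> Q_omega"
proof -
  assume "x \<in> Q_omega" "y \<in> Q_omega"
  then obtain a b c d where *: "x = a + b * \<omega>" "y = c + d * \<omega>" "a \<in> \<rat>" "b \<in> \<rat>" "c \<in> \<rat>" "d \<in> \<rat>" by (auto simp: Q_omega_def)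
  then have "x + y = (a+c) + (b+d) * \<omega>" by (simp add: algebra_simps)
  then show ?thesis using * Q_omegaI by (metis Rats_add)
qed

lemma Q_omega_mult: "x \<in> Q_omega \<Longrightarrow> y \<in> Q_omega \<Longrightarrow> x * y \<in> Q_omega"
proof -
  assume "x \<in> Q_omega" "y \<in> Q_omega"
  then obtain a b c d where *: "x = a + b * \<omega>" "y = c + d * \<omega>" "a \<in> \<rat>" "b \<in> \<rat>" "c \<in> \<rat>" "d \<in> \<rat>" by (auto simp: Q_omega_def)
  have "x * y = a*c + (a*d + b*c) * \<omega> + b*d * \<omega>^2" unfolding * by (simp add: algebra_simps power2_eq_square)
  also have "\<dots> = (a*c - b*d) + (a*d + b*c - b*d) * \<omega>" unfolding omega_square by (simp add: algebra_simps)
  finally show ?thesis using * Q_omegaI by (metis Rats_add Rats_mult Rats_diff)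
qed

lemma Q_omega_uminus: "x \<in> Q_omega \<Longrightarrow> -x \<in> Q_omega"
  using Q_omega_mult[of "-1" x] Q_omegaI[of "-1" 0] by (simp add: Rats_minus_iff)

lemma Q_omega_power: "x \<in> Q_omega \<Longrightarrow> x^n \<in> Q_omega"
  by (induction n) (auto intro: Q_omega_mult)

lemma Q_omega_sum: "(\<And>i. i \<in> I \<Longrightarrow> f i \<in> Q_omega) \<Longrightarrow> sum f I \<in> Q_omega"
  by (induction I rule: infinite_finite_induct) (auto intro: Q_omega_add)

lemma rat_poly_intros:
  "rat_poly p \<Longrightarrow> rat_poly q \<Longrightarrow> rat_poly (p + q)" "rat_poly p \<Longrightarrow> rat_poly q \<Longrightarrow> rat_poly (p * q)"
  "rat_poly p \<Longrightarrow> rat_poly (- p)" "rat_poly p \<Longrightarrow> rat_poly q \<Longrightarrow> rat_poly (p - q)"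
  "rat_poly p \<Longrightarrow> rat_poly (p ^ n)" "c \<in> Q_omega \<Longrightarrow> rat_poly (K c)" "rat_poly [:0,1:]" "rat_poly 1"
proof -
  show m: "rat_poly p \<Longrightarrow> rat_poly q \<Longrightarrow> rat_poly (p * q)" for p q
    by (auto simp: rat_poly_def coeff_mult intro!: Q_omega_sum Q_omega_mult)
  show "rat_poly p \<Longrightarrow> rat_poly q \<Longrightarrow> rat_poly (p + q)" by (auto simp: rat_poly_def intro: Q_omega_add)
  show u: "rat_poly p \<Longrightarrow> rat_poly (- p)" for p by (auto simp: rat_poly_def intro: Q_omega_uminus)
  show "rat_poly p \<Longrightarrow> rat_poly q \<Longrightarrow> rat_poly (p - q)"
    unfolding rat_poly_def using Q_omega_add Q_omega_uminus by (metis coeff_diff diff_conv_add_uminus)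
  show k: "c \<in> Q_omega \<Longrightarrow> rat_poly (K c)" for c by (auto simp: rat_poly_def K_def coeff_pCons split: nat.split)
  show "rat_poly [:0,1:]" by (auto simp: rat_poly_def coeff_pCons split: nat.split)
  show o: "rat_poly 1" using k[of 1] by simp
  show "rat_poly p \<Longrightarrow> rat_poly (p ^ n)" by (induction n) (auto intro: m o)
qed

text \<open>
  The case \<open>a = 0\<close> stands for the points at infinity. Including it makes the
  set of realised numbers closed under addition of \<open>1\<close>.
\<close>

definition realised :: "complex \<Rightarrow> bool" where
  "realised a \<longleftrightarrow> a = 0 \<or> (\<exists>P Q R. sol a P Q R \<and> rat_poly P \<and> rat_poly Q \<and> rat_poly R)"

lemma realised_uminus: "realised a \<Longrightarrow> realised (-a)"
proof -
  have "\<exists>P Q R. sol (-a) P Q R \<and> rat_poly P \<and> rat_poly Q \<and> rat_poly R" if "sol a P Q R" "rat_poly P" "rat_poly Q" "rat_poly R" for P Q R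
    using sol_swap[OF that(1)] that by blast
  then show "realised a \<Longrightarrow> realised (-a)" unfolding realised_def by auto
qed

lemma realised_omega: "realised a \<Longrightarrow> realised (\<omega>*a)"
proof -
  have "\<exists>P Q R. sol (\<omega>*a) P Q R \<and> rat_poly P \<and> rat_poly Q \<and> rat_poly R" if "sol a P Q R" "rat_poly P" "rat_poly Q" "rat_poly R" for P Q R
    using sol_omega[OF that(1), of \<omega> 1] that by (intro exI[of _ "K \<omega> * P"] exI[of _ "K 1 * Q"] exI[of _ R]) (auto intro!: rat_poly_intros)
  then show "realised a \<Longrightarrow> realised (\<omega>*a)" unfolding realised_def by auto
qed

lemma realised_add_1:
  assumes "realised a" shows "realised (a+1)"
proof -
  consider "a = 0" | "a = -1" | "a = 1" | "a \<noteq> 0" "a \<noteq> 1" "a \<noteq> -1" by blast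
  then show ?thesis
  proof cases
    case 1
    then show ?thesis using sol_id rat_poly_intros unfolding realised_def by (metis add_0)
  next
    case 2 then show ?thesis by (simp add: realised_def)
  next
    case 3
    have two: "rat_poly 2" using rat_poly_intros(1)[of 1 1] rat_poly_intros(8) by simp
    have "\<exists>P Q R. sol (2*1) P Q R \<and> rat_poly P \<and> rat_poly Q \<and> rat_poly R"
      by (intro exI conjI, rule sol_double[OF sol_id]) (intro rat_poly_intros two)+
    then show ?thesis by (simp add: realised_def 3)
  next
    case 4
    then obtain P Q R where *: "sol a P Q R" "rat_poly P" "rat_poly Q" "rat_poly R" using assms by (auto simp: realised_def)
    have "\<exists>P Q R. sol (a+1) P Q R \<and> rat_poly P \<and> rat_poly Q \<and> rat_poly R"
      by (intro exI conjI, rule sol_add_chord[OF *(1) sol_id chord_nonzero[OF *(1) sol_id 4(2,3)]]) (intro rat_poly_intros *)+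
    then show ?thesis by (simp add: realised_def)
  qed
qed

lemma realised_add_int: "realised a \<Longrightarrow> realised (a + of_int n)"
proof (induction n rule: int_induct[of _ 0])
  case base then show ?case by simp
next
  case (step1 i) then show ?case using realised_add_1[of "a + of_int i"] by (simp add: add.assoc)
next
  case (step2 i)
  then have "realised (-(-(a + of_int i) + 1))" by (intro realised_uminus realised_add_1) auto
  then show ?case by (simp add: algebra_simps)
qed

text \<open>
  Every Eisenstein integer arises from \<open>0\<close> by adding integers and multiplying
  by \<open>\<omega>\<close>.
\<close>

theorem realised_Eis: "a \<in> Eis \<Longrightarrow> realised a"
proof -
  assume "a \<in> Eis"
  then obtain m n where a: "a = of_int m + of_int n * \<omega>" by (auto simp: Eis_def)
  have "realised 0" by (simp add: realised_def)
  then have "realised (\<omega> * (0 + of_int n))" by (intro realised_omega realised_add_int)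
  from realised_add_int[OF this, of m] show ?thesis by (simp add: a algebra_simps)
qed

lemma sol_exists: "a \<in> Eis \<Longrightarrow> a \<noteq> 0 \<Longrightarrow> \<exists>P Q R. sol a P Q R"
  using realised_Eis[of a] unfolding realised_def by blast

section \<open>The degree is the norm\<close>

text \<open>
  The multiplier of \<open>v\<^sub>3\<close>, a square root of \<open>-3\<close>.
\<close>

definition theta :: complex where "theta = - \<i> * sqrt 3"

lemma theta_eq: "theta = \<omega>^2 - \<omega>" "inverse \<zeta>^2 - \<zeta>^2 = theta" "theta^2 = -3"
  "\<zeta> * inverse \<zeta> = 1" "\<zeta>^3 + inverse \<zeta>^3 = 0" "3 * (\<zeta> + inverse \<zeta>) = of_real (sqrt 3)^3" "\<zeta> \<noteq> 0"
proof -
  have i: "inverse \<zeta> = Complex (sqrt 3/2) (-1/2)"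
    by (rule inverse_unique) (simp add: zeta_eq complex_eq_iff)
  have s: "sqrt 3 * (sqrt 3 * x) = 3 * x" for x by (simp flip: mult.assoc)
  show "theta = \<omega>^2 - \<omega>" "inverse \<zeta>^2 - \<zeta>^2 = theta" "theta^2 = -3" "\<zeta> * inverse \<zeta> = 1" 
      "\<zeta>^3 + inverse \<zeta>^3 = 0" "3 * (\<zeta> + inverse \<zeta>) = of_real (sqrt 3)^3" "\<zeta> \<noteq> 0"
    unfolding i by (simp_all add: theta_def zeta_eq omega_eq complex_eq_iff power2_eq_square power3_eq_cube s)
qed

text \<open>
  Composition with \<open>v\<^sub>3\<close>. As \<open>\<zeta>\<^sup>3 +
  \<zeta>\<^sup>-\<^sup>3 = 0\<close>, the sum of the cubes of the first two coordinates
  is \<open>3 (\<zeta> + \<zeta>\<^sup>-\<^sup>1) P\<^sup>3 Q\<^sup>3 (P\<^sup>3 +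
  Q\<^sup>3)\<close>.
\<close>

lemma sol_theta:
  assumes s: "sol a P Q R"
  defines "z \<equiv> K \<zeta>" and "z' \<equiv> K (inverse \<zeta>)"
  shows "sol (theta * a) (z' * P^3 + z * Q^3) (z * P^3 + z' * Q^3) (K (of_real (sqrt 3)) * P * Q * R)"
proof -
  have c: "P^3+Q^3 = e3*R^3" and R: "R \<noteq> 0" and w: "wronskian P Q = K a * R^2" and oc: "on_curve P Q R" using s by (auto simp: sol_def on_curve_def)
  have zz: "z * z' = 1" "z^3 + z'^3 = 0" "3 * (z + z') = K (of_real (sqrt 3))^3" "z'^2 - z^2 = K theta"
    using arg_cong[OF theta_eq(4), of K] arg_cong[OF theta_eq(5), of K] arg_cong[OF theta_eq(6), of K] arg_cong[OF theta_eq(2), of K]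
    by (simp_all add: z_def z'_def K_hom)
  have "(z' * P^3 + z * Q^3)^3 + (z * P^3 + z' * Q^3)^3 = (z^3 + z'^3) * (P^9+Q^9) + 3 * (z*z') * (z+z') * P^3*Q^3*(P^3+Q^3)"
    by (simp add: algebra_simps power_numeral_reduce)
  also have "\<dots> = e3 * (K (of_real (sqrt 3)) * P * Q * R)^3"
    unfolding zz(2) zz(1) c using zz(3) by (simp add: power_mult_distrib mult_ac)
  finally have 1: "(z' * P^3 + z * Q^3)^3 + (z * P^3 + z' * Q^3)^3 = e3 * (K (of_real (sqrt 3)) * P * Q * R)^3" .
  have s3: "K (of_real (sqrt 3))^2 = 3"
  proof -
    have "(of_real (sqrt 3) :: complex)^2 = 3" by (simp flip: of_real_power)
    then show ?thesis by (metis K_hom(5,6))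
  qed
  have "wronskian (z' * P^3 + z * Q^3) (z * P^3 + z' * Q^3) = K (inverse \<zeta> * inverse \<zeta> - \<zeta> * \<zeta>) * wronskian (P^3) (Q^3)"
    unfolding z_def z'_def by (rule wr_lincomb)
  also have "wronskian (P^3) (Q^3) = 3 * (P*Q)^2 * wronskian P Q" unfolding wronskian_def pderiv_cube by (simp add: algebra_simps power_numeral_reduce)
  also have "inverse \<zeta> * inverse \<zeta> - \<zeta> * \<zeta> = theta" using theta_eq(2) by (simp add: power2_eq_square)
  also have "K theta * (3 * (P*Q)^2 * wronskian P Q) = K (theta * a) * (K (of_real (sqrt 3)) * P * Q * R)^2"
    unfolding w power_mult_distrib s3 by (simp add: K_hom mult_ac)
  finally show ?thesis using 1 R on_curve_nz[OF oc] by (simp add: sol_def on_curve_def K_hom)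
qed

text \<open>
  The new coordinates are independent linear combinations of \<open>P\<^sup>3\<close> and
  \<open>Q\<^sup>3\<close>, so they are coprime when \<open>P\<close>, \<open>Q\<close>
  are, and no degree is lost.
\<close>

lemma Deg_theta: assumes "sol a P Q R" shows "Deg (theta * a) = 3 * Deg a"
proof (rule sol_normalise[OF assms])
  fix P Q R assume s: "sol a P Q R" and cp: "coprime P Q"
  let ?z = "K \<zeta>" and ?z' = "K (inverse \<zeta>)"
  define A B where "A = ?z' * P^3 + ?z * Q^3" and "B = ?z * P^3 + ?z' * Q^3"
  have s': "sol (theta * a) A B (K (of_real (sqrt 3)) * P * Q * R)" unfolding A_def B_def by (rule sol_theta[OF s])
  have th: "theta \<noteq> 0" using theta_eq(3) by auto
  have zz: "?z * ?z' = 1" "?z'^2 - ?z^2 = K theta"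
    using arg_cong[OF theta_eq(4), of K] arg_cong[OF theta_eq(2), of K] by (simp_all only: K_hom K_simps)
  have "?z' * A - ?z * B = (?z'^2 - ?z^2) * P^3" "?z' * B - ?z * A = (?z'^2 - ?z^2) * Q^3"
    by (simp_all add: A_def B_def algebra_simps power2_eq_square)
  then have inv: "K theta * P^3 = ?z' * A - ?z * B" "K theta * Q^3 = ?z' * B - ?z * A" by (simp_all add: zz)
  have cAB: "coprime A B"
  proof -
    have "\<not> (poly A x = 0 \<and> poly B x = 0)" for x
      using arg_cong[OF inv(1), of "\<lambda>p. poly p x"] arg_cong[OF inv(2), of "\<lambda>p. poly p x"] coprime_poly_0[OF cp, of x] th by auto
    moreover have "A \<noteq> 0" using on_curve_nz[of A B] s' by (auto simp: sol_def)
    ultimately show ?thesis using coprime_iff_no_common_root by blast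
  qed
  have nz: "\<zeta> \<noteq> 0" "inverse \<zeta> \<noteq> 0" using theta_eq(7) by auto
  have dP: "degree (P^3) = 3 * degree P" "degree (Q^3) = 3 * degree Q" using on_curve_nz[of P Q R] s by (simp_all add: sol_def degree_power_eq)
  have "degree A \<le> 3 * max (degree P) (degree Q)" "degree B \<le> 3 * max (degree P) (degree Q)"
    unfolding A_def B_def using nz dP by (auto intro!: degree_add_le simp: degree_K_mult)
  moreover have "degree (K theta * P^3) \<le> max (degree A) (degree B)" "degree (K theta * Q^3) \<le> max (degree A) (degree B)"
    unfolding inv using nz by (auto intro!: degree_diff_le simp: degree_K_mult)
  ultimately have "max (degree A) (degree B) = 3 * max (degree P) (degree Q)" using th dP by (simp add: degree_K_mult max_def split: if_splits)
  then show ?thesis using Deg_eq[OF s cp] Deg_eq[OF s' cAB] by simp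
qed

lemma Deg_1: "Deg 1 = 1"
  using Deg_eq[OF sol_id] by simp

lemma Deg_2: "Deg 2 = 4"
proof -
  define X where "X = [:0,1::complex:]"
  define A B where "A = -(X*(2*1^3+X^3))" and "B = 1*(1^3+2*X^3)"
  have s: "sol 2 A B (1*(1^3-X^3))" using sol_double[OF sol_id] by (simp add: A_def B_def X_def)
  have "\<not> (poly A x = 0 \<and> poly B x = 0)" for x
  proof
    assume "poly A x = 0 \<and> poly B x = 0"
    then have "x * (2 + x^3) = 0" "1 + 2 * x^3 = 0" by (auto simp: A_def B_def X_def)
    then have "x^3 = -2" "1 + 2 * x^3 = 0" by (auto simp: add_eq_0_iff)
    then show False by simp
  qed
  moreover have "A \<noteq> 0" using on_curve_nz[of A B] s by (auto simp: sol_def)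
  ultimately have "coprime A B" using coprime_iff_no_common_root by blast
  from Deg_eq[OF s this] have "Deg 2 = max (degree A) (degree B)" .
  moreover have "A = [:0,-2,0,0,-1:]" "B = [:1,0,0,2:]" 
    by (simp_all add: A_def B_def X_def power3_eq_cube numeral_poly one_pCons)
  ultimately show ?thesis by simp
qed

text \<open>
  The difference of degree and norm satisfies the assumptions of
  \<open>hexagonal_concave_zero\<close>. Concavity is \<open>Deg_concave\<close>, with the
  values at \<open>0\<close>, \<open>\<plusminus>1\<close>, \<open>\<plusminus>2\<close>
  computed directly where a summand is at infinity or the points coincide; the powers of
  \<open>3\<close> come from \<open>\<theta>\<^sup>2 = -3\<close> and
  \<open>Deg_theta\<close>.
\<close>

theorem Deg_norm: "int (Deg (of_int x + of_int y * \<omega>)) = x^2 - x*y + y^2"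
proof -
  define E where "E x y = int (Deg (of_int x + of_int y * \<omega>)) - (x^2 - x*y + y^2)" for x y
  have zero: "of_int x + of_int y * \<omega> = 0 \<longleftrightarrow> x = 0 \<and> y = 0" for x y
    by (auto simp: omega_eq complex_eq_iff)
  have D0: "Deg 0 = 0" by (simp add: Deg_def)
  have ex: "\<exists>P Q R. sol a P Q R" if "a \<in> Eis" "a \<noteq> 0" for a using sol_exists that by blast
  have "E x y = 0" for x y
  proof (rule hexagonal_concave_zero[where E = E])
    fix x y :: int
    define a where "a = of_int x + of_int y * \<omega>"
    have aE: "a \<in> Eis" by (auto simp: a_def Eis_def)
    have am: "Deg (-1) = 1" using Deg_swap[OF sol_id] Deg_1 by simp
    have "Deg (a+1) + Deg (a-1) \<le> 2 * Deg a + 2"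
    proof -
      consider "a = 0" | "a = 1" | "a = -1" | "a \<noteq> 0" "a \<noteq> 1" "a \<noteq> -1" by blast
      then show ?thesis
      proof cases
        case 3
        have "Deg (-2) = 4" using Deg_swap[OF sol_double[OF sol_id]] Deg_2 by simp
        then show ?thesis using 3 am D0 by simp
      qed (use Deg_1 Deg_2 am D0 ex[OF aE] Deg_concave in \<open>auto\<close>)
    qed
    then have "int (Deg (a+1)) + int (Deg (a-1)) \<le> 2 * int (Deg a) + 2" by linarith
    moreover have eqs: "of_int (x+1) + of_int y * \<omega> = a + 1" "of_int (x-1) + of_int y * \<omega> = a - 1" by (simp_all add: a_def)
    ultimately show "E (x+1) y + E (x-1) y \<le> 2 * E x y"
      unfolding E_def eqs a_def[symmetric] by (simp add: algebra_simps power2_eq_square)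
    have "Deg (-(\<omega> * (\<omega> * a))) = Deg a"
    proof (cases "a = 0")
      case False
      then obtain P Q R where s: "sol a P Q R" using ex[OF aE] by blast
      have s1: "sol (\<omega> * 1 * a) (K \<omega> * P) (K 1 * Q) R" by (rule sol_omega[OF s]) auto
      have s2: "sol (\<omega> * 1 * (\<omega> * 1 * a)) (K \<omega> * (K \<omega> * P)) (K 1 * (K 1 * Q)) R" by (rule sol_omega[OF s1]) auto
      show ?thesis using Deg_omega[OF s] Deg_omega[OF s1] Deg_swap[OF s2] by simp
    qed simp
    moreover have "-(\<omega> * (\<omega> * a)) = of_int (x-y) + of_int x * \<omega>"
    proof -
      have w2: "\<omega> * \<omega> = -1 - \<omega>" using omega_square by (simp add: power2_eq_square)
      have "-(\<omega> * (\<omega> * a)) = -(\<omega> * \<omega>) * of_int x - \<omega>^3 * of_int y" by (simp add: a_def algebra_simps power3_eq_cube)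
      also have "\<dots> = of_int (x-y) + of_int x * \<omega>" unfolding w2 omega_cube by (simp add: algebra_simps)
      finally show ?thesis .
    qed
    ultimately have "Deg (of_int (x-y) + of_int x * \<omega>) = Deg a" by (simp only:)
    moreover have "(x-y)^2 - (x-y)*x + x^2 = x^2 - x*y + y^2" by (simp add: algebra_simps power2_eq_square)
    ultimately show "E (x-y) x = E x y" unfolding E_def a_def[symmetric] by (simp only:)
    show "E 0 0 = 0" by (simp add: E_def D0)
    fix k :: nat
    have "Deg (3^k) = 9^k"
    proof (induction k)
      case 0 show ?case by (simp add: Deg_1)
    next
      case (Suc k)
      obtain P Q R where s: "sol (3^k) P Q R" using ex[of "3^k"] Eis_power[OF Eis_of_int[of 3], of k] by auto
      note s1 = sol_theta[OF s] and s2 = sol_theta[OF sol_theta[OF s]]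
      have "theta * (theta * 3^k) = - (3^Suc k)" using theta_eq(3) by (simp add: power2_eq_square flip: mult.assoc)
      then have "Deg (3^Suc k) = Deg (theta * (theta * 3^k))" using Deg_swap[OF s2] by simp
      then show ?case using Deg_theta[OF s1] Deg_theta[OF s] Suc by simp
    qed
    then show "E (3^k) 0 = 0" by (simp add: E_def power_mult[symmetric] power2_eq_square power_mult_distrib[symmetric])
  qed
  then show ?thesis by (simp add: E_def)
qed

section \<open>Representations by the norm form\<close>

text \<open>
  The norm of \<open>x + y \<omega>\<close>.
\<close>

definition norm_form :: "int \<Rightarrow> int \<Rightarrow> int" where "norm_form x y = x^2 - x*y + y^2"

definition reps :: "nat \<Rightarrow> (int \<times> int) set" where
  "reps n = {(x, y). norm_form x y = int n}"

lemma four_nf: "4 * norm_form x y = (2*x - y)^2 + 3*y^2" "4 * norm_form x y = (2*y - x)^2 + 3*x^2"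
  by (simp_all add: norm_form_def algebra_simps power2_eq_square)

lemma nf_nonneg: "0 \<le> norm_form x y" using four_nf(1)[of x y] zero_le_power2[of "2*x-y"] zero_le_power2[of y] by linarith

lemma nf_eq_0: "norm_form x y = 0 \<longleftrightarrow> x = 0 \<and> y = 0"
proof
  assume "norm_form x y = 0"
  then have "(2*x - y)^2 + 3*y^2 = 0" "(2*y - x)^2 + 3*x^2 = 0" using four_nf[of x y] by auto
  then have "y^2 \<le> 0" "x^2 \<le> 0" using zero_le_power2[of "2*x-y"] zero_le_power2[of "2*y-x"] zero_le_power2[of x] zero_le_power2[of y] by linarith+
  then show "x = 0 \<and> y = 0" by simp
qed (simp add: norm_form_def)

lemma nf_bound: "norm_form x y = n \<Longrightarrow> 3 * x^2 \<le> 4 * n" "norm_form x y = n \<Longrightarrow> 3 * y^2 \<le> 4 * n"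
  using four_nf[of x y] zero_le_power2[of "2*x-y"] zero_le_power2[of "2*y-x"] by linarith+

lemma abs_le_square: "\<bar>x\<bar> \<le> (x::int)^2"
proof (cases "x = 0")
  case False
  then have "1 * \<bar>x\<bar> \<le> \<bar>x\<bar> * \<bar>x\<bar>" by (intro mult_right_mono) auto
  then show ?thesis by (simp add: power2_eq_square)
qed simp

lemma finite_reps: "finite (reps n)"
proof (rule finite_subset)
  show "reps n \<subseteq> {-4 * int n..4 * int n} \<times> {-4 * int n..4 * int n}"
  proof
    fix z assume "z \<in> reps n"
    then obtain x y where z: "z = (x,y)" "norm_form x y = int n" by (auto simp: reps_def)
    have "\<bar>x\<bar> \<le> 4 * int n" "\<bar>y\<bar> \<le> 4 * int n" using nf_bound[OF z(2)] abs_le_square[of x] abs_le_square[of y] zero_le_power2[of x] zero_le_power2[of y] by linarith+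
    then show "z \<in> {-4 * int n..4 * int n} \<times> {-4 * int n..4 * int n}" unfolding z by auto
  qed
qed simp

lemma nf_mult: "norm_form (a*c - b*d) (a*d + b*c - b*d) = norm_form a b * norm_form c d"
  by (simp add: norm_form_def algebra_simps power2_eq_square)

text \<open>
  Multiplication by the element \<open>c + d \<omega>\<close> of norm \<open>p\<close> is
  injective, and its image consists of the elements divisible by \<open>c + d
  \<omega>\<close>, which is expressed by a congruence modulo \<open>p\<close>.
\<close>

lemma card_multiples:
  fixes p :: nat
  assumes p: "prime p" and N: "norm_form c d = int p"
  shows "card {(a,b) \<in> reps (p*n). int p dvd b*c - a*d} = card (reps n)"
proof -
  define m where "m = (\<lambda>(x,y). (c*x - d*y, c*y + d*x - d*y))"
  have p0: "int p > 0" using p by (simp add: prime_gt_0_nat)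
  have pp: "prime (int p)" using p by simp
  have inv: "(c-d)*(c*x - d*y) + d*(c*y+d*x-d*y) = int p * x" "c*(c*y+d*x-d*y) - d*(c*x-d*y) = int p * y" for x y
    using N by (simp_all add: norm_form_def algebra_simps power2_eq_square flip: N)
  have inj: "inj_on m (reps n)"
  proof (rule inj_onI)
    fix z w assume "m z = m w"
    then obtain x y x' y' where zw: "z = (x,y)" "w = (x',y')" "c*x-d*y = c*x'-d*y'" "c*y+d*x-d*y = c*y'+d*x'-d*y'"
      by (cases z; cases w) (auto simp: m_def)
    have "int p * x = int p * x'" by (simp only: inv(1)[of x y, symmetric] inv(1)[of x' y', symmetric] zw(3,4))
    moreover have "int p * y = int p * y'" by (simp only: inv(2)[of y x, symmetric] inv(2)[of y' x', symmetric] zw(3,4))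
    ultimately have "int p * x = int p * x'" "int p * y = int p * y'" by auto
    then show "z = w" using p0 zw by simp
  qed
  have "m ` reps n = {(a,b) \<in> reps (p*n). int p dvd b*c - a*d}"
  proof (intro equalityI subsetI)
    fix z assume "z \<in> m ` reps n"
    then obtain x y where z: "z = (c*x-d*y, c*y+d*x-d*y)" "norm_form x y = int n" by (auto simp: m_def reps_def)
    have "norm_form (c*x-d*y) (c*y+d*x-d*y) = int p * int n" using nf_mult[of c x d y] z N by simp
    moreover have "int p dvd (c*y+d*x-d*y)*c - (c*x-d*y)*d" using inv(2)[of y x] by (metis dvd_triv_left mult.commute)
    ultimately show "z \<in> {(a,b) \<in> reps (p*n). int p dvd b*c - a*d}" by (simp add: z reps_def)
  next
    fix z assume "z \<in> {(a,b) \<in> reps (p*n). int p dvd b*c - a*d}"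
    then obtain a b where z: "z = (a,b)" "norm_form a b = int p * int n" "int p dvd b*c - a*d" by (auto simp: reps_def)
    \<comment> \<open>\<open>u + v \<omega>\<close> is \<open>a + b \<omega>\<close> times the conjugate of \<open>c + d \<omega>\<close>\<close>
    define u v where "u = a*(c-d) + b*d" and "v = b*c - a*d"
    have uv: "u^2 = int p * (int p * int n) + u*v - v^2"
    proof -
      have "norm_form u v = norm_form a b * norm_form c d" by (simp add: norm_form_def u_def v_def algebra_simps power2_eq_square)
      then have "norm_form u v = int p * (int p * int n)" using z(2) N by simp
      then show ?thesis unfolding norm_form_def by linarith
    qed
    have "int p dvd v" using z by (simp add: v_def)
    then have "int p dvd u^2" unfolding uv by (intro dvd_diff dvd_add) (auto simp: power2_eq_square)
    then have "int p dvd u" using pp prime_dvd_power by blast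
    then obtain x y where xy: "u = int p * x" "v = int p * y" using \<open>int p dvd v\<close> by (auto simp: dvd_def)
    have "c*u - d*v = int p * a" "c*v + d*u - d*v = int p * b"
      by (simp_all add: u_def v_def norm_form_def algebra_simps power2_eq_square flip: N)
    then have "int p * (c*x - d*y) = int p * a" "int p * (c*y + d*x - d*y) = int p * b" by (simp_all add: xy algebra_simps)
    then have ab: "c*x - d*y = a" "c*y+d*x-d*y = b" using p0 by simp_all
    have "int p * norm_form x y = norm_form a b" using nf_mult[of c x d y] N ab by simp
    then have "norm_form x y = int n" using z p0 by simp
    then show "z \<in> m ` reps n" using ab z by (force simp: m_def reps_def)
  qed
  then show ?thesis using card_image[OF inj] by simp
qed

lemma card_scaled:
  fixes p :: nat
  assumes "p > 0"
  shows "card {(a,b) \<in> reps (p*n). int p dvd a \<and> int p dvd b} = (if p dvd n then card (reps (n div p)) else 0)"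
proof (cases "p dvd n")
  case True
  then obtain k where k: "n = p*k" by auto
  have "{(a,b) \<in> reps (p*n). int p dvd a \<and> int p dvd b} = (\<lambda>(x,y). (int p * x, int p * y)) ` reps k"
  proof -
    have nn: "norm_form (int p * x) (int p * y) = int p * int p * norm_form x y" for x y by (simp add: norm_form_def algebra_simps power2_eq_square)
    show ?thesis using assms by (auto simp: reps_def k nn dvd_def image_iff mult.assoc)
  qed
  moreover have "inj_on (\<lambda>(x,y). (int p * x, int p * y)) (reps k)" using assms by (auto simp: inj_on_def)
  ultimately show ?thesis using assms by (simp add: card_image k)
next
  case False
  have "{(a,b) \<in> reps (p*n). int p dvd a \<and> int p dvd b} = {}"
  proof (rule ccontr)
    assume "\<not> ?thesis"
    then obtain x y where "norm_form (int p * x) (int p * y) = int p * int n" by (auto simp: reps_def dvd_def)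
    then have "int p * (int p * norm_form x y) = int p * int n" by (simp add: norm_form_def algebra_simps power2_eq_square)
    then have "int p dvd int n" using assms by (metis dvd_triv_left mult_left_cancel of_nat_0_less_iff less_irrefl)
    then show False using False by simp
  qed
  then have "card {(a,b) \<in> reps (p*n). int p dvd a \<and> int p dvd b} = 0" by (simp only: card.empty)
  with False show ?thesis by simp
qed

text \<open>
  If \<open>p\<close> divides neither coordinate then \<open>a\<^sup>3 \<equiv>
  (-b)\<^sup>3\<close>. Cubing is injective modulo \<open>p\<close> because
  \<open>3\<close> is prime to \<open>p - 1\<close>, so \<open>a \<equiv> -b\<close> and
  \<open>p\<close> divides \<open>3 b\<^sup>2\<close>, a contradiction.
\<close>

lemma inert_dvd:
  fixes p :: nat
  assumes p: "prime p" "p mod 3 = 2" and d: "int p dvd norm_form a b"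
  shows "int p dvd a \<and> int p dvd b"
proof -
  have pp: "prime (int p)" using p by simp
  have ab: "int p dvd a \<longleftrightarrow> int p dvd b"
  proof
    assume "int p dvd a"
    then have "int p dvd norm_form a b - a * (a - b)" using d by (intro dvd_diff) auto
    also have "norm_form a b - a * (a - b) = b^2" by (simp add: norm_form_def algebra_simps power2_eq_square)
    finally show "int p dvd b" using pp prime_dvd_power by blast
  next
    assume "int p dvd b"
    then have "int p dvd norm_form a b - b * (b - a)" using d by (intro dvd_diff) auto
    also have "norm_form a b - b * (b - a) = a^2" by (simp add: norm_form_def algebra_simps power2_eq_square)
    finally show "int p dvd a" using pp prime_dvd_power by blast
  qed
  show ?thesis
  proof (rule ccontr)
    assume "\<not> ?thesis"
    then have n: "\<not> int p dvd a" "\<not> int p dvd b" using ab by auto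
    define k where "k = p div 3"
    have k: "p - 1 = 3*k+1" using p(2) by (simp add: k_def) presburger
    have "int p dvd (a+b) * norm_form a b" using d by simp
    also have "(a+b) * norm_form a b = a^3 - (-b)^3" by (simp add: norm_form_def algebra_simps power2_eq_square power3_eq_cube)
    finally have c3: "[a^3 = (-b)^3] (mod int p)" by (simp add: cong_iff_dvd_diff)
    have fa: "[x^(p-1) = 1] (mod int p)" if "\<not> int p dvd x" for x
    proof -
      have "[(x mod int p)^(p-1) = 1] (mod int p)"
      proof -
        define y where "y = nat (x mod int p)"
        have y: "int y = x mod int p" using p by (simp add: y_def prime_gt_0_nat)
        have "\<not> p dvd y" using that by (metis y dvd_mod_iff int_dvd_int_iff dvd_refl)
        from fermat_theorem[OF p(1) this] have "[int (y^(p-1)) = int 1] (mod int p)" by (simp only: cong_int_iff)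
        then show ?thesis by (simp add: y)
      qed
      then show ?thesis by (simp add: cong_def power_mod)
    qed
    have "[(a^3)^k * a = ((-b)^3)^k * (-b)] (mod int p)"
    proof -
      have "(a^3)^k * a = a^(p-1)" "((-b)^3)^k * (-b) = (-b)^(p-1)" unfolding k by (simp_all only: power_mult[symmetric] power_add power_one_right)
      moreover have "[a^(p-1) = (-b)^(p-1)] (mod int p)" using fa[of a] fa[of "-b"] n by (metis cong_sym cong_trans dvd_minus_iff)
      ultimately show ?thesis by simp
    qed
    moreover have "[(a^3)^k * (-b) = ((-b)^3)^k * (-b)] (mod int p)" by (rule cong_mult[OF cong_pow[OF c3] cong_refl])
    ultimately have "[(a^3)^k * a = (a^3)^k * (-b)] (mod int p)" by (metis cong_sym cong_trans)
    moreover have "coprime ((a^3)^k) (int p)" using prime_imp_coprime[OF pp n(1)] by (simp add: coprime_commute)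
    ultimately have "[a = -b] (mod int p)" using cong_mult_lcancel by blast
    then have s: "int p dvd a + b" by (simp add: cong_iff_dvd_diff)
    have "int p dvd norm_form a b - (a+b)*(a - 2*b)" using d s by (intro dvd_diff) auto
    also have "norm_form a b - (a+b)*(a-2*b) = 3*b^2" by (simp add: norm_form_def algebra_simps power2_eq_square)
    finally have "int p dvd 3 \<or> int p dvd b" using pp prime_dvd_mult_iff prime_dvd_power by blast
    moreover have "\<not> int p dvd 3"
    proof
      assume "int p dvd 3"
      then have "p dvd 3" by presburger
      then have "p = 3" using p(1) primes_dvd_imp_eq[of p 3] by simp
      then show False using p(2) by simp
    qed
    ultimately show False using n by simp
  qed
qed

text \<open>
  Thue's argument. For a primitive cube root of unity \<open>t\<close> modulo
  \<open>p\<close> the pigeonhole principle yields a small nonzero solution of \<open>c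
  \<equiv> t d\<close>. The norm of \<open>c - d \<omega>\<close> is a multiple \<open>q p\<close> with \<open>0 < q <
  3\<close>, and \<open>q = 2\<close> would force both coordinates to be even.
\<close>

lemma split_prime_norm:
  fixes p :: nat
  assumes p: "prime p" "p mod 3 = 1"
  shows "\<exists>c d. norm_form c d = int p"
proof -
  have pp: "prime (int p)" and p0: "int p > 0" using p by (simp_all add: prime_gt_0_nat)
  have p7: "p > 3"
  proof -
    have "p \<noteq> 0" "p \<noteq> 1" "p \<noteq> 2" "p \<noteq> 3" using p by auto
    then show ?thesis by linarith
  qed
  \<comment> \<open>a cube root of unity modulo p\<close>
  obtain g where g: "residue_primroot p g" using prime_primitive_root_exists[OF prime_gt_1_nat[OF p(1)] p(1)] by blast
  define m where "m = (p - 1) div 3"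
  have m: "p - 1 = 3*m" using p(2) by (simp add: m_def) presburger
  have og: "ord p g = p - 1" using g p by (simp add: residue_primroot_def totient_prime)
  define t where "t = int (g^m)"
  have "[g^(3*m) = 1] (mod p)" using ord[of g p] og m by simp
  then have "[int (g^(3*m)) = int 1] (mod int p)" by (simp only: cong_int_iff)
  then have t3: "[t^3 = 1] (mod int p)" by (simp add: t_def power_mult[symmetric] mult.commute)
  have "\<not> [g^m = 1] (mod p)"
  proof
    assume "[g^m = 1] (mod p)"
    then have "3*m dvd m" using ord_divides[of g m p] og m by simp
    moreover have "m > 0" using p7 m by auto
    ultimately show False using dvd_imp_le by fastforce
  qed
  then have "\<not> [int (g^m) = int 1] (mod int p)" unfolding cong_int_iff .
  then have "\<not> [t = 1] (mod int p)" unfolding t_def by simp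
  then have t1: "\<not> int p dvd t - 1" unfolding cong_iff_dvd_diff .
  have "int p dvd (t-1)*(t^2+t+1)" using t3 by (simp add: cong_iff_dvd_diff algebra_simps power2_eq_square power3_eq_cube)
  then have t2: "int p dvd t^2+t+1" using t1 pp prime_dvd_mult_iff by blast
  \<comment> \<open>two close points of the grid with the same residue\<close>
  define k where "k = (LEAST k. p < (k+1)^2)"
  have "p < (p+1)^2" by (simp add: power2_eq_square)
  then have k1: "p < (k+1)^2" unfolding k_def by (rule LeastI)
  have k2: "k^2 \<le> p"
  proof (rule ccontr)
    assume "\<not> k^2 \<le> p"
    then have "p < ((k-1)+1)^2" "k > 0" by (cases k; simp)+
    then show False using not_less_Least[of "k-1" "\<lambda>k. p < (k+1)^2"] by (simp add: k_def)
  qed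
  have "k^2 \<noteq> p"
  proof
    assume "k^2 = p"
    then have "k dvd p" "k*k = p" by (auto simp: power2_eq_square)
    then have "k = 1 \<or> k = p" using p(1) prime_nat_iff by blast
    then show False using \<open>k*k = p\<close> p7 by auto
  qed
  with k2 have k3: "int k * int k < int p" unfolding power2_eq_square by (metis of_nat_less_iff of_nat_mult le_neq_implies_less)
  define A where "A = {0..int k} \<times> {0..int k}"
  define f where "f = (\<lambda>(x,y). (x + t*y) mod int p)"
  have "card {0..int k} = k + 1" by simp
  then have cA: "card A = (k+1)^2" unfolding A_def card_cartesian_product power2_eq_square by simp
  have "f ` A \<subseteq> {0..<int p}" using p0 by (auto simp: f_def)
  then have "card (f ` A) \<le> card {0..<int p}" by (intro card_mono) auto
  then have "card (f ` A) < card A" using k1 cA by simp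
  then have "\<not> inj_on f A" by (rule pigeonhole)
  then obtain x y x' y' where xy: "(x,y) \<in> A" "(x',y') \<in> A" "f (x,y) = f (x',y')" "(x,y) \<noteq> (x',y')"
    by (auto simp: inj_on_def)
  define c d where "c = x - x'" and "d = y' - y"
  have "int p dvd (x + t*y) - (x' + t*y')" using xy(3) by (simp add: f_def mod_eq_dvd_iff)
  then have ct: "int p dvd c - t*d" by (simp add: c_def d_def algebra_simps)
  have nz: "c \<noteq> 0 \<or> d \<noteq> 0" using xy(4) by (auto simp: c_def d_def)
  have bd: "\<bar>c\<bar> \<le> int k" "\<bar>d\<bar> \<le> int k" using xy(1,2) by (auto simp: A_def c_def d_def)
  \<comment> \<open>the norm of the difference, with a sign change, is a small multiple of p\<close>
  have "norm_form c (-d) = (c - t*d)*(c + t*d + d) + d^2*(t^2+t+1)" by (simp add: norm_form_def algebra_simps power2_eq_square)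
  then have "int p dvd norm_form c (-d)" using ct t2 by simp
  then obtain q where q: "norm_form c (-d) = int p * q" by (auto simp: dvd_def)
  have "norm_form c (-d) > 0" using nf_nonneg[of c "-d"] nf_eq_0[of c "-d"] nz by force
  then have q0: "q > 0" using q p0 by (metis zero_less_mult_pos)
  have "c*c \<le> int k * int k" "d*d \<le> int k * int k" "\<bar>c*d\<bar> \<le> int k * int k"
    using mult_mono[OF bd(1) bd(1)] mult_mono[OF bd(2) bd(2)] mult_mono[OF bd] by (simp_all add: abs_mult)
  then have "norm_form c (-d) < 3 * int p" using k3 by (simp add: norm_form_def power2_eq_square)
  then have "q < 3" using q p0 by (simp add: mult.commute[of "int p"])
  moreover have "q \<noteq> 2"
  proof
    assume "q = 2"
    then have "int 2 dvd norm_form c (-d)" using q by simp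
    then have "int 2 dvd c \<and> int 2 dvd -d" by (intro inert_dvd) auto
    then obtain a b where ab: "c = 2*a" "-d = 2*b" by (auto simp only: dvd_def of_nat_numeral)
    have "norm_form c (-d) = 4 * norm_form a b" unfolding ab by (simp add: norm_form_def algebra_simps power2_eq_square)
    then have "4 * norm_form a b = 2 * int p" using q \<open>q = 2\<close> by simp
    then have "2 dvd int p" by presburger
    then have "2 dvd p" by presburger
    then show False using primes_dvd_imp_eq[of 2 p] p(1) p7 by simp
  qed
  ultimately have "q = 1" using q0 by linarith
  then show ?thesis using q by auto
qed

definition chi :: "nat \<Rightarrow> int" where "chi e = Legendre (int e) 3"

lemma chi_eq: "chi e = (if e mod 3 = 0 then 0 else if e mod 3 = 1 then 1 else -1)"
proof -
  have 0: "[int e = 0] (mod 3) \<longleftrightarrow> e mod 3 = 0" by (simp add: cong_def) presburger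
  have "QuadRes 3 (int e) \<longleftrightarrow> e mod 3 \<noteq> 2"
  proof
    assume "QuadRes 3 (int e)"
    then obtain y where y: "y^2 mod 3 = int e mod 3" by (auto simp: QuadRes_def cong_def)
    have "y^2 mod 3 = (y mod 3)^2 mod 3" by (simp add: power_mod)
    moreover have "y mod 3 = 0 \<or> y mod 3 = 1 \<or> y mod 3 = 2" by presburger
    ultimately have "y^2 mod 3 \<noteq> 2" by auto
    then show "e mod 3 \<noteq> 2" using y by presburger
  next
    assume "e mod 3 \<noteq> 2"
    then have "int e mod 3 = 0 \<or> int e mod 3 = 1" by presburger
    then have "[0^2 = int e] (mod 3) \<or> [1^2 = int e] (mod 3)" by (auto simp: cong_def)
    then show "QuadRes 3 (int e)" unfolding QuadRes_def by blast
  qed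
  then show ?thesis using 0 by (auto simp: chi_def Legendre_def)
qed

lemma chi_mult: "chi (a*b) = chi a * chi b"
proof -
  have "(a*b) mod 3 = ((a mod 3)*(b mod 3)) mod 3" by (simp add: mod_mult_eq)
  moreover have "a mod 3 = 0 \<or> a mod 3 = 1 \<or> a mod 3 = 2" "b mod 3 = 0 \<or> b mod 3 = 1 \<or> b mod 3 = 2" by presburger+
  ultimately show ?thesis unfolding chi_eq by auto
qed

definition divsum :: "nat \<Rightarrow> int" where "divsum n = (\<Sum>e | e dvd n. chi e)"

text \<open>
  A divisor of \<open>p n\<close> divides \<open>n\<close> or is \<open>p\<close> times a
  divisor of \<open>n\<close>; the divisors of both kinds are \<open>p\<close> times the
  divisors of \<open>n / p\<close>.
\<close>

lemma divsum_prime_mult: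
  assumes p: "prime p" and n: "n > 0"
  shows "divsum (p*n) = (1 + chi p) * divsum n - chi p * (if p dvd n then divsum (n div p) else 0)"
proof -
  have p0: "p > 0" using p by (simp add: prime_gt_0_nat)
  have inj: "inj_on ((*) p) X" for X using p0 by (auto simp: inj_on_def)
  have un: "{e. e dvd p*n} = {e. e dvd n} \<union> (*) p ` {e. e dvd n}"
  proof (intro equalityI subsetI)
    fix e assume "e \<in> {e. e dvd p*n}"
    then have e: "e dvd p*n" by simp
    show "e \<in> {e. e dvd n} \<union> (*) p ` {e. e dvd n}"
    proof (cases "p dvd e")
      case True
      then obtain k where "e = p*k" by auto
      then show ?thesis using e p0 by auto
    next
      case False
      then have "coprime e p" using p prime_imp_coprime coprime_commute by blast
      then show ?thesis using e by (simp add: coprime_dvd_mult_right_iff)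
    qed
  next
    fix e assume "e \<in> {e. e dvd n} \<union> (*) p ` {e. e dvd n}"
    then show "e \<in> {e. e dvd p*n}" by auto
  qed
  have fin: "finite {e. e dvd n}" if "n > 0" for n :: nat using that by (rule finite_divisors_nat)
  have sp: "sum chi ((*) p ` {e. e dvd k}) = chi p * divsum k" for k
    by (simp add: sum.reindex[OF inj] chi_mult sum_distrib_left divsum_def)
  have "{e. e dvd n} \<inter> (*) p ` {e. e dvd n} = (if p dvd n then (*) p ` {e. e dvd n div p} else {})"
  proof (cases "p dvd n")
    case True
    then obtain m where m: "n = p*m" by auto
    have "{e. e dvd p*m} \<inter> (*) p ` {e. e dvd p*m} = (*) p ` {e. e dvd m}" using p0 by auto
    then show ?thesis using m p0 by simp
  next
    case False
    then have "\<not> p*k dvd n" for k using dvd_mult_left by blast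
    then show ?thesis using False by auto
  qed
  then have int: "sum chi ({e. e dvd n} \<inter> (*) p ` {e. e dvd n}) = chi p * (if p dvd n then divsum (n div p) else 0)"
    by (simp add: sp)
  have "divsum (p*n) + chi p * (if p dvd n then divsum (n div p) else 0) = divsum n + chi p * divsum n"
    unfolding int[symmetric] sp[symmetric] unfolding divsum_def un using fin[OF n] by (intro sum.union_inter) auto
  then show ?thesis by (simp add: algebra_simps)
qed

text \<open>
  The number of elements of norm \<open>p n\<close> obeys the recursion of
  \<open>divsum_prime_mult\<close>. For \<open>p = 3\<close> every such element is
  divisible by the prime above \<open>3\<close>; for \<open>p \<equiv> 2\<close> it is
  divisible by \<open>p\<close>; for \<open>p \<equiv> 1\<close> it is divisible by one of
  the two conjugate primes above \<open>p\<close>, and by \<open>p\<close> if by both.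
\<close>

lemma card_reps_prime_mult:
  assumes p: "prime p" and n: "n > 0"
  shows "int (card (reps (p*n))) = (1 + chi p) * int (card (reps n)) - chi p * (if p dvd n then int (card (reps (n div p))) else 0)"
proof -
  have pp: "prime (int p)" and p0: "p > 0" using p by (simp_all add: prime_gt_0_nat)
  consider "p mod 3 = 0" | "p mod 3 = 1" | "p mod 3 = 2" by linarith
  then show ?thesis
  proof cases
    case 1
    then have "3 dvd p" by presburger
    then have p3: "p = 3" using p primes_dvd_imp_eq[of 3 p] by simp
    have "int p dvd b*2 - a*1" if "(a,b) \<in> reps (p*n)" for a b
    proof -
      have "norm_form a b = 3 * int n" using that by (simp add: reps_def p3)
      moreover have "(b*2-a)^2 = 4 * norm_form a b - 3 * a^2" by (simp add: norm_form_def algebra_simps power2_eq_square)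
      ultimately have "3 dvd (b*2-a)^2" by simp
      then show ?thesis using pp p3 prime_dvd_power[of "3::int"] by simp
    qed
    then have "{(a,b) \<in> reps (p*n). int p dvd b*2 - a*1} = reps (p*n)" by auto
    then have "card (reps (p*n)) = card (reps n)" using card_multiples[OF p, of 2 1 n] by (simp add: p3 norm_form_def)
    then show ?thesis by (simp add: chi_eq 1)
  next
    case 3
    have "int p dvd a \<and> int p dvd b" if "(a,b) \<in> reps (p*n)" for a b
    proof (rule inert_dvd[OF p 3])
      show "int p dvd norm_form a b" using that by (simp add: reps_def)
    qed
    then have "{(a,b) \<in> reps (p*n). int p dvd a \<and> int p dvd b} = reps (p*n)" by blast
    then show ?thesis using card_scaled[OF p0, of n] by (simp add: chi_eq 3)
  next
    case 2
    obtain c d where N: "norm_form c d = int p" using split_prime_norm[OF p 2] by blast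
    have N': "norm_form (c-d) (-d) = int p" using N by (simp add: norm_form_def algebra_simps power2_eq_square)
    have pd: "\<not> int p dvd d"
    proof
      assume d: "int p dvd d"
      have "c^2 = int p + d*(c-d)" using N by (simp add: norm_form_def algebra_simps power2_eq_square)
      then have "int p dvd c^2" using d by simp
      then have "int p dvd c" using pp prime_dvd_power by blast
      then obtain x y where "c = int p*x" "d = int p*y" using d by (auto simp: dvd_def)
      then have "int p * (int p * norm_form x y) = int p * 1" using N by (simp add: norm_form_def algebra_simps power2_eq_square)
      then have "int p * norm_form x y = 1" using p0 by simp
      then have "int p dvd 1" by (metis dvd_triv_left)
      then show False using pp not_prime_unit by blast
    qed
    define A where "A = {(a,b) \<in> reps (p*n). int p dvd b*c - a*d}"
    define B where "B = {(a,b) \<in> reps (p*n). int p dvd b*(c-d) - a*(-d)}"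
    have "A \<union> B = reps (p*n)"
    proof -
      have "int p dvd b*c - a*d \<or> int p dvd b*(c-d) - a*(-d)" if "(a,b) \<in> reps (p*n)" for a b
      proof -
        have ab: "norm_form a b = int p * int n" using that by (simp add: reps_def)
        have "(b*c - a*d) * (b*(c-d) - a*(-d)) = b^2 * norm_form c d - d^2 * norm_form a b"
          by (simp add: norm_form_def algebra_simps power2_eq_square)
        then have "int p dvd (b*c - a*d) * (b*(c-d) - a*(-d))" unfolding N ab by simp
        then show ?thesis using pp prime_dvd_mult_iff by blast
      qed
      then show ?thesis by (auto simp: A_def B_def)
    qed
    moreover have "A \<inter> B = {(a,b) \<in> reps (p*n). int p dvd a \<and> int p dvd b}"
    proof -
      have "int p dvd a \<and> int p dvd b" if "(a,b) \<in> reps (p*n)" "int p dvd b*c - a*d" "int p dvd b*(c-d) - a*(-d)" for a b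
      proof -
        have ab: "norm_form a b = int p * int n" using that by (simp add: reps_def)
        have "int p dvd (b*(c-d) - a*(-d)) - (b*c - a*d)" by (rule dvd_diff[OF that(3,2)])
        also have "(b*(c-d) - a*(-d)) - (b*c - a*d) = d*(2*a - b)" by (simp add: algebra_simps)
        finally have e: "int p dvd 2*a - b" using pd pp prime_dvd_mult_iff by blast
        have "3*b^2 = 4 * norm_form a b - (2*a-b)*(2*a-b)" by (simp add: norm_form_def algebra_simps power2_eq_square)
        then have "int p dvd 3*b^2" using e ab by simp
        moreover have "\<not> int p dvd 3"
        proof
          assume "int p dvd 3"
          then have "p dvd 3" by presburger
          then have "p = 3" using p by (simp add: primes_dvd_imp_eq)
          then show False using 2 by simp
        qed
        ultimately have b: "int p dvd b" using pp prime_dvd_mult_iff prime_dvd_power by blast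
        then have "int p dvd (2*a - b) + b" using e by (intro dvd_add)
        then have "int p dvd 2 \<or> int p dvd a" using pp by (simp add: prime_dvd_mult_iff)
        moreover have "\<not> int p dvd 2"
        proof
          assume "int p dvd 2"
          then have "p dvd 2" by presburger
          then have "p = 2" using p by (simp add: primes_dvd_imp_eq)
          then show False using 2 by simp
        qed
        ultimately show ?thesis using b by blast
      qed
      then show ?thesis by (auto simp: A_def B_def)
    qed
    moreover have "card A = card (reps n)" "card B = card (reps n)"
      unfolding A_def B_def by (rule card_multiples[OF p N], rule card_multiples[OF p N'])
    moreover have "finite A" "finite B" using finite_reps[of "p*n"] by (auto simp: A_def B_def intro: finite_subset[OF _ finite_reps[of "p*n"]])
    then have "card A + card B = card (A \<union> B) + card (A \<inter> B)" by (rule card_Un_Int)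
    ultimately have "2 * card (reps n) = card (reps (p*n)) + (if p dvd n then card (reps (n div p)) else 0)"
      using card_scaled[OF p0, of n] by simp
    then show ?thesis by (cases "p dvd n"; simp add: chi_eq 2; linarith)
  qed
qed

lemma card_reps_1: "card (reps 1) = 6"
proof -
  have "reps 1 = {(1,0),(-1,0),(0,1),(0,-1),(1,1),(-1,-1)}"
  proof (intro equalityI subsetI)
    fix z assume "z \<in> reps 1"
    then obtain x y where z: "z = (x,y)" "norm_form x y = 1" by (auto simp: reps_def)
    have s: "\<bar>x\<bar> \<le> 1" if "3 * x^2 \<le> 4 * 1" for x :: int
      using that abs_le_square[of x] by linarith
    have "\<bar>x\<bar> \<le> 1" "\<bar>y\<bar> \<le> 1" using s nf_bound[OF z(2)] by auto
    then have "x = -1 \<or> x = 0 \<or> x = 1" "y = -1 \<or> y = 0 \<or> y = 1" by auto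
    then show "z \<in> {(1,0),(-1,0),(0,1),(0,-1),(1,1),(-1,-1)}" using z by (auto simp: norm_form_def)
  qed (auto simp: reps_def norm_form_def)
  then show ?thesis by simp
qed

theorem card_reps: "n > 0 \<Longrightarrow> int (card (reps n)) = 6 * divsum n"
proof (induction n rule: less_induct)
  case (less n)
  show ?case
  proof (cases "n = 1")
    case True
    have "divsum 1 = 1" by (simp add: divsum_def chi_eq)
    then show ?thesis using card_reps_1 True by simp
  next
    case False
    then obtain p where p: "prime p" "p dvd n" using prime_factor_nat by blast
    then obtain m where m: "n = p*m" by auto
    have m0: "m > 0" using less.prems m by auto
    have p1: "p > 1" using p prime_gt_1_nat by blast
    have mn: "m < n" using m m0 p1 by simp
    have mp: "m div p < n" "p dvd m \<Longrightarrow> m div p > 0" using mn m0 p1 by (auto simp: dvd_div_eq_0_iff intro: le_less_trans[OF div_le_dividend] dest: dvd_imp_le simp: div_greater_zero_iff)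
    show ?thesis unfolding m card_reps_prime_mult[OF p(1) m0] divsum_prime_mult[OF p(1) m0]
      using less.IH[OF mn m0] less.IH[OF mp(1)] mp(2) by (auto simp: algebra_simps)
  qed
qed

text \<open>
  Positivity of the left-hand side of \<open>card_reps_prime_mult\<close> shows which
  smaller numbers are norms: a prime \<open>p \<equiv> 2\<close> can only be split off
  together with a second factor \<open>p\<close>, any other prime factor by itself.
\<close>

theorem norm_factorisation:
  assumes "reps n \<noteq> {}" 
  shows "\<exists>m :: nat. \<exists>ps :: nat multiset. (\<forall>p \<in># ps. prime p \<and> (p mod 3 = 0 \<or> p mod 3 = 1)) \<and> n = m ^ 2 * prod_mset ps"
  using assms
proof (induction n rule: less_induct)
  case (less n)
  consider "n = 0" | "n = 1" | "n > 1" by linarith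
  then show ?case
  proof cases
    case 1 then show ?thesis by (intro exI[of _ 0] exI[of _ "{#}"]) simp
  next
    case 2 then show ?thesis by (intro exI[of _ 1] exI[of _ "{#}"]) simp
  next
    case 3
    then obtain p where p: "prime p" "p dvd n" using prime_factor_nat[of n] by auto
    then obtain m where m: "n = p*m" by auto
    have m0: "m > 0" using 3 m by (cases m) auto
    have p1: "p > 1" using p prime_gt_1_nat by blast
    have mn: "m < n" using m m0 p1 by simp
    have "card (reps n) > 0" using less.prems finite_reps by (simp add: card_gt_0_iff)
    then have pos: "(1 + chi p) * int (card (reps m)) - chi p * (if p dvd m then int (card (reps (m div p))) else 0) > 0"
      using card_reps_prime_mult[OF p(1) m0] m by simp
    show ?thesis
    proof (cases "p mod 3 = 2")
      case True
      then have "p dvd m" "card (reps (m div p)) > 0" using pos by (auto simp: chi_eq split: if_splits)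
      moreover define k where "k = m div p"
      ultimately have k: "m = p*k" "reps k \<noteq> {}" by auto
      have "k < n" using m k p1 m0 by (metis mn le_less_trans dvd_imp_le dvd_triv_right)
      from less.IH[OF this k(2)] obtain q ps where *: "\<forall>p \<in># ps. prime p \<and> (p mod 3 = 0 \<or> p mod 3 = 1)" "k = q^2 * prod_mset ps" by blast
      then have "n = (p*q)^2 * prod_mset ps" by (simp add: m k power2_eq_square)
      with *(1) show ?thesis by blast
    next
      case False
      then have p3: "p mod 3 = 0 \<or> p mod 3 = 1" by linarith
      have "card (reps m) > 0"
      proof (rule ccontr)
        assume "\<not> 0 < card (reps m)"
        then have "- (chi p * (if p dvd m then int (card (reps (m div p))) else 0)) > 0" using pos by simp
        moreover have "chi p \<ge> 0" using p3 by (auto simp: chi_eq)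
        ultimately show False by (simp add: zero_less_mult_iff mult_nonneg_nonneg not_less split: if_splits)
          (metis mult_nonneg_nonneg of_nat_0_le_iff not_less)
      qed
      then have "reps m \<noteq> {}" by auto
      from less.IH[OF mn this] obtain q ps where *: "\<forall>p \<in># ps. prime p \<and> (p mod 3 = 0 \<or> p mod 3 = 1)" "m = q^2 * prod_mset ps" by blast
      then have "n = q^2 * prod_mset (add_mset p ps)" by (simp add: m)
      moreover have "\<forall>x \<in># add_mset p ps. prime x \<and> (x mod 3 = 0 \<or> x mod 3 = 1)" using * p p3 by simp
      ultimately show ?thesis by blast
    qed
  qed
qed

section \<open>Composition\<close>

text \<open>
  The homogenised value \<open>A\<^sup>n P(B/A)\<close>.
\<close>

definition hev :: "nat \<Rightarrow> complex poly \<Rightarrow> complex poly \<Rightarrow> complex poly \<Rightarrow> complex poly" where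
  "hev n P A B = (\<Sum>j\<le>n. K (coeff P j) * A^(n-j) * B^j)"

lemma poly_hev:
  assumes "degree P \<le> n" "poly A t \<noteq> 0"
  shows "poly (hev n P A B) t = poly A t ^ n * poly P (poly B t / poly A t)"
proof -
  let ?a = "poly A t" and ?b = "poly B t"
  have "poly P (?b/?a) = (\<Sum>j\<le>degree P. coeff P j * (?b/?a)^j)" by (rule poly_altdef)
  also have "\<dots> = (\<Sum>j\<le>n. coeff P j * (?b/?a)^j)"
    using assms(1) by (intro sum.mono_neutral_left) (auto simp: coeff_eq_0)
  finally have "?a^n * poly P (?b/?a) = (\<Sum>j\<le>n. ?a^n * (coeff P j * (?b/?a)^j))" by (simp add: sum_distrib_left)
  also have "\<dots> = (\<Sum>j\<le>n. coeff P j * ?a^(n-j) * ?b^j)"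
  proof (intro sum.cong refl)
    fix j assume "j \<in> {..n}"
    then have "?a^n = ?a^(n-j) * ?a^j" by (simp flip: power_add)
    then show "?a^n * (coeff P j * (?b/?a)^j) = coeff P j * ?a^(n-j) * ?b^j"
      using assms(2) by (simp add: power_divide field_simps)
  qed
  also have "\<dots> = poly (hev n P A B) t" by (simp add: hev_def poly_sum)
  finally show ?thesis by simp
qed

text \<open>
  The chain rule for \<open>A\<^sup>n P(B/A)\<close>, multiplied by \<open>A\<close> so
  that no division occurs.
\<close>

lemma pderiv_hev:
  assumes "degree P \<le> Suc n"
  shows "A * pderiv (hev (Suc n) P A B) = of_nat (Suc n) * pderiv A * hev (Suc n) P A B + wronskian A B * hev n (pderiv P) A B"
proof -
  let ?N = "Suc n"
  have t: "A * pderiv (K c * A^(?N-j) * B^j) = of_nat ?N * pderiv A * (K c * A^(?N-j) * B^j)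
      + wronskian A B * (if j = 0 then 0 else K (of_nat j * c) * A^(?N-j) * B^(j-1))" if "j \<le> ?N" for j c
  proof -
    have dS: "pderiv (X^Suc m) = of_nat (Suc m) * X^m * pderiv X" for m and X :: "complex poly"
    proof -
      have "smult (of_nat (Suc m)) (X^m) = of_nat (Suc m) * X^m" by (simp add: of_nat_poly del: of_nat_Suc)
      then show ?thesis by (simp only: pderiv_power_Suc)
    qed
    have A: "A * pderiv (A^m) = of_nat m * pderiv A * A^m" for m
    proof (cases m)
      case (Suc i)
      show ?thesis unfolding Suc dS by (simp only: power_Suc mult_ac)
    qed simp
    show ?thesis
    proof (cases j)
      case 0
      then show ?thesis using A[of ?N] by (auto simp: pderiv_mult algebra_simps)
    next
      case (Suc i)
      note dB = dS[where X = B and m = i]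
      have N: "of_nat ?N = of_nat (?N-j) + (of_nat j :: complex poly)" using that by (simp flip: of_nat_add)
      have Kn: "K (of_nat j * c) = of_nat j * K c" by (simp add: K_def of_nat_poly)
      have "A * pderiv (K c * A^(?N-j) * B^j) = K c * (A * pderiv (A^(?N-j))) * B^j + K c * A^(?N-j) * A * pderiv (B^j)"
        by (simp add: pderiv_mult algebra_simps)
      also have "\<dots> = K c * (of_nat (?N-j) * pderiv A * A^(?N-j)) * B^j + K c * A^(?N-j) * A * (of_nat j * B^i * pderiv B)"
        unfolding A unfolding Suc dB by (simp only: mult.assoc)
      also have "\<dots> = (of_nat (?N-j) + of_nat j) * pderiv A * (K c * A^(?N-j) * B^j) + wronskian A B * (K (of_nat j * c) * A^(?N-j) * B^i)"
        unfolding Kn wronskian_def by (simp add: Suc algebra_simps)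
      finally show ?thesis unfolding N[symmetric] using Suc by simp
    qed
  qed
  have "A * pderiv (hev ?N P A B) = (\<Sum>j\<le>?N. A * pderiv (K (coeff P j) * A^(?N-j) * B^j))"
    unfolding hev_def by (simp only: higher_pderiv_sum[of 1, simplified] sum_distrib_left)
  also have "\<dots> = (\<Sum>j\<le>?N. of_nat ?N * pderiv A * (K (coeff P j) * A^(?N-j) * B^j)
      + wronskian A B * (if j = 0 then 0 else K (of_nat j * coeff P j) * A^(?N-j) * B^(j-1)))"
    by (intro sum.cong refl t) auto
  also have "\<dots> = of_nat ?N * pderiv A * hev ?N P A B + wronskian A B * (\<Sum>j\<le>?N. if j = 0 then 0 else K (of_nat j * coeff P j) * A^(?N-j) * B^(j-1))"
    unfolding hev_def by (simp only: sum.distrib sum_distrib_left)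
  also have "(\<Sum>j\<le>?N. if j = 0 then 0 else K (of_nat j * coeff P j) * A^(?N-j) * B^(j-1)) = hev n (pderiv P) A B"
    unfolding sum.atMost_Suc_shift by (simp add: hev_def coeff_pderiv)
  finally show ?thesis .
qed

lemma poly_zero_if_times:
  assumes "A \<noteq> (0 :: complex poly)" "\<And>t. poly A t \<noteq> 0 \<Longrightarrow> poly p t = poly q t"
  shows "p = q"
proof -
  have "poly (A * (p - q)) t = 0" for t using assms(2)[of t] by auto
  then have "A * (p - q) = 0" using poly_all_0_iff_0 by blast
  then show ?thesis using assms(1) by simp
qed

text \<open>
  Where \<open>A\<close> does not vanish, a zero of \<open>R(B/A)\<close> is a zero of
  some \<open>B - x A\<close> with \<open>x\<close> a root of \<open>R\<close>; if the
  value were identically zero, one of these factors would be.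
\<close>

lemma hev_nonzero:
  assumes AB: "\<And>c. B \<noteq> K c * A" and A: "A \<noteq> 0" and R: "R \<noteq> 0" "degree R \<le> n"
  shows "hev n R A B \<noteq> 0"
proof
  assume z: "hev n R A B = 0"
  let ?S = "{x. poly R x = 0}"
  have fin: "finite ?S" using R(1) by (rule poly_roots_finite)
  have "(\<Prod>x\<in>?S. B - K x * A) = 0"
  proof (rule poly_zero_if_times[OF A])
    fix t assume t: "poly A t \<noteq> 0"
    have "poly R (poly B t / poly A t) = 0" using poly_hev[OF R(2) t, of B] z t by simp
    then have "\<exists>x\<in>?S. poly (B - K x * A) t = 0" using t by (intro bexI[of _ "poly B t / poly A t"]) auto
    then show "poly (\<Prod>x\<in>?S. B - K x * A) t = poly 0 t" using fin by (simp add: poly_prod)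
  qed
  then obtain x where "B - K x * A = 0" using fin by auto
  then show False using AB by simp
qed

text \<open>
  Both equations are verified at the points where \<open>A\<close> does not vanish, where
  the homogenised values are powers of \<open>A\<close> times values at
  \<open>B/A\<close>; by the chain rule the multipliers multiply.
\<close>

theorem sol_compose:
  assumes s: "sol a P Q R" and s': "sol b A B C" and d: "degree P \<le> Suc n" "degree Q \<le> Suc n" "degree R \<le> n"
  shows "sol (a*b) (hev (Suc n) P A B) (hev (Suc n) Q A B) (C * hev n R A B)"
proof -
  have oc: "on_curve P Q R" "on_curve A B C" using s s' by (auto simp: sol_def)
  note nz = on_curve_nz[OF oc(1)] and nz' = on_curve_nz[OF oc(2)]
  let ?X = "hev (Suc n) P A B" and ?Y = "hev (Suc n) Q A B" and ?Z = "hev n R A B"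
  have c: "poly P x^3 + poly Q x^3 = (1+x^3) * poly R x^3" for x
  proof -
    have "poly (P^3+Q^3) x = poly (e3*R^3) x" using oc(1) by (simp only: on_curve_def)
    then show ?thesis by (simp add: poly_e3)
  qed
  have c': "poly A x^3 + poly B x^3 = (1+x^3) * poly C x^3" for x
  proof -
    have "poly (A^3+B^3) x = poly (e3*C^3) x" using oc(2) by (simp only: on_curve_def)
    then show ?thesis by (simp add: poly_e3)
  qed
  have "?X^3 + ?Y^3 = e3 * (C * ?Z)^3"
  proof (rule poly_zero_if_times[OF nz'(1)])
    fix t assume t: "poly A t \<noteq> 0"
    let ?a = "poly A t" and ?b = "poly B t"
    have "poly (?X^3 + ?Y^3) t = ?a^(3*Suc n) * (poly P (?b/?a)^3 + poly Q (?b/?a)^3)"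
      using poly_hev[OF d(1) t, of B] poly_hev[OF d(2) t, of B] by (simp add: power_mult_distrib distrib_left flip: power_mult) (simp add: mult_ac power_add)
    also have "\<dots> = ?a^(3*n) * (?a^3 * (1 + (?b/?a)^3)) * poly R (?b/?a)^3" unfolding c
    proof -
      have "?a^(3*Suc n) = ?a^(3*n) * ?a^3" by (simp add: power_add[symmetric] add.commute)
      then show "?a^(3*Suc n) * ((1 + (?b/?a)^3) * poly R (?b/?a)^3) = ?a^(3*n) * (?a^3 * (1 + (?b/?a)^3)) * poly R (?b/?a)^3"
        by (simp only: mult.assoc)
    qed
    also have "?a^3 * (1 + (?b/?a)^3) = ?a^3 + ?b^3" using t by (simp add: distrib_left power_divide)
    also have "?a^(3*n) * (?a^3 + ?b^3) * poly R (?b/?a)^3 = poly (e3 * (C * ?Z)^3) t"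
      unfolding c' using poly_hev[OF d(3) t, of B] by (simp add: poly_e3 power_mult_distrib mult_ac flip: power_mult)
    finally show "poly (?X^3 + ?Y^3) t = poly (e3 * (C * ?Z)^3) t" .
  qed
  moreover have "C * ?Z \<noteq> 0" using hev_nonzero[OF nz'(4) nz'(1) nz(3) d(3)] nz'(3) by simp
  moreover have "wronskian ?X ?Y = K (a*b) * (C * ?Z)^2"
  proof (rule poly_zero_if_times[OF nz'(1)])
    fix t assume t: "poly A t \<noteq> 0"
    let ?a = "poly A t" and ?b = "poly B t"
    have ap: "?a^(2*n+1) = ?a^n * ?a^n * ?a" by (simp add: mult_2 power_add)
    have dp: "degree (pderiv P) \<le> n" "degree (pderiv Q) \<le> n" using d by (simp_all add: degree_pderiv)
    have "A * wronskian ?X ?Y = ?X * (A * pderiv ?Y) - ?Y * (A * pderiv ?X)" by (simp add: wronskian_def algebra_simps)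
    also have "\<dots> = wronskian A B * (?X * hev n (pderiv Q) A B - ?Y * hev n (pderiv P) A B)"
      unfolding pderiv_hev[OF d(1)] pderiv_hev[OF d(2)] by (simp add: algebra_simps)
    finally have "poly (A * wronskian ?X ?Y) t = poly (wronskian A B * (?X * hev n (pderiv Q) A B - ?Y * hev n (pderiv P) A B)) t" by simp
    also have "\<dots> = b * poly C t^2 * (?a^(2*n+1) * poly (wronskian P Q) (?b/?a))"
      using s' poly_hev[OF d(1) t, of B] poly_hev[OF d(2) t, of B] poly_hev[OF dp(1) t, of B] poly_hev[OF dp(2) t, of B]
      unfolding ap by (simp add: sol_def wronskian_def[of P Q] algebra_simps)
    also have "poly (wronskian P Q) (?b/?a) = a * poly R (?b/?a)^2" using s by (simp add: sol_def)
    also have "b * poly C t^2 * (?a^(2*n+1) * (a * poly R (?b/?a)^2)) = ?a * (a * b * (poly C t * (?a^n * poly R (?b/?a)))^2)"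
      unfolding ap by (simp add: power2_eq_square algebra_simps)
    also have "\<dots> = ?a * poly (K (a*b) * (C * ?Z)^2) t" using poly_hev[OF d(3) t, of B] by simp
    finally show "poly (wronskian ?X ?Y) t = poly (K (a*b) * (C * ?Z)^2) t" using t by simp
  qed
  ultimately show ?thesis by (simp add: sol_def on_curve_def)
qed

section \<open>Exponents modulo 3\<close>

lemma coeff_hev_scale: "coeff (hev n P (K c) [:0,1:]) j = (if j \<le> n then c^(n-j) * coeff P j else 0)"
proof -
  have "hev n P (K c) [:0,1:] = (\<Sum>i\<le>n. monom (c^(n-i) * coeff P i) i)"
    unfolding hev_def by (intro sum.cong refl) (simp add: K_def monom_altdef poly_const_pow mult.commute)
  then show ?thesis by (simp add: coeff_sum)
qed

lemma mod_3_flip: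
  fixes N i a :: nat
  assumes "i \<le> N" "(N - i) mod 3 = a mod 3" shows "i mod 3 = (N + 2*a) mod 3"
proof -
  obtain c where c: "N = i + c" using assms(1) le_Suc_ex by blast
  then have "c mod 3 = a mod 3" using assms(2) by simp
  then have "(c + 2*a) mod 3 = 0" by presburger
  then show ?thesis unfolding c by presburger
qed

text \<open>
  Substituting \<open>(\<omega> x, y)\<close> into a point multiplies its multiplier by
  \<open>\<omega>\<close>, and so does multiplying \<open>P\<close> by
  \<open>\<omega>\<close>. By \<open>sol_unique_degree\<close> the two resulting points
  differ by a twist \<open>j\<close> and a constant \<open>k\<close>, so each of
  \<open>P\<close>, \<open>Q\<close>, \<open>R\<close> is an eigenvector of the
  substitution and its exponents lie in one residue class modulo \<open>3\<close>. Which
  classes are possible follows from the leading and the constant coefficients: by the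
  curve equation at most one of the three can vanish in the top degree, and at most one at
  \<open>0\<close>.
\<close>

theorem exponents_mod_3:
  assumes s: "sol a P Q R" and cp: "coprime P Q" and N: "N = max (degree P) (degree Q)"
  shows "(N mod 3 = 0 \<and> (\<forall>i. coeff P i \<noteq> 0 \<longrightarrow> i mod 3 = 0) \<and> (\<forall>i. coeff Q i \<noteq> 0 \<longrightarrow> i mod 3 = 0) \<and> (\<forall>i. coeff R i \<noteq> 0 \<longrightarrow> i mod 3 = 1))
    \<or> (N mod 3 = 1 \<and> (\<forall>i. coeff P i \<noteq> 0 \<longrightarrow> i mod 3 = 0) \<and> (\<forall>i. coeff Q i \<noteq> 0 \<longrightarrow> i mod 3 = 1) \<and> (\<forall>i. coeff R i \<noteq> 0 \<longrightarrow> i mod 3 = 0))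
    \<or> (N mod 3 = 1 \<and> (\<forall>i. coeff P i \<noteq> 0 \<longrightarrow> i mod 3 = 1) \<and> (\<forall>i. coeff Q i \<noteq> 0 \<longrightarrow> i mod 3 = 0) \<and> (\<forall>i. coeff R i \<noteq> 0 \<longrightarrow> i mod 3 = 0))"
proof -
  have oc: "on_curve P Q R" using s by (simp add: sol_def)
  note nz = on_curve_nz[OF oc]
  have dR: "degree R + 1 \<le> N" using on_curve_degree[OF oc] by (simp add: N)
  define n where "n = N - 1"
  have N1: "N = Suc n" using dR by (simp add: n_def)
  have "degree P \<le> N" "degree Q \<le> N" by (simp_all add: N)
  then have d: "degree P \<le> Suc n" "degree Q \<le> Suc n" "degree R \<le> n" using dR by (simp_all only: N1[symmetric]) (simp add: n_def)
  have sw: "sol \<omega> (K \<omega>) [:0,1:] 1" using sol_omega[OF sol_id, of \<omega> 1] by simp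
  let ?h = "\<lambda>m X. hev m X (K \<omega>) [:0,1:]"
  have s1: "sol (a*\<omega>) (?h N P) (?h N Q) (1 * ?h n R)" unfolding N1 by (rule sol_compose[OF s sw d])
  have s2: "sol (\<omega>*1*a) (K \<omega> * P) (K 1 * Q) R" by (rule sol_omega[OF s]) auto
  have s2': "sol (a*\<omega>) (K \<omega> * P) Q R" using s2 by (simp add: mult.commute)
  have pe: "poly (?h N X) t = \<omega>^N * poly X (t/\<omega>)" if "degree X \<le> N" for X t
    using poly_hev[OF that, of "K \<omega>" t "[:0,1:]"] by simp
  have cp1: "coprime (?h N P) (?h N Q)"
  proof -
    have "\<not> (poly (?h N P) t = 0 \<and> poly (?h N Q) t = 0)" for t
      using pe[of P t] pe[of Q t] coprime_poly_0[OF cp, of "t/\<omega>"] by (auto simp: N)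
    moreover have "?h N P \<noteq> 0" using on_curve_nz[of "?h N P" "?h N Q"] s1 by (auto simp: sol_def)
    ultimately show ?thesis using coprime_iff_no_common_root by blast
  qed
  have cp2: "coprime (K \<omega> * P) Q" using coprime_K[of \<omega> 1 P Q] cp by simp
  obtain j k where j: "j < 3" "k \<noteq> 0" "?h N P = K (k * \<omega>^j) * (K \<omega> * P)" "?h N Q = K (k * (\<omega>^j)^2) * Q" "1 * ?h n R = K k * R"
    using sol_unique_degree[OF s2' s1 cp2 cp1] .
  have cK: "coeff (K c * X) i = c * coeff X i" for c X i by (simp add: K_def)
  have eP: "\<omega>^(N-i) = k * \<omega>^(j+1)" if "coeff P i \<noteq> 0" for i
  proof -
    have "i \<le> N" using that le_degree[of P i] by (simp add: N)
    then show ?thesis using arg_cong[OF j(3), of "\<lambda>p. coeff p i"] that by (simp add: coeff_hev_scale cK)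
  qed
  have eQ: "\<omega>^(N-i) = k * \<omega>^(2*j)" if "coeff Q i \<noteq> 0" for i
  proof -
    have "i \<le> N" using that le_degree[of Q i] by (simp add: N)
    then show ?thesis using arg_cong[OF j(4), of "\<lambda>p. coeff p i"] that by (simp add: coeff_hev_scale cK power_mult mult.commute[of 2])
  qed
  have eR: "\<omega>^(n-i) = k" if "coeff R i \<noteq> 0" for i
  proof -
    have "i \<le> n" using that le_degree[of R i] d by simp
    then show ?thesis using arg_cong[OF j(5), of "\<lambda>p. coeff p i"] that by (simp add: coeff_hev_scale cK)
  qed
  have "coeff R (degree R) \<noteq> 0" using nz by simp
  then have "k = \<omega>^(n - degree R)" using eR by metis
  then have "k = \<omega>^((n - degree R) mod 3)" using omega_power_mod[of "n - degree R"] by (rule trans)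
  moreover define l where "l = (n - degree R) mod 3"
  ultimately have l: "l < 3" "k = \<omega>^l" by simp_all
  have wmod: "x mod 3 = y mod 3" if "\<omega>^x = \<omega>^y" for x y
  proof (rule omega_power_inj)
    show "\<omega>^(x mod 3) = \<omega>^(y mod 3)" using that by (simp only: omega_power_mod[of x, symmetric] omega_power_mod[of y, symmetric])
  qed simp_all
  have aP: "(N-i) mod 3 = (l+j+1) mod 3" if "coeff P i \<noteq> 0" for i
    using wmod[of "N-i" "l+(j+1)"] eP[OF that] l by (simp only: power_add add.assoc)
  have aQ: "(N-i) mod 3 = (l+2*j) mod 3" if "coeff Q i \<noteq> 0" for i
    using wmod[of "N-i" "l+2*j"] eQ[OF that] l by (simp only: power_add add.assoc)
  have aR: "(n-i) mod 3 = l" if "coeff R i \<noteq> 0" for i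
    using wmod[of "n-i" "l"] eR[OF that] l by simp
  have leP: "i \<le> N" if "coeff P i \<noteq> 0" for i using that le_degree[of P i] by (simp add: N)
  have leQ: "i \<le> N" if "coeff Q i \<noteq> 0" for i using that le_degree[of Q i] by (simp add: N)
  have leR: "i \<le> n" if "coeff R i \<noteq> 0" for i using that le_degree[of R i] d by simp
  have bP: "i mod 3 = (N + 2*(l+j+1)) mod 3" if "coeff P i \<noteq> 0" for i using mod_3_flip[OF leP[OF that], of "l+j+1"] aP[OF that] l(1) by simp
  have bQ: "i mod 3 = (N + 2*(l+2*j)) mod 3" if "coeff Q i \<noteq> 0" for i using mod_3_flip[OF leQ[OF that], of "l+2*j"] aQ[OF that] l(1) by simp
  have bR: "i mod 3 = (n + 2*l) mod 3" if "coeff R i \<noteq> 0" for i using mod_3_flip[OF leR[OF that], of "l"] aR[OF that] l(1) by simp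
  have top: "coeff P N \<noteq> 0 \<or> coeff Q N \<noteq> 0" using nz by (auto simp: N max_def leading_coeff_0_iff)
  \<comment> \<open>the curve equation in the top degree, and below at \<open>0\<close>\<close>
  have topeq: "coeff P N ^ 3 + coeff Q N ^ 3 = coeff R n ^ 3"
  proof -
    have top3: "coeff (X^3) (3*m) = coeff X m ^ 3" if "degree X \<le> m" for X :: "complex poly" and m
    proof (cases "degree X = m")
      case True
      have "coeff (X^3) (3*degree X) = lead_coeff X ^ 3"
        using lead_coeff_power[of X 3] by (cases "X = 0") (simp_all add: degree_power_eq)
      then show ?thesis using True by simp
    next
      case False
      then have "degree X < m" using that by simp
      moreover have "degree (X^3) < 3*m" using degree_power_le[of X 3] \<open>degree X < m\<close> by simp
      ultimately show ?thesis by (simp add: coeff_eq_0)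
    qed
    have "coeff (e3 * R^3) (3*N) = coeff (R^3) (3*n)"
    proof -
      have "e3 * R^3 = R^3 + monom 1 3 * R^3" by (simp add: e3_def monom_altdef power3_eq_cube one_pCons algebra_simps)
      moreover have "coeff (R^3) (3*N) = 0" using degree_power_le[of R 3] d(3) N1 by (intro coeff_eq_0) simp
      ultimately show ?thesis by (simp add: coeff_monom_mult N1)
    qed
    moreover have "P^3 + Q^3 = e3*R^3" using oc by (simp add: on_curve_def)
    then have "coeff (P^3) (3*N) + coeff (Q^3) (3*N) = coeff (e3 * R^3) (3*N)" by (metis coeff_add)
    ultimately show ?thesis using top3[of P N] top3[of Q N] top3[of R n] d by (simp add: N)
  qed
  have bot: "coeff P 0 \<noteq> 0 \<or> coeff Q 0 \<noteq> 0" using coprime_poly_0[OF cp, of 0] by (simp add: poly_0_coeff_0)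
  have boteq: "coeff P 0 ^ 3 + coeff Q 0 ^ 3 = coeff R 0 ^ 3"
  proof -
    have "poly (P^3+Q^3) 0 = poly (e3*R^3) 0" using oc by (simp only: on_curve_def)
    then have "poly P 0^3 + poly Q 0^3 = (1+0^3) * poly R 0^3" by (simp only: poly_add poly_mult poly_power poly_e3)
    then show ?thesis by (simp add: poly_0_coeff_0)
  qed
  have t2: "\<not> (coeff P N = 0 \<and> coeff R n = 0)" "\<not> (coeff Q N = 0 \<and> coeff R n = 0)"
     "\<not> (coeff P 0 = 0 \<and> coeff R 0 = 0)" "\<not> (coeff Q 0 = 0 \<and> coeff R 0 = 0)"
    using top topeq bot boteq by auto
  have P0: "(l+j+1) mod 3 = 0" if "coeff P N \<noteq> 0" using aP[OF that] by simp
  have Q0: "(l+2*j) mod 3 = 0" if "coeff Q N \<noteq> 0" using aQ[OF that] by simp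
  have R0: "l = 0" if "coeff R n \<noteq> 0" using aR[OF that] by simp
  have P00: "N mod 3 = (l+j+1) mod 3" if "coeff P 0 \<noteq> 0" using aP[OF that] by simp
  have Q00: "N mod 3 = (l+2*j) mod 3" if "coeff Q 0 \<noteq> 0" using aQ[OF that] by simp
  have R00: "n mod 3 = l" if "coeff R 0 \<noteq> 0" using aR[OF that] by simp
  have f: "(l+j+1) mod 3 = 0 \<or> (l+2*j) mod 3 = 0" "(l+j+1) mod 3 = 0 \<or> l = 0" "(l+2*j) mod 3 = 0 \<or> l = 0"
    using top P0 Q0 t2(1,2) R0 by metis+
  have g: "N mod 3 = (l+j+1) mod 3 \<or> N mod 3 = (l+2*j) mod 3" "N mod 3 = (l+j+1) mod 3 \<or> n mod 3 = l"
      "N mod 3 = (l+2*j) mod 3 \<or> n mod 3 = l"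
    using bot P00 Q00 t2(3,4) R00 by metis+
  have Nn: "N mod 3 = (n mod 3 + 1) mod 3" unfolding N1 by presburger
  have "(j = 1 \<and> l = 1) \<or> (j = 0 \<and> l = 0) \<or> (j = 2 \<and> l = 0)"
    using nat_less_3[OF j(1)] nat_less_3[OF l(1)] by (elim disjE; use f in simp)
  moreover have "n mod 3 = 0 \<or> n mod 3 = 1 \<or> n mod 3 = 2" by presburger
  ultimately consider "N mod 3 = 0" "j = 1" "l = 1" "n mod 3 = 2" | "N mod 3 = 1" "j = 0" "l = 0" "n mod 3 = 0" | "N mod 3 = 1" "j = 2" "l = 0" "n mod 3 = 0"
    by (elim disjE conjE; use g Nn in simp)
  then show ?thesis
  proof cases
    case 1
    have "(N + 2*(l+j+1)) mod 3 = 0" "(N + 2*(l+2*j)) mod 3 = 0" "(n + 2*l) mod 3 = 1" unfolding 1(2,3) using 1(1,4) by presburger+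
    then show ?thesis using bP bQ bR 1 by simp
  next
    case 2
    have "(N + 2*(l+j+1)) mod 3 = 0" "(N + 2*(l+2*j)) mod 3 = 1" "(n + 2*l) mod 3 = 0" unfolding 2(2,3) using 2(1,4) by presburger+
    then show ?thesis using bP bQ bR 2 by simp
  next
    case 3
    have "(N + 2*(l+j+1)) mod 3 = 1" "(N + 2*(l+2*j)) mod 3 = 0" "(n + 2*l) mod 3 = 0" unfolding 3(2,3) using 3(1,4) by presburger+
    then show ?thesis using bP bQ bR 3 by simp
  qed
qed

section \<open>Evaluation of forms\<close>

text \<open>
  Values at points of \<open>\<complex>\<^sup>2\<close> determine the polynomial
  (\<open>ev_eqI\<close>), so identities between polynomials built with substitutions
  reduce to complex arithmetic.
\<close>

definition ev :: "bipoly \<Rightarrow> complex \<Rightarrow> complex \<Rightarrow> complex" where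
  "ev p a b = poly (poly p [:b:]) a"

lemma ev_simps [simp]:
  "ev 0 a b = 0" "ev 1 a b = 1" "ev (p + q) a b = ev p a b + ev q a b" "ev (p - q) a b = ev p a b - ev q a b"
  "ev (- p) a b = - ev p a b" "ev (p * q) a b = ev p a b * ev q a b" "ev (p ^ n) a b = ev p a b ^ n"
  "ev (cst c) a b = c" "ev vx a b = a" "ev vy a b = b"
  by (simp_all add: ev_def cst_def vx_def vy_def)

lemma ev_pCons: "ev (pCons c p) a b = poly c a + b * ev p a b"
  by (simp add: ev_def)

lemma ev_sum: "ev (sum f A) a b = (\<Sum>x\<in>A. ev (f x) a b)"
  by (induction A rule: infinite_finite_induct) auto

lemma ev_eqI: assumes "\<And>a b. ev p a b = ev q a b" shows "p = q"
proof -
  have "poly (p - q) [:b:] = 0" for b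
    using assms by (intro poly_all_0_iff_0[THEN iffD1]) (auto simp: ev_def)
  then have "range (\<lambda>b. [:b:]) \<subseteq> {x. poly (p - q) x = 0}" by auto
  moreover have "infinite (range (\<lambda>b::complex. [:b:]))"
    using finite_imageD[of "\<lambda>b::complex. [:b:]" UNIV] infinite_UNIV_char_0 by (auto simp: inj_on_def)
  ultimately have "p - q = 0" using poly_roots_finite infinite_super by blast
  then show ?thesis by simp
qed

lemma ev_subst [simp]: "ev (subst p a b) s t = ev p (ev a s t) (ev b s t)"
proof -
  have c: "ev (poly (map_poly cst c) a) s t = poly c (ev a s t)" for c
  proof (induction c)
    case (pCons x c)
    have "cst 0 = 0" by (simp add: cst_def)
    then show ?case using pCons by (simp add: map_poly_pCons)
  qed simp
  show ?thesis unfolding subst_def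
    by (induction p) (auto simp: map_poly_pCons c ev_pCons)
qed

text \<open>
  Dehomogenisation: the value at \<open>x = 1\<close>, as a polynomial in
  \<open>y\<close>. It is injective on the forms of a given degree.
\<close>

definition dh :: "bipoly \<Rightarrow> complex poly" where
  "dh p = map_poly (\<lambda>c. poly c 1) p"

lemma poly_dh: "poly (dh p) t = ev p 1 t"
  unfolding dh_def by (induction p) (auto simp: map_poly_pCons ev_pCons)

lemma coeff_dh: "coeff (dh p) j = poly (coeff p j) 1"
  by (simp add: dh_def coeff_map_poly)

lemma cpoly_ext: "(\<And>t. poly p t = poly q t) \<Longrightarrow> p = (q :: complex poly)"
  using poly_eq_poly_eq_iff by blast

lemma dh_simps [simp]:
  "dh 0 = 0" "dh 1 = 1" "dh (p + q) = dh p + dh q" "dh (p - q) = dh p - dh q"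
  "dh (- p) = - dh p" "dh (p * q) = dh p * dh q" "dh (p ^ n) = dh p ^ n"
  "dh (cst c) = K c" "dh vx = 1" "dh vy = [:0,1:]"
  by (rule cpoly_ext; simp add: poly_dh)+

lemma dh_e3: "dh (vx^3 + vy^3) = e3"
  by (rule cpoly_ext) (simp add: poly_e3)

section \<open>Homogeneous polynomials\<close>

lemma homog_coeff: assumes "homog n p" shows "coeff p j = (if j \<le> n then monom (coeff (dh p) j) (n-j) else 0)"
proof -
  have h: "coeff (coeff p j) i \<noteq> 0 \<Longrightarrow> i + j = n" for i using assms by (auto simp: homog_def bicoeff_def)
  have "coeff p j = monom (coeff (coeff p j) (n-j)) (n-j)" if "j \<le> n"
  proof (rule poly_eqI)
    fix i show "coeff (coeff p j) i = coeff (monom (coeff (coeff p j) (n-j)) (n-j)) i"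
      using h[of i] that by (cases "i + j = n") auto
  qed
  moreover have "coeff p j = 0" if "\<not> j \<le> n" using h that by (intro poly_eqI) auto
  ultimately show ?thesis by (metis coeff_dh mult.right_neutral poly_monom power_one)
qed

lemma homog_eqI: "homog n p \<Longrightarrow> homog n q \<Longrightarrow> dh p = dh q \<Longrightarrow> p = q"
  by (rule poly_eqI) (simp add: homog_coeff)

lemma homog_bicoeff: "homog n p \<Longrightarrow> bicoeff p i j = (if i + j = n then coeff (dh p) j else 0)"
  by (auto simp: bicoeff_def homog_coeff)

lemma degree_dh: "homog n p \<Longrightarrow> degree (dh p) \<le> n"
  by (rule degree_le) (auto simp: coeff_dh homog_coeff)

text \<open>
  Homogenisation to degree \<open>n\<close>, the inverse of \<open>dh\<close>.
\<close>

definition hz :: "nat \<Rightarrow> complex poly \<Rightarrow> bipoly" where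
  "hz n P = (\<Sum>j\<le>n. cst (coeff P j) * vx^(n-j) * vy^j)"

lemma homog_mult: assumes "homog m p" "homog n q" shows "homog (m+n) (p*q)"
  unfolding homog_def
proof (intro allI impI)
  fix i j assume "bicoeff (p*q) i j \<noteq> 0"
  then have "(\<Sum>k\<le>j. \<Sum>l\<le>i. coeff (coeff p k) l * coeff (coeff q (j-k)) (i-l)) \<noteq> 0"
    by (simp add: bicoeff_def coeff_mult coeff_sum)
  then obtain k where k: "k \<le> j" "(\<Sum>l\<le>i. coeff (coeff p k) l * coeff (coeff q (j-k)) (i-l)) \<noteq> 0"
    by (meson sum.not_neutral_contains_not_neutral atMost_iff)
  then obtain l where l: "l \<le> i" "coeff (coeff p k) l * coeff (coeff q (j-k)) (i-l) \<noteq> 0"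
    by (meson sum.not_neutral_contains_not_neutral atMost_iff)
  then have "l + k = m" "(i-l) + (j-k) = n" using assms by (auto simp: homog_def bicoeff_def)
  then show "i + j = m + n" using k l by linarith
qed

lemma homog_0 [simp]: "homog n 0" by (simp add: homog_def bicoeff_def)

lemma homog_add: "homog n p \<Longrightarrow> homog n q \<Longrightarrow> homog n (p+q)"
  unfolding homog_def bicoeff_def by (metis coeff_add add.right_neutral)

lemma homog_uminus: "homog n p \<Longrightarrow> homog n (-p)"
  unfolding homog_def bicoeff_def by simp

lemma homog_diff: "homog n p \<Longrightarrow> homog n q \<Longrightarrow> homog n (p-q)"
  using homog_add[of n p "-q"] homog_uminus[of n q] by simp

lemma homog_cst [simp]: "homog 0 (cst c)"
  by (auto simp: homog_def bicoeff_def cst_def coeff_pCons split: nat.splits)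

lemma homog_1 [simp]: "homog 0 1" using homog_cst[of 1] by (simp add: cst_def one_pCons)

lemma homog_vars [simp]: "homog 1 vx" "homog 1 vy" "homog (Suc 0) vx" "homog (Suc 0) vy"
  by (auto simp: homog_def bicoeff_def vx_def vy_def coeff_pCons split: nat.splits)

lemma homog_power: "homog m p \<Longrightarrow> homog (m*n) (p^n)"
proof (induction n)
  case (Suc n) then show ?case using homog_mult[of m p "m*n" "p^n"] by simp
qed simp

lemma homog_cst_mult: "homog n p \<Longrightarrow> homog n (cst c * p)"
  using homog_mult[of 0 "cst c" n p] by simp

lemma homog_sum: "(\<And>i. i \<in> I \<Longrightarrow> homog n (f i)) \<Longrightarrow> homog n (sum f I)"
  by (induction I rule: infinite_finite_induct) (auto intro: homog_add)

lemma homog_hz: "homog n (hz n P)"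
  unfolding hz_def
proof (rule homog_sum)
  fix j assume "j \<in> {..n}"
  then have "0 + 1*(n-j) + 1*j = n" by simp
  then show "homog n (cst (coeff P j) * vx^(n-j) * vy^j)"
    by (metis homog_mult homog_cst homog_power homog_vars(1,2))
qed

lemma dh_hz: "degree P \<le> n \<Longrightarrow> dh (hz n P) = P"
proof (rule cpoly_ext)
  fix t assume "degree P \<le> n"
  then have "poly P t = (\<Sum>j\<le>n. coeff P j * t^j)" unfolding poly_altdef
    by (intro sum.mono_neutral_left) (auto simp: coeff_eq_0)
  then show "poly (dh (hz n P)) t = poly P t" by (simp add: poly_dh hz_def ev_sum)
qed

lemma hz_dh: "homog n p \<Longrightarrow> hz n (dh p) = p"
  by (rule homog_eqI[OF homog_hz]) (auto simp: dh_hz degree_dh)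

lemma ev_hz: "ev (hz n P) a b = (\<Sum>j\<le>n. coeff P j * a^(n-j) * b^j)"
  by (simp add: hz_def ev_sum)

lemma homog_degree_unique: "homog m p \<Longrightarrow> homog n p \<Longrightarrow> p \<noteq> 0 \<Longrightarrow> m = n"
proof -
  assume h: "homog m p" "homog n p" "p \<noteq> 0"
  then obtain i j where "bicoeff p i j \<noteq> 0" unfolding bicoeff_def by (metis leading_coeff_0_iff)
  then show "m = n" using h by (auto simp: homog_def)
qed

lemma homog_dh_0: "homog n p \<Longrightarrow> dh p = 0 \<longleftrightarrow> p = 0"
  using homog_eqI[of n p 0] by auto

lemma dh_subst: "homog n p \<Longrightarrow> dh (subst p a b) = hev n (dh p) (dh a) (dh b)"
proof (rule cpoly_ext)
  fix t assume h: "homog n p"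
  have "poly (dh (subst p a b)) t = ev (hz n (dh p)) (ev a 1 t) (ev b 1 t)" unfolding hz_dh[OF h] by (simp add: poly_dh)
  then show "poly (dh (subst p a b)) t = poly (hev n (dh p) (dh a) (dh b)) t"
    by (simp add: ev_hz hev_def poly_sum poly_dh)
qed

lemma homog_subst: assumes "homog n p" "homog m a" "homog m b" shows "homog (m*n) (subst p a b)"
proof -
  have "subst p a b = (\<Sum>j\<le>n. cst (coeff (dh p) j) * a^(n-j) * b^j)"
  proof (rule ev_eqI)
    fix s t
    have "ev (subst p a b) s t = ev (hz n (dh p)) (ev a s t) (ev b s t)" unfolding hz_dh[OF assms(1)] by simp
    then show "ev (subst p a b) s t = ev (\<Sum>j\<le>n. cst (coeff (dh p) j) * a^(n-j) * b^j) s t"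
      by (simp add: ev_hz ev_sum)
  qed
  moreover have "homog (m*n) (\<Sum>j\<le>n. cst (coeff (dh p) j) * a^(n-j) * b^j)"
  proof (rule homog_sum)
    fix j assume "j \<in> {..n}"
    then have "0 + m*(n-j) + m*j = m*n" by (simp flip: distrib_left)
    then show "homog (m*n) (cst (coeff (dh p) j) * a^(n-j) * b^j)"
      using homog_mult[OF homog_mult[OF homog_cst[of "coeff (dh p) j"] homog_power[OF assms(2), of "n-j"]] homog_power[OF assms(3), of j]] by simp
  qed
  ultimately show ?thesis by simp
qed

lemma form_mult: "form p \<Longrightarrow> form q \<Longrightarrow> form (p*q)" using homog_mult unfolding form_def by blast

lemma form_homog: "homog n p \<Longrightarrow> form p" by (auto simp: form_def)

text \<open>
  If all exponents of \<open>y\<close> are congruent to \<open>b\<close> then, as \<open>N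
  \<equiv> a + b\<close>, all exponents of \<open>x\<close> are congruent to
  \<open>a\<close>.
\<close>

lemma form_in_cubes:
  assumes h: "homog N p" and N: "N = a + b + 3*M" and e: "\<And>i. coeff (dh p) i \<noteq> 0 \<Longrightarrow> i mod 3 = b"
    and ab: "a < 3" "b < 3"
  shows "\<exists>F. form F \<and> p = vx^a * vy^b * subst F (vx^3) (vy^3)"
proof -
  define G where "G = (\<Sum>j\<le>M. monom (coeff (dh p) (b+3*j)) j)"
  have cG: "coeff G j = (if j \<le> M then coeff (dh p) (b+3*j) else 0)" for j by (simp add: G_def coeff_sum)
  have "p = vx^a * vy^b * subst (hz M G) (vx^3) (vy^3)"
  proof (rule ev_eqI)
    fix s t
    have "ev p s t = ev (hz N (dh p)) s t" using h by (simp add: hz_dh)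
    also have "\<dots> = (\<Sum>i\<le>N. coeff (dh p) i * s^(N-i) * t^i)" by (rule ev_hz)
    also have "\<dots> = (\<Sum>i\<in>(\<lambda>j. b+3*j) ` {..M}. coeff (dh p) i * s^(N-i) * t^i)"
    proof (rule sum.mono_neutral_right)
      show "(\<lambda>j. b+3*j) ` {..M} \<subseteq> {..N}" using N by auto
      show "\<forall>i\<in>{..N} - (\<lambda>j. b+3*j) ` {..M}. coeff (dh p) i * s^(N-i) * t^i = 0"
      proof
        fix i assume i: "i \<in> {..N} - (\<lambda>j. b+3*j) ` {..M}"
        have "coeff (dh p) i = 0"
        proof (rule ccontr)
          assume "coeff (dh p) i \<noteq> 0"
          then have "i mod 3 = b" by (rule e)
          then have "i = b + 3 * (i div 3)" by presburger
          moreover from this have "i div 3 \<le> M" using i N ab by simp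
          ultimately show False using i by blast
        qed
        then show "coeff (dh p) i * s^(N-i) * t^i = 0" by simp
      qed
    qed simp
    also have "\<dots> = (\<Sum>j\<le>M. coeff (dh p) (b+3*j) * s^(N-(b+3*j)) * t^(b+3*j))"
      by (subst sum.reindex) (auto simp: inj_on_def)
    also have "\<dots> = (\<Sum>j\<le>M. s^a * t^b * (coeff G j * (s^3)^(M-j) * (t^3)^j))"
    proof (intro sum.cong refl)
      fix j assume "j \<in> {..M}"
      then have Nj: "N - (b+3*j) = a + 3*(M-j)" using N by auto
      then show "coeff (dh p) (b+3*j) * s^(N-(b+3*j)) * t^(b+3*j) = s^a * t^b * (coeff G j * (s^3)^(M-j) * (t^3)^j)"
        using \<open>j \<in> {..M}\<close> unfolding Nj cG power_add power_mult by (simp add: mult_ac)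
    qed
    also have "\<dots> = ev (vx^a * vy^b * subst (hz M G) (vx^3) (vy^3)) s t" by (simp add: ev_hz sum_distrib_left)
    finally show "ev p s t = ev (vx^a * vy^b * subst (hz M G) (vx^3) (vy^3)) s t" .
  qed
  then show ?thesis using homog_hz form_homog by blast
qed

section \<open>Solutions as classes\<close>

lemma triplesI:
  assumes "homog (Suc n) p" "homog (Suc n) q" "homog n r" "on_curve (dh p) (dh q) (dh r)"
  shows "(p, q, r) \<in> triples" "r \<noteq> 0"
proof -
  show r: "r \<noteq> 0" using assms(4) by (auto simp: on_curve_def)
  have "p^3 + q^3 = (vx^3 + vy^3) * r^3"
  proof (rule homog_eqI)
    show "homog (Suc n * 3) (p^3 + q^3)" using assms by (intro homog_add homog_power)
    have "homog (1*3 + n*3) ((vx^3 + vy^3) * r^3)" using assms by (intro homog_mult homog_add homog_power) auto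
    then show "homog (Suc n * 3) ((vx^3 + vy^3) * r^3)" by simp
    show "dh (p^3 + q^3) = dh ((vx^3 + vy^3) * r^3)"
      using assms(4) dh_e3 by (simp only: dh_simps on_curve_def)
  qed
  then show "(p, q, r) \<in> triples" using assms r by (auto simp: triples_def form_def)
qed

lemma triples_fin:
  assumes "(p, q, r) \<in> triples" "r \<noteq> 0"
  obtains n where "homog (Suc n) p" "homog (Suc n) q" "homog n r" "on_curve (dh p) (dh q) (dh r)"
proof -
  obtain n where n: "homog (Suc n) p" "homog (Suc n) q" "homog n r" using assms by (auto simp: triples_def)
  have "p^3 + q^3 = (vx^3 + vy^3) * r^3" using assms by (simp add: triples_def)
  then have "dh (p^3 + q^3) = dh ((vx^3 + vy^3) * r^3)" by simp
  then have "dh p^3 + dh q^3 = e3 * dh r^3" using dh_e3 by (simp only: dh_simps)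
  then have "on_curve (dh p) (dh q) (dh r)" using homog_dh_0[OF n(3)] assms(2) by (simp add: on_curve_def)
  with n that show thesis by blast
qed

lemma cst_hom: "cst (a * b) = cst a * cst b" "cst 1 = 1" "cst 0 = 0" "cst (a + b) = cst a + cst b" "cst (-a) = - cst a"
   "cst (a^n) = cst a ^ n" "cst a = 0 \<longleftrightarrow> a = 0"
proof -
  show "cst (a * b) = cst a * cst b" "cst 1 = 1" "cst 0 = 0" "cst (a + b) = cst a + cst b" "cst (-a) = - cst a" "cst (a^n) = cst a ^ n"
    by (rule ev_eqI; simp)+
  show "cst a = 0 \<longleftrightarrow> a = 0" by (simp add: cst_def)
qed

lemma cst_dvd_1: "cst c dvd 1 \<longleftrightarrow> c \<noteq> 0"
proof -
  have "cst c * cst (inverse c) = 1" if "c \<noteq> 0" using that by (simp flip: cst_hom(1,2))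
  then show ?thesis using cst_hom(3) by (metis dvd_0_left_iff dvd_triv_left one_neq_zero)
qed

lemma form_cst [simp]: "form (cst c)" by (rule form_homog[OF homog_cst])

lemma form_1 [simp]: "form 1" by (rule form_homog[OF homog_1])

text \<open>
  For \<open>r = 0\<close> the equation factors as \<open>(q + p) (q + \<omega> p) (q +
  \<omega>\<^sup>2 p) = 0\<close>.
\<close>

lemma triples_inf:
  assumes "(p, q, 0) \<in> triples"
  obtains j n where "j < 3" "q = cst (-(\<omega>^j)) * p" "homog n p" "p \<noteq> 0"
proof -
  have f: "form p" "\<not> (p = 0 \<and> q = 0)" "p^3 + q^3 = 0" using assms by (auto simp: triples_def)
  have "(q + p) * (q + cst \<omega> * p) * (q + cst (\<omega>^2) * p) = q^3 + p^3"
  proof (rule ev_eqI)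
    fix a b
    have "(y + x) * (y + \<omega> * x) * (y + \<omega>^2 * x) = y^3 + (1 + \<omega> + \<omega>^2)*y^2*x + (\<omega> + \<omega>^2 + \<omega>^3)*y*x^2 + \<omega>^3*x^3" for x y
      by (simp add: algebra_simps power_numeral_reduce)
    moreover have "\<omega> + \<omega>^2 + \<omega>^3 = 0" using omega_sum by (simp add: add_ac)
    ultimately show "ev ((q + p) * (q + cst \<omega> * p) * (q + cst (\<omega>^2) * p)) a b = ev (q^3 + p^3) a b"
      using omega_sum by simp
  qed
  then have "(q + p) * (q + cst \<omega> * p) * (q + cst (\<omega>^2) * p) = 0" using f by (simp add: add.commute)
  then consider "q + p = 0" | "q + cst \<omega> * p = 0" | "q + cst (\<omega>^2) * p = 0" by auto
  then obtain j where j: "j < 3" "q + cst (\<omega>^j) * p = 0"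
  proof cases
    case 1 then show ?thesis using that[of 0] by (simp add: cst_hom)
  next
    case 2 then show ?thesis using that[of 1] by simp
  next
    case 3 then show ?thesis using that[of 2] by simp
  qed
  then have "q = cst (-(\<omega>^j)) * p" by (simp add: cst_hom add_eq_0_iff)
  moreover have "p \<noteq> 0" using f calculation by auto
  moreover obtain n where "homog n p" using f by (auto simp: form_def)
  ultimately show thesis using j that by blast
qed

lemma triples_infI: "homog n p \<Longrightarrow> p \<noteq> 0 \<Longrightarrow> (p, cst (-(\<omega>^j)) * p, 0) \<in> triples"
proof -
  assume h: "homog n p" "p \<noteq> 0"
  have "cst (-(\<omega>^j))^3 = -1" unfolding cst_hom(6)[symmetric] using omega_power_3[of j] by (simp add: power3_eq_cube[of "- _"] power3_eq_cube[symmetric] cst_hom)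
  then show ?thesis using h homog_cst_mult[OF h(1)] by (auto simp: triples_def form_def power_mult_distrib intro: exI[of _ 0])
qed

lemma proj_eqI: "t \<in> triples \<Longrightarrow> t' \<in> triples \<Longrightarrow> form a \<Longrightarrow> form b \<Longrightarrow> a \<noteq> 0 \<Longrightarrow> b \<noteq> 0 \<Longrightarrow> t = (p,q,r) \<Longrightarrow> t' = (p',q',r') \<Longrightarrow>
   a*p = b*p' \<Longrightarrow> a*q = b*q' \<Longrightarrow> a*r = b*r' \<Longrightarrow> (t, t') \<in> proj_eq"
  unfolding proj_eq_def by blast

lemma equiv_proj_eq: "equiv triples proj_eq"
proof (rule equivI)
  show "proj_eq \<subseteq> triples \<times> triples" by (auto simp: proj_eq_def)
  show "refl_on triples proj_eq"
  proof (rule refl_onI)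
    fix t assume "t \<in> triples"
    then show "(t, t) \<in> proj_eq" by (cases t) (auto intro!: proj_eqI[of _ _ "cst 1" "cst 1"] simp: cst_hom)
  qed
  show "sym proj_eq"
  proof (rule symI)
    fix t u assume "(t, u) \<in> proj_eq"
    then show "(u, t) \<in> proj_eq" by (auto simp: proj_eq_def) metis
  qed
  show "trans proj_eq"
  proof (rule transI)
    fix t u v assume *: "(t, u) \<in> proj_eq" "(u, v) \<in> proj_eq"
    obtain p q r p' q' r' p'' q'' r'' where t: "t = (p,q,r)" "u = (p',q',r')" "v = (p'',q'',r'')" by (metis surj_pair)
    obtain a b where ab: "form a" "form b" "a \<noteq> 0" "b \<noteq> 0" "a*p = b*p'" "a*q = b*q'" "a*r = b*r'" and tu: "t \<in> triples" "u \<in> triples"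
      using *(1) unfolding proj_eq_def t by auto
    obtain c d where cd: "form c" "form d" "c \<noteq> 0" "d \<noteq> 0" "c*p' = d*p''" "c*q' = d*q''" "c*r' = d*r''" and v: "v \<in> triples"
      using *(2) unfolding proj_eq_def t by auto
    have e: "(c*a)*x = (b*d)*z" if "a*x = b*y" "c*y = d*z" for x y z
    proof -
      have "(c*a)*x = c*(b*y)" unfolding that(1)[symmetric] by (rule mult.assoc)
      also have "\<dots> = b*(d*z)" unfolding that(2)[symmetric] by (rule mult.left_commute)
      finally show ?thesis by (simp only: mult.assoc)
    qed
    show "(t, v) \<in> proj_eq"
      by (rule proj_eqI[OF tu(1) v form_mult[OF cd(1) ab(1)] form_mult[OF ab(2) cd(2)] _ _ t(1,3)
          e[OF ab(5) cd(5)] e[OF ab(6) cd(6)] e[OF ab(7) cd(7)]]) (use ab(3,4) cd(3,4) in simp_all)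
  qed
qed

lemma proj_eq_triples: "(t, t') \<in> proj_eq \<Longrightarrow> t \<in> triples \<and> t' \<in> triples" by (auto simp: proj_eq_def)

text \<open>
  Projective equality only sees the ratios to the last coordinate, and forms of equal
  degree may be compared after dehomogenising. The forms required as factors are the last
  coordinates themselves.
\<close>

lemma proj_eq_fin_iff:
  assumes t: "(p, q, r) \<in> triples" "(p', q', r') \<in> triples" and r: "r \<noteq> 0"
  shows "((p, q, r), (p', q', r')) \<in> proj_eq \<longleftrightarrow> r' \<noteq> 0 \<and> dh p * dh r' = dh p' * dh r \<and> dh q * dh r' = dh q' * dh r"
proof
  assume "((p, q, r), (p', q', r')) \<in> proj_eq"
  then obtain a b where ab: "a \<noteq> 0" "b \<noteq> 0" "a*p = b*p'" "a*q = b*q'" "a*r = b*r'" by (auto simp: proj_eq_def)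
  have r': "r' \<noteq> 0" using ab r by auto
  have x: "x * r' = x' * r" if "a*x = b*x'" for x x'
  proof -
    have "a * (x * r') = b * x' * r'" unfolding that[symmetric] by (rule mult.assoc[symmetric])
    also have "\<dots> = x' * (b * r')" by (simp only: mult_ac)
    also have "\<dots> = a * (x' * r)" unfolding ab(5)[symmetric] by (rule mult.left_commute)
    finally have "a * (x * r') = a * (x' * r)" .
    then show ?thesis using ab(1) by simp
  qed
  have "dh (p * r') = dh (p' * r)" "dh (q * r') = dh (q' * r)" by (simp_all only: x[OF ab(3)] x[OF ab(4)])
  then show "r' \<noteq> 0 \<and> dh p * dh r' = dh p' * dh r \<and> dh q * dh r' = dh q' * dh r" using r' by simp
next
  assume e: "r' \<noteq> 0 \<and> dh p * dh r' = dh p' * dh r \<and> dh q * dh r' = dh q' * dh r"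
  obtain n where n: "homog (Suc n) p" "homog (Suc n) q" "homog n r" using triples_fin[OF t(1) r] by metis
  obtain m where m: "homog (Suc m) p'" "homog (Suc m) q'" "homog m r'" using triples_fin[OF t(2)] e by metis
  have x: "r' * x = r * x'" if "homog (Suc n) x" "homog (Suc m) x'" "dh x * dh r' = dh x' * dh r" for x x'
  proof (rule homog_eqI)
    show "homog (m + Suc n) (r' * x)" using m that by (intro homog_mult)
    have "homog (n + Suc m) (r * x')" using n that by (intro homog_mult)
    then show "homog (m + Suc n) (r * x')" by (simp add: add.commute)
    show "dh (r' * x) = dh (r * x')" using that(3) by (simp add: mult.commute)
  qed
  show "((p, q, r), (p', q', r')) \<in> proj_eq"
    by (rule proj_eqI[OF t, of r' r]) (use e r x n m form_homog in \<open>auto simp: mult.commute\<close>)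
qed

lemma pt_solution: "(p, q, r) \<in> triples \<Longrightarrow> pt p q r \<in> solutions"
  unfolding pt_def solutions_def by (rule quotientI)

lemma mem_pt_self: "(p, q, r) \<in> triples \<Longrightarrow> (p, q, r) \<in> pt p q r"
  unfolding pt_def using equiv_proj_eq by (simp add: equiv_def refl_on_def)

lemma pt_eq_iff: "(p, q, r) \<in> triples \<Longrightarrow> (p', q', r') \<in> triples \<Longrightarrow> pt p q r = pt p' q' r' \<longleftrightarrow> ((p, q, r), (p', q', r')) \<in> proj_eq"
  unfolding pt_def using eq_equiv_class_iff[OF equiv_proj_eq] by blast

lemma solution_pt: "v \<in> solutions \<Longrightarrow> (p, q, r) \<in> v \<Longrightarrow> (p, q, r) \<in> triples \<and> v = pt p q r"
proof -
  assume v: "v \<in> solutions" and t: "(p, q, r) \<in> v"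
  then obtain u where u: "u \<in> triples" "v = proj_eq `` {u}" by (auto simp: solutions_def elim: quotientE)
  then have ut: "(u, (p,q,r)) \<in> proj_eq" using t by simp
  then have "proj_eq `` {u} = proj_eq `` {(p,q,r)}" using equiv_class_eq[OF equiv_proj_eq] by blast
  then show ?thesis using proj_eq_triples[OF ut] u by (simp add: pt_def)
qed

lemma solution_nonempty: "v \<in> solutions \<Longrightarrow> \<exists>p q r. (p, q, r) \<in> v"
proof -
  assume v: "v \<in> solutions"
  then obtain u where "u \<in> triples" "v = proj_eq `` {u}" by (auto simp: solutions_def elim: quotientE)
  then have "u \<in> v" using equiv_class_self[OF equiv_proj_eq] by blast
  then show ?thesis by (metis surj_pair)
qed

lemma pt_scale:
  assumes t: "(p, q, r) \<in> triples" and k: "k \<noteq> 0"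
  shows "(cst k * p, cst k * q, cst k * r) \<in> triples" "pt (cst k * p) (cst k * q) (cst k * r) = pt p q r"
proof -
  have f: "form (cst k * x)" if "form x" for x using that by (intro form_mult) auto
  have eq: "p^3 + q^3 = (vx^3 + vy^3) * r^3" using t by (simp add: triples_def)
  have "(cst k * p)^3 + (cst k * q)^3 = cst k^3 * (p^3 + q^3)" by (simp add: power_mult_distrib distrib_left)
  also have "\<dots> = (vx^3 + vy^3) * (cst k * r)^3" unfolding eq by (simp add: power_mult_distrib mult_ac)
  finally show t': "(cst k * p, cst k * q, cst k * r) \<in> triples"
    using t k f by (auto simp: triples_def cst_hom intro: homog_cst_mult)
  show "pt (cst k * p) (cst k * q) (cst k * r) = pt p q r"
    unfolding pt_eq_iff[OF t' t] by (rule proj_eqI[OF t' t, of 1 "cst k"]) (use k in \<open>auto simp: cst_hom form_homog[OF homog_1]\<close>)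
qed

text \<open>
  \<open>multiplier v a\<close>: the solution \<open>v\<close> is finite with multiplier
  \<open>a\<close>.
\<close>

definition multiplier :: "triple set \<Rightarrow> complex \<Rightarrow> bool" where
  "multiplier v a \<longleftrightarrow> v \<in> solutions \<and> (\<exists>p q r. (p, q, r) \<in> v \<and> sol a (dh p) (dh q) (dh r))"

lemma LamI: "(p, q, r) \<in> triples \<Longrightarrow> sol a (dh p) (dh q) (dh r) \<Longrightarrow> multiplier (pt p q r) a"
  unfolding multiplier_def using pt_solution mem_pt_self by blast

lemma sol_dh_nz: "sol a (dh p) (dh q) (dh r) \<Longrightarrow> r \<noteq> 0"
  by (auto simp: sol_def on_curve_def)

lemma Lam_all: assumes "multiplier v a" "(p, q, r) \<in> v" shows "(p, q, r) \<in> triples" "r \<noteq> 0" "sol a (dh p) (dh q) (dh r)" "v = pt p q r"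
proof -
  have v: "v \<in> solutions" using assms by (simp add: multiplier_def)
  obtain p' q' r' where t: "(p', q', r') \<in> v" and s: "sol a (dh p') (dh q') (dh r')" using assms by (auto simp: multiplier_def)
  have t1: "(p, q, r) \<in> triples" "v = pt p q r" "(p', q', r') \<in> triples" "v = pt p' q' r'" using solution_pt[OF v] t assms(2) by blast+
  then have pe: "((p', q', r'), (p, q, r)) \<in> proj_eq" using pt_eq_iff by metis
  note e = pe[unfolded proj_eq_fin_iff[OF t1(3,1) sol_dh_nz[OF s]]]
  show "(p, q, r) \<in> triples" "v = pt p q r" "r \<noteq> 0" using t1 e by auto
  have "dh r \<noteq> 0" using triples_fin[OF t1(1)] e on_curve_nz(3) by metis
  then show "sol a (dh p) (dh q) (dh r)" using e by (intro sol_cong[OF s]) auto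
qed

lemma Lam_unique: "multiplier v a \<Longrightarrow> multiplier v b \<Longrightarrow> a = b"
  using Lam_all(3) sol_mult_unique unfolding multiplier_def by metis

lemma Lam_solution: "multiplier v a \<Longrightarrow> v \<in> solutions" by (simp add: multiplier_def)

lemma Lam_exists: "v \<in> solutions \<Longrightarrow> (p, q, r) \<in> v \<Longrightarrow> r \<noteq> 0 \<Longrightarrow> \<exists>a\<in>Eis. a \<noteq> 0 \<and> multiplier v a"
proof -
  assume v: "v \<in> solutions" "(p, q, r) \<in> v" "r \<noteq> 0"
  then have t: "(p, q, r) \<in> triples" using solution_pt by blast
  then obtain n where "on_curve (dh p) (dh q) (dh r)" using triples_fin v(3) by metis
  then obtain a where "a \<in> Eis" "sol a (dh p) (dh q) (dh r)" using multiplier_eisenstein by blast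
  then show ?thesis unfolding multiplier_def using v sol_nonzero by blast
qed

lemma Lam_Eis: "multiplier v a \<Longrightarrow> a \<in> Eis \<and> a \<noteq> 0"
proof -
  assume l: "multiplier v a"
  then obtain p q r where "(p, q, r) \<in> v" using Lam_solution solution_nonempty by blast
  then obtain b where "b \<in> Eis" "b \<noteq> 0" "multiplier v b" using Lam_exists[OF Lam_solution[OF l]] Lam_all(2)[OF l] by blast
  then show ?thesis using Lam_unique[OF l] by blast
qed

text \<open>
  The three solutions at infinity.
\<close>

definition at_inf :: "nat \<Rightarrow> triple set" where "at_inf j = pt 1 (cst (-(\<omega>^j))) 0"

lemma inf_triple: "(1, cst (-(\<omega>^j)), 0) \<in> triples" using triples_infI[OF homog_1, of j] by simp

lemma inf_solution: "at_inf j \<in> solutions" unfolding at_inf_def by (rule pt_solution[OF inf_triple])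

lemma pt_inf: "homog n p \<Longrightarrow> p \<noteq> 0 \<Longrightarrow> pt p (cst (-(\<omega>^j)) * p) 0 = at_inf j"
  unfolding at_inf_def using triples_infI[of n p j]
  by (subst pt_eq_iff[OF _ inf_triple]) (auto intro!: proj_eqI[OF _ inf_triple, of _ 1 p] simp: form_homog[OF homog_1] form_homog mult.commute)

lemma solution_cases:
  assumes "v \<in> solutions"
  obtains a where "multiplier v a" | j where "j < 3" "v = at_inf j"
proof -
  obtain p q r where t: "(p, q, r) \<in> v" using solution_nonempty[OF assms] by blast
  show thesis
  proof (cases "r = 0")
    case False
    then show ?thesis using Lam_exists[OF assms t] that(1) by blast
  next
    case True
    have tr: "(p, q, 0) \<in> triples" "v = pt p q 0" using solution_pt[OF assms t] True by auto
    obtain j n where "j < 3" "q = cst (-(\<omega>^j)) * p" "homog n p" "p \<noteq> 0" using triples_inf[OF tr(1)] .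
    then show ?thesis using pt_inf that(2) tr(2) by blast
  qed
qed

lemma inf_members: "(p, q, r) \<in> at_inf j \<Longrightarrow> r = 0 \<and> q = cst (-(\<omega>^j)) * p \<and> p \<noteq> 0 \<and> (\<exists>n. homog n p)"
proof -
  assume t: "(p, q, r) \<in> at_inf j"
  then have tr: "(p, q, r) \<in> triples" using solution_pt[OF inf_solution] by blast
  have "((1, cst (-(\<omega>^j)), 0), (p, q, r)) \<in> proj_eq" using t by (simp add: at_inf_def pt_def)
  then obtain a b where ab: "a \<noteq> 0" "b \<noteq> 0" "a = b*p" "a * cst (-(\<omega>^j)) = b*q" "b*r = 0" by (auto simp: proj_eq_def)
  then have "r = 0" "p \<noteq> 0" "b * (cst (-(\<omega>^j)) * p) = b * q" by (auto simp: mult_ac)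
  moreover have "form p" using tr by (simp add: triples_def)
  ultimately show ?thesis using ab by (auto simp: form_def)
qed

section \<open>Twists, negatives and affiliates\<close>

lemma diag_triples:
  assumes t: "(p, q, r) \<in> triples" and c: "c^3 = 1" "d^3 = 1"
  shows "(cst c * p, cst d * q, r) \<in> triples"
proof -
  have nz: "c \<noteq> 0" "d \<noteq> 0" using c by auto
  have cc: "cst c ^ 3 = 1" "cst d ^ 3 = 1" using c by (simp_all flip: cst_hom(6) add: cst_hom(2))
  have f: "form (cst k * x)" if "form x" for k x using that by (intro form_mult) auto
  show ?thesis using t cc nz f by (auto simp: triples_def power_mult_distrib cst_hom intro: homog_cst_mult)
qed

lemma diag_proj_eq:
  assumes e: "((p, q, r), (p', q', r')) \<in> proj_eq" and c: "c^3 = 1" "d^3 = 1"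
  shows "((cst c * p, cst d * q, r), (cst c * p', cst d * q', r')) \<in> proj_eq"
proof -
  have t: "(p,q,r) \<in> triples" "(p',q',r') \<in> triples" using e by (auto simp: proj_eq_def)
  obtain a b where ab: "form a" "form b" "a \<noteq> 0" "b \<noteq> 0" "a*p = b*p'" "a*q = b*q'" "a*r = b*r'" using e by (auto simp: proj_eq_def)
  have m: "a * (cst k * x) = b * (cst k * x')" if "a * x = b * x'" for k x x' using that by (simp add: mult.left_commute)
  show ?thesis
    by (rule proj_eqI[OF diag_triples[OF t(1) c] diag_triples[OF t(2) c] ab(1-4) refl refl m[OF ab(5)] m[OF ab(6)] ab(7)])
qed

lemma swap_triples: "(p, q, r) \<in> triples \<Longrightarrow> (q, p, r) \<in> triples"
  by (auto simp: triples_def add.commute)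

lemma swap_proj_eq: "((p, q, r), (p', q', r')) \<in> proj_eq \<Longrightarrow> ((q, p, r), (q', p', r')) \<in> proj_eq"
proof -
  assume e: "((p, q, r), (p', q', r')) \<in> proj_eq"
  have t: "(p,q,r) \<in> triples" "(p',q',r') \<in> triples" using e by (auto simp: proj_eq_def)
  obtain a b where ab: "form a" "form b" "a \<noteq> 0" "b \<noteq> 0" "a*p = b*p'" "a*q = b*q'" "a*r = b*r'" using e by (auto simp: proj_eq_def)
  show ?thesis by (rule proj_eqI[OF swap_triples[OF t(1)] swap_triples[OF t(2)] ab(1-4) refl refl ab(6,5,7)])
qed

lemma class_members: "v \<in> solutions \<Longrightarrow> (p, q, r) \<in> v \<Longrightarrow> (p', q', r') \<in> v \<Longrightarrow> ((p, q, r), (p', q', r')) \<in> proj_eq"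
  using solution_pt pt_eq_iff by metis

lemma omega_inverse_power: "inverse \<omega> ^ j = \<omega>^(2*j)" "(inverse \<omega> ^ j)^3 = 1"
proof -
  show "inverse \<omega> ^ j = \<omega>^(2*j)" by (simp only: cnj_omega(2) power_mult)
  then show "(inverse \<omega> ^ j)^3 = 1" by (simp only: omega_power_3)
qed

text \<open>
  The operations on classes are unions over representatives; they are evaluated at one
  representative after checking that all members of the union agree.
\<close>

lemma union_of_equal:
  assumes "x \<in> A" and e: "\<And>y. y \<in> A \<Longrightarrow> f y = f x"
  shows "(\<Union>y\<in>A. f y) = f x"
proof -
  have "(\<Union>y\<in>A. f y) = (\<Union>y\<in>A. f x)" by (rule SUP_cong[OF refl e])
  then show ?thesis using assms(1) by blast
qed

lemma twist_eq:
  assumes v: "v \<in> solutions" "(p, q, r) \<in> v"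
  shows "twist j v = pt (cst (\<omega>^j) * p) (cst (inverse \<omega>^j) * q) r"
proof -
  have "(\<Union>t\<in>v. case t of (p,q,r) \<Rightarrow> pt (cst (\<omega>^j) * p) (cst (inverse \<omega>^j) * q) r) = (case (p,q,r) of (p,q,r) \<Rightarrow> pt (cst (\<omega>^j) * p) (cst (inverse \<omega>^j) * q) r)"
  proof (rule union_of_equal[OF v(2)])
    fix t assume t: "t \<in> v"
    obtain p' q' r' where tt: "t = (p', q', r')" by (metis surj_pair)
    have pe: "((p', q', r'), (p, q, r)) \<in> proj_eq" using class_members[OF v(1)] t tt v(2) by blast
    note d = diag_proj_eq[OF pe omega_power_3 omega_inverse_power(2), of j j]
    from d have "pt (cst (\<omega>^j) * p') (cst (inverse \<omega>^j) * q') r' = pt (cst (\<omega>^j) * p) (cst (inverse \<omega>^j) * q) r"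
      using proj_eq_triples[OF d] by (subst pt_eq_iff) auto
    then show "(case t of (p,q,r) \<Rightarrow> pt (cst (\<omega>^j) * p) (cst (inverse \<omega>^j) * q) r) = (case (p,q,r) of (p,q,r) \<Rightarrow> pt (cst (\<omega>^j) * p) (cst (inverse \<omega>^j) * q) r)"
      by (simp add: tt)
  qed
  then show ?thesis by (simp add: twist_def)
qed

lemma sol_neg_eq:
  assumes v: "v \<in> solutions" "(p, q, r) \<in> v"
  shows "sol_neg v = pt q p r"
proof -
  have "(\<Union>t\<in>v. case t of (p,q,r) \<Rightarrow> pt q p r) = (case (p,q,r) of (p,q,r) \<Rightarrow> pt q p r)"
  proof (rule union_of_equal[OF v(2)])
    fix t assume t: "t \<in> v"
    obtain p' q' r' where tt: "t = (p', q', r')" by (metis surj_pair)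
    have pe: "((p', q', r'), (p, q, r)) \<in> proj_eq" using class_members[OF v(1)] t tt v(2) by blast
    note d = swap_proj_eq[OF pe]
    from d have "pt q' p' r' = pt q p r" using proj_eq_triples[OF d] by (subst pt_eq_iff) auto
    then show "(case t of (p,q,r) \<Rightarrow> pt q p r) = (case (p,q,r) of (p,q,r) \<Rightarrow> pt q p r)" by (simp add: tt)
  qed
  then show ?thesis by (simp add: sol_neg_def)
qed

lemma sol_neg_solution: "v \<in> solutions \<Longrightarrow> sol_neg v \<in> solutions"
  using solution_nonempty[of v] sol_neg_eq swap_triples solution_pt pt_solution by metis

lemma sol_neg_neg: "v \<in> solutions \<Longrightarrow> sol_neg (sol_neg v) = v"
proof -
  assume v: "v \<in> solutions"
  obtain p q r where t: "(p,q,r) \<in> v" using solution_nonempty[OF v] by blast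
  have tr: "(p,q,r) \<in> triples" "v = pt p q r" using solution_pt[OF v t] by auto
  have "(q,p,r) \<in> sol_neg v" using sol_neg_eq[OF v t] mem_pt_self[OF swap_triples[OF tr(1)]] by simp
  then show ?thesis using sol_neg_eq[OF sol_neg_solution[OF v]] tr(2) by metis
qed

lemma Lam_neg: "multiplier v a \<Longrightarrow> multiplier (sol_neg v) (-a)"
proof -
  assume l: "multiplier v a"
  obtain p q r where t: "(p,q,r) \<in> v" using solution_nonempty[OF Lam_solution[OF l]] by blast
  note tt = Lam_all[OF l t]
  show ?thesis unfolding sol_neg_eq[OF Lam_solution[OF l] t] by (rule LamI[OF swap_triples[OF tt(1)] sol_swap[OF tt(3)]])
qed

lemma Lam_diag:
  assumes "(p, q, r) \<in> triples" "sol a (dh p) (dh q) (dh r)" "c^3 = 1" "d^3 = 1"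
  shows "multiplier (pt (cst c * p) (cst d * q) r) (c*d*a)"
  by (rule LamI[OF diag_triples[OF assms(1,3,4)]]) (use sol_omega[OF assms(2-4)] in simp)

lemma Lam_twist: assumes "multiplier v a" shows "multiplier (twist j v) a"
proof -
  obtain p q r where t: "(p,q,r) \<in> v" using solution_nonempty[OF Lam_solution[OF assms]] by blast
  note tt = Lam_all[OF assms t]
  have "\<omega>^j * inverse \<omega>^j = 1" by (simp flip: power_mult_distrib)
  then show ?thesis unfolding twist_eq[OF Lam_solution[OF assms] t] 
    using Lam_diag[OF tt(1,3) omega_power_3[of j] omega_inverse_power(2)[of j]] by (simp only: mult_1)
qed

text \<open>
  \<open>sol_unique\<close>, read on classes.
\<close>

theorem Lam_rigid:
  assumes "multiplier v a" "multiplier w a" shows "\<exists>j<3. w = twist j v"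
proof -
  obtain p q r where t: "(p,q,r) \<in> v" using solution_nonempty[OF Lam_solution[OF assms(1)]] by blast
  obtain p' q' r' where t': "(p',q',r') \<in> w" using solution_nonempty[OF Lam_solution[OF assms(2)]] by blast
  note tt = Lam_all[OF assms(1) t] and tt' = Lam_all[OF assms(2) t']
  obtain j where j: "j < 3" "dh p' * dh r = K (\<omega>^j) * (dh p * dh r')" "dh q * dh r' = K (\<omega>^j) * (dh q' * dh r)"
    using sol_unique[OF tt(3) tt'(3)] .
  have i: "inverse \<omega>^j * \<omega>^j = 1" by (simp flip: power_mult_distrib)
  have "K (inverse \<omega>^j) * (dh q * dh r') = dh q' * dh r"
    unfolding j(3) mult.assoc[symmetric] K_hom(2)[symmetric] i by (simp only: K_simps mult_1)
  then have "twist j v = w" unfolding twist_eq[OF Lam_solution[OF assms(1)] t] tt'(4)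
    using j(2) diag_triples[OF tt(1) omega_power_3[of j] omega_inverse_power(2)[of j]] tt'(1,2) tt(2)
    by (subst pt_eq_iff) (auto simp: proj_eq_fin_iff mult.assoc)
  then show ?thesis using j(1) by blast
qed

text \<open>
  The solutions whose multiplier is an associate of \<open>a\<close>.
\<close>

definition unit_class :: "complex \<Rightarrow> triple set set" where
  "unit_class a = {w. \<exists>m. multiplier w (\<omega>^m * a) \<or> multiplier w (- (\<omega>^m * a))}"

lemma affiliatesI:
  assumes "(p, q, r) \<in> v"
  shows "pt (cst (\<omega>^j) * p) (cst (\<omega>^k) * q) r \<in> affiliates v" "pt (cst (\<omega>^k) * q) (cst (\<omega>^j) * p) r \<in> affiliates v"
proof -
  have *: "\<omega>^j = \<omega>^(j mod 3)" "\<omega>^k = \<omega>^(k mod 3)" "j mod 3 < 3" "k mod 3 < 3" using omega_power_mod[of j] omega_power_mod[of k] by auto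
  show "pt (cst (\<omega>^j) * p) (cst (\<omega>^k) * q) r \<in> affiliates v" "pt (cst (\<omega>^k) * q) (cst (\<omega>^j) * p) r \<in> affiliates v"
    unfolding affiliates_def *(1,2) using assms *(3,4) by blast+
qed

text \<open>
  Multiplying the coordinates by \<open>\<omega>\<^sup>j\<close> and
  \<open>\<omega>\<^sup>k\<close> multiplies the multiplier by
  \<open>\<omega>\<^sup>j\<^sup>+\<^sup>k\<close>, exchanging them changes its sign.
  Conversely a solution with an associated multiplier is a twist of such an affiliate by
  \<open>Lam_rigid\<close>, and twists are affiliates.
\<close>

theorem affiliates_eq_unit_class:
  assumes l: "multiplier v a" shows "affiliates v = unit_class a"
proof (intro equalityI subsetI)
  fix w assume "w \<in> affiliates v"
  then obtain p q r j k where t: "(p, q, r) \<in> v" and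
    w: "w = pt (cst (\<omega>^j) * p) (cst (\<omega>^k) * q) r \<or> w = pt (cst (\<omega>^k) * q) (cst (\<omega>^j) * p) r"
    unfolding affiliates_def by blast
  note tt = Lam_all[OF l t]
  from w show "w \<in> unit_class a"
  proof
    assume "w = pt (cst (\<omega>^j) * p) (cst (\<omega>^k) * q) r"
    then have "multiplier w (\<omega>^(j+k) * a)" using Lam_diag[OF tt(1,3) omega_power_3 omega_power_3, of j k] by (simp add: power_add)
    then show ?thesis by (auto simp: unit_class_def)
  next
    assume "w = pt (cst (\<omega>^k) * q) (cst (\<omega>^j) * p) r"
    then have "multiplier w (-(\<omega>^(k+j) * a))" using Lam_diag[OF swap_triples[OF tt(1)] sol_swap[OF tt(3)] omega_power_3 omega_power_3, of k j] by (simp add: power_add)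
    then show ?thesis by (auto simp: unit_class_def)
  qed
next
  fix w assume "w \<in> unit_class a"
  obtain p q r where t: "(p,q,r) \<in> v" using solution_nonempty[OF Lam_solution[OF l]] by blast
  note tt = Lam_all[OF l t]
  have c1: "cst 1 * x = x" for x by (simp add: cst_hom)
  have i: "inverse \<omega>^i = \<omega>^(2*i)" for i by (rule omega_inverse_power(1))
  from \<open>w \<in> unit_class a\<close> obtain m where "multiplier w (\<omega>^m * a) \<or> multiplier w (- (\<omega>^m * a))" by (auto simp: unit_class_def)
  then show "w \<in> affiliates v"
  proof
    assume lw: "multiplier w (\<omega>^m * a)"
    have l1: "multiplier (pt (cst (\<omega>^m) * p) (cst 1 * q) r) (\<omega>^m * 1 * a)" by (rule Lam_diag[OF tt(1,3) omega_power_3]) simp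
    then have l1': "multiplier (pt (cst (\<omega>^m) * p) q r) (\<omega>^m * a)" by (simp add: c1)
    obtain j where j: "w = twist j (pt (cst (\<omega>^m) * p) q r)" using Lam_rigid[OF l1' lw] by blast
    have tr: "(cst (\<omega>^m) * p, q, r) \<in> triples" using diag_triples[OF tt(1) omega_power_3[of m], of 1] by (simp add: c1)
    have "w = pt (cst (\<omega>^j) * (cst (\<omega>^m) * p)) (cst (inverse \<omega>^j) * q) r"
      unfolding j by (rule twist_eq[OF pt_solution[OF tr] mem_pt_self[OF tr]])
    then have "w = pt (cst (\<omega>^(j+m)) * p) (cst (\<omega>^(2*j)) * q) r" by (simp only: i cst_hom power_add mult.assoc)
    then show ?thesis using affiliatesI(1)[OF t] by simp
  next
    assume lw: "multiplier w (-(\<omega>^m * a))"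
    have l1: "multiplier (pt (cst (\<omega>^m) * q) (cst 1 * p) r) (\<omega>^m * 1 * (-a))" by (rule Lam_diag[OF swap_triples[OF tt(1)] sol_swap[OF tt(3)] omega_power_3]) simp
    then have l1': "multiplier (pt (cst (\<omega>^m) * q) p r) (-(\<omega>^m * a))" by (simp add: c1)
    obtain j where j: "w = twist j (pt (cst (\<omega>^m) * q) p r)" using Lam_rigid[OF l1' lw] by blast
    have tr: "(cst (\<omega>^m) * q, p, r) \<in> triples" using diag_triples[OF swap_triples[OF tt(1)] omega_power_3[of m], of 1] by (simp add: c1)
    have "w = pt (cst (\<omega>^j) * (cst (\<omega>^m) * q)) (cst (inverse \<omega>^j) * p) r"
      unfolding j by (rule twist_eq[OF pt_solution[OF tr] mem_pt_self[OF tr]])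
    then have "w = pt (cst (\<omega>^(j+m)) * q) (cst (\<omega>^(2*j)) * p) r" by (simp only: i cst_hom power_add mult.assoc)
    then show ?thesis using affiliatesI(2)[OF t] by simp
  qed
qed

lemma affiliates_inf: "at_inf k \<in> affiliates (at_inf j)"
proof -
  have m: "(1, cst (-(\<omega>^j)), 0) \<in> at_inf j" unfolding at_inf_def by (rule mem_pt_self[OF inf_triple])
  have "\<omega>^(k+2*j) * (-(\<omega>^j)) = -(\<omega>^k)" using omega_power_3[of j] by (simp add: power_add power_mult_distrib power_numeral_reduce mult_2)
  then have "cst (\<omega>^(k+2*j)) * cst (-(\<omega>^j)) = cst (-(\<omega>^k))" by (simp only: cst_hom(1)[symmetric])
  then show ?thesis using affiliatesI(1)[OF m, of 0 "k+2*j"] by (simp add: at_inf_def cst_hom)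
qed

section \<open>Normalised representatives\<close>

text \<open>
  A linear factor of the dehomogenised form comes from a linear factor of the form.
\<close>

lemma homog_factor:
  assumes "homog (Suc n) p" "dh p = l * P'" "degree l = 1"
  shows "hz 1 l dvd p"
proof -
  have "degree P' \<le> n"
  proof (cases "P' = 0")
    case False
    then have "degree (dh p) = 1 + degree P'" unfolding assms(2) using assms(3) by (subst degree_mult_eq) auto
    then show ?thesis using degree_dh[OF assms(1)] by simp
  qed simp
  then have "dh (hz 1 l * hz n P') = dh p" using assms by (simp add: dh_hz)
  moreover have "homog (Suc n) (hz 1 l * hz n P')" using homog_mult[OF homog_hz[of 1 l] homog_hz[of n P']] by simp
  ultimately have "p = hz 1 l * hz n P'" using homog_eqI[OF assms(1)] by metis
  then show ?thesis by simp
qed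

lemma homog_vx_dvd: "homog (Suc n) p \<Longrightarrow> degree (dh p) \<le> n \<Longrightarrow> vx dvd p"
proof -
  assume h: "homog (Suc n) p" "degree (dh p) \<le> n"
  have "p = vx * hz n (dh p)"
  proof (rule homog_eqI[OF h(1)])
    show "homog (Suc n) (vx * hz n (dh p))" using homog_mult[OF homog_vars(1) homog_hz[of n "dh p"]] by simp
  qed (simp add: dh_hz h)
  then show "vx dvd p" by (metis dvd_triv_left)
qed

text \<open>
  A common linear factor of \<open>dh p\<close> and \<open>dh q\<close> also divides
  \<open>dh r\<close> and lifts to a common factor of the forms. If the degree dropped on
  dehomogenising both \<open>p\<close> and \<open>q\<close>, then \<open>x\<close> would
  divide all three forms.
\<close>

lemma normalised_coprime:
  assumes h: "homog (Suc n) p" "homog (Suc n) q" "homog n r" and oc: "on_curve (dh p) (dh q) (dh r)"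
    and ncf: "no_common_factor p q r"
  shows "coprime (dh p) (dh q)" "Suc n = max (degree (dh p)) (degree (dh q))"
proof -
  note nz = on_curve_nz[OF oc]
  show "coprime (dh p) (dh q)"
  proof (rule ccontr)
    assume "\<not> coprime (dh p) (dh q)"
    then obtain x where x: "poly (dh p) x = 0" "poly (dh q) x = 0" using coprime_iff_no_common_root[OF nz(1)] by blast
    have xr: "poly (dh r) x = 0" by (rule on_curve_common_root[OF oc x])
    obtain P' Q' R' where f: "dh p = [:-x,1:]*P'" "dh q = [:-x,1:]*Q'" "dh r = [:-x,1:]*R'"
      using x xr by (auto simp: poly_eq_0_iff_dvd dvd_def)
    have "degree (dh r) \<noteq> 0"
    proof
      assume "degree (dh r) = 0"
      then obtain c where "dh r = [:c:]" by (rule degree_eq_zeroE)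
      then show False using xr nz(3) by simp
    qed
    then obtain m where m: "n = Suc m" using degree_dh[OF h(3)] by (cases n) auto
    have "hz 1 [:-x,1:] dvd p" "hz 1 [:-x,1:] dvd q" "hz 1 [:-x,1:] dvd r"
      using homog_factor[OF h(1) f(1)] homog_factor[OF h(2) f(2)] homog_factor[of m r, OF _ f(3)] h(3) m by auto
    then have "hz 1 [:-x,1:] dvd 1" using ncf by (auto simp: no_common_factor_def)
    then obtain k where "1 = hz 1 [:-x,1:] * k" by (auto simp: dvd_def)
    then have "dh 1 = dh (hz 1 [:-x,1:] * k)" by simp
    then have "1 = [:-x,1:] * dh k" by (simp only: dh_simps) (simp add: dh_hz)
    then have "[:-x,1:] dvd 1" by (metis dvd_triv_left)
    then show False by (simp add: is_unit_iff_degree)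
  qed
  show "Suc n = max (degree (dh p)) (degree (dh q))"
  proof (rule ccontr)
    assume "Suc n \<noteq> max (degree (dh p)) (degree (dh q))"
    then have d: "degree (dh p) \<le> n" "degree (dh q) \<le> n" using degree_dh[OF h(1)] degree_dh[OF h(2)] by (auto simp: max_def split: if_splits)
    then have "degree (dh r) + 1 \<le> n" using on_curve_degree[OF oc] by simp
    then obtain m where m: "n = Suc m" "degree (dh r) \<le> m" by (cases n) auto
    have "vx dvd p" "vx dvd q" "vx dvd r" using homog_vx_dvd h d m by auto
    then have "vx dvd 1" using ncf by (auto simp: no_common_factor_def)
    then obtain k where "1 = vx * k" by (auto simp: dvd_def)
    then have "ev 1 0 0 = ev (vx * k) 0 0" by simp
    then show False by simp
  qed
qed

lemma ev_hz_poly: assumes "degree P \<le> n" "s \<noteq> 0" shows "ev (hz n P) s t = s^n * poly P (t/s)"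
  using poly_hev[OF assms(1), of "K s" 0 "K t"] assms(2) by (simp add: ev_hz hev_def poly_sum)

lemma unit_bipoly: "c dvd 1 \<Longrightarrow> \<exists>k. k \<noteq> 0 \<and> c = cst k"
  by (metis cst_def cst_dvd_1 is_unit_polyE)

text \<open>
  A common factor of positive degree in \<open>y\<close> has a zero \<open>(s, t)\<close>
  with \<open>s \<noteq> 0\<close>, which gives the common root \<open>t/s\<close>. A
  common factor in \<open>\<complex>[x]\<close> divides the coefficient of
  \<open>y\<^sup>n\<close>, which is a nonzero constant in one of the two forms.
\<close>

lemma hz_no_common_factor:
  assumes cp: "coprime P Q" and n: "n = max (degree P) (degree Q)" and nz: "P \<noteq> 0"
  shows "no_common_factor (hz n P) (hz n Q) r"
  unfolding no_common_factor_def
proof (intro allI impI)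
  fix c assume "c dvd hz n P \<and> c dvd hz n Q \<and> c dvd r"
  then have d: "c dvd hz n P" "c dvd hz n Q" by auto
  have dPQ: "degree P \<le> n" "degree Q \<le> n" by (simp_all add: n)
  have c0: "c \<noteq> 0" using d(1) dh_hz[OF dPQ(1)] nz by auto
  have "degree c = 0"
  proof (rule ccontr)
    assume dc: "degree c \<noteq> 0"
    have "lead_coeff c * [:0,1:] \<noteq> 0" using c0 by auto
    then obtain s where "poly (lead_coeff c * [:0,1:]) s \<noteq> 0" using poly_all_0_iff_0 by blast
    then have s: "s \<noteq> 0" "poly (lead_coeff c) s \<noteq> 0" by auto
    define cs where "cs = map_poly (\<lambda>k. poly k s) c"
    have pe: "poly cs t = ev c s t" for t
      unfolding cs_def by (induction c) (auto simp: map_poly_pCons ev_pCons)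
    have "coeff cs (degree c) \<noteq> 0" using s by (simp add: cs_def coeff_map_poly)
    then have "degree cs \<noteq> 0" using dc le_degree by fastforce
    then obtain t where "poly cs t = 0" using alg_closed_imp_poly_has_root[of cs] by auto
    then have "ev (hz n P) s t = 0" "ev (hz n Q) s t = 0" using d pe by (auto simp: dvd_def)
    then have "poly P (t/s) = 0" "poly Q (t/s) = 0" using ev_hz_poly dPQ s by auto
    then show False using coprime_poly_0[OF cp] by blast
  qed
  then obtain c1 where c1: "c = [:c1:]" by (rule degree_eq_zeroE)
  have "coeff P n \<noteq> 0 \<or> coeff Q n \<noteq> 0"
  proof (cases "degree P = n")
    case True then show ?thesis using nz by auto
  next
    case False
    then have "degree Q = n" "n > 0" using n by (auto simp: max_def split: if_splits)
    then show ?thesis by auto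
  qed
  then obtain X where X: "X = P \<or> X = Q" "coeff X n \<noteq> 0" by blast
  have "[:c1:] dvd hz n X" using d X c1 by auto
  then have "c1 dvd coeff (hz n X) n" by (simp add: const_poly_dvd_iff)
  also have "coeff (hz n X) n = [:coeff X n:]"
    using homog_coeff[OF homog_hz, of n X n] dh_hz[of X n] dPQ X by (auto simp: monom_0)
  also have "[:coeff X n:] dvd 1" using X(2) by (simp add: is_unit_const_poly_iff dvd_field_iff)
  finally have "c1 dvd 1" .
  then show "c dvd 1" unfolding c1 by (simp add: is_unit_const_poly_iff)
qed

lemma normalized_subset: "t \<in> normalized v \<Longrightarrow> t \<in> v" by (auto simp: normalized_def)

text \<open>
  A representative without common factor dehomogenises to reduced coordinates without loss
  of degree.
\<close>

theorem normalized_fin: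
  assumes l: "multiplier v a" and t: "(p, q, r) \<in> normalized v"
  shows "coprime (dh p) (dh q)" "Deg a = max (degree (dh p)) (degree (dh q))" "Deg a \<ge> 1"
    "homog (Deg a) p" "homog (Deg a) q" "homog (Deg a - 1) r"
proof -
  note tt = Lam_all[OF l normalized_subset[OF t]]
  have ncf: "no_common_factor p q r" using t by (auto simp: normalized_def)
  obtain n where n: "homog (Suc n) p" "homog (Suc n) q" "homog n r" and oc: "on_curve (dh p) (dh q) (dh r)"
    using triples_fin[OF tt(1,2)] .
  note c = normalised_coprime[OF n oc ncf]
  show "coprime (dh p) (dh q)" by (rule c(1))
  show D: "Deg a = max (degree (dh p)) (degree (dh q))" by (rule Deg_eq[OF tt(3) c(1)])
  then have "Deg a = Suc n" using c(2) by simp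
  then show "Deg a \<ge> 1" "homog (Deg a) p" "homog (Deg a) q" "homog (Deg a - 1) r" using n by auto
qed

lemma mk_triple:
  assumes "on_curve P Q R" and n: "Suc n = max (degree P) (degree Q)"
  shows "(hz (Suc n) P, hz (Suc n) Q, hz n R) \<in> triples" "dh (hz (Suc n) P) = P" "dh (hz (Suc n) Q) = Q" "dh (hz n R) = R"
proof -
  have d: "degree P \<le> Suc n" "degree Q \<le> Suc n" "degree R \<le> n" using on_curve_degree[OF assms(1)] n by auto
  show e: "dh (hz (Suc n) P) = P" "dh (hz (Suc n) Q) = Q" "dh (hz n R) = R" by (simp_all add: dh_hz d)
  show "(hz (Suc n) P, hz (Suc n) Q, hz n R) \<in> triples" by (rule triplesI(1)[OF homog_hz homog_hz homog_hz]) (simp only: e assms(1))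
qed

lemma on_curve_Suc: assumes "on_curve P Q R" obtains n where "Suc n = max (degree P) (degree Q)"
  using on_curve_degree[OF assms] by (metis Suc_eq_plus1 Suc_le_D)

lemma Lam_realise: assumes "sol a P Q R" shows "\<exists>v. multiplier v a"
proof -
  have oc: "on_curve P Q R" using assms by (simp add: sol_def)
  obtain n where n: "Suc n = max (degree P) (degree Q)" using on_curve_Suc[OF oc] .
  note m = mk_triple[OF oc n]
  have "multiplier (pt (hz (Suc n) P) (hz (Suc n) Q) (hz n R)) a" by (rule LamI[OF m(1)]) (simp add: m assms)
  then show ?thesis by blast
qed

lemma Lam_surj: "a \<in> Eis \<Longrightarrow> a \<noteq> 0 \<Longrightarrow> \<exists>v. multiplier v a"
  using sol_exists Lam_realise by metis

lemma normalized_inf: "(p, q, r) \<in> normalized (at_inf j) \<Longrightarrow> \<exists>c. c \<noteq> 0 \<and> p = cst c \<and> q = cst (-(\<omega>^j)) * cst c \<and> r = 0"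
proof -
  assume t: "(p, q, r) \<in> normalized (at_inf j)"
  then have m: "r = 0" "q = cst (-(\<omega>^j)) * p" using inf_members[OF normalized_subset[OF t]] by auto
  have "p dvd 1" using t m by (auto simp: normalized_def no_common_factor_def)
  then obtain c where "c \<noteq> 0" "p = cst c" using unit_bipoly by blast
  then show ?thesis using m by blast
qed

lemma normalized_nonempty: "v \<in> solutions \<Longrightarrow> \<exists>p q r. (p, q, r) \<in> normalized v"
proof (erule solution_cases)
  fix j assume v: "v = at_inf j"
  have "(1, cst (-(\<omega>^j)), 0) \<in> at_inf j" unfolding at_inf_def by (rule mem_pt_self[OF inf_triple])
  then have "(1, cst (-(\<omega>^j)), 0) \<in> normalized v" by (auto simp: normalized_def no_common_factor_def v)
  then show ?thesis by blast
next
  fix a assume l: "multiplier v a"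
  obtain p q r where t: "(p, q, r) \<in> v" using solution_nonempty[OF Lam_solution[OF l]] by blast
  note tt = Lam_all[OF l t]
  obtain g P Q R where g: "g \<noteq> 0" "dh p = g*P" "dh q = g*Q" "dh r = g*R" and cp: "coprime P Q" and s: "sol a P Q R"
    using sol_normalise[OF tt(3)] .
  have oc: "on_curve P Q R" using s by (simp add: sol_def)
  obtain n where n: "Suc n = max (degree P) (degree Q)" using on_curve_Suc[OF oc] .
  note m = mk_triple[OF oc n]
  have "((p, q, r), (hz (Suc n) P, hz (Suc n) Q, hz n R)) \<in> proj_eq"
    using m on_curve_nz[OF oc] by (subst proj_eq_fin_iff[OF tt(1) m(1) tt(2)]) (auto simp: g)
  then have "(hz (Suc n) P, hz (Suc n) Q, hz n R) \<in> v" by (simp add: tt(4) pt_def)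
  moreover have "no_common_factor (hz (Suc n) P) (hz (Suc n) Q) (hz n R)" by (rule hz_no_common_factor[OF cp n on_curve_nz(1)[OF oc]])
  ultimately show ?thesis by (auto simp: normalized_def)
qed

theorem sol_degree_Lam: assumes l: "multiplier v a" shows "sol_degree v = Deg a"
  unfolding sol_degree_def
proof (rule the_equality)
  obtain p q r where t: "(p, q, r) \<in> normalized v" using normalized_nonempty[OF Lam_solution[OF l]] by blast
  show "\<exists>(p, q, r)\<in>normalized v. homog (Deg a) p \<and> homog (Deg a) q"
    using t normalized_fin[OF l t] by blast
  fix n assume "\<exists>(p, q, r)\<in>normalized v. homog n p \<and> homog n q"
  then obtain p q r where t: "(p, q, r) \<in> normalized v" "homog n p" by blast
  have "p \<noteq> 0" using on_curve_nz(1) Lam_all(3)[OF l normalized_subset[OF t(1)]] by (force simp: sol_def)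
  then show "n = Deg a" using homog_degree_unique t(2) normalized_fin(4)[OF l t(1)] by blast
qed

lemma sol_degree_inf: "sol_degree (at_inf j) = 0"
  unfolding sol_degree_def
proof (rule the_equality)
  obtain p q r where t: "(p, q, r) \<in> normalized (at_inf j)" using normalized_nonempty[OF inf_solution] by blast
  show "\<exists>(p, q, r)\<in>normalized (at_inf j). homog 0 p \<and> homog 0 q"
    using t normalized_inf[OF t] homog_cst homog_cst_mult by blast
  fix n assume "\<exists>(p, q, r)\<in>normalized (at_inf j). homog n p \<and> homog n q"
  then obtain p q r where t: "(p, q, r) \<in> normalized (at_inf j)" "homog n p" by blast
  then obtain c where "c \<noteq> 0" "p = cst c" using normalized_inf[OF t(1)] by blast
  then show "n = 0" using homog_degree_unique[OF t(2), of 0] by (simp add: cst_hom)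
qed

lemma normalized_unique:
  assumes v: "v \<in> solutions" and t: "(p, q, r) \<in> normalized v" "(p', q', r') \<in> normalized v"
  obtains k where "k \<noteq> 0" "p' = cst k * p" "q' = cst k * q" "r' = cst k * r"
  using v
proof (rule solution_cases)
  fix j assume v: "v = at_inf j"
  obtain c where c: "c \<noteq> 0" "p = cst c" "q = cst (-(\<omega>^j)) * cst c" "r = 0" using normalized_inf t v by blast
  obtain c' where c': "c' \<noteq> 0" "p' = cst c'" "q' = cst (-(\<omega>^j)) * cst c'" "r' = 0" using normalized_inf t v by blast
  have "cst c' = cst (c'/c) * cst c" using c(1) by (simp flip: cst_hom(1))
  then show thesis using c c' by (intro that[of "c'/c"]) (auto simp: mult.left_commute)
next
  fix a assume l: "multiplier v a"
  note n = normalized_fin[OF l t(1)] and n' = normalized_fin[OF l t(2)]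
  note tt = Lam_all[OF l normalized_subset[OF t(1)]] and tt' = Lam_all[OF l normalized_subset[OF t(2)]]
  have "((p, q, r), (p', q', r')) \<in> proj_eq" using class_members[OF v] t normalized_subset by blast
  then have e: "dh p * dh r' = dh p' * dh r" "dh q * dh r' = dh q' * dh r" using proj_eq_fin_iff[OF tt(1) tt'(1) tt(2)] by auto
  have oc: "on_curve (dh p) (dh q) (dh r)" "on_curve (dh p') (dh q') (dh r')" using tt(3) tt'(3) by (auto simp: sol_def)
  obtain k where k: "k \<noteq> 0" "dh p' = K k * dh p" "dh q' = K k * dh q" "dh r' = K k * dh r"
    using coprime_proportional[OF oc n(1) n'(1) e] .
  have "p' = cst k * p" "q' = cst k * q" "r' = cst k * r"
    using homog_eqI[OF n'(4) homog_cst_mult[OF n(4)]] homog_eqI[OF n'(5) homog_cst_mult[OF n(5)]] homog_eqI[OF n'(6) homog_cst_mult[OF n(6)]] k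
    by simp_all
  then show thesis using that k(1) by blast
qed

section \<open>Composition of solutions\<close>

lemma subst_cst: assumes "homog N p" shows "subst (cst k * p) (cst k' * a) (cst k' * b) = cst (k * k'^N) * subst p a b"
proof (rule ev_eqI)
  fix s t
  have e: "ev p (c * x) (c * y) = c^N * ev p x y" for c x y
  proof -
    have "ev p (c * x) (c * y) = ev (hz N (dh p)) (c * x) (c * y)" using assms by (simp add: hz_dh)
    also have "\<dots> = (\<Sum>j\<le>N. c^N * (coeff (dh p) j * x^(N-j) * y^j))"
      unfolding ev_hz
    proof (intro sum.cong refl)
      fix j assume "j \<in> {..N}"
      then have "c^N = c^(N-j) * c^j" by (simp flip: power_add)
      then show "coeff (dh p) j * (c*x)^(N-j) * (c*y)^j = c^N * (coeff (dh p) j * x^(N-j) * y^j)"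
        by (simp add: power_mult_distrib mult_ac)
    qed
    also have "\<dots> = c^N * ev (hz N (dh p)) x y" by (simp add: ev_hz sum_distrib_left)
    finally show ?thesis using assms by (simp add: hz_dh)
  qed
  show "ev (subst (cst k * p) (cst k' * a) (cst k' * b)) s t = ev (cst (k * k'^N) * subst p a b) s t"
    by (simp add: e)
qed

lemma normalized_homog:
  assumes v: "v \<in> solutions" and t: "(p, q, r) \<in> normalized v"
  obtains N where "homog N p" "homog N q" "r = 0 \<or> (N \<ge> 1 \<and> homog (N-1) r)"
  using v
proof (rule solution_cases)
  fix j assume "v = at_inf j"
  then obtain c where "p = cst c" "q = cst (-(\<omega>^j)) * cst c" "r = 0" using normalized_inf t by blast
  then show thesis using that[of 0] by (simp add: homog_cst_mult)
next
  fix a assume "multiplier v a"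
  from normalized_fin[OF this t] show thesis using that by blast
qed

lemma sol_comp_rep:
  assumes v: "v \<in> solutions" "v' \<in> solutions" and t: "(p, q, r) \<in> normalized v" "(p', q', r') \<in> normalized v'"
    and tr: "(subst p p' q', subst q p' q', r' * subst r p' q') \<in> triples"
  shows "sol_comp v v' = pt (subst p p' q') (subst q p' q') (r' * subst r p' q')"
proof -
  let ?f = "\<lambda>(p, q, r). \<lambda>(p', q', r'). pt (subst p p' q') (subst q p' q') (r' * subst r p' q')"
  obtain N where N: "homog N p" "homog N q" "r = 0 \<or> (N \<ge> 1 \<and> homog (N-1) r)" using normalized_homog[OF v(1) t(1)] .
  have e: "?f u u' = ?f (p,q,r) (p',q',r')" if "u \<in> normalized v" "u' \<in> normalized v'" for u u'
  proof -
    obtain p1 q1 r1 p2 q2 r2 where u: "u = (p1,q1,r1)" "u' = (p2,q2,r2)" by (metis surj_pair)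
    have m: "(p1,q1,r1) \<in> normalized v" "(p2,q2,r2) \<in> normalized v'" using that by (simp_all add: u)
    obtain k where k: "k \<noteq> 0" "p1 = cst k * p" "q1 = cst k * q" "r1 = cst k * r" using normalized_unique[OF v(1) t(1) m(1)] .
    obtain k' where k': "k' \<noteq> 0" "p2 = cst k' * p'" "q2 = cst k' * q'" "r2 = cst k' * r'" using normalized_unique[OF v(2) t(2) m(2)] .
    let ?c = "k * k'^N"
    have c: "?c \<noteq> 0" using k k' by simp
    have "subst p1 p2 q2 = cst ?c * subst p p' q'" "subst q1 p2 q2 = cst ?c * subst q p' q'"
      unfolding k k' by (rule subst_cst[OF N(1)], rule subst_cst[OF N(2)])
    moreover have "r2 * subst r1 p2 q2 = cst ?c * (r' * subst r p' q')"
    proof (cases "r = 0")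
      case True
      have "subst 0 x y = 0" for x y by (rule ev_eqI) simp
      then show ?thesis by (simp add: True k)
    next
      case False
      then have N1: "N \<ge> 1" "homog (N-1) r" using N(3) by auto
      have "r2 * subst r1 p2 q2 = cst (k' * (k * k'^(N-1))) * (r' * subst r p' q')"
        unfolding k k' subst_cst[OF N1(2)] by (simp add: cst_hom mult_ac)
      also have "k' * (k * k'^(N-1)) = ?c" using N1(1) by (cases N) auto
      finally show ?thesis .
    qed
    ultimately show ?thesis using pt_scale(2)[OF tr c] by (simp add: u)
  qed
  have "sol_comp v v' = (\<Union>u\<in>normalized v. \<Union>u'\<in>normalized v'. ?f u u')"
    unfolding sol_comp_def by (intro SUP_cong refl) auto
  also have "\<dots> = (\<Union>u\<in>normalized v. ?f (p,q,r) (p',q',r'))"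
  proof (rule SUP_cong[OF refl])
    fix u assume u: "u \<in> normalized v"
    show "(\<Union>u'\<in>normalized v'. ?f u u') = ?f (p,q,r) (p',q',r')"
      by (subst union_of_equal[OF t(2), of "?f u"]) (simp_all only: e[OF u] e[OF u t(2)])
  qed
  also have "\<dots> = ?f (p,q,r) (p',q',r')" using t(1) by blast
  finally show ?thesis by simp
qed

lemma compose_triple:
  assumes h: "homog (Suc n) p" "homog (Suc n) q" "homog n r" and s: "sol a (dh p) (dh q) (dh r)"
    and h': "homog (Suc m) p'" "homog (Suc m) q'" "homog m r'" and s': "sol b (dh p') (dh q') (dh r')"
  shows "(subst p p' q', subst q p' q', r' * subst r p' q') \<in> triples"
    "sol (a*b) (dh (subst p p' q')) (dh (subst q p' q')) (dh (r' * subst r p' q'))"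
proof -
  have d: "dh (subst p p' q') = hev (Suc n) (dh p) (dh p') (dh q')" "dh (subst q p' q') = hev (Suc n) (dh q) (dh p') (dh q')"
    "dh (r' * subst r p' q') = dh r' * hev n (dh r) (dh p') (dh q')"
    using dh_subst[OF h(1)] dh_subst[OF h(2)] dh_subst[OF h(3)] by simp_all
  show so: "sol (a*b) (dh (subst p p' q')) (dh (subst q p' q')) (dh (r' * subst r p' q'))"
    unfolding d by (rule sol_compose[OF s s' degree_dh[OF h(1)] degree_dh[OF h(2)] degree_dh[OF h(3)]])
  have 1: "homog (Suc (m + n + m*n)) (subst p p' q')" "homog (Suc (m + n + m*n)) (subst q p' q')"
    using homog_subst[OF h(1) h'(1,2)] homog_subst[OF h(2) h'(1,2)] by (simp_all add: algebra_simps)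
  have 2: "homog (m + n + m*n) (r' * subst r p' q')"
    using homog_mult[OF h'(3) homog_subst[OF h(3) h'(1,2)]] by (simp add: algebra_simps)
  show "(subst p p' q', subst q p' q', r' * subst r p' q') \<in> triples"
    by (rule triplesI(1)[OF 1 2]) (use so in \<open>simp add: sol_def\<close>)
qed

text \<open>
  \<open>sol_compose\<close>, read on classes.
\<close>

theorem Lam_comp:
  assumes l: "multiplier v a" "multiplier v' b" shows "multiplier (sol_comp v v') (a*b)"
proof -
  note v = Lam_solution[OF l(1)] Lam_solution[OF l(2)]
  obtain p q r where t: "(p, q, r) \<in> normalized v" using normalized_nonempty v by blast
  obtain p' q' r' where t': "(p', q', r') \<in> normalized v'" using normalized_nonempty v by blast
  note tt = Lam_all[OF l(1) normalized_subset[OF t]] and tt' = Lam_all[OF l(2) normalized_subset[OF t']]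
  obtain n where n: "homog (Suc n) p" "homog (Suc n) q" "homog n r" using triples_fin[OF tt(1,2)] by metis
  obtain m where m: "homog (Suc m) p'" "homog (Suc m) q'" "homog m r'" using triples_fin[OF tt'(1,2)] by metis
  note c = compose_triple[OF n tt(3) m tt'(3)]
  show ?thesis unfolding sol_comp_rep[OF v t t' c(1)] by (rule LamI[OF c])
qed

lemma comp_inf_left: assumes v': "v' \<in> solutions" shows "sol_comp (at_inf j) v' = at_inf j"
proof -
  obtain p q r where t: "(p, q, r) \<in> normalized (at_inf j)" using normalized_nonempty inf_solution by blast
  then obtain c where c: "c \<noteq> 0" "p = cst c" "q = cst (-(\<omega>^j)) * cst c" "r = 0" using normalized_inf by blast
  obtain p' q' r' where t': "(p', q', r') \<in> normalized v'" using normalized_nonempty v' by blast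
  have s: "subst (cst x) y z = cst x" "subst (cst w * cst x) y z = cst w * cst x" "subst 0 y z = 0" for w x y z by (rule ev_eqI; simp)+
  have c0: "cst c \<noteq> 0" using c by (simp add: cst_hom)
  have tr: "(cst c, cst (-(\<omega>^j)) * cst c, 0) \<in> triples" by (rule triples_infI[OF homog_cst c0])
  have "sol_comp (at_inf j) v' = pt (subst p p' q') (subst q p' q') (r' * subst r p' q')"
    by (rule sol_comp_rep[OF inf_solution v' t t']) (use tr in \<open>simp only: c s mult_zero_right\<close>)
  also have "\<dots> = at_inf j" using pt_inf[OF homog_cst c0] by (simp only: c s mult_zero_right)
  finally show ?thesis .
qed

text \<open>
  At \<open>p' = 1\<close>, \<open>q' = -\<omega>\<^sup>j\<close> the cubic form
  \<open>x\<^sup>3 + y\<^sup>3\<close> vanishes, so the composition is again at infinity;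
  its coordinates are not both zero because the representative of \<open>v\<close> is
  normalised.
\<close>

lemma comp_inf_right: assumes l: "multiplier v a" shows "\<exists>k. sol_comp v (at_inf j) = at_inf k"
proof -
  note v = Lam_solution[OF l]
  obtain p q r where t: "(p, q, r) \<in> normalized v" using normalized_nonempty v by blast
  note tt = Lam_all[OF l normalized_subset[OF t]] and nn = normalized_fin[OF l t]
  obtain p' q' r' where t': "(p', q', r') \<in> normalized (at_inf j)" using normalized_nonempty inf_solution by blast
  then obtain c where c0: "c \<noteq> 0" "p' = cst c" "q' = cst (-(\<omega>^j)) * cst c" "r' = 0" using normalized_inf by blast
  define d where "d = -(\<omega>^j) * c"
  have c: "c \<noteq> 0" "p' = cst c" "q' = cst d" "r' = 0" using c0 by (simp_all only: d_def cst_hom(1) not_False_eq_True)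
  have s: "subst x (cst c) (cst d) = cst (ev x c d)" for x by (rule ev_eqI) simp
  have d3: "d^3 = - (c^3)" using omega_power_3[of j] by (simp add: d_def power_mult_distrib)
  have "ev (p^3 + q^3) c d = ev ((vx^3+vy^3) * r^3) c d" using tt(1) by (simp add: triples_def)
  then have z: "ev p c d^3 + ev q c d^3 = 0" using d3 by simp
  have nz: "ev p c d \<noteq> 0 \<or> ev q c d \<noteq> 0"
  proof (rule ccontr)
    assume "\<not> ?thesis"
    moreover have "ev p c d = c^Deg a * poly (dh p) (d/c)" "ev q c d = c^Deg a * poly (dh q) (d/c)"
      using ev_hz_poly[OF degree_dh[OF nn(4)] c(1), of d] ev_hz_poly[OF degree_dh[OF nn(5)] c(1), of d] hz_dh[OF nn(4)] hz_dh[OF nn(5)] by simp_all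
    ultimately have "poly (dh p) (d/c) = 0" "poly (dh q) (d/c) = 0" using c by auto
    then show False using coprime_poly_0[OF nn(1)] by blast
  qed
  have "cst (ev p c d)^3 + cst (ev q c d)^3 = 0" using z by (simp flip: cst_hom(6,4) add: cst_hom(3))
  then have tr: "(cst (ev p c d), cst (ev q c d), 0) \<in> triples" using nz form_homog[OF homog_0] by (auto simp: triples_def cst_hom(7))
  have "sol_comp v (at_inf j) = pt (subst p p' q') (subst q p' q') (r' * subst r p' q')"
    by (rule sol_comp_rep[OF v inf_solution t t']) (use tr in \<open>simp only: c(2-4) s mult_zero_left\<close>)
  also have "\<dots> = pt (cst (ev p c d)) (cst (ev q c d)) 0" by (simp only: c(2-4) s mult_zero_left)
  also have "\<exists>k. \<dots> = at_inf k" using triples_inf[OF tr] pt_inf by metis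
  finally show ?thesis .
qed

text \<open>
  For finite solutions both compositions have multiplier \<open>a b\<close>. If one factor
  is at infinity, both compositions are, and the solutions at infinity are affiliates of
  each other.
\<close>

theorem comp_commute:
  assumes v: "v \<in> solutions" "v' \<in> solutions" shows "sol_comp v' v \<in> affiliates (sol_comp v v')"
  using v(1)
proof (rule solution_cases)
  fix j assume j: "v = at_inf j"
  show ?thesis using v(2)
  proof (rule solution_cases)
    fix b assume "multiplier v' b"
    then obtain k where "sol_comp v' v = at_inf k" using comp_inf_right j by blast
    then show ?thesis using comp_inf_left[OF v(2)] affiliates_inf j by simp
  next
    fix k assume "v' = at_inf k"
    then show ?thesis using comp_inf_left[OF v(2)] comp_inf_left[OF v(1)] affiliates_inf j by simp
  qed
next
  fix a assume l: "multiplier v a"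
  show ?thesis using v(2)
  proof (rule solution_cases)
    fix j assume j: "v' = at_inf j"
    then obtain k where "sol_comp v v' = at_inf k" using comp_inf_right l by blast
    then show ?thesis using comp_inf_left[OF v(1)] affiliates_inf j by simp
  next
    fix b assume l': "multiplier v' b"
    have 1: "multiplier (sol_comp v' v) (\<omega>^0 * (a*b))" using Lam_comp[OF l' l] by (simp add: mult.commute)
    show ?thesis unfolding affiliates_eq_unit_class[OF Lam_comp[OF l l']] unit_class_def using 1 by blast
  qed
qed

section \<open>Symmetry and coefficients\<close>

text \<open>
  \<open>(f(y, x), g(y, x))\<close> is the composition with \<open>(y, x)\<close>, whose
  multiplier is \<open>-1\<close>, just as \<open>(g, f)\<close> has the negative of the
  multiplier of \<open>(f, g)\<close>. So the two differ by a twist, and cubes are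
  insensitive to twists.
\<close>

theorem swap_variables:
  assumes v: "v \<in> solutions" and t: "(p, q, r) \<in> normalized v" and r: "r \<noteq> 0"
  shows "(Fract q r) ^ 3 = (Fract (subst p vy vx) (subst r vy vx)) ^ 3"
proof -
  obtain a where l: "multiplier v a" using Lam_exists[OF v normalized_subset[OF t] r] by blast
  note tt = Lam_all[OF l normalized_subset[OF t]]
  obtain n where n: "homog (Suc n) p" "homog (Suc n) q" "homog n r" using triples_fin[OF tt(1,2)] by metis
  have sX: "sol (-1) (dh vy) (dh vx) (dh 1)" using sol_swap[OF sol_id] by simp
  have h: "homog (Suc 0) vy" "homog (Suc 0) vx" "homog 0 1" by auto
  note c = compose_triple[OF n tt(3) h sX]
  have r': "subst r vy vx \<noteq> 0" using sol_dh_nz[OF c(2)] by simp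
  have c2: "sol (-a) (dh (subst p vy vx)) (dh (subst q vy vx)) (dh (subst r vy vx))" using c(2) by simp
  obtain j where "dh (subst p vy vx) * dh r = K (\<omega>^j) * (dh q * dh (subst r vy vx))"
    using sol_unique[OF sol_swap[OF tt(3)] c2] by metis
  then have "(dh (subst p vy vx) * dh r)^3 = (dh q * dh (subst r vy vx))^3"
    by (simp only: power_mult_distrib K_hom(5)[symmetric] omega_power_3 K_simps mult_1)
  then have e: "dh (q^3 * subst r vy vx^3) = dh (subst p vy vx^3 * r^3)" by (simp add: power_mult_distrib)
  have sp: "homog (Suc n) (subst p vy vx)" "homog n (subst r vy vx)"
    using homog_subst[OF n(1) h(1,2)] homog_subst[OF n(3) h(1,2)] by simp_all
  have hs: "homog (Suc n * 3 + n * 3) (subst p vy vx^3 * r^3)" "homog (Suc n * 3 + n * 3) (q^3 * subst r vy vx^3)"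
    by (rule homog_mult[OF homog_power[OF sp(1)] homog_power[OF n(3)]], rule homog_mult[OF homog_power[OF n(2)] homog_power[OF sp(2)]])
  have "q^3 * subst r vy vx^3 = subst p vy vx^3 * r^3" by (rule homog_eqI[OF hs(2,1) e])
  then have "Fract (q^3) (r^3) = Fract (subst p vy vx^3) (subst r vy vx^3)" using tt(2) r' by (simp add: eq_fract)
  moreover have "Fract x y ^ 3 = Fract (x^3) (y^3)" for x y :: bipoly by (simp add: power3_eq_cube)
  ultimately show ?thesis by simp
qed

lemma bicoeff_hz: "degree P \<le> n \<Longrightarrow> bicoeff (hz n P) i j = (if i + j = n then coeff P j else 0)"
  using homog_bicoeff[OF homog_hz] dh_hz by metis

lemma rat_representative:
  assumes l: "multiplier v a"
  obtains P Q R where "sol a P Q R" "rat_poly P" "rat_poly Q" "rat_poly R"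
  using realised_Eis Lam_Eis[OF l] unfolding realised_def by blast

text \<open>
  By \<open>realised_Eis\<close> some solution with the same multiplier has coefficients
  in \<open>\<rat>[\<omega>]\<close>; the given one is a twist of it.
\<close>

theorem coefficients_Q_omega:
  assumes v: "v \<in> solutions" and t: "(p, q, r) \<in> normalized v" and r: "r \<noteq> 0"
  shows "Fract p r \<in> Q_omega_ratfuns" "Fract q r \<in> Q_omega_ratfuns"
proof -
  obtain a where l: "multiplier v a" using Lam_exists[OF v normalized_subset[OF t] r] by blast
  have main: "Fract x z \<in> Q_omega_ratfuns" if s: "sol b P Q R" "rat_poly P" "rat_poly R"
     and h: "homog (Suc n) x" "homog n z" "z \<noteq> 0" and s': "sol b (dh x) (dh y) (dh z)" for b P Q R x y z n
  proof -
    have oc: "on_curve P Q R" using s by (simp add: sol_def)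
    obtain m where m: "Suc m = max (degree P) (degree Q)" using on_curve_Suc[OF oc] .
    have d: "degree P \<le> Suc m" "degree R \<le> m" using on_curve_degree[OF oc] m by auto
    obtain j where j: "dh x * R = K (\<omega>^j) * (P * dh z)" using sol_unique[OF s(1) s'] by metis
    let ?P = "K (\<omega>^j) * P"
    have dP: "degree ?P \<le> Suc m" using d by (simp add: degree_K_mult)
    have "x * hz m R = hz (Suc m) ?P * z"
    proof (rule homog_eqI)
      show "homog (Suc n + m) (x * hz m R)" using h homog_hz by (intro homog_mult)
      have "homog (Suc m + n) (hz (Suc m) ?P * z)" using h homog_hz by (intro homog_mult)
      then show "homog (Suc n + m) (hz (Suc m) ?P * z)" by (simp add: add.commute)
      show "dh (x * hz m R) = dh (hz (Suc m) ?P * z)" using j d dP by (simp add: dh_hz mult.assoc)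
    qed
    moreover have Rz: "hz m R \<noteq> 0" using dh_hz[OF d(2)] on_curve_nz(3)[OF oc] by auto
    ultimately have "Fract x z = Fract (hz (Suc m) ?P) (hz m R)" using h(3) by (simp add: eq_fract)
    moreover have "rat_poly ?P" using s by (intro rat_poly_intros) (auto intro: Q_omega_power)
    then have "bicoeff (hz (Suc m) ?P) i j \<in> Q_omega" "bicoeff (hz m R) i j \<in> Q_omega" for i j
      using s d dP by (auto simp: bicoeff_hz rat_poly_def)
    ultimately show ?thesis using Rz unfolding Q_omega_ratfuns_def by blast
  qed
  note tt = Lam_all[OF l normalized_subset[OF t]]
  obtain n where n: "homog (Suc n) p" "homog (Suc n) q" "homog n r" using triples_fin[OF tt(1,2)] by metis
  obtain P Q R where s: "sol a P Q R" "rat_poly P" "rat_poly Q" "rat_poly R" using rat_representative[OF l] .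
  show "Fract p r \<in> Q_omega_ratfuns" by (rule main[OF s(1,2,4) n(1,3) tt(2,3)])
  show "Fract q r \<in> Q_omega_ratfuns" by (rule main[OF sol_swap[OF s(1)] s(3,4) n(2,3) tt(2) sol_swap[OF tt(3)]])
qed

section \<open>Degrees modulo 3\<close>

lemma Lam_v3: "multiplier v3 theta"
  and v3_member: "(cst (inverse \<zeta>) * vx ^ 3 + cst \<zeta> * vy ^ 3, cst \<zeta> * vx ^ 3 + cst (inverse \<zeta>) * vy ^ 3, cst (of_real (sqrt 3)) * vx * vy) \<in> v3"
proof -
  have 1: "homog (Suc 2) (cst x * vx^3 + cst y * vy^3)" for x y
    using homog_power[OF homog_vars(1), of 3] homog_power[OF homog_vars(2), of 3] by (intro homog_add homog_cst_mult) (simp_all add: numeral_eq_Suc)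
  have 2: "homog 2 (cst x * vx * vy)" for x
    using homog_mult[OF homog_cst_mult[OF homog_vars(1), of x] homog_vars(2)] by (simp add: numeral_2_eq_2)
  have s: "sol theta (dh (cst (inverse \<zeta>) * vx ^ 3 + cst \<zeta> * vy ^ 3)) (dh (cst \<zeta> * vx ^ 3 + cst (inverse \<zeta>) * vy ^ 3)) (dh (cst (of_real (sqrt 3)) * vx * vy))"
    using sol_theta[OF sol_id] by simp
  have tr: "(cst (inverse \<zeta>) * vx ^ 3 + cst \<zeta> * vy ^ 3, cst \<zeta> * vx ^ 3 + cst (inverse \<zeta>) * vy ^ 3, cst (of_real (sqrt 3)) * vx * vy) \<in> triples"
    by (rule triplesI(1)[OF 1 1 2]) (use s in \<open>simp add: sol_def\<close>)
  show "multiplier v3 theta" unfolding v3_def by (rule LamI[OF tr s])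
  show "(cst (inverse \<zeta>) * vx ^ 3 + cst \<zeta> * vy ^ 3, cst \<zeta> * vx ^ 3 + cst (inverse \<zeta>) * vy ^ 3, cst (of_real (sqrt 3)) * vx * vy) \<in> v3"
    unfolding v3_def by (rule mem_pt_self[OF tr])
qed

lemma Deg_eis: "int (Deg (of_int x + of_int y * \<omega>)) = norm_form x y"
  using Deg_norm by (simp add: norm_form_def)

text \<open>
  As \<open>norm_form x y = (x + y)\<^sup>2 - 3 x y\<close>, the norm is divisible by
  \<open>3\<close> only if \<open>x + y\<close> is; the quotient by \<open>\<theta> = -1 -
  2 \<omega>\<close> is then explicit.
\<close>

lemma theta_divides:
  assumes a: "a \<in> Eis" and d: "Deg a mod 3 = 0"
  obtains b where "b \<in> Eis" "a = b * theta"
proof -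
  obtain x y where xy: "a = of_int x + of_int y * \<omega>" using a by (auto simp: Eis_def)
  have "3 dvd norm_form x y" using d Deg_eis[of x y] unfolding xy by presburger
  moreover have "norm_form x y = (x+y)^2 - 3 * (x*y)" by (simp add: norm_form_def algebra_simps power2_eq_square)
  ultimately have "3 dvd (x+y)^2" by (metis dvd_diff_commute dvd_triv_left diff_add_cancel dvd_add)
  then have "3 dvd x + y" using prime_dvd_power[of "3::int" "x+y" 2] by simp
  then obtain k where k: "x = 3*k - y" by (metis add_diff_cancel_right' dvd_def)
  define b where "b = of_int (k-y) + of_int (2*k-y) * \<omega>"
  have th: "theta = -1 - 2 * \<omega>" unfolding theta_eq(1) omega_square by simp
  have "b * theta = - of_int (k-y) - (2 * of_int (k-y) + of_int (2*k-y)) * \<omega> - 2 * of_int (2*k-y) * \<omega>^2"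
    unfolding th b_def by (simp add: algebra_simps power2_eq_square)
  also have "\<dots> = a" unfolding omega_square xy k by (simp add: algebra_simps)
  finally have "a = b * theta" by simp
  moreover have "b \<in> Eis" unfolding b_def by (rule EisI)
  ultimately show thesis using that by blast
qed

text \<open>
  If the multiplier is \<open>\<alpha> = \<beta> \<theta>\<close> then the composition of
  a solution of multiplier \<open>\<beta>\<close> with \<open>v\<^sub>3\<close> has
  multiplier \<open>\<alpha>\<close>. Solutions at infinity are unchanged by composition
  with \<open>v\<^sub>3\<close>.
\<close>

theorem factor_through_v3:
  assumes v: "v \<in> solutions" and d: "int (sol_degree v) = 3 * d'"
  shows "\<exists>w \<in> solutions. int (sol_degree w) = d' \<and> sol_comp w v3 \<in> affiliates v"
  using v
proof (rule solution_cases)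
  fix j assume j: "v = at_inf j"
  have "sol_comp v v3 \<in> affiliates v" using comp_inf_left[OF Lam_solution[OF Lam_v3]] affiliates_inf j by simp
  then show ?thesis using v d sol_degree_inf j by auto
next
  fix a assume l: "multiplier v a"
  have "Deg a mod 3 = 0" using d sol_degree_Lam[OF l] by presburger
  then obtain b where b: "b \<in> Eis" "a = b * theta" by (rule theta_divides[OF conjunct1[OF Lam_Eis[OF l]]])
  then have "b \<noteq> 0" using Lam_Eis[OF l] by auto
  then obtain P Q R where s: "sol b P Q R" using sol_exists b by blast
  obtain w where w: "multiplier w b" using Lam_realise[OF s] by blast
  have "int (sol_degree w) = d'" using Deg_theta[OF s] d by (simp add: sol_degree_Lam[OF l] sol_degree_Lam[OF w] b(2) mult.commute)
  moreover have "multiplier (sol_comp w v3) (\<omega>^0 * a)" using Lam_comp[OF w Lam_v3] b by simp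
  then have "sol_comp w v3 \<in> affiliates v" unfolding affiliates_eq_unit_class[OF l] unit_class_def by blast
  ultimately show ?thesis using Lam_solution[OF w] by blast
qed

lemma pred_mod_3:
  fixes N :: nat
  assumes "N mod 3 = 0" "1 \<le> N" shows "(N - 1) mod 3 = 2" "2 \<le> N - 1"
proof -
  obtain k where k: "N = 3*k" "k \<ge> 1" using assms by auto
  then obtain m where "k = Suc m" by (cases k) auto
  then have "N - 1 = 2 + 3 * m" using k by simp
  then show "(N - 1) mod 3 = 2" "2 \<le> N - 1" by presburger+
qed

text \<open>
  \<open>exponents_mod_3\<close> restricts the exponents of \<open>y\<close>; homogeneity
  transfers the restriction to the exponents of \<open>x\<close>.
\<close>

theorem shape_of_representatives:
  assumes l: "multiplier v a" and t: "(p, q, r) \<in> normalized v"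
  shows "(Deg a mod 3 = 0 \<and> (\<exists>P Q R. form P \<and> form Q \<and> form R \<and> p = subst P (vx^3) (vy^3) \<and> q = subst Q (vx^3) (vy^3) \<and> r = vx * vy * subst R (vx^3) (vy^3)))
     \<or> (Deg a mod 3 = 1 \<and> (\<exists>P Q R. form P \<and> form Q \<and> form R \<and>
         ((p = vx * subst P (vx^3) (vy^3) \<and> q = vy * subst Q (vx^3) (vy^3)) \<or> (q = vx * subst P (vx^3) (vy^3) \<and> p = vy * subst Q (vx^3) (vy^3))) \<and>
         r = subst R (vx^3) (vy^3)))"
    and "\<forall>s\<in>{p,q,r}. \<forall>i j. bicoeff s i j \<noteq> 0 \<longrightarrow> i mod 3 \<noteq> 2 \<and> j mod 3 \<noteq> 2"
proof -
  note nn = normalized_fin[OF l t] and tt = Lam_all[OF l normalized_subset[OF t]]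
  define N where "N = Deg a"
  have N1: "N \<ge> 1" using nn(3) by (simp add: N_def)
  note h = nn(4-6)[folded N_def]
  note ex = exponents_mod_3[OF tt(3) nn(1,2), folded N_def]
  have F: "\<exists>F. form F \<and> x = vx^a * vy^b * subst F (vx^3) (vy^3)"
    if "homog M x" "M mod 3 = (a+b) mod 3" "a+b \<le> M" "\<forall>i. coeff (dh x) i \<noteq> 0 \<longrightarrow> i mod 3 = b" "a < 3" "b < 3" for M x a b
  proof -
    have "3 dvd M - (a+b)" using mod_eq_dvd_iff_nat[OF that(3), of 3] that(2) by simp
    then obtain k where "M - (a+b) = 3 * k" by (auto simp: dvd_def)
    then have "M = a + b + 3 * k" using that(3) by simp
    then show ?thesis using form_in_cubes[OF that(1) _ _ that(5,6)] that(4) by blast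
  qed
  have B: "i mod 3 \<noteq> 2 \<and> j mod 3 \<noteq> 2" if "homog M x" "bicoeff x i j \<noteq> 0" "\<forall>i. coeff (dh x) i \<noteq> 0 \<longrightarrow> i mod 3 = b" "b < 2" "(M + 2*b) mod 3 \<noteq> 2" for M x b i j
  proof -
    have e: "i + j = M" "coeff (dh x) j \<noteq> 0" using homog_bicoeff[OF that(1)] that(2) by (auto split: if_splits)
    then have j: "j mod 3 = b" using that(3) by blast
    obtain k where "j = b + 3 * k" using j by (metis mod_mult_div_eq)
    then have "i + j + 2*b = i + 3 * (b + k)" by simp
    then have "(i + j + 2*b) mod 3 = i mod 3" by (simp only: mod_mult_self2)
    then have "i mod 3 \<noteq> 2" using e(1) that(5) by simp
    then show ?thesis using j that(4) by simp
  qed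
  from ex show "(Deg a mod 3 = 0 \<and> (\<exists>P Q R. form P \<and> form Q \<and> form R \<and> p = subst P (vx^3) (vy^3) \<and> q = subst Q (vx^3) (vy^3) \<and> r = vx * vy * subst R (vx^3) (vy^3)))
     \<or> (Deg a mod 3 = 1 \<and> (\<exists>P Q R. form P \<and> form Q \<and> form R \<and>
         ((p = vx * subst P (vx^3) (vy^3) \<and> q = vy * subst Q (vx^3) (vy^3)) \<or> (q = vx * subst P (vx^3) (vy^3) \<and> p = vy * subst Q (vx^3) (vy^3))) \<and>
         r = subst R (vx^3) (vy^3)))"
  proof (elim disjE)
    assume e: "N mod 3 = 0 \<and> (\<forall>i. coeff (dh p) i \<noteq> 0 \<longrightarrow> i mod 3 = 0) \<and> (\<forall>i. coeff (dh q) i \<noteq> 0 \<longrightarrow> i mod 3 = 0) \<and> (\<forall>i. coeff (dh r) i \<noteq> 0 \<longrightarrow> i mod 3 = 1)"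
    have N0: "N mod 3 = 0" using e by blast
    have N: "(N - 1) mod 3 = (1+1) mod 3" "1+1 \<le> N - 1" using pred_mod_3[OF N0 N1] by simp_all
    obtain P Q R where "form P" "p = subst P (vx^3) (vy^3)" "form Q" "q = subst Q (vx^3) (vy^3)" "form R" "r = vx * vy * subst R (vx^3) (vy^3)"
    proof -
      have "\<exists>F. form F \<and> p = vx^0 * vy^0 * subst F (vx^3) (vy^3)" by (rule F[OF h(1)]) (use e in auto)
      moreover have "\<exists>F. form F \<and> q = vx^0 * vy^0 * subst F (vx^3) (vy^3)" by (rule F[OF h(2)]) (use e in auto)
      moreover have "\<exists>F. form F \<and> r = vx^1 * vy^1 * subst F (vx^3) (vy^3)" by (rule F[OF h(3) N]) (use e in auto)
      ultimately show thesis using that by (simp only: power_0 power_one_right mult_1) blast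
    qed
    then show ?thesis using e[unfolded N_def] by blast
  next
    assume e: "N mod 3 = 1 \<and> (\<forall>i. coeff (dh p) i \<noteq> 0 \<longrightarrow> i mod 3 = 0) \<and> (\<forall>i. coeff (dh q) i \<noteq> 0 \<longrightarrow> i mod 3 = 1) \<and> (\<forall>i. coeff (dh r) i \<noteq> 0 \<longrightarrow> i mod 3 = 0)"
    have N0: "N mod 3 = 1" using e by blast
    have N: "(N - 1) mod 3 = 0" using N0 N1 by presburger
    obtain P Q R where "form P" "p = vx * subst P (vx^3) (vy^3)" "form Q" "q = vy * subst Q (vx^3) (vy^3)" "form R" "r = subst R (vx^3) (vy^3)"
    proof -
      have "\<exists>F. form F \<and> p = vx^1 * vy^0 * subst F (vx^3) (vy^3)" by (rule F[OF h(1)]) (use e N1 in auto)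
      moreover have "\<exists>F. form F \<and> q = vx^0 * vy^1 * subst F (vx^3) (vy^3)" by (rule F[OF h(2)]) (use e N1 in auto)
      moreover have "\<exists>F. form F \<and> r = vx^0 * vy^0 * subst F (vx^3) (vy^3)" by (rule F[OF h(3)]) (use e N in auto)
      ultimately show thesis using that by (simp only: power_0 power_one_right mult_1 mult_1_right) blast
    qed
    then show ?thesis using e[unfolded N_def] by blast
  next
    assume e: "N mod 3 = 1 \<and> (\<forall>i. coeff (dh p) i \<noteq> 0 \<longrightarrow> i mod 3 = 1) \<and> (\<forall>i. coeff (dh q) i \<noteq> 0 \<longrightarrow> i mod 3 = 0) \<and> (\<forall>i. coeff (dh r) i \<noteq> 0 \<longrightarrow> i mod 3 = 0)"
    have N0: "N mod 3 = 1" using e by blast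
    have N: "(N - 1) mod 3 = 0" using N0 N1 by presburger
    obtain P Q R where "form P" "q = vx * subst P (vx^3) (vy^3)" "form Q" "p = vy * subst Q (vx^3) (vy^3)" "form R" "r = subst R (vx^3) (vy^3)"
    proof -
      have "\<exists>F. form F \<and> q = vx^1 * vy^0 * subst F (vx^3) (vy^3)" by (rule F[OF h(2)]) (use e N1 in auto)
      moreover have "\<exists>F. form F \<and> p = vx^0 * vy^1 * subst F (vx^3) (vy^3)" by (rule F[OF h(1)]) (use e N1 in auto)
      moreover have "\<exists>F. form F \<and> r = vx^0 * vy^0 * subst F (vx^3) (vy^3)" by (rule F[OF h(3)]) (use e N in auto)
      ultimately show thesis using that by (simp only: power_0 power_one_right mult_1 mult_1_right) blast
    qed
    then show ?thesis using e[unfolded N_def] by blast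
  qed
  show "\<forall>s\<in>{p,q,r}. \<forall>i j. bicoeff s i j \<noteq> 0 \<longrightarrow> i mod 3 \<noteq> 2 \<and> j mod 3 \<noteq> 2"
  proof (intro ballI allI impI)
    fix s i j assume s: "s \<in> {p,q,r}" "bicoeff s i j \<noteq> 0"
    have m: "(N + 2*0) mod 3 \<noteq> 2 \<Longrightarrow> N mod 3 \<noteq> 2" by simp
    from ex show "i mod 3 \<noteq> 2 \<and> j mod 3 \<noteq> 2"
    proof (elim disjE)
      assume e: "N mod 3 = 0 \<and> (\<forall>i. coeff (dh p) i \<noteq> 0 \<longrightarrow> i mod 3 = 0) \<and> (\<forall>i. coeff (dh q) i \<noteq> 0 \<longrightarrow> i mod 3 = 0) \<and> (\<forall>i. coeff (dh r) i \<noteq> 0 \<longrightarrow> i mod 3 = 1)"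
      have N0: "N mod 3 = 0" using e by blast
      have shift: "(M + 2*1) mod 3 \<noteq> 2" if "M mod 3 = 2" for M :: nat using that by presburger
      have N: "(N + 2*0) mod 3 \<noteq> 2" "(N - 1 + 2*1) mod 3 \<noteq> 2"
        using N0 shift[OF pred_mod_3(1)[OF N0 N1]] by simp_all
      show ?thesis using s B[OF h(1) _ _ _ N(1), of i j] B[OF h(2) _ _ _ N(1), of i j] B[OF h(3) _ _ _ N(2), of i j] e by fastforce
    next
      assume e: "N mod 3 = 1 \<and> (\<forall>i. coeff (dh p) i \<noteq> 0 \<longrightarrow> i mod 3 = 0) \<and> (\<forall>i. coeff (dh q) i \<noteq> 0 \<longrightarrow> i mod 3 = 1) \<and> (\<forall>i. coeff (dh r) i \<noteq> 0 \<longrightarrow> i mod 3 = 0)"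
      have N0: "N mod 3 = 1" using e by blast
      have "(N - 1) mod 3 = 0" using N0 by presburger
      moreover have "(N + 2) mod 3 = 0" using N0 by presburger
      ultimately have N: "(N + 2*0) mod 3 \<noteq> 2" "(N + 2*1) mod 3 \<noteq> 2" "(N - 1 + 2*0) mod 3 \<noteq> 2" using N0 by simp_all
      show ?thesis using s B[OF h(1) _ _ _ N(1), of i j] B[OF h(2) _ _ _ N(2), of i j] B[OF h(3) _ _ _ N(3), of i j] e by fastforce
    next
      assume e: "N mod 3 = 1 \<and> (\<forall>i. coeff (dh p) i \<noteq> 0 \<longrightarrow> i mod 3 = 1) \<and> (\<forall>i. coeff (dh q) i \<noteq> 0 \<longrightarrow> i mod 3 = 0) \<and> (\<forall>i. coeff (dh r) i \<noteq> 0 \<longrightarrow> i mod 3 = 0)"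
      have N0: "N mod 3 = 1" using e by blast
      have "(N - 1) mod 3 = 0" using N0 by presburger
      moreover have "(N + 2) mod 3 = 0" using N0 by presburger
      ultimately have N: "(N + 2*0) mod 3 \<noteq> 2" "(N + 2*1) mod 3 \<noteq> 2" "(N - 1 + 2*0) mod 3 \<noteq> 2" using N0 by simp_all
      show ?thesis using s B[OF h(1) _ _ _ N(2), of i j] B[OF h(2) _ _ _ N(1), of i j] B[OF h(3) _ _ _ N(3), of i j] e by fastforce
    qed
  qed
qed

lemma shape_inf:
  assumes t: "(p, q, r) \<in> normalized (at_inf k)"
  shows "\<exists>P Q R. form P \<and> form Q \<and> form R \<and> p = subst P (vx^3) (vy^3) \<and> q = subst Q (vx^3) (vy^3) \<and> r = vx * vy * subst R (vx^3) (vy^3)"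
    and "\<forall>s\<in>{p,q,r}. \<forall>i j. bicoeff s i j \<noteq> 0 \<longrightarrow> i mod 3 \<noteq> 2 \<and> j mod 3 \<noteq> 2"
proof -
  obtain c where c: "p = cst c" "q = cst (-(\<omega>^k) * c)" "r = cst 0" using normalized_inf[OF t] by (auto simp: cst_hom)
  have s: "cst x = subst (cst x) (vx^3) (vy^3)" "cst 0 = vx * vy * subst (cst 0) (vx^3) (vy^3)" for x by (rule ev_eqI; simp)+
  show "\<exists>P Q R. form P \<and> form Q \<and> form R \<and> p = subst P (vx^3) (vy^3) \<and> q = subst Q (vx^3) (vy^3) \<and> r = vx * vy * subst R (vx^3) (vy^3)"
    unfolding c using s form_cst by blast
  have "i + j = 0" if "bicoeff (cst x) i j \<noteq> 0" for x i j using homog_cst[of x] that unfolding homog_def by blast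
  then show "\<forall>s\<in>{p,q,r}. \<forall>i j. bicoeff s i j \<noteq> 0 \<longrightarrow> i mod 3 \<noteq> 2 \<and> j mod 3 \<noteq> 2"
    unfolding c by fastforce
qed

section \<open>Counting\<close>

definition eis :: "int \<times> int \<Rightarrow> complex" where "eis z = of_int (fst z) + of_int (snd z) * \<omega>"

lemma eis_inj: "inj eis"
  by (rule injI) (auto simp: eis_def omega_eq complex_eq_iff prod_eq_iff)

lemma Eis_eis: "Eis = range eis"
proof (intro equalityI subsetI)
  fix a assume "a \<in> Eis"
  then obtain x y where "a = of_int x + of_int y * \<omega>" by (auto simp: Eis_def)
  then have "a = eis (x, y)" by (simp add: eis_def)
  then show "a \<in> range eis" by blast
next
  fix a assume "a \<in> range eis"
  then show "a \<in> Eis" by (auto simp: Eis_def eis_def)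
qed

lemma Deg_eis': "int (Deg (eis z)) = norm_form (fst z) (snd z)" by (simp add: eis_def Deg_eis)

text \<open>
  The class of \<open>b\<close> is not empty, since \<open>b\<close> is the multiplier of
  some solution.
\<close>

lemma unit_class_eq_iff:
  assumes "a \<in> Eis" "a \<noteq> 0" "b \<in> Eis" "b \<noteq> 0"
  shows "unit_class b = unit_class a \<longleftrightarrow> (\<exists>m. b = \<omega>^m * a \<or> b = -(\<omega>^m * a))"
proof
  assume e: "unit_class b = unit_class a"
  obtain v where v: "multiplier v b" using Lam_surj assms by blast
  then have "multiplier v (\<omega>^0 * b)" by simp
  then have "v \<in> unit_class b" unfolding unit_class_def by blast
  then have "v \<in> unit_class a" using e by simp
  then show "\<exists>m. b = \<omega>^m * a \<or> b = -(\<omega>^m * a)" using Lam_unique[OF v] by (auto simp: unit_class_def)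
next
  have sub: "unit_class y \<subseteq> unit_class x" if "y = \<omega>^m * x \<or> y = -(\<omega>^m * x)" for x y m
  proof
    fix w assume "w \<in> unit_class y"
    then obtain k where "multiplier w (\<omega>^k * y) \<or> multiplier w (-(\<omega>^k * y))" by (auto simp: unit_class_def)
    then have "multiplier w (\<omega>^(k+m) * x) \<or> multiplier w (-(\<omega>^(k+m) * x))" using that by (auto simp: power_add mult.assoc)
    then show "w \<in> unit_class x" unfolding unit_class_def by blast
  qed
  assume "\<exists>m. b = \<omega>^m * a \<or> b = -(\<omega>^m * a)"
  then obtain m where m: "b = \<omega>^m * a \<or> b = -(\<omega>^m * a)" by blast
  have "\<omega>^(2*m) * \<omega>^m = 1" using omega_power_3[of m] by (simp add: mult_2 power_add power3_eq_cube)
  then have "\<omega>^(2*m) * (\<omega>^m * a) = a" by (simp flip: mult.assoc)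
  then have "a = \<omega>^(2*m) * b \<or> a = -(\<omega>^(2*m) * b)" using m by auto
  then show "unit_class b = unit_class a" using sub m by blast
qed

lemma unit_orbit_card:
  assumes "a \<noteq> 0" shows "card {b. \<exists>m. b = \<omega>^m * a \<or> b = -(\<omega>^m * a)} = 6"
proof -
  have orbit: "{b. \<exists>m. b = \<omega>^m * a \<or> b = -(\<omega>^m * a)} = (\<lambda>u. u * a) ` {1, \<omega>, \<omega>^2, -1, -\<omega>, -(\<omega>^2)}"
  proof (intro equalityI subsetI)
    fix b assume "b \<in> {b. \<exists>m. b = \<omega>^m * a \<or> b = -(\<omega>^m * a)}"
    then obtain m where m: "b = \<omega>^m * a \<or> b = -(\<omega>^m * a)" by blast
    have "m mod 3 < 3" by simp
    from nat_less_3[OF this] have "\<omega>^m = 1 \<or> \<omega>^m = \<omega> \<or> \<omega>^m = \<omega>^2" using omega_power_mod[of m] by auto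
    then show "b \<in> (\<lambda>u. u * a) ` {1, \<omega>, \<omega>^2, -1, -\<omega>, -(\<omega>^2)}" using m by auto
  next
    fix b assume "b \<in> (\<lambda>u. u * a) ` {1, \<omega>, \<omega>^2, -1, -\<omega>, -(\<omega>^2)}"
    then have "b = \<omega>^0 * a \<or> b = \<omega>^1 * a \<or> b = \<omega>^2 * a \<or> b = -(\<omega>^0 * a) \<or> b = -(\<omega>^1 * a) \<or> b = -(\<omega>^2 * a)" by auto
    then show "b \<in> {b. \<exists>m. b = \<omega>^m * a \<or> b = -(\<omega>^m * a)}" by blast
  qed
  have "inj_on (\<lambda>u. u * a) {1, \<omega>, \<omega>^2, -1, -\<omega>, -(\<omega>^2)}" using assms by (auto simp: inj_on_def)
  moreover have "card {1, \<omega>, \<omega>^2, -1, -\<omega>, -(\<omega>^2)} = 6"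
    by (simp add: omega_eq complex_eq_iff power2_eq_square card_insert_if)
  ultimately show ?thesis unfolding orbit by (simp only: card_image)
qed

lemma card_fibres:
  assumes f: "finite A" and c: "\<And>x. x \<in> A \<Longrightarrow> card {y \<in> A. g y = g x} = k"
  shows "card A = k * card (g ` A)"
proof -
  have "card A = (\<Sum>z\<in>g ` A. card {y \<in> A. g y = z})"
    unfolding card_eq_sum using f by (intro sum.group[symmetric]) auto
  also have "\<dots> = (\<Sum>z\<in>g ` A. k)" using c by (intro sum.cong) auto
  finally show ?thesis by (simp add: mult.commute)
qed

text \<open>
  Collections of affiliates correspond to orbits of the six units on the elements of norm
  \<open>d\<close> of \<open>\<int>[\<omega>]\<close>, and all orbits have six elements.
\<close>

theorem count_affiliate_classes:
  assumes d: "1 \<le> d"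
  shows "finite (affiliates ` {v \<in> solutions. sol_degree v = d})"
    "int (card (affiliates ` {v \<in> solutions. sol_degree v = d})) = (\<Sum>e | e dvd d. Legendre (int e) 3)"
proof -
  define A where "A = eis ` reps d"
  have fA: "finite A" unfolding A_def by (intro finite_imageI finite_reps)
  have cA: "card A = card (reps d)" unfolding A_def using eis_inj by (intro card_image) (auto simp: inj_on_def)
  have A: "a \<in> A \<longleftrightarrow> a \<in> Eis \<and> Deg a = d" for a
  proof
    assume "a \<in> A"
    then obtain z where z: "a = eis z" "norm_form (fst z) (snd z) = int d" by (auto simp: A_def reps_def)
    then show "a \<in> Eis \<and> Deg a = d" using Deg_eis'[of z] by (simp add: Eis_eis)
  next
    assume h: "a \<in> Eis \<and> Deg a = d"
    then obtain z where z: "a = eis z" by (auto simp: Eis_eis)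
    have "z \<in> reps d" using Deg_eis'[of z] h z by (auto simp: reps_def)
    then show "a \<in> A" by (simp add: A_def z)
  qed
  have A0: "a \<noteq> 0" if "a \<in> A" for a using that A d by (auto simp: Deg_def)
  have im: "affiliates ` {v \<in> solutions. sol_degree v = d} = unit_class ` A"
  proof (intro equalityI subsetI)
    fix X assume "X \<in> affiliates ` {v \<in> solutions. sol_degree v = d}"
    then obtain v where v: "v \<in> solutions" "sol_degree v = d" "X = affiliates v" by blast
    from v(1) show "X \<in> unit_class ` A"
    proof (rule solution_cases)
      fix a assume l: "multiplier v a"
      then have "a \<in> A" using A Lam_Eis sol_degree_Lam v(2) by metis
      then show ?thesis using affiliates_eq_unit_class[OF l] v(3) by blast
    next
      fix j assume "v = at_inf j"
      then show ?thesis using sol_degree_inf v(2) d by simp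
    qed
  next
    fix X assume "X \<in> unit_class ` A"
    then obtain a where a: "a \<in> A" "X = unit_class a" by blast
    obtain v where l: "multiplier v a" using Lam_surj A0[OF a(1)] A a(1) by blast
    then have "v \<in> solutions" "sol_degree v = d" "affiliates v = X"
      using Lam_solution sol_degree_Lam affiliates_eq_unit_class a A by metis+
    then show "X \<in> affiliates ` {v \<in> solutions. sol_degree v = d}" by blast
  qed
  show "finite (affiliates ` {v \<in> solutions. sol_degree v = d})" unfolding im using fA by simp
  have fib: "card {y \<in> A. unit_class y = unit_class x} = 6" if x: "x \<in> A" for x
  proof -
    have xE: "x \<in> Eis" "x \<noteq> 0" using x A A0 by auto
    obtain P Q R where s: "sol x P Q R" using sol_exists xE by blast
    have unitA: "b \<in> A" if "b = \<omega>^m * x \<or> b = -(\<omega>^m * x)" for b m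
    proof -
      have bE: "b \<in> Eis" using that xE by (auto intro!: Eis_uminus Eis_mult Eis_power)
      have "Deg (\<omega>^m * x) = Deg x"
      proof (induction m)
        case (Suc m)
        have "\<exists>P Q R. sol (\<omega>^m * x) P Q R" using xE by (intro sol_exists Eis_mult Eis_power) auto
        then obtain P Q R where "sol (\<omega>^m * x) P Q R" by blast
        then show ?case using Deg_omega Suc by (simp add: mult.assoc)
      qed simp
      moreover have "\<exists>P Q R. sol (\<omega>^m * x) P Q R" using xE by (intro sol_exists Eis_mult Eis_power) auto
      then have "Deg (-(\<omega>^m * x)) = Deg (\<omega>^m * x)" using Deg_swap by blast
      ultimately show ?thesis using that bE A x by auto
    qed
    have "{y \<in> A. unit_class y = unit_class x} = {b. \<exists>m. b = \<omega>^m * x \<or> b = -(\<omega>^m * x)}"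
      using unit_class_eq_iff[OF xE] A A0 unitA by blast
    then show ?thesis using unit_orbit_card[OF xE(2)] by simp
  qed
  have "card A = 6 * card (unit_class ` A)" by (rule card_fibres[OF fA fib])
  then have "6 * int (card (unit_class ` A)) = 6 * divsum d" using card_reps[of d] d cA by simp
  then show "int (card (affiliates ` {v \<in> solutions. sol_degree v = d})) = (\<Sum>e | e dvd d. Legendre (int e) 3)"
    unfolding im divsum_def chi_def by simp
qed

theorem degree_factorisation:
  assumes v: "v \<in> solutions"
  shows "\<exists>m :: nat. \<exists>ps :: nat multiset. (\<forall>p \<in># ps. prime p \<and> (p mod 3 = 0 \<or> p mod 3 = 1)) \<and> sol_degree v = m ^ 2 * prod_mset ps"
proof (rule norm_factorisation)
  show "reps (sol_degree v) \<noteq> {}" using v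
  proof (rule solution_cases)
    fix j assume "v = at_inf j"
    then have "(0, 0) \<in> reps (sol_degree v)" by (simp add: sol_degree_inf reps_def norm_form_def)
    then show ?thesis by blast
  next
    fix a assume l: "multiplier v a"
    then obtain z where z: "a = eis z" using Lam_Eis[OF l] unfolding Eis_eis by blast
    have "z \<in> reps (sol_degree v)" using Deg_eis'[of z] by (auto simp: sol_degree_Lam[OF l] reps_def z)
    then show ?thesis by blast
  qed
qed

section \<open>Collinear points of the generic cubic\<close>

definition E :: ratfun where "E = Fract (vx^3 + vy^3) 1"

text \<open>
  The symmetric trilinear form whose diagonal is the cubic.
\<close>

definition polar :: "ratfun \<times> ratfun \<times> ratfun \<Rightarrow> ratfun \<times> ratfun \<times> ratfun \<Rightarrow> ratfun \<times> ratfun \<times> ratfun \<Rightarrow> ratfun" where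
  "polar = (\<lambda>(a1,a2,a3) (b1,b2,b3) (c1,c2,c3). a1*b1*c1 + a2*b2*c2 - E*a3*b3*c3)"

definition scale :: "ratfun \<Rightarrow> ratfun \<times> ratfun \<times> ratfun \<Rightarrow> ratfun \<times> ratfun \<times> ratfun" where
  "scale c = (\<lambda>(x,y,z). (c*x, c*y, c*z))"

definition indep :: "ratfun \<times> ratfun \<times> ratfun \<Rightarrow> ratfun \<times> ratfun \<times> ratfun \<Rightarrow> bool" where
  "indep A B \<longleftrightarrow> (\<forall>s t. lincomb s A t B = (0,0,0) \<longrightarrow> s = 0 \<and> t = 0)"

lemma numerals_nonzero: "(2::ratfun) \<noteq> 0" "(3::ratfun) \<noteq> 0"
proof -
  have "of_nat k = (0::ratfun) \<longleftrightarrow> k = 0" for k by (simp flip: Fract_of_nat_eq add: Zero_fract_def eq_fract)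
  from this[of 2] this[of 3] show "(2::ratfun) \<noteq> 0" "(3::ratfun) \<noteq> 0" by simp_all
qed

lemma cubic_E: "cubic (X, Y, Z) = X^3 + Y^3 - E * Z^3" by (simp add: cubic_def E_def)

lemma lincomb_lincomb: "lincomb s (lincomb a V b W) t (lincomb c V d W) = lincomb (s*a+t*c) V (s*b+t*d) W"
  by (cases V; cases W) (simp add: lincomb_def algebra_simps)

lemma lincomb_zero [simp]: "lincomb 0 V 0 W = (0,0,0)" "lincomb 1 V 0 W = V" "lincomb 0 V 1 W = W"
  by (cases V; cases W; simp add: lincomb_def)+

lemma scale_lincomb: "scale c (lincomb s A t B) = lincomb (c*s) A (c*t) B"
  by (cases A; cases B) (simp add: scale_def lincomb_def algebra_simps)

lemma scale_inverse: "c \<noteq> 0 \<Longrightarrow> scale c X = Y \<Longrightarrow> X = scale (inverse c) Y"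
  by (cases X; cases Y) (auto simp: scale_def)

lemma cubic_lincomb:
  "cubic (lincomb s A t B) = s^3 * cubic A + 3 * s^2 * t * polar A A B + 3 * s * t^2 * polar A B B + t^3 * cubic B"
  by (cases A; cases B) (simp add: cubic_E polar_def lincomb_def algebra_simps power_numeral_reduce)

text \<open>
  Rescaling a point rescales its parameter on the line, which is absorbed by the constant
  \<open>k\<close>.
\<close>

lemma line_section_scale:
  assumes "line_section (scale c A) (scale d B) C" and c: "c \<noteq> 0" "d \<noteq> 0"
  shows "line_section A B C"
proof -
  obtain V W s1 t1 s2 t2 s3 t3 k where ind: "\<forall>s t. lincomb s V t W = (0, 0, 0) \<longrightarrow> s = 0 \<and> t = 0"
    and ABC: "scale c A = lincomb s1 V t1 W" "scale d B = lincomb s2 V t2 W" "C = lincomb s3 V t3 W" and k: "k \<noteq> 0"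
    and F: "\<forall>s t. cubic (lincomb s V t W) = k * (s * t1 - t * s1) * (s * t2 - t * s2) * (s * t3 - t * s3)"
    using assms(1) unfolding line_section_def by blast
  have "A = lincomb (inverse c * s1) V (inverse c * t1) W" "B = lincomb (inverse d * s2) V (inverse d * t2) W"
    using scale_inverse[OF c(1) ABC(1)] scale_inverse[OF c(2) ABC(2)] by (simp_all add: scale_lincomb)
  moreover have "k * c * d \<noteq> 0" using k c by simp
  moreover have "cubic (lincomb s V t W) = (k * c * d) * (s * (inverse c * t1) - t * (inverse c * s1)) * (s * (inverse d * t2) - t * (inverse d * s2)) * (s * t3 - t * s3)" for s t
  proof -
    have pull: "s * (inverse x * y) - t * (inverse x * z) = inverse x * (s*y - t*z)" for x y z by (simp add: algebra_simps)
    have "(k * c * d) * (s * (inverse c * t1) - t * (inverse c * s1)) * (s * (inverse d * t2) - t * (inverse d * s2)) * (s * t3 - t * s3)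
      = (c * inverse c) * (d * inverse d) * (k * (s * t1 - t * s1) * (s * t2 - t * s2) * (s * t3 - t * s3))" unfolding pull by (simp only: mult_ac)
    then show ?thesis unfolding F[rule_format] right_inverse[OF c(1)] right_inverse[OF c(2)] mult_1 by (rule sym)
  qed
  ultimately show ?thesis unfolding line_section_def using ind ABC(3) by blast
qed

text \<open>
  For independent \<open>A\<close> and \<open>B\<close> the parametrisation of the line
  can be traded for \<open>(s : t) \<mapsto> s A + t B\<close>. There the cubic is
  \<open>3 s t (s F\<^sub>1 + t F\<^sub>2)\<close>, with \<open>F\<^sub>1\<close>,
  \<open>F\<^sub>2\<close> the two mixed polar values, and the third root is
  \<open>(F\<^sub>2 : -F\<^sub>1)\<close>. The polar values are extracted by evaluating at
  \<open>A + B\<close> and \<open>A - B\<close>.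
\<close>

lemma chord_parameters:
  assumes ls: "line_section A B C" and ind: "indep A B"
  shows "\<exists>c. C = lincomb (c * polar A B B) A (- (c * polar A A B)) B"
proof -
  obtain V W s1 t1 s2 t2 s3 t3 k where
    ABC: "A = lincomb s1 V t1 W" "B = lincomb s2 V t2 W" "C = lincomb s3 V t3 W" and k: "k \<noteq> 0"
    and F: "\<And>s t. cubic (lincomb s V t W) = k * (s * t1 - t * s1) * (s * t2 - t * s2) * (s * t3 - t * s3)"
    using ls unfolding line_section_def by blast
  define D where "D = s2*t1 - t2*s1"
  define d1 where "d1 = s1*t3 - t1*s3"
  define d2 where "d2 = s2*t3 - t2*s3"
  have D: "D \<noteq> 0"
  proof
    assume "D = 0"
    then have e: "s2*t1 = t2*s1" by (simp add: D_def)
    have "lincomb s2 A (-s1) B = (0,0,0)" "lincomb t2 A (-t1) B = (0,0,0)"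
      unfolding ABC lincomb_lincomb using e by (simp_all add: mult.commute)
    then have "s1 = 0" "t1 = 0" using ind unfolding indep_def by fastforce+
    then have "lincomb 1 A 0 B = (0,0,0)" by (simp add: ABC)
    then show False using ind unfolding indep_def by fastforce
  qed
  have FAB: "cubic (lincomb s A t B) = k * (t * D) * (- (s * D)) * (s * d1 + t * d2)" for s t
    unfolding ABC lincomb_lincomb F D_def d1_def d2_def by (simp add: algebra_simps)
  have c0: "cubic A = 0" "cubic B = 0" using FAB[of 1 0] FAB[of 0 1] by simp_all
  let ?T1 = "polar A A B" and ?T2 = "polar A B B"
  have p: "3 * ?T1 + 3 * ?T2 = - (k * D^2 * (d1 + d2))" "3 * ?T2 - 3 * ?T1 = k * D^2 * (d1 - d2)"
    using FAB[of 1 1] FAB[of 1 "-1"] unfolding cubic_lincomb c0 by (simp_all add: power2_eq_square algebra_simps)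
  have "2 * (3 * ?T2) = (3 * ?T1 + 3 * ?T2) + (3 * ?T2 - 3 * ?T1)" "2 * (3 * ?T1) = (3 * ?T1 + 3 * ?T2) - (3 * ?T2 - 3 * ?T1)" by simp_all
  then have "2 * (3 * ?T2) = 2 * (- (k * D^2 * d2))" "2 * (3 * ?T1) = 2 * (- (k * D^2 * d1))" unfolding p by (simp_all add: algebra_simps)
  then have T: "3 * ?T2 = - (k * D^2 * d2)" "3 * ?T1 = - (k * D^2 * d1)" using numerals_nonzero(1) by (simp_all only: mult_cancel_left) auto
  \<comment> \<open>this factor gives \<open>C = (d2 A - d1 B) / D\<close>, which is Cramer's rule\<close>
  define c where "c = - 3 / (k * D^3)"
  have "c * ?T2 = - (3 * ?T2) / (k * D^3)" "c * ?T1 = - (3 * ?T1) / (k * D^3)" unfolding c_def by simp_all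
  then have cT: "c * ?T2 = d2 / D" "c * ?T1 = d1 / D" unfolding T using D k by (simp_all add: field_simps power_numeral_reduce)
  have "d2 * s1 - d1 * s2 = D * s3" "d2 * t1 - d1 * t2 = D * t3" unfolding d1_def d2_def D_def by (simp_all add: algebra_simps)
  then have "d2 / D * s1 + - (d1 / D) * s2 = s3" "d2 / D * t1 + - (d1 / D) * t2 = t3" using D by (simp_all add: field_simps)
  then have "C = lincomb (d2/D) A (- (d1/D)) B" unfolding ABC lincomb_lincomb by simp
  then show ?thesis using cT by metis
qed

text \<open>
  The root of \<open>s F\<^sub>1 + t F\<^sub>2\<close> may be given by any nonzero
  \<open>(x : y)\<close>. That one of the mixed polar values is nonzero means that the
  cubic does not contain the line.
\<close>

theorem chord_section:
  assumes ind: "indep A B" and on: "cubic A = 0" "cubic B = 0" and xy: "x \<noteq> 0 \<or> y \<noteq> 0"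
    and rel: "x * polar A A B + y * polar A B B = 0" and T: "polar A A B \<noteq> 0 \<or> polar A B B \<noteq> 0"
  shows "line_section A B (lincomb x A y B)"
    and "line_section A B C \<Longrightarrow> \<exists>c. C = scale c (lincomb x A y B)"
proof -
  let ?T1 = "polar A A B" and ?T2 = "polar A B B"
  obtain k where k: "k \<noteq> 0" "3 * ?T1 = - (k * y)" "3 * ?T2 = k * x"
  proof (cases "x = 0")
    case False
    have "y * ?T2 = - (x * ?T1)" using rel by (simp add: eq_neg_iff_add_eq_0 add.commute)
    then have t1: "?T1 = - (y * ?T2 / x)" using False by (simp add: field_simps)
    then have "?T2 \<noteq> 0" using T by auto
    then show thesis using False t1 numerals_nonzero by (intro that[of "3 * ?T2 / x"]) auto
  next
    case True
    then have "y \<noteq> 0" "?T2 = 0" "?T1 \<noteq> 0" using xy rel T by auto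
    then show thesis using True numerals_nonzero by (intro that[of "- (3 * ?T1 / y)"]) auto
  qed
  have "cubic (lincomb s A t B) = k * (s * 0 - t * 1) * (s * 1 - t * 0) * (s * y - t * x)" for s t
  proof -
    have "cubic (lincomb s A t B) = s^2 * t * (3 * ?T1) + s * t^2 * (3 * ?T2)" unfolding cubic_lincomb on by simp
    then show ?thesis unfolding k by (simp add: algebra_simps power_numeral_reduce)
  qed
  moreover have "A = lincomb 1 A 0 B" "B = lincomb 0 A 1 B" by simp_all
  ultimately show "line_section A B (lincomb x A y B)" unfolding line_section_def using ind[unfolded indep_def] k(1) by blast
  assume "line_section A B C"
  from chord_parameters[OF this ind] obtain c where c: "C = lincomb (c * ?T2) A (- (c * ?T1)) B" by blast
  have "3 * (c * ?T2) = c * k * x" "3 * (- (c * ?T1)) = c * k * y" using k(2,3) by (simp_all add: algebra_simps)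
  then have "c * ?T2 = c * k / 3 * x" "- (c * ?T1) = c * k / 3 * y" using numerals_nonzero(2) by (simp_all add: field_simps)
  then have "C = scale (c * k / 3) (lincomb x A y B)" unfolding c scale_lincomb by metis
  then show "\<exists>c. C = scale c (lincomb x A y B)" by blast
qed

text \<open>
  The tangent line at \<open>A\<close> is spanned by \<open>A\<close> and
  \<open>D\<close>. The restriction of the cubic to it is \<open>3 F s t\<^sup>2\<close>,
  where \<open>F = polar A D D\<close> is \<open>9 X\<^sup>3 Y\<^sup>3 (X\<^sup>3 +
  Y\<^sup>3)\<close>; so \<open>A\<close> counts twice and the third point is
  \<open>D\<close>. Conversely the line of any section that counts \<open>A\<close> twice
  contains a second point \<open>G\<close>, which satisfies the tangent equation
  \<open>polar A A G = 0\<close> and therefore is a combination of \<open>A\<close> and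
  \<open>D\<close>.
\<close>

theorem tangent_section:
  assumes on: "X^3 + Y^3 = E * Z^3" and nz: "X \<noteq> 0" "Y \<noteq> 0" "Z \<noteq> 0" "E \<noteq> 0"
  defines "A \<equiv> (X, Y, Z)" and "D \<equiv> (X * (X^3 + 2*Y^3), - (Y * (2*X^3 + Y^3)), Z * (X^3 - Y^3))"
  shows "line_section A A D" and "line_section A A C \<Longrightarrow> \<exists>c. C = scale c D"
proof -
  have cA: "cubic A = 0" using on by (simp add: A_def cubic_E)
  have cD: "cubic D = 0" using tangent_point_on_curve[OF on] by (simp only: D_def cubic_E right_minus_eq)
  have T1: "polar A A D = 0"
  proof -
    have "polar A A D = (X^3 - Y^3) * (X^3 + Y^3 - E * Z^3)"
      by (simp add: A_def D_def polar_def algebra_simps power_numeral_reduce)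
    then show ?thesis using on by simp
  qed
  have T2: "polar A D D = 9 * X^3 * Y^3 * (X^3 + Y^3)"
  proof -
    have "polar A D D = 9 * X^3 * Y^3 * (X^3 + Y^3) + (X^3 - Y^3)^2 * (X^3 + Y^3 - E * Z^3)"
      by (simp add: A_def D_def polar_def algebra_simps power_numeral_reduce)
    then show ?thesis using on by simp
  qed
  have "(9::ratfun) = 3 * 3" by simp
  then have T2nz: "polar A D D \<noteq> 0" unfolding T2 on using nz numerals_nonzero(2) by (metis mult_eq_0_iff power_eq_0_iff)
  \<comment> \<open>the minor of \<open>A\<close>, \<open>D\<close> in the first two coordinates, for Cramer's rule\<close>
  define m where "m = X * (- (Y * (2*X^3 + Y^3))) - Y * (X * (X^3 + 2*Y^3))"
  have "m = - (3 * X * Y * (X^3 + Y^3))" unfolding m_def by (simp add: algebra_simps power_numeral_reduce)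
  then have m: "m \<noteq> 0" unfolding on using nz numerals_nonzero(2) by (simp add: neg_equal_0_iff_equal)
  have ind: "s = 0 \<and> t = 0" if "lincomb s A t D = (0,0,0)" for s t
  proof -
    have e: "s * X + t * (X * (X^3 + 2*Y^3)) = 0" "s * Y + t * (- (Y * (2*X^3 + Y^3))) = 0"
      using that unfolding lincomb_def A_def D_def by (simp_all only: prod.case prod.inject)
    have "s * m = (s * X + t * (X * (X^3 + 2*Y^3))) * (- (Y * (2*X^3 + Y^3))) - (s * Y + t * (- (Y * (2*X^3 + Y^3)))) * (X * (X^3 + 2*Y^3))"
      unfolding m_def by (simp add: algebra_simps)
    moreover have "t * m = (s * Y + t * (- (Y * (2*X^3 + Y^3)))) * X - (s * X + t * (X * (X^3 + 2*Y^3))) * Y"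
      unfolding m_def by (simp add: algebra_simps)
    ultimately show ?thesis unfolding e using m by simp
  qed
  have "cubic (lincomb s A t D) = (3 * polar A D D) * (s * 0 - t * 1) * (s * 0 - t * 1) * (s * 1 - t * 0)" for s t
    unfolding cubic_lincomb cA cD T1 by (simp add: algebra_simps power2_eq_square)
  moreover have "A = lincomb 1 A 0 D" "D = lincomb 0 A 1 D" by simp_all
  moreover have "3 * polar A D D \<noteq> 0" using T2nz numerals_nonzero(2) by simp
  ultimately show "line_section A A D" unfolding line_section_def using ind by blast
  assume "line_section A A C"
  then obtain V W s1 t1 s2 t2 s3 t3 k where indVW: "\<And>s t. lincomb s V t W = (0,0,0) \<Longrightarrow> s = 0 \<and> t = 0" and
    ABC: "A = lincomb s1 V t1 W" "A = lincomb s2 V t2 W" "C = lincomb s3 V t3 W" and k: "k \<noteq> 0"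
    and F: "\<And>s t. cubic (lincomb s V t W) = k * (s * t1 - t * s1) * (s * t2 - t * s2) * (s * t3 - t * s3)"
    unfolding line_section_def by blast
  have "lincomb 1 A (-1) A = (0,0,0)" by (cases A) (simp add: lincomb_def)
  then have "lincomb (s1 - s2) V (t1 - t2) W = (0,0,0)" using lincomb_lincomb[of 1 s1 V t1 W "-1" s2 t2] ABC(1,2) by simp
  then have st: "s2 = s1" "t2 = t1" using indVW by fastforce+
  have "s1 \<noteq> 0 \<or> t1 \<noteq> 0"
  proof (rule ccontr)
    assume "\<not> (s1 \<noteq> 0 \<or> t1 \<noteq> 0)"
    then have "A = (0,0,0)" using ABC(1) by simp
    then show False using nz by (simp add: A_def)
  qed
  then obtain s0 t0 where "s1*t0 - t1*s0 \<noteq> 0"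
    by (metis diff_zero diff_0 mult.right_neutral mult_zero_right neg_equal_0_iff_equal)
  moreover define \<delta> where "\<delta> = s1*t0 - t1*s0"
  ultimately have \<delta>: "\<delta> \<noteq> 0" by simp
  define G where "G = lincomb s0 V t0 W"
  \<comment> \<open>the parameters of \<open>A\<close>, \<open>G\<close> paired with those of \<open>C\<close>: \<open>\<delta> C = d1 G - d0 A\<close>\<close>
  define d1 where "d1 = s1*t3 - t1*s3"
  define d0 where "d0 = s0*t3 - t0*s3"
  have FG: "cubic (lincomb s A t G) = k * \<delta>^2 * t^2 * (s * d1 + t * d0)" for s t
    unfolding ABC(1) G_def lincomb_lincomb F st \<delta>_def d1_def d0_def by (simp add: algebra_simps power2_eq_square)
  have cG: "cubic G = k * \<delta>^2 * d0" using FG[of 0 1] by simp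
  have TG: "polar A A G = 0" "3 * polar A G G = k * \<delta>^2 * d1"
  proof -
    have p: "3 * polar A A G + 3 * polar A G G = k * \<delta>^2 * d1" "3 * polar A A G - 3 * polar A G G = - (k * \<delta>^2 * d1)"
      using FG[of 1 1] FG[of "-1" 1] unfolding cubic_lincomb cA cG by (simp_all add: algebra_simps)
    have "2 * (3 * polar A A G) = (3 * polar A A G + 3 * polar A G G) + (3 * polar A A G - 3 * polar A G G)" by simp
    then have "2 * (3 * polar A A G) = 0" unfolding p by (simp only: add.right_inverse)
    then show "polar A A G = 0" using numerals_nonzero by (metis mult_eq_0_iff)
    then show "3 * polar A G G = k * \<delta>^2 * d1" using p(1) by simp
  qed
  obtain g1 g2 g3 where g: "G = (g1,g2,g3)" by (cases G)
  obtain D1 D2 D3 where D': "D = (D1,D2,D3)" by (cases D)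
  have m': "m = X * D2 - Y * D1" using D' by (simp add: m_def D_def)
  have tan: "X^2 * g1 + Y^2 * g2 = E * Z^2 * g3" "X^2 * D1 + Y^2 * D2 = E * Z^2 * D3" "X^2 * X + Y^2 * Y = E * Z^2 * Z"
    using TG(1) T1 on unfolding g D' A_def polar_def by (simp_all add: power2_eq_square power3_eq_cube mult_ac)
  define x where "x = (g1*D2 - g2*D1) / m"
  define y where "y = (X*g2 - Y*g1) / m"
  have xm: "x * m = g1*D2 - g2*D1" "y * m = X*g2 - Y*g1" using m by (simp_all add: x_def y_def)
  have g12: "g1 = x*X + y*D1" "g2 = x*Y + y*D2"
  proof -
    have "m * (x*X + y*D1) = (x*m)*X + (y*m)*D1" "m * (x*Y + y*D2) = (x*m)*Y + (y*m)*D2" by (simp_all only: distrib_left mult_ac)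
    then have "m * (x*X + y*D1) = m * g1" "m * (x*Y + y*D2) = m * g2" unfolding xm unfolding m' by (simp_all add: algebra_simps)
    then show "g1 = x*X + y*D1" "g2 = x*Y + y*D2" using m by simp_all
  qed
  have "E * Z^2 * g3 = x * (X^2*X + Y^2*Y) + y * (X^2*D1 + Y^2*D2)" unfolding tan(1)[symmetric] g12 by (simp add: algebra_simps)
  also have "\<dots> = E * Z^2 * (x*Z + y*D3)" unfolding tan(2,3) by (simp add: algebra_simps)
  finally have g3: "g3 = x*Z + y*D3" using nz by simp
  have G: "G = lincomb x A y D" unfolding g D' A_def lincomb_def using g12 g3 by simp
  have polar_lin: "polar A (lincomb x A y D) (lincomb x A y D) = x^2 * cubic A + 2*x*y * polar A A D + y^2 * polar A D D"
    by (cases A; cases D) (simp add: cubic_E polar_def lincomb_def algebra_simps power_numeral_reduce)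
  have e1: "k * \<delta>^2 * d1 = 3 * (y^2 * polar A D D)" using TG(2) unfolding G polar_lin cA T1 by simp
  have e0: "k * \<delta>^2 * d0 = x * (3 * (y^2 * polar A D D))" using cG unfolding G cubic_lincomb cA cD T1 by (simp add: mult_ac)
  have "k * \<delta>^2 * d0 = k * \<delta>^2 * (x * d1)" using e0 unfolding e1[symmetric] by (simp add: mult_ac)
  then have d0: "d0 = x * d1" using k \<delta> by simp
  have "d1 * s0 - d0 * s1 = \<delta> * s3" "d1 * t0 - d0 * t1 = \<delta> * t3" unfolding d1_def d0_def \<delta>_def by (simp_all add: algebra_simps)
  then have "d1/\<delta> * s0 + - (d0/\<delta>) * s1 = s3" "d1/\<delta> * t0 + - (d0/\<delta>) * t1 = t3" using \<delta> by (simp_all add: field_simps)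
  then have "C = lincomb (d1/\<delta>) G (- (d0/\<delta>)) A" unfolding ABC(3) ABC(1) G_def lincomb_lincomb by simp
  also have "\<dots> = scale (d1/\<delta>*y) D" unfolding G d0 using \<delta> by (cases A; cases D) (simp add: lincomb_def scale_def field_simps)
  finally show "\<exists>c. C = scale c D" by blast
qed

section \<open>Addition of solutions\<close>

lemma E_nonzero: "E \<noteq> 0"
proof -
  have "dh (vx^3 + vy^3) \<noteq> 0" using dh_e3 by simp
  then have "vx^3 + vy^3 \<noteq> 0" by (metis dh_simps(1))
  then show ?thesis by (simp add: E_def Zero_fract_def eq_fract)
qed

lemma Fract_hom:
  "Fract (a + b) 1 = Fract a 1 + Fract b (1::bipoly)" "Fract (a - b) 1 = Fract a 1 - Fract b (1::bipoly)"
  "Fract (a * b) 1 = Fract a 1 * Fract b (1::bipoly)" "Fract (- a) 1 = - Fract a (1::bipoly)"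
  "Fract (a ^ n) 1 = Fract a (1::bipoly) ^ n" "Fract 0 (1::bipoly) = 0" "Fract 1 (1::bipoly) = 1"
  "Fract 2 (1::bipoly) = 2"
proof -
  have m: "Fract (x * y) 1 = Fract x 1 * Fract y (1::bipoly)" for x y by simp
  show "Fract (a ^ n) 1 = Fract a (1::bipoly) ^ n" 
  proof (induction n)
    case (Suc n)
    then show ?case by (simp only: power_Suc m)
  qed (simp add: One_fract_def)
  have "Fract (1 + 1) (1::bipoly) = 1 + 1" by (simp add: One_fract_def)
  then show "Fract 2 (1::bipoly) = 2" by (simp only: one_add_one)
qed (simp_all add: Zero_fract_def One_fract_def)

lemma Fract_1_eq_iff: "Fract a 1 = Fract b (1::bipoly) \<longleftrightarrow> a = b" by (simp add: eq_fract)

lemma Fract_1_eq_0: "Fract a (1::bipoly) = 0 \<longleftrightarrow> a = 0" by (simp add: Zero_fract_def eq_fract)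

lemma on_cubic: assumes "(p, q, r) \<in> triples"
  shows "Fract p 1 ^ 3 + Fract q 1 ^ 3 = E * Fract r 1 ^ 3" "cubic (embed (p, q, r)) = 0"
proof -
  have "p^3 + q^3 = (vx^3 + vy^3) * r^3" using assms by (simp add: triples_def)
  then have "Fract (p^3 + q^3) 1 = Fract ((vx^3 + vy^3) * r^3) 1" by simp
  then show "Fract p 1 ^ 3 + Fract q 1 ^ 3 = E * Fract r 1 ^ 3" unfolding E_def Fract_hom .
  then show "cubic (embed (p, q, r)) = 0" by (simp add: embed_def cubic_E)
qed

lemma embed_proportional:
  assumes "(t, t') \<in> proj_eq"
  obtains c where "c \<noteq> 0" "embed t' = scale c (embed t)"
proof -
  obtain p q r p' q' r' where t: "t = (p,q,r)" "t' = (p',q',r')" by (cases t, cases t')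
  obtain a b where ab: "a \<noteq> 0" "b \<noteq> 0" "a*p = b*p'" "a*q = b*q'" "a*r = b*r'" using assms unfolding t by (auto simp: proj_eq_def)
  have "Fract x' 1 = Fract a b * Fract x 1" if "a * x = b * x'" for x x' using ab that by (simp add: eq_fract mult.commute)
  then have "embed t' = scale (Fract a b) (embed t)" using ab(3-5) unfolding t embed_def scale_def by simp
  moreover have "Fract a b \<noteq> 0" using ab by (simp add: Zero_fract_def eq_fract)
  ultimately show thesis using that by blast
qed

text \<open>
  A priori the factor \<open>c\<close> is an arbitrary rational function; comparing cross
  products of coordinates shows that it can be chosen as a quotient of forms.
\<close>

lemma proportional_pt:
  assumes t: "(p, q, r) \<in> triples" "(p', q', r') \<in> triples" and e: "embed (p', q', r') = scale c (embed (p, q, r))"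
  shows "pt p' q' r' = pt p q r"
proof -
  have c: "Fract p' 1 = c * Fract p 1" "Fract q' 1 = c * Fract q 1" "Fract r' 1 = c * Fract r 1"
    using e by (simp_all add: embed_def scale_def)
  have "Fract (x' * y) 1 = Fract (y' * x) 1" if "Fract x' 1 = c * Fract x 1" "Fract y' 1 = c * Fract y 1" for x y x' y'
    unfolding Fract_hom that by (simp only: mult_ac)
  then have x: "p' * r = r' * p" "q' * r = r' * q" "p' * q = q' * p" using c unfolding Fract_1_eq_iff by metis+
  have c0: "c \<noteq> 0"
  proof
    assume "c = 0"
    then have "p' = 0" "q' = 0" "r' = 0" using c by (simp_all add: Fract_1_eq_0)
    then show False using t(2) by (simp add: triples_def)
  qed
  show ?thesis
  proof (cases "r = 0")
    case False
    have r': "r' \<noteq> 0" using c(3) c0 False by (metis Fract_1_eq_0 mult_eq_0_iff)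
    have "dh (p' * r) = dh (r' * p)" "dh (q' * r) = dh (r' * q)" using x by simp_all
    then have "((p,q,r),(p',q',r')) \<in> proj_eq" unfolding proj_eq_fin_iff[OF t False] using r' by (simp add: mult.commute)
    then show ?thesis using pt_eq_iff[OF t] by simp
  next
    case True
    then have r': "r' = 0" using c(3) by (simp add: Fract_1_eq_0 Fract_hom)
    obtain j n where j: "q = cst (-(\<omega>^j)) * p" "homog n p" "p \<noteq> 0" using triples_inf t(1) True by metis
    obtain j' n' where j': "homog n' p'" "p' \<noteq> 0" using triples_inf t(2) r' by metis
    have "p * q' = p * (cst (-(\<omega>^j)) * p')" using x(3)[symmetric] unfolding j(1) by (simp only: mult_ac)
    then have "q' = cst (-(\<omega>^j)) * p'" using j(3) by simp
    then show ?thesis using pt_inf[OF j(2,3), of j] pt_inf[OF j', of j] j(1) True r' by simp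
  qed
qed

text \<open>
  Different representatives of the summands only rescale the points, so one pair of
  representatives with a unique third point suffices to evaluate the sum.
\<close>

theorem sol_add_eqI:
  assumes u: "u \<in> solutions" "a \<in> u" and v: "v \<in> solutions" "b \<in> v" and t: "(p, q, r) \<in> triples"
    and ls: "line_section (embed a) (embed b) (embed (q, p, r))"
    and uniq: "\<And>C. line_section (embed a) (embed b) C \<Longrightarrow> \<exists>c. C = scale c (embed (q, p, r))"
  shows "sol_add u v = pt p q r"
  unfolding sol_add_def
proof (rule the_equality)
  have w: "pt p q r \<in> solutions" "(p,q,r) \<in> pt p q r" using pt_solution mem_pt_self t by auto
  have neg: "sol_neg (pt p q r) = pt q p r" by (rule sol_neg_eq[OF w])
  have "(q,p,r) \<in> sol_neg (pt p q r)" unfolding neg by (rule mem_pt_self[OF swap_triples[OF t]])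
  then show "pt p q r \<in> solutions \<and> sum_zero u v (sol_neg (pt p q r))" unfolding sum_zero_def using u v ls w by blast
  fix w' assume w': "w' \<in> solutions \<and> sum_zero u v (sol_neg w')"
  then obtain a' b' c where abc: "a' \<in> u" "b' \<in> v" "c \<in> sol_neg w'" "line_section (embed a') (embed b') (embed c)" unfolding sum_zero_def by blast
  have "(a, a') \<in> proj_eq" "(b, b') \<in> proj_eq"
    using class_members u v abc(1,2) by (metis prod_cases3)+
  then obtain x y where xy: "x \<noteq> 0" "embed a' = scale x (embed a)" "y \<noteq> 0" "embed b' = scale y (embed b)"
    using embed_proportional by metis
  have "line_section (embed a) (embed b) (embed c)" using line_section_scale abc(4) xy by metis
  from uniq[OF this] obtain k where k: "embed c = scale k (embed (q,p,r))" by blast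
  obtain p' q' r' where c: "c = (p',q',r')" by (cases c)
  have wn: "sol_neg w' \<in> solutions" using sol_neg_solution w' by blast
  have t': "(p',q',r') \<in> triples" "sol_neg w' = pt p' q' r'" using solution_pt[OF wn] abc(3) c by blast+
  have "sol_neg w' = sol_neg (pt p q r)" unfolding neg t'(2) using proportional_pt[OF swap_triples[OF t] t'(1)] k c by simp
  then show "w' = pt p q r" using sol_neg_neg w' w by metis
qed

lemma Lam_coordinates_nonzero:
  assumes "multiplier u \<alpha>" "(p, q, r) \<in> u" shows "p \<noteq> 0" "q \<noteq> 0" "r \<noteq> 0"
proof -
  note l = Lam_all[OF assms]
  have "on_curve (dh p) (dh q) (dh r)" using l(3) by (simp add: sol_def)
  from on_curve_nz[OF this] show "p \<noteq> 0" "q \<noteq> 0" "r \<noteq> 0" by auto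
qed

lemma sol_zero_inf: "sol_zero = at_inf 0"
  by (simp add: sol_zero_def at_inf_def cst_hom)

text \<open>
  The line through \<open>(X, Y, Z)\<close> and \<open>(1, -1, 0)\<close> meets the cubic
  again in \<open>(Y, X, Z)\<close>.
\<close>

theorem add_zero:
  assumes l: "multiplier u \<alpha>" shows "sol_add u sol_zero = u"
proof -
  obtain p q r where t: "(p,q,r) \<in> u" using solution_nonempty[OF Lam_solution[OF l]] by blast
  note tt = Lam_all[OF l t]
  note nz = Lam_coordinates_nonzero[OF l t]
  have z: "sol_zero \<in> solutions" "(1,-1,0) \<in> sol_zero" "(1,-1,0) \<in> triples"
    unfolding sol_zero_inf using inf_solution[of 0] mem_pt_self[OF inf_triple, of 0] inf_triple[of 0] by (simp_all add: at_inf_def cst_hom)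
  define X Y Z where "X = Fract p 1" and "Y = Fract q 1" and "Z = Fract r 1"
  have on: "X^3 + Y^3 = E * Z^3" using on_cubic[OF tt(1)] by (simp add: X_def Y_def Z_def)
  have nz': "Z \<noteq> 0" using nz by (simp add: Z_def Fract_1_eq_0)
  have e: "embed (p,q,r) = (X,Y,Z)" "embed (1,-1,0) = (1,-1,0)" "embed (q,p,r) = (Y,X,Z)"
    by (simp_all add: embed_def X_def Y_def Z_def Fract_hom)
  have C: "(Y,X,Z) = lincomb 1 (X,Y,Z) (Y-X) (1,-1,0)" by (simp add: lincomb_def)
  have P: "polar (X,Y,Z) (X,Y,Z) (1,-1,0) = X^2 - Y^2" "polar (X,Y,Z) (1,-1,0) (1,-1,0) = X + Y"
    by (simp_all add: polar_def power2_eq_square)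
  have "X + Y \<noteq> 0"
  proof
    assume "X + Y = 0"
    then have "Y = - X" by (simp add: eq_neg_iff_add_eq_0 add.commute)
    then have "E * Z^3 = 0" using on by (simp add: power3_eq_cube)
    then show False using nz' E_nonzero by simp
  qed
  then have T: "polar (X,Y,Z) (X,Y,Z) (1,-1,0) \<noteq> 0 \<or> polar (X,Y,Z) (1,-1,0) (1,-1,0) \<noteq> 0" unfolding P by blast
  have rel: "1 * polar (X,Y,Z) (X,Y,Z) (1,-1,0) + (Y-X) * polar (X,Y,Z) (1,-1,0) (1,-1,0) = 0"
    unfolding P by (simp add: algebra_simps power2_eq_square)
  have ind: "indep (X,Y,Z) (1,-1,0)" unfolding indep_def lincomb_def using nz' by auto
  have cub: "cubic (X,Y,Z) = 0" "cubic (1,-1,0) = 0" using on by (simp_all add: cubic_E power3_eq_cube[of "- 1"])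
  have "sol_add u sol_zero = pt p q r"
  proof (rule sol_add_eqI[OF Lam_solution[OF l] t z(1,2) tt(1)], unfold e C)
    show "line_section (X,Y,Z) (1,-1,0) (lincomb 1 (X,Y,Z) (Y-X) (1,-1,0))"
      by (rule chord_section(1)[OF ind cub _ rel T]) simp
    show "\<exists>c. C = scale c (lincomb 1 (X,Y,Z) (Y-X) (1,-1,0))" if "line_section (X,Y,Z) (1,-1,0) C" for C
      by (rule chord_section(2)[OF ind cub _ rel T that]) simp
  qed
  then show ?thesis using tt(4) by simp
qed

theorem add_double:
  assumes l: "multiplier u \<alpha>" and t: "(p, q, r) \<in> u"
  defines "w \<equiv> pt (-(q*(2*p^3+q^3))) (p*(p^3+2*q^3)) (r*(p^3-q^3))"
  shows "sol_add u u = w" "multiplier w (2*\<alpha>)" "(-(q*(2*p^3+q^3)), p*(p^3+2*q^3), r*(p^3-q^3)) \<in> w"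
proof -
  note tt = Lam_all[OF l t]
  note nz = Lam_coordinates_nonzero[OF l t]
  obtain n where n: "homog (Suc n) p" "homog (Suc n) q" "homog n r" using triples_fin[OF tt(1,2)] by metis
  have n3: "homog (Suc n * 3) (p^3)" "homog (Suc n * 3) (q^3)" by (rule homog_power[OF n(1)], rule homog_power[OF n(2)])
  have hom2: "homog k (2 * x)" if "homog k x" for k x unfolding mult_2 by (rule homog_add[OF that that])
  have h: "homog (Suc (n + Suc n * 3)) (-(q*(2*p^3+q^3)))" "homog (Suc (n + Suc n * 3)) (p*(p^3+2*q^3))" "homog (n + Suc n * 3) (r*(p^3-q^3))"
    using homog_uminus[OF homog_mult[OF n(2) homog_add[OF hom2[OF n3(1)] n3(2)]]] homog_mult[OF n(1) homog_add[OF n3(1) hom2[OF n3(2)]]]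
      homog_mult[OF n(3) homog_diff[OF n3]] unfolding add_Suc .
  have two: "dh 2 = 2" by (metis dh_simps(2,3) one_add_one)
  have s: "sol (2*\<alpha>) (dh (-(q*(2*p^3+q^3)))) (dh (p*(p^3+2*q^3))) (dh (r*(p^3-q^3)))"
    using sol_double[OF tt(3)] unfolding dh_simps two .
  have tr: "(-(q*(2*p^3+q^3)), p*(p^3+2*q^3), r*(p^3-q^3)) \<in> triples"
    by (rule triplesI(1)[OF h]) (use s in \<open>simp only: sol_def\<close>)
  show "multiplier w (2*\<alpha>)" unfolding w_def by (rule LamI[OF tr s])
  show "(-(q*(2*p^3+q^3)), p*(p^3+2*q^3), r*(p^3-q^3)) \<in> w" unfolding w_def by (rule mem_pt_self[OF tr])
  define X Y Z where "X = Fract p 1" and "Y = Fract q 1" and "Z = Fract r 1"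
  have on: "X^3 + Y^3 = E * Z^3" using on_cubic[OF tt(1)] by (simp add: X_def Y_def Z_def)
  have nz': "X \<noteq> 0" "Y \<noteq> 0" "Z \<noteq> 0" using nz by (simp_all add: X_def Y_def Z_def Fract_1_eq_0)
  have e: "embed (p,q,r) = (X,Y,Z)"
    "embed (p*(p^3+2*q^3), -(q*(2*p^3+q^3)), r*(p^3-q^3)) = (X * (X^3 + 2*Y^3), - (Y * (2*X^3 + Y^3)), Z * (X^3 - Y^3))"
    unfolding embed_def X_def Y_def Z_def prod.case Fract_hom by (rule refl)+
  show "sol_add u u = w" unfolding w_def
    by (rule sol_add_eqI[OF Lam_solution[OF l] t Lam_solution[OF l] t tr]; unfold e)
       (erule tangent_section[OF on nz' E_nonzero] | rule tangent_section[OF on nz' E_nonzero])+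
qed

text \<open>
  The third point is the chord formula, which lies on the line by
  \<open>third_point_on_chord\<close>. If both mixed polar values vanished, the cubic
  would contain the whole line; its point with last coordinate \<open>0\<close> would then
  be \<open>(g1, g2, 0)\<close> with \<open>X1\<^sup>2 g1 + Y1\<^sup>2 g2 = 0 = X1
  g1\<^sup>2 + Y1 g2\<^sup>2\<close>, which is possible only for \<open>g1 = g2 =
  0\<close>.
\<close>

theorem add_chord:
  assumes l: "multiplier u \<alpha>" "multiplier v \<beta>" and t: "(p1, q1, r1) \<in> u" "(p2, q2, r2) \<in> v" and ab: "\<alpha> \<noteq> \<beta>" "\<alpha> \<noteq> -\<beta>"
  defines "A \<equiv> p1^2*q2*r2 - p2^2*q1*r1" and "B \<equiv> q1^2*p2*r2 - q2^2*p1*r1" and "C \<equiv> r1^2*p2*q2 - r2^2*p1*q1"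
  shows "sol_add u v = pt B A C" "multiplier (pt B A C) (\<alpha>+\<beta>)" "(B, A, C) \<in> pt B A C"
proof -
  note tt1 = Lam_all[OF l(1) t(1)] and tt2 = Lam_all[OF l(2) t(2)]
  note nz1 = Lam_coordinates_nonzero[OF l(1) t(1)] and nz2 = Lam_coordinates_nonzero[OF l(2) t(2)]
  obtain n where n: "homog (Suc n) p1" "homog (Suc n) q1" "homog n r1" using triples_fin[OF tt1(1,2)] by metis
  obtain m where m: "homog (Suc m) p2" "homog (Suc m) q2" "homog m r2" using triples_fin[OF tt2(1,2)] by metis
  have hom3: "homog N (x^2*y*z)" if "homog i x" "homog j y" "homog k z" "N = i*2 + j + k" for N i j k x y z
    using homog_mult[OF homog_mult[OF homog_power[OF that(1), of 2] that(2)] that(3)] that(4) by simp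
  have h: "homog (Suc (2*n+2*m+2)) B" "homog (Suc (2*n+2*m+2)) A" "homog (2*n+2*m+2) C"
    unfolding A_def B_def C_def using n m by (auto intro!: homog_diff hom3)
  have dC: "dh C \<noteq> 0" using chord_nonzero[OF tt1(3) tt2(3) ab] by (simp add: C_def)
  have s: "sol (\<alpha>+\<beta>) (dh B) (dh A) (dh C)"
    using sol_add_chord[OF tt1(3) tt2(3)] dC unfolding A_def B_def C_def dh_simps by blast
  have tr: "(B, A, C) \<in> triples" by (rule triplesI(1)[OF h]) (use s in \<open>simp only: sol_def\<close>)
  show "multiplier (pt B A C) (\<alpha>+\<beta>)" by (rule LamI[OF tr s])
  show "(B, A, C) \<in> pt B A C" by (rule mem_pt_self[OF tr])
  define X1 Y1 Z1 where "X1 = Fract p1 1" and "Y1 = Fract q1 1" and "Z1 = Fract r1 1"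
  define X2 Y2 Z2 where "X2 = Fract p2 1" and "Y2 = Fract q2 1" and "Z2 = Fract r2 1"
  have on: "X1^3 + Y1^3 = E * Z1^3" "X2^3 + Y2^3 = E * Z2^3"
    using on_cubic(1)[OF tt1(1)] on_cubic(1)[OF tt2(1)] by (simp_all add: X1_def Y1_def Z1_def X2_def Y2_def Z2_def)
  have nz: "X1 \<noteq> 0" "Y1 \<noteq> 0" "Z1 \<noteq> 0" "X2 \<noteq> 0" "Y2 \<noteq> 0" "Z2 \<noteq> 0"
    using nz1 nz2 by (simp_all add: X1_def Y1_def Z1_def X2_def Y2_def Z2_def Fract_1_eq_0)
  define D1 D2 D3 where "D1 = X1^2*Y2*Z2 - X2^2*Y1*Z1" and "D2 = Y1^2*X2*Z2 - Y2^2*X1*Z1" and "D3 = Z1^2*X2*Y2 - Z2^2*X1*Y1"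
  have e: "embed (p1,q1,r1) = (X1,Y1,Z1)" "embed (p2,q2,r2) = (X2,Y2,Z2)" "embed (A,B,C) = (D1,D2,D3)"
    unfolding embed_def prod.case A_def B_def C_def Fract_hom D1_def D2_def D3_def X1_def Y1_def Z1_def X2_def Y2_def Z2_def by (rule refl)+
  have D3: "D3 \<noteq> 0"
  proof -
    have "Fract C 1 = D3" using e(3) by (simp add: embed_def)
    then show ?thesis using dC Fract_1_eq_0[of C] by auto
  qed
  let ?a = "(X1,Y1,Z1)" and ?b = "(X2,Y2,Z2)"
  define x where "x = X1*Y2*Z2 + Y1*X2*Z2 + Z1*X2*Y2"
  define y where "y = - (X2*Y1*Z1 + Y2*X1*Z1 + Z2*X1*Y1)"
  have D: "(D1,D2,D3) = lincomb x ?a y ?b"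
    by (simp add: lincomb_def D1_def D2_def D3_def x_def y_def algebra_simps power2_eq_square)
  have xy: "x \<noteq> 0 \<or> y \<noteq> 0" using D D3 by (auto simp: lincomb_def)
  have cub: "cubic ?a = 0" "cubic ?b = 0" using on by (simp_all add: cubic_E)
  have P: "polar ?a ?a ?b = X1^2*X2 + Y1^2*Y2 - E*Z1^2*Z2" "polar ?a ?b ?b = X1*X2^2 + Y1*Y2^2 - E*Z1*Z2^2"
    by (simp_all add: polar_def power2_eq_square mult_ac)
  have rel: "x * polar ?a ?a ?b + y * polar ?a ?b ?b = 0"
    using third_point_on_chord[OF on] unfolding P x_def y_def by (simp only: mult_minus_left add_uminus_conv_diff right_minus_eq)
  have ind: "indep ?a ?b" unfolding indep_def
  proof (intro allI impI)
    fix s t assume "lincomb s ?a t ?b = (0,0,0)"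
    then have st: "s*X1 = - (t*X2)" "s*Y1 = - (t*Y2)" "s*Z1 = - (t*Z2)" by (simp_all add: lincomb_def eq_neg_iff_add_eq_0)
    have "s^2 * D3 = (s*Z1)^2 * (X2*Y2) - Z2^2 * (s*X1) * (s*Y1)" by (simp add: D3_def algebra_simps power2_eq_square)
    also have "\<dots> = 0" unfolding st by (simp add: algebra_simps power2_eq_square)
    finally have "s = 0" using D3 by simp
    then show "s = 0 \<and> t = 0" using st(1) nz by simp
  qed
  have T: "polar ?a ?a ?b \<noteq> 0 \<or> polar ?a ?b ?b \<noteq> 0"
  proof (rule ccontr)
    assume "\<not> (polar ?a ?a ?b \<noteq> 0 \<or> polar ?a ?b ?b \<noteq> 0)"
    then have T0: "X1^2*X2 + Y1^2*Y2 - E*Z1^2*Z2 = 0" "X1*X2^2 + Y1*Y2^2 - E*Z1*Z2^2 = 0" unfolding P by auto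
    define g1 g2 where "g1 = Z2*X1 - Z1*X2" and "g2 = Z2*Y1 - Z1*Y2"
    have "X1^2*g1 + Y1^2*g2 = Z2 * (X1^3 + Y1^3 - E*Z1^3) - Z1 * (X1^2*X2 + Y1^2*Y2 - E*Z1^2*Z2)"
      unfolding g1_def g2_def by (simp add: algebra_simps power_numeral_reduce)
    then have a: "X1^2*g1 = - (Y1^2*g2)" unfolding T0 using on by (simp add: eq_neg_iff_add_eq_0)
    have "X1*g1^2 + Y1*g2^2 = Z2^2 * (X1^3 + Y1^3 - E*Z1^3) - 2*Z1*Z2 * (X1^2*X2 + Y1^2*Y2 - E*Z1^2*Z2) + Z1^2 * (X1*X2^2 + Y1*Y2^2 - E*Z1*Z2^2)"
      unfolding g1_def g2_def by (simp add: algebra_simps power_numeral_reduce)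
    then have b: "X1*g1^2 + Y1*g2^2 = 0" unfolding T0 using on by simp
    have "X1^3 * (X1*g1^2 + Y1*g2^2) = (X1^2*g1)^2 + X1^3*Y1*g2^2" by (simp add: algebra_simps power_numeral_reduce)
    also have "\<dots> = Y1*g2^2*(X1^3 + Y1^3)" unfolding a by (simp add: algebra_simps power_numeral_reduce)
    finally have "Y1*g2^2*(E*Z1^3) = 0" unfolding b on by simp
    then have "g2 = 0" using nz E_nonzero by simp
    moreover then have "g1 = 0" using a nz by simp
    ultimately have "lincomb Z2 ?a (-Z1) ?b = (0,0,0)" by (simp add: lincomb_def g1_def g2_def mult.commute)
    then show False using ind nz unfolding indep_def by blast
  qed
  show "sol_add u v = pt B A C"
  proof (rule sol_add_eqI[OF Lam_solution[OF l(1)] t(1) Lam_solution[OF l(2)] t(2) tr], unfold e D)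
    show "line_section ?a ?b (lincomb x ?a y ?b)" by (rule chord_section(1)[OF ind cub xy rel T])
    show "\<exists>c. C = scale c (lincomb x ?a y ?b)" if "line_section ?a ?b C" for C
      by (rule chord_section(2)[OF ind cub xy rel T that])
  qed
qed

section \<open>Multiples\<close>

lemma pt_scale_member: "(p, q, r) \<in> v \<Longrightarrow> v \<in> solutions \<Longrightarrow> k \<noteq> 0 \<Longrightarrow> (cst k * p, cst k * q, cst k * r) \<in> v"
  using solution_pt pt_scale mem_pt_self by metis

text \<open>
  The multiples of \<open>u\<close> are computed by one doubling and then by chords, since
  \<open>\<alpha>\<close> and \<open>n \<alpha>\<close> with \<open>n > 1\<close> are
  neither equal nor opposite. A property \<open>G\<close> of representatives that survives
  both formulas is carried along; for doubling the representative may be rescaled by a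
  constant.
\<close>

theorem multiples:
  assumes l: "multiplier u \<alpha>" and t: "(p, q, r) \<in> u" and G: "G p q r"
    and G_scale: "\<And>p q r p' q' r'. G p q r \<Longrightarrow> G p' q' r' \<Longrightarrow>
        G (q^2*p'*r' - q'^2*p*r) (p^2*q'*r' - p'^2*q*r) (r^2*p'*q' - r'^2*p*q)"
    and G_double: "\<And>p q r. G p q r \<Longrightarrow> \<exists>k. k \<noteq> 0 \<and>
        G (cst k * (-(q*(2*p^3+q^3)))) (cst k * (p*(p^3+2*q^3))) (cst k * (r*(p^3-q^3)))"
    and G_swap: "\<And>p q r. G p q r \<Longrightarrow> G q p r"
    and m: "m \<noteq> 0"
  shows "multiplier (sol_mult m u) (of_int m * \<alpha>) \<and> (\<exists>p q r. (p, q, r) \<in> sol_mult m u \<and> G p q r)"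
proof -
  have a0: "\<alpha> \<noteq> 0" using Lam_Eis[OF l] by blast
  define M where "M n = (sol_add u ^^ n) sol_zero" for n
  have M_Suc: "M (Suc n) = sol_add u (M n)" for n by (simp add: M_def)
  have M1: "M 1 = u" using add_zero[OF l] by (simp add: M_def)
  have pos: "multiplier (M (Suc n)) (of_nat (Suc n) * \<alpha>) \<and> (\<exists>p q r. (p, q, r) \<in> M (Suc n) \<and> G p q r)" for n
  proof (induction n)
    case 0
    then show ?case using M1 l t G by auto
  next
    case (Suc n)
    show ?case
    proof (cases "n = 0")
      case True
      note d = add_double[OF l t]
      obtain k where k: "k \<noteq> 0" "G (cst k * (-(q*(2*p^3+q^3)))) (cst k * (p*(p^3+2*q^3))) (cst k * (r*(p^3-q^3)))"
        using G_double[OF G] by blast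
      have M2: "M (Suc (Suc n)) = pt (-(q*(2*p^3+q^3))) (p*(p^3+2*q^3)) (r*(p^3-q^3))"
        using d(1) M1 True M_Suc by simp
      have "of_nat (Suc (Suc n)) * \<alpha> = 2 * \<alpha>" using True by simp
      then show ?thesis unfolding M2 using d(2) k(2) pt_scale_member[OF d(3) Lam_solution[OF d(2)] k(1)] by metis
    next
      case False
      obtain p' q' r' where t': "(p', q', r') \<in> M (Suc n)" "G p' q' r'" using Suc by blast
      have l': "multiplier (M (Suc n)) (of_nat (Suc n) * \<alpha>)" using Suc by blast
      have "\<alpha> = of_nat k * \<alpha> \<longleftrightarrow> k = 1" for k using a0 by simp
      then have ne: "\<alpha> \<noteq> of_nat (Suc n) * \<alpha>" using False a0 by simp
      have "\<alpha> * of_nat (Suc (Suc n)) \<noteq> 0" using a0 by (simp only: mult_eq_0_iff of_nat_eq_0_iff) simp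
      then have ne': "\<alpha> \<noteq> - (of_nat (Suc n) * \<alpha>)" by (auto simp: algebra_simps eq_neg_iff_add_eq_0)
      note c = add_chord[OF l l' t t'(1) ne ne']
      have "\<alpha> + of_nat (Suc n) * \<alpha> = of_nat (Suc (Suc n)) * \<alpha>" by (simp add: algebra_simps)
      then show ?thesis unfolding M_Suc[of "Suc n"] using c G_scale[OF G t'(2)] by metis
    qed
  qed
  have main: "multiplier (M n) (of_nat n * \<alpha>) \<and> (\<exists>p q r. (p, q, r) \<in> M n \<and> G p q r)" if "n \<noteq> 0" for n
    using pos[of "n - 1"] that by simp
  show ?thesis
  proof (cases "0 \<le> m")
    case True
    have "of_nat (nat m) = (of_int m :: complex)" using True by simp
    then show ?thesis using main[of "nat m"] True m unfolding sol_mult_def M_def by simp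
  next
    case False
    have e: "- (of_nat (nat (-m)) * \<alpha>) = of_int m * \<alpha>" using False by simp
    have n0: "nat (-m) \<noteq> 0" using False by simp
    have s: "sol_mult m u = sol_neg (M (nat (-m)))" using False by (simp add: sol_mult_def M_def)
    note mn = main[OF n0]
    obtain p' q' r' where t': "(p', q', r') \<in> M (nat (-m))" "G p' q' r'" using mn by blast
    have v: "M (nat (-m)) \<in> solutions" using mn Lam_solution by blast
    have "(q', p', r') \<in> sol_neg (M (nat (-m)))"
      unfolding sol_neg_eq[OF v t'(1)] using mem_pt_self swap_triples solution_pt[OF v t'(1)] by blast
    then show ?thesis unfolding s using Lam_neg[of "M (nat (-m))"] mn e G_swap[OF t'(2)] by metis
  qed
qed

lemma sol_mult_0: "sol_mult 0 u = at_inf 0"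
  by (simp add: sol_mult_def sol_zero_inf)

section \<open>Complex conjugation\<close>

abbreviation conj1 :: "complex poly \<Rightarrow> complex poly" where "conj1 \<equiv> map_poly cnj"

lemma poly_conj1: "poly (conj1 p) x = cnj (poly p (cnj x))"
  by (induction p) (simp_all add: map_poly_pCons)

lemma conj1_simps [simp]:
  "conj1 (p * q) = conj1 p * conj1 q" "conj1 (p - q) = conj1 p - conj1 q" "conj1 (p + q) = conj1 p + conj1 q"
  "conj1 (p ^ n) = conj1 p ^ n" "conj1 (K c) = K (cnj c)" "conj1 e3 = e3" "conj1 (conj1 p) = p"
  by (rule cpoly_ext; simp add: poly_conj1 poly_e3)+

lemma conj1_eq_0 [simp]: "conj1 p = 0 \<longleftrightarrow> p = 0"
  by (metis conj1_simps(7) map_poly_0)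

lemma pderiv_conj1: "pderiv (conj1 p) = conj1 (pderiv p)"
  by (rule poly_eqI) (simp add: coeff_pderiv coeff_map_poly)

lemma sol_conj: "sol a P Q R \<Longrightarrow> sol (cnj a) (conj1 P) (conj1 Q) (conj1 R)"
proof -
  assume s: "sol a P Q R"
  then have "conj1 (P^3 + Q^3) = conj1 (e3 * R^3)" "conj1 (P * pderiv Q - Q * pderiv P) = conj1 (K a * R^2)"
    by (auto simp: sol_def on_curve_def wronskian_def)
  then have "conj1 P^3 + conj1 Q^3 = e3 * conj1 R^3" "conj1 P * conj1 (pderiv Q) - conj1 Q * conj1 (pderiv P) = K (cnj a) * conj1 R^2"
    by (simp_all only: conj1_simps)
  moreover have "R \<noteq> 0" using s by (auto simp: sol_def on_curve_def)
  ultimately show ?thesis unfolding sol_def on_curve_def wronskian_def pderiv_conj1 by simp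
qed

lemma ev_conj: "ev (conj_poly p) s t = cnj (ev p (cnj s) (cnj t))"
  unfolding conj_poly_def by (induction p) (simp_all add: map_poly_pCons ev_pCons poly_conj1)

lemma conj_poly_simps [simp]:
  "conj_poly (p * q) = conj_poly p * conj_poly q" "conj_poly (p - q) = conj_poly p - conj_poly q" "conj_poly (p + q) = conj_poly p + conj_poly q"
  "conj_poly (- p) = - conj_poly p"
  "conj_poly (p ^ n) = conj_poly p ^ n" "conj_poly (cst c) = cst (cnj c)" "conj_poly vx = vx" "conj_poly vy = vy"
  "conj_poly 0 = 0" "conj_poly 1 = 1" "conj_poly (conj_poly p) = p"
  by (rule ev_eqI; simp add: ev_conj)+

lemma conj_poly_2 [simp]: "conj_poly 2 = 2"
  by (metis conj_poly_simps(3,10) one_add_one)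

lemma conj_poly_eq_0 [simp]: "conj_poly p = 0 \<longleftrightarrow> p = 0"
  by (metis conj_poly_simps(9,11))

lemma cst_mult_cancel: "p \<noteq> 0 \<Longrightarrow> cst x * p = cst y * p \<longleftrightarrow> x = y"
  by (simp only: mult_cancel_right) (simp add: cst_def)

lemma dh_conj: "dh (conj_poly p) = conj1 (dh p)"
  by (rule cpoly_ext) (simp add: poly_dh ev_conj poly_conj1)

lemma real_poly_conj: "real_poly p \<longleftrightarrow> conj_poly p = p"
proof -
  have "bicoeff (conj_poly p) i j = cnj (bicoeff p i j)" for i j
    by (simp add: bicoeff_def conj_poly_def coeff_map_poly)
  moreover have "p = q \<longleftrightarrow> (\<forall>i j. bicoeff p i j = bicoeff q i j)" for q
    by (auto simp: bicoeff_def poly_eq_iff)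
  ultimately show ?thesis unfolding real_poly_def by (metis Reals_cnj_iff)
qed

lemma omega_power_real: assumes "j < 3" "\<omega>^j \<in> \<real>" shows "j = 0"
  using nat_less_3[OF assms(1)] assms(2) by (auto simp: omega_eq complex_is_Real_iff power2_eq_square)

section \<open>Real solutions\<close>

lemma Lam_h1: "multiplier h1 1"
proof -
  have s: "sol 1 (dh vx) (dh vy) (dh 1)" using sol_id by simp
  have "(vx, vy, 1) \<in> triples" by (rule triplesI(1)[of 0]) (use s in \<open>auto simp: sol_def\<close>)
  then show ?thesis unfolding h1_def by (rule LamI[OF _ s])
qed

lemma h1_multiple:
  assumes "m \<noteq> 0"
  shows "multiplier (sol_mult m h1) (of_int m)" "\<exists>p q r. (p, q, r) \<in> sol_mult m h1 \<and> conj_poly p = p \<and> conj_poly q = q \<and> conj_poly r = r"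
proof -
  have t: "(vx, vy, 1) \<in> h1"
  proof -
    have "(vx, vy, 1) \<in> triples" by (rule triplesI(1)[of 0]) (use sol_id in \<open>auto simp: sol_def\<close>)
    then show ?thesis unfolding h1_def by (rule mem_pt_self)
  qed
  have "multiplier (sol_mult m h1) (of_int m * 1) \<and> (\<exists>p q r. (p, q, r) \<in> sol_mult m h1 \<and> (conj_poly p = p \<and> conj_poly q = q \<and> conj_poly r = r))"
    by (rule multiples[OF Lam_h1 t, where G = "\<lambda>p q r. conj_poly p = p \<and> conj_poly q = q \<and> conj_poly r = r"])
       (use assms in \<open>auto intro: exI[of _ 1] simp: cst_hom\<close>)
  then show "multiplier (sol_mult m h1) (of_int m)" "\<exists>p q r. (p, q, r) \<in> sol_mult m h1 \<and> conj_poly p = p \<and> conj_poly q = q \<and> conj_poly r = r" by simp_all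
qed

lemma degree_h1_multiple: "int (sol_degree (sol_mult m h1)) = m^2"
proof (cases "m = 0")
  case True then show ?thesis by (simp add: sol_mult_0 sol_degree_inf)
next
  case False
  then show ?thesis using sol_degree_Lam[OF h1_multiple(1)] Deg_norm[of m 0] by simp
qed

text \<open>
  Conjugation maps points to points and conjugates the multiplier, as \<open>1 +
  t\<^sup>3\<close> is real.
\<close>

lemma real_multiplier:
  assumes s: "sol a P Q R" and c: "conj1 P = P" "conj1 Q = Q" "conj1 R = R"
  shows "cnj a = a"
  using sol_mult_unique[OF sol_conj[OF s, unfolded c] s] .

text \<open>
  The multiplier of a real solution is a real Eisenstein integer, hence an integer
  \<open>m\<close>, so the solution is a twist of \<open>m h\<^sub>1\<close>, which is
  real itself. Comparing real representatives, the twisting factor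
  \<open>\<omega>\<^sup>j\<close> is real, so it is \<open>1\<close>.
\<close>

theorem real_solutions: "{v \<in> solutions. real_solution v} = {sol_mult m h1 | m. True}"
proof (intro equalityI subsetI)
  fix v assume "v \<in> {v \<in> solutions. real_solution v}"
  then obtain p q r where v: "v \<in> solutions" and t: "(p,q,r) \<in> v" and c: "conj_poly p = p" "conj_poly q = q" "conj_poly r = r"
    by (auto simp: real_solution_def real_poly_conj)
  from v show "v \<in> {sol_mult m h1 | m. True}"
  proof (rule solution_cases)
    fix j assume j: "j < 3" "v = at_inf j"
    have m: "q = cst (-(\<omega>^j)) * p" "p \<noteq> 0" using inf_members t j by auto
    have "cst (cnj (-(\<omega>^j))) * p = cst (-(\<omega>^j)) * p" using c m(1) by (metis conj_poly_simps(1,6))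
    then have "cnj (-(\<omega>^j)) = -(\<omega>^j)" using cst_mult_cancel[OF m(2)] by blast
    then have "\<omega>^j \<in> \<real>" by (simp add: Reals_cnj_iff)
    then have "j = 0" using omega_power_real j by blast
    then have "v = sol_mult 0 h1" using j sol_mult_0 by simp
    then show ?thesis by blast
  next
    fix a assume l: "multiplier v a"
    note tt = Lam_all[OF l t]
    have "cnj a = a" using real_multiplier[OF tt(3)] c dh_conj by metis
    moreover obtain x y where xy: "a = of_int x + of_int y * \<omega>" using Lam_Eis[OF l] by (auto simp: Eis_def)
    ultimately have "y = 0" by (auto simp: omega_eq complex_eq_iff)
    then have a: "a = of_int x" "x \<noteq> 0" using xy Lam_Eis[OF l] by auto
    note h = h1_multiple[OF a(2)]
    obtain p' q' r' where t': "(p',q',r') \<in> sol_mult x h1" "conj_poly p' = p'" "conj_poly q' = q'" "conj_poly r' = r'" using h(2) by blast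
    obtain j where j: "j < 3" "v = twist j (sol_mult x h1)" using Lam_rigid h(1) l a by blast
    note tt' = Lam_all[OF h(1) t'(1)]
    have nz: "p \<noteq> 0" "r \<noteq> 0" "p' \<noteq> 0" "r' \<noteq> 0" using Lam_coordinates_nonzero[OF l t] Lam_coordinates_nonzero[OF h(1) t'(1)] by auto
    have tw: "v = pt (cst (\<omega>^j) * p') (cst (inverse \<omega>^j) * q') r'" using twist_eq[OF Lam_solution[OF h(1)] t'(1)] j by simp
    have "(cst (\<omega>^j) * p', cst (inverse \<omega>^j) * q', r') \<in> triples"
      by (rule diag_triples[OF tt'(1) omega_power_3 omega_inverse_power(2)])
    then have "((p,q,r), (cst (\<omega>^j) * p', cst (inverse \<omega>^j) * q', r')) \<in> proj_eq" using pt_eq_iff[OF tt(1)] tw tt(4) by simp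
    then obtain b d where bd: "b \<noteq> 0" "d \<noteq> 0" "b * p = d * (cst (\<omega>^j) * p')" "b * r = d * r'" by (auto simp: proj_eq_def)
    have "b * (p * r') = (b * p) * r'" by (simp only: mult.assoc)
    also have "\<dots> = cst (\<omega>^j) * p' * (d * r')" unfolding bd(3) by (simp only: mult_ac)
    also have "\<dots> = b * (cst (\<omega>^j) * (p' * r))" unfolding bd(4)[symmetric] by (simp only: mult_ac)
    finally have e: "p * r' = cst (\<omega>^j) * (p' * r)" using bd(1) by simp
    then have "conj_poly (p * r') = conj_poly (cst (\<omega>^j) * (p' * r))" by simp
    then have "p * r' = cst (cnj (\<omega>^j)) * (p' * r)" using c t' by simp
    then have "cst (cnj (\<omega>^j)) * (p' * r) = cst (\<omega>^j) * (p' * r)" unfolding e by (rule sym)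
    then have "cnj (\<omega>^j) = \<omega>^j" using cst_mult_cancel[of "p' * r"] nz by simp
    then have "j = 0" using omega_power_real j(1) by (simp add: Reals_cnj_iff)
    then have "v = sol_mult x h1" using tw tt'(4) by (simp add: cst_hom)
    then show ?thesis by blast
  qed
next
  fix v assume "v \<in> {sol_mult m h1 | m. True}"
  then obtain m where m: "v = sol_mult m h1" by blast
  show "v \<in> {v \<in> solutions. real_solution v}"
  proof (cases "m = 0")
    case True
    have "(1, -1, 0) \<in> at_inf 0" using mem_pt_self[OF inf_triple, of 0] by (simp add: at_inf_def cst_hom)
    moreover have "real_poly 1" "real_poly (-1)" "real_poly 0" by (simp_all add: real_poly_conj)
    ultimately show ?thesis unfolding m True sol_mult_0 real_solution_def using inf_solution by blast
  next
    case False
    then show ?thesis using h1_multiple[OF False] Lam_solution unfolding m real_solution_def real_poly_conj by blast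
  qed
qed

section \<open>Conjugate coordinates\<close>

text \<open>
  The representatives \<open>(p, q, r)\<close> with \<open>q\<close> conjugate to
  \<open>p\<close> and \<open>r\<close> real are preserved by the chord formula. The
  doubling formula yields first two coordinates that are conjugate up to sign and an
  imaginary last one, which multiplication by \<open>\<i>\<close> corrects.
\<close>

lemma v3_multiple:
  assumes "m \<noteq> 0"
  shows "multiplier (sol_mult m v3) (of_int m * theta)" "\<exists>p r. (p, conj_poly p, r) \<in> sol_mult m v3 \<and> conj_poly r = r"
proof -
  let ?p = "cst (inverse \<zeta>) * vx ^ 3 + cst \<zeta> * vy ^ 3" and ?q = "cst \<zeta> * vx ^ 3 + cst (inverse \<zeta>) * vy ^ 3" and ?r = "cst (of_real (sqrt 3)) * vx * vy"
  have cz: "cnj \<zeta> = inverse \<zeta>" "cnj (inverse \<zeta>) = \<zeta>"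
    by (simp_all add: zeta_eq complex_eq_iff power2_eq_square)
  have "(?p, ?q, ?r) \<in> v3" by (rule v3_member)
  moreover have "conj_poly ?p = ?q \<and> conj_poly ?q = ?p \<and> conj_poly ?r = ?r" by (simp add: cz)
  ultimately have "multiplier (sol_mult m v3) (of_int m * theta) \<and> (\<exists>p q r. (p, q, r) \<in> sol_mult m v3 \<and> (conj_poly p = q \<and> conj_poly q = p \<and> conj_poly r = r))"
  proof (rule multiples[OF Lam_v3, where G = "\<lambda>p q r. conj_poly p = q \<and> conj_poly q = p \<and> conj_poly r = r"])
    fix p q r :: bipoly assume c: "conj_poly p = q \<and> conj_poly q = p \<and> conj_poly r = r"
    show "conj_poly q = p \<and> conj_poly p = q \<and> conj_poly r = r" using c by simp
    have ii: "cst (cnj \<i>) = - cst \<i>" by (simp add: cst_hom)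
    have "conj_poly (cst \<i> * (-(q*(2*p^3+q^3)))) = cst \<i> * (p*(p^3+2*q^3)) \<and> conj_poly (cst \<i> * (p*(p^3+2*q^3))) = cst \<i> * (-(q*(2*p^3+q^3))) \<and>
       conj_poly (cst \<i> * (r*(p^3-q^3))) = cst \<i> * (r*(p^3-q^3))" using c ii by (simp add: algebra_simps)
    then show "\<exists>k. k \<noteq> 0 \<and> conj_poly (cst k * (-(q*(2*p^3+q^3)))) = cst k * (p*(p^3+2*q^3)) \<and> conj_poly (cst k * (p*(p^3+2*q^3))) = cst k * (-(q*(2*p^3+q^3))) \<and>
       conj_poly (cst k * (r*(p^3-q^3))) = cst k * (r*(p^3-q^3))" by (intro exI[of _ \<i>]) simp
  next
    fix p q r p' q' r' :: bipoly
    assume "conj_poly p = q \<and> conj_poly q = p \<and> conj_poly r = r" "conj_poly p' = q' \<and> conj_poly q' = p' \<and> conj_poly r' = r'"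
    then show "conj_poly (q^2*p'*r' - q'^2*p*r) = p^2*q'*r' - p'^2*q*r \<and> conj_poly (p^2*q'*r' - p'^2*q*r) = q^2*p'*r' - q'^2*p*r \<and>
        conj_poly (r^2*p'*q' - r'^2*p*q) = r^2*p'*q' - r'^2*p*q" by (simp add: mult_ac)
  qed (rule assms)
  then show "multiplier (sol_mult m v3) (of_int m * theta)" "\<exists>p r. (p, conj_poly p, r) \<in> sol_mult m v3 \<and> conj_poly r = r" by auto
qed

lemma Deg_theta_multiple: "m \<noteq> 0 \<Longrightarrow> int (Deg (of_int m * theta)) = 3 * m^2"
proof -
  assume m: "m \<noteq> 0"
  note l = h1_multiple(1)[OF m]
  obtain p q r where "(p,q,r) \<in> sol_mult m h1" using h1_multiple(2)[OF m] by blast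
  from Deg_theta[OF Lam_all(3)[OF l this]] have "Deg (theta * of_int m) = 3 * Deg (of_int m)" .
  then show ?thesis using Deg_norm[of m 0] by (simp add: mult.commute)
qed

lemma twist_inf: "twist j (at_inf 0) = at_inf j"
proof -
  have "(1, -1, 0) \<in> at_inf 0" using mem_pt_self[OF inf_triple, of 0] by (simp add: at_inf_def cst_hom)
  then have "twist j (at_inf 0) = pt (cst (\<omega>^j) * 1) (cst (inverse \<omega>^j) * (-1)) 0" by (rule twist_eq[OF inf_solution])
  moreover have "cst (inverse \<omega>^j) * (-1) = cst (-(\<omega>^j)) * cst (\<omega>^j)"
    by (simp add: omega_inverse_power(1) mult_2 power_add flip: cst_hom(1,5))
  moreover have "cst (\<omega>^j) \<noteq> 0" by (simp add: cst_hom)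
  ultimately show ?thesis using pt_inf[OF homog_cst, of "\<omega>^j" j] by simp
qed

lemma degree_twisted_v3_multiple: "int (sol_degree (twist j (sol_mult m v3))) = 3 * m^2" "int (sol_degree (sol_mult m v3)) = 3 * m^2"
proof -
  have "int (sol_degree (twist j (sol_mult m v3))) = 3 * m^2 \<and> int (sol_degree (sol_mult m v3)) = 3 * m^2"
  proof (cases "m = 0")
    case True then show ?thesis by (simp add: sol_mult_0 twist_inf sol_degree_inf)
  next
    case False
    then show ?thesis using sol_degree_Lam[OF v3_multiple(1)] sol_degree_Lam[OF Lam_twist[OF v3_multiple(1)]] Deg_theta_multiple by simp
  qed
  then show "int (sol_degree (twist j (sol_mult m v3))) = 3 * m^2" "int (sol_degree (sol_mult m v3)) = 3 * m^2" by auto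
qed

lemma conj_solutionI:
  assumes "(p, q, r) \<in> v" "r \<noteq> 0" "conj_poly p = q" "conj_poly r = r"
  shows "conj_solution v"
  unfolding conj_solution_def by (rule bexI[OF _ assms(1)]) (simp add: assms)

lemma conj_v3_multiple: assumes "m \<noteq> 0" shows "conj_solution (twist j (sol_mult m v3))" "conj_solution (sol_mult m v3)"
proof -
  note l = v3_multiple(1)[OF assms]
  obtain p r where t: "(p, conj_poly p, r) \<in> sol_mult m v3" "conj_poly r = r" using v3_multiple(2)[OF assms] by blast
  note tt = Lam_all[OF l t(1)]
  show "conj_solution (sol_mult m v3)" by (rule conj_solutionI[OF t(1) tt(2) refl t(2)])
  have tw: "(cst (\<omega>^j) * p, cst (inverse \<omega>^j) * conj_poly p, r) \<in> twist j (sol_mult m v3)"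
    unfolding twist_eq[OF Lam_solution[OF l] t(1)] by (rule mem_pt_self[OF diag_triples[OF tt(1) omega_power_3 omega_inverse_power(2)]])
  have "conj_poly (cst (\<omega>^j) * p) = cst (inverse \<omega>^j) * conj_poly p"
    by (simp only: conj_poly_simps complex_cnj_power cnj_omega)
  then show "conj_solution (twist j (sol_mult m v3))" by (rule conj_solutionI[OF tw tt(2) _ t(2)])
qed

text \<open>
  Conjugating and exchanging the coordinates changes the multiplier \<open>a\<close> into
  \<open>- cnj a\<close>; if this leaves the solution unchanged, \<open>a\<close> is
  imaginary, and the imaginary Eisenstein integers are the integer multiples of
  \<open>\<theta>\<close>. Twists preserve the condition because
  \<open>\<omega>\<^sup>j\<close> and \<open>\<omega>\<^sup>-\<^sup>j\<close> are
  conjugate.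
\<close>

theorem conj_solutions: "{v \<in> solutions. conj_solution v} = {twist j (sol_mult m v3) | m j. m \<noteq> 0 \<and> j < 3}"
proof (intro equalityI subsetI)
  fix v assume "v \<in> {v \<in> solutions. conj_solution v}"
  then obtain p q r where v: "v \<in> solutions" and t: "(p,q,r) \<in> v" and r: "r \<noteq> 0" and f: "Fract q r = Fract (conj_poly p) (conj_poly r)"
    by (auto simp: conj_solution_def)
  have e: "q * conj_poly r = conj_poly p * r" using f r by (simp add: eq_fract)
  then have "conj_poly (q * conj_poly r) = conj_poly (conj_poly p * r)" by simp
  then have e': "conj_poly q * r = p * conj_poly r" by simp
  obtain a where l: "multiplier v a" using Lam_exists[OF v t r] by blast
  note tt = Lam_all[OF l t]
  have "sol (- cnj a) (dh p) (dh q) (dh r)"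
  proof (rule sol_cong[OF sol_swap[OF sol_conj[OF tt(3)]]])
    show "dh r \<noteq> 0" using tt(3) by (auto simp: sol_def on_curve_def)
    show "dh p * conj1 (dh r) = conj1 (dh q) * dh r" "dh q * conj1 (dh r) = conj1 (dh p) * dh r"
      unfolding dh_conj[symmetric] dh_simps(6)[symmetric] using e e' by simp_all
  qed
  then have a: "a = - cnj a" using sol_mult_unique[OF tt(3)] by blast
  obtain x y where xy: "a = of_int x + of_int y * \<omega>" using Lam_Eis[OF l] by (auto simp: Eis_def)
  have "Re a = 0" using arg_cong[OF a, of Re] by simp
  then have "real_of_int (2 * x) = real_of_int y" using xy by (simp add: omega_eq)
  then have y: "y = 2 * x" by (simp only: of_int_eq_iff)
  have "a = of_int (-x) * theta" unfolding xy y theta_eq(1) omega_square by (simp add: algebra_simps)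
  moreover have "-x \<noteq> 0" using xy y Lam_Eis[OF l] by auto
  ultimately obtain m where m: "a = of_int m * theta" "m \<noteq> 0" by blast
  obtain j where "j < 3" "v = twist j (sol_mult m v3)" using Lam_rigid v3_multiple(1)[OF m(2)] l m(1) by blast
  then show "v \<in> {twist j (sol_mult m v3) | m j. m \<noteq> 0 \<and> j < 3}" using m(2) by blast
next
  fix v assume "v \<in> {twist j (sol_mult m v3) | m j. m \<noteq> 0 \<and> j < 3}"
  then obtain m j where m: "v = twist j (sol_mult m v3)" "m \<noteq> 0" by blast
  then show "v \<in> {v \<in> solutions. conj_solution v}"
    using conj_v3_multiple(1)[OF m(2)] Lam_solution[OF Lam_twist[OF v3_multiple(1)[OF m(2)]]] by simp
qed

theorem theorem1p2:
  shows
    \<comment> \<open>(1)\<close>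
    "(\<forall>v \<in> solutions. \<forall>(p, q, r) \<in> normalized v. r \<noteq> 0 \<longrightarrow>
        (Fract q r) ^ 3 = (Fract (subst p vy vx) (subst r vy vx)) ^ 3)
   \<and> \<comment> \<open>(2)\<close>
     (\<forall>v \<in> solutions. \<forall>v' \<in> solutions. sol_comp v' v \<in> affiliates (sol_comp v v'))
   \<and> \<comment> \<open>(3)\<close>
     (\<forall>v \<in> solutions. \<forall>(p, q, r) \<in> normalized v. r \<noteq> 0 \<longrightarrow>
        Fract p r \<in> Q_omega_ratfuns \<and> Fract q r \<in> Q_omega_ratfuns)
   \<and> \<comment> \<open>(4)\<close>
     (\<forall>v \<in> solutions. \<forall>d' :: int. int (sol_degree v) = 3 * d' \<longrightarrow>
        (\<exists>w \<in> solutions. int (sol_degree w) = d' \<and> sol_comp w v3 \<in> affiliates v) \<and>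
        (\<forall>(p, q, r) \<in> normalized v. \<exists>P Q R. form P \<and> form Q \<and> form R \<and>
           p = subst P (vx ^ 3) (vy ^ 3) \<and>
           q = subst Q (vx ^ 3) (vy ^ 3) \<and>
           r = vx * vy * subst R (vx ^ 3) (vy ^ 3)))
   \<and> \<comment> \<open>(5)\<close>
     (\<forall>v \<in> solutions. \<forall>d' :: int. int (sol_degree v) = 3 * d' + 1 \<longrightarrow>
        (\<forall>(p, q, r) \<in> normalized v. \<exists>P Q R. form P \<and> form Q \<and> form R \<and>
           ((p = vx * subst P (vx ^ 3) (vy ^ 3) \<and> q = vy * subst Q (vx ^ 3) (vy ^ 3)) \<or>
            (q = vx * subst P (vx ^ 3) (vy ^ 3) \<and> p = vy * subst Q (vx ^ 3) (vy ^ 3))) \<and>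
           r = subst R (vx ^ 3) (vy ^ 3)))
   \<and> \<comment> \<open>(6)\<close>
     (\<forall>v \<in> solutions. sol_degree v mod 3 \<noteq> 2 \<and>
        (\<forall>(p, q, r) \<in> normalized v. \<forall>s \<in> {p, q, r}. \<forall>i j. bicoeff s i j \<noteq> 0 \<longrightarrow>
           i mod 3 \<noteq> 2 \<and> j mod 3 \<noteq> 2))
   \<and> \<comment> \<open>(7)\<close>
     {v \<in> solutions. real_solution v} = {sol_mult m h1 | m. True}
   \<and> (\<forall>m. int (sol_degree (sol_mult m h1)) = m ^ 2)
   \<and> (\<forall>m. m \<noteq> 0 \<longrightarrow> conj_solution (sol_mult m v3))
   \<and> {v \<in> solutions. conj_solution v} = {twist j (sol_mult m v3) | m j. m \<noteq> 0 \<and> j < 3}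
   \<and> (\<forall>m. int (sol_degree (sol_mult m v3)) = 3 * m ^ 2)
   \<and> (\<forall>m. \<forall>j < 3. int (sol_degree (twist j (sol_mult m v3))) = 3 * m ^ 2)
   \<and> \<comment> \<open>(8)\<close>
     (\<forall>d :: nat. 1 \<le> d \<longrightarrow>
        finite (affiliates ` {v \<in> solutions. sol_degree v = d}) \<and>
        int (card (affiliates ` {v \<in> solutions. sol_degree v = d})) =
          (\<Sum>e | e dvd d. Legendre (int e) 3))
   \<and> (\<forall>v \<in> solutions. \<exists>m :: nat. \<exists>ps :: nat multiset.
        (\<forall>p \<in># ps. prime p \<and> (p mod 3 = 0 \<or> p mod 3 = 1)) \<and>
        sol_degree v = m ^ 2 * prod_mset ps)"
proof -
  have deg: "Deg a mod 3 = 0 \<or> Deg a mod 3 = 1" if "multiplier v a" for v a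
    using normalized_nonempty[OF Lam_solution[OF that]] shape_of_representatives(1)[OF that] by blast
  have p4: "\<exists>P Q R. form P \<and> form Q \<and> form R \<and> p = subst P (vx ^ 3) (vy ^ 3) \<and> q = subst Q (vx ^ 3) (vy ^ 3) \<and> r = vx * vy * subst R (vx ^ 3) (vy ^ 3)"
    if v: "v \<in> solutions" "int (sol_degree v) = 3 * d'" and t: "(p, q, r) \<in> normalized v" for v d' p q r
    using v(1)
  proof (rule solution_cases)
    fix a assume l: "multiplier v a"
    have "int (Deg a) mod 3 = 0" using v(2) unfolding sol_degree_Lam[OF l] by simp
    then have "Deg a mod 3 \<noteq> 1" by presburger
    then show ?thesis using shape_of_representatives(1)[OF l t] by (elim disjE conjE) (erule (1) notE | assumption)+
  next
    fix j assume "v = at_inf j"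
    then show ?thesis using shape_inf(1) t by blast
  qed
  have p5: "\<exists>P Q R. form P \<and> form Q \<and> form R \<and> ((p = vx * subst P (vx ^ 3) (vy ^ 3) \<and> q = vy * subst Q (vx ^ 3) (vy ^ 3)) \<or>
      (q = vx * subst P (vx ^ 3) (vy ^ 3) \<and> p = vy * subst Q (vx ^ 3) (vy ^ 3))) \<and> r = subst R (vx ^ 3) (vy ^ 3)"
    if v: "v \<in> solutions" "int (sol_degree v) = 3 * d' + 1" and t: "(p, q, r) \<in> normalized v" for v d' p q r
    using v(1)
  proof (rule solution_cases)
    fix a assume l: "multiplier v a"
    have "int (Deg a) mod 3 = 1" using v(2) unfolding sol_degree_Lam[OF l] by simp
    then have "Deg a mod 3 \<noteq> 0" by presburger
    then show ?thesis using shape_of_representatives(1)[OF l t] by (elim disjE conjE) (erule (1) notE | assumption)+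
  next
    fix j assume "v = at_inf j"
    then have "3 * d' + 1 = 0" using v(2) sol_degree_inf by simp
    then have False by presburger
    then show ?thesis ..
  qed
  have p6: "sol_degree v mod 3 \<noteq> 2" if "v \<in> solutions" for v
    using that
  proof (rule solution_cases)
    fix a assume l: "multiplier v a"
    then show ?thesis using deg[OF l] sol_degree_Lam[OF l] by auto
  qed (simp add: sol_degree_inf)
  have p6': "\<forall>s \<in> {p, q, r}. \<forall>i j. bicoeff s i j \<noteq> 0 \<longrightarrow> i mod 3 \<noteq> 2 \<and> j mod 3 \<noteq> 2"
    if "v \<in> solutions" and t: "(p, q, r) \<in> normalized v" for v p q r
    using that(1)
  proof (rule solution_cases)
    fix a assume l: "multiplier v a"
    show ?thesis by (rule shape_of_representatives(2)[OF l t])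
  next
    fix j assume j: "v = at_inf j"
    show ?thesis by (rule shape_inf(2)[OF t[unfolded j]])
  qed
  have c1: "\<forall>v \<in> solutions. \<forall>(p, q, r) \<in> normalized v. r \<noteq> 0 \<longrightarrow>
      (Fract q r) ^ 3 = (Fract (subst p vy vx) (subst r vy vx)) ^ 3"
    by (clarify, rule swap_variables)
  have c2: "\<forall>v \<in> solutions. \<forall>v' \<in> solutions. sol_comp v' v \<in> affiliates (sol_comp v v')"
    by (intro ballI comp_commute)
  have c3: "\<forall>v \<in> solutions. \<forall>(p, q, r) \<in> normalized v. r \<noteq> 0 \<longrightarrow>
      Fract p r \<in> Q_omega_ratfuns \<and> Fract q r \<in> Q_omega_ratfuns"
    by (clarify, intro conjI coefficients_Q_omega)
  have c4: "\<forall>v \<in> solutions. \<forall>d' :: int. int (sol_degree v) = 3 * d' \<longrightarrow>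
      (\<exists>w \<in> solutions. int (sol_degree w) = d' \<and> sol_comp w v3 \<in> affiliates v) \<and>
      (\<forall>(p, q, r) \<in> normalized v. \<exists>P Q R. form P \<and> form Q \<and> form R \<and>
      p = subst P (vx ^ 3) (vy ^ 3) \<and>
      q = subst Q (vx ^ 3) (vy ^ 3) \<and>
      r = vx * vy * subst R (vx ^ 3) (vy ^ 3))"
    by (intro ballI allI impI conjI factor_through_v3, assumption+) (clarify, rule p4, assumption+)
  have c5: "\<forall>v \<in> solutions. \<forall>d' :: int. int (sol_degree v) = 3 * d' + 1 \<longrightarrow>
      (\<forall>(p, q, r) \<in> normalized v. \<exists>P Q R. form P \<and> form Q \<and> form R \<and>
      ((p = vx * subst P (vx ^ 3) (vy ^ 3) \<and> q = vy * subst Q (vx ^ 3) (vy ^ 3)) \<or>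
      (q = vx * subst P (vx ^ 3) (vy ^ 3) \<and> p = vy * subst Q (vx ^ 3) (vy ^ 3))) \<and>
      r = subst R (vx ^ 3) (vy ^ 3))"
    by (intro ballI allI impI) (clarify, rule p5, assumption+)
  have c6: "\<forall>v \<in> solutions. sol_degree v mod 3 \<noteq> 2 \<and>
      (\<forall>(p, q, r) \<in> normalized v. \<forall>s \<in> {p, q, r}. \<forall>i j. bicoeff s i j \<noteq> 0 \<longrightarrow>
      i mod 3 \<noteq> 2 \<and> j mod 3 \<noteq> 2)"
    proof (intro ballI conjI)
    fix v assume v: "v \<in> solutions"
    show "sol_degree v mod 3 \<noteq> 2" by (rule p6[OF v])
    fix t assume "t \<in> normalized v"
    then show "case t of (p, q, r) \<Rightarrow> \<forall>s \<in> {p, q, r}. \<forall>i j. bicoeff s i j \<noteq> 0 \<longrightarrow> i mod 3 \<noteq> 2 \<and> j mod 3 \<noteq> 2"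
      using p6'[OF v] by (cases t) blast
  qed
  have c7: "{v \<in> solutions. real_solution v} = {sol_mult m h1 | m. True}"
    by (rule real_solutions)
  have c8: "\<forall>m. int (sol_degree (sol_mult m h1)) = m ^ 2"
    by (intro allI degree_h1_multiple)
  have c9: "\<forall>m. m \<noteq> 0 \<longrightarrow> conj_solution (sol_mult m v3)"
    by (intro allI impI conj_v3_multiple(2))
  have c10: "{v \<in> solutions. conj_solution v} = {twist j (sol_mult m v3) | m j. m \<noteq> 0 \<and> j < 3}"
    by (rule conj_solutions)
  have c11: "\<forall>m. int (sol_degree (sol_mult m v3)) = 3 * m ^ 2"
    by (intro allI degree_twisted_v3_multiple(2))
  have c12: "\<forall>m. \<forall>j < 3. int (sol_degree (twist j (sol_mult m v3))) = 3 * m ^ 2"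
    by (intro allI impI degree_twisted_v3_multiple(1))
  have c13: "\<forall>d :: nat. 1 \<le> d \<longrightarrow>
      finite (affiliates ` {v \<in> solutions. sol_degree v = d}) \<and>
      int (card (affiliates ` {v \<in> solutions. sol_degree v = d})) =
      (\<Sum>e | e dvd d. Legendre (int e) 3)"
    by (intro allI impI conjI count_affiliate_classes)
  have c14: "\<forall>v \<in> solutions. \<exists>m :: nat. \<exists>ps :: nat multiset.
      (\<forall>p \<in># ps. prime p \<and> (p mod 3 = 0 \<or> p mod 3 = 1)) \<and>
      sol_degree v = m ^ 2 * prod_mset ps"
    by (intro ballI degree_factorisation)
  show ?thesis by (intro conjI c1 c2 c3 c4 c5 c6 c7 c8 c9 c10 c11 c12 c13 c14)
qed

end
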